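(* Consider either of the following two settings, with Lebesgue measure: (a) (heat-diffusion semigroup of Hermite functions) on $\mathbb{R}^d$, $d\ge1$, $D=\Delta-|x|^2$, and for $t>0$, $T^tf(x)=\int_{\mathbb{R}^d}W_t(x,y)f(y)\,dy$ with $W_t(x,y)=\sum_{n=0}^\infty e^{-(2n+d)t}\sum_{|\nu|=n}\tilde h_\nu(x)\tilde h_\nu(y)$; (b) on $\mathbb{R}$, $D=b^2\frac{d^2}{dx^2}$ with $b>0$ fixed, and for $t>0$, $T^tf(x)=\int_{\mathbb{R}}f(\xi)\frac{e^{-(x-\xi)^2/(4b^2t)}}{2b\sqrt{\pi t}}\,d\xi$. Let $r\in\mathbb{N}$, $r\ge1$, and $1\le p\le\infty$. Then there is a positive constant $M=M(r,p)$, independent of $f$ and $t$, such that for all $f\in L^p$ and all $t>0$ $$\frac1M\,\omega_r(f,t)_p\le K_r(f,t^{r})_p\le M\,\omega_r(f,t)_p .$$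
   Context: In (a), for a multi-index $\nu=(n_1,\dots,n_d)$, $\tilde h_\nu(x)=\prod_i\tilde h_{n_i}(x_i)$, with $\tilde h_k(s)=(2^kk!\sqrt\pi)^{-1/2}H_k(s)e^{-s^2/2}$, $H_k$ the Hermite polynomials. Modulus of smoothness: $\Delta_tf=T^tf-f$, $\Delta_t^rf=\Delta_t(\Delta_t^{r-1}f)$, $\omega_r(f,t)_p=\sup_{0<h\le t}\|\Delta_h^rf\|_p$. Sobolev space: $W^p_{D,r}=\{g\in L^p: D^lg\in L^p,\ l=1,\dots,r\}$ (derivatives in the weak sense). K-functional: $K_r(f,s)_p=\inf_{g\in W^p_{D,r}}\{\|f-g\|_p+s\|D^rg\|_p\}$. *)

theory Defs
  imports "HOL-Analysis.Analysis" "HOL-Probability.Essential_Supremum"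
begin

section \<open>Lebesgue spaces\<close>

definition Lp_norm :: "ennreal \<Rightarrow> ('a::euclidean_space \<Rightarrow> real) \<Rightarrow> ennreal" where
  "Lp_norm p f =
    (if p = \<infinity> then esssup lebesgue (\<lambda>x. ennreal \<bar>f x\<bar>)
     else let I = \<integral>\<^sup>+x. ennreal (\<bar>f x\<bar> powr enn2real p) \<partial>lebesgue
          in if I = \<infinity> then \<infinity> else ennreal (enn2real I powr (1 / enn2real p)))"

definition Lp :: "ennreal \<Rightarrow> ('a::euclidean_space \<Rightarrow> real) set" where
  "Lp p = {f \<in> borel_measurable lebesgue. Lp_norm p f < \<infinity>}"

section \<open>Test functions and weak derivatives\<close>

definition partial :: "'a::euclidean_space \<Rightarrow> ('a \<Rightarrow> real) \<Rightarrow> 'a \<Rightarrow> real" where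
  "partial i f x = frechet_derivative f (at x) i"

primrec Ck :: "nat \<Rightarrow> ('a::euclidean_space \<Rightarrow> real) \<Rightarrow> bool" where
  "Ck 0 f \<longleftrightarrow> continuous_on UNIV f"
| "Ck (Suc k) f \<longleftrightarrow> f differentiable_on UNIV \<and> (\<forall>i\<in>Basis. Ck k (partial i f))"

definition test_function :: "('a::euclidean_space \<Rightarrow> real) \<Rightarrow> bool" where
  "test_function \<phi> \<longleftrightarrow> (\<forall>k. Ck k \<phi>) \<and> compact (closure {x. \<phi> x \<noteq> 0})"

text \<open>The weak (distributional) identity \<open>D\<^sup>l g = u\<close>. Both operators to which this is applied
  are formally self-adjoint, so \<open>D\<close> itself, and not its formal adjoint, acts on the test
  function.\<close>

definition weak_power ::
  "(('a::euclidean_space \<Rightarrow> real) \<Rightarrow> 'a \<Rightarrow> real) \<Rightarrow> nat \<Rightarrow> ('a \<Rightarrow> real) \<Rightarrow> ('a \<Rightarrow> real) \<Rightarrow> bool" where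
  "weak_power D l g u \<longleftrightarrow>
    (\<forall>\<phi>. test_function \<phi> \<longrightarrow>
      (\<integral>x. g x * (D ^^ l) \<phi> x \<partial>lebesgue) = (\<integral>x. u x * \<phi> x \<partial>lebesgue))"

definition sobolev ::
  "(('a::euclidean_space \<Rightarrow> real) \<Rightarrow> 'a \<Rightarrow> real) \<Rightarrow> nat \<Rightarrow> ennreal \<Rightarrow> ('a \<Rightarrow> real) set" where
  "sobolev D r p = {g \<in> Lp p. \<forall>l\<in>{1..r}. \<exists>u\<in>Lp p. weak_power D l g u}"

section \<open>K-functional and modulus of smoothness\<close>

text \<open>The weak derivative \<open>u = D\<^sup>r g\<close> is unique up to null sets, so the infimum over the pairs
  \<open>(g, u)\<close> is the infimum over \<open>g\<close>.\<close>

definition K_functional ::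
  "(('a::euclidean_space \<Rightarrow> real) \<Rightarrow> 'a \<Rightarrow> real) \<Rightarrow> nat \<Rightarrow> ennreal \<Rightarrow> ('a \<Rightarrow> real) \<Rightarrow> real \<Rightarrow> ennreal" where
  "K_functional D r p f s =
    (INF (g, u) \<in> {(g, u). g \<in> sobolev D r p \<and> u \<in> Lp p \<and> weak_power D r g u}.
      Lp_norm p (\<lambda>x. f x - g x) + ennreal s * Lp_norm p u)"

definition semigroup_diff ::
  "(real \<Rightarrow> ('a \<Rightarrow> real) \<Rightarrow> 'a \<Rightarrow> real) \<Rightarrow> real \<Rightarrow> ('a \<Rightarrow> real) \<Rightarrow> 'a \<Rightarrow> real" where
  "semigroup_diff T t f = (\<lambda>x. T t f x - f x)"

definition modulus ::
  "(real \<Rightarrow> ('a::euclidean_space \<Rightarrow> real) \<Rightarrow> 'a \<Rightarrow> real) \<Rightarrow> nat \<Rightarrow> ennreal \<Rightarrow> ('a \<Rightarrow> real) \<Rightarrow> real \<Rightarrow> ennreal" where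
  "modulus T r p f t = (SUP h\<in>{0<..t}. Lp_norm p ((semigroup_diff T h ^^ r) f))"

section \<open>The Hermite heat-diffusion semigroup\<close>

definition hermite_poly :: "nat \<Rightarrow> real \<Rightarrow> real" where
  "hermite_poly k s = (-1) ^ k * exp (s\<^sup>2) * (deriv ^^ k) (\<lambda>u. exp (- u\<^sup>2)) s"

definition hermite_fun :: "nat \<Rightarrow> real \<Rightarrow> real" where
  "hermite_fun k s =
    (2 ^ k * fact k * sqrt pi) powr (- 1 / 2) * hermite_poly k s * exp (- s\<^sup>2 / 2)"

definition hermite_fun_multi :: "('n::finite \<Rightarrow> nat) \<Rightarrow> real ^ 'n \<Rightarrow> real" where
  "hermite_fun_multi \<nu> x = (\<Prod>i\<in>UNIV. hermite_fun (\<nu> i) (x $ i))"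

definition hermite_kernel :: "real \<Rightarrow> real ^ 'n::finite \<Rightarrow> real ^ 'n \<Rightarrow> real" where
  "hermite_kernel t x y =
    (\<Sum>n. exp (- (2 * real n + real CARD('n)) * t) *
      (\<Sum>\<nu> | sum \<nu> UNIV = n. hermite_fun_multi \<nu> x * hermite_fun_multi \<nu> y))"

definition hermite_semigroup :: "real \<Rightarrow> (real ^ 'n::finite \<Rightarrow> real) \<Rightarrow> real ^ 'n \<Rightarrow> real" where
  "hermite_semigroup t f x = (\<integral>y. hermite_kernel t x y * f y \<partial>lebesgue)"

definition hermite_op :: "(real ^ 'n::finite \<Rightarrow> real) \<Rightarrow> real ^ 'n \<Rightarrow> real" where
  "hermite_op \<phi> x = (\<Sum>i\<in>Basis. partial i (partial i \<phi>) x) - (norm x)\<^sup>2 * \<phi> x"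

section \<open>The heat semigroup on the line\<close>

definition heat_semigroup :: "real \<Rightarrow> real \<Rightarrow> (real \<Rightarrow> real) \<Rightarrow> real \<Rightarrow> real" where
  "heat_semigroup b t f x =
    (\<integral>\<xi>. f \<xi> * (exp (- (x - \<xi>)\<^sup>2 / (4 * b\<^sup>2 * t)) / (2 * b * sqrt (pi * t))) \<partial>lebesgue)"

definition heat_op :: "real \<Rightarrow> (real \<Rightarrow> real) \<Rightarrow> real \<Rightarrow> real" where
  "heat_op b \<phi> x = b\<^sup>2 * deriv (deriv \<phi>) x"

end

theory Submission
  imports Defs "HOL-Probability.Probability" "HOL-Complex_Analysis.Complex_Analysis"
begin

text \<open>
  The direct estimate writes the difference \<open>T\<^sup>h g - g\<close> of a function with weak derivative \<open>u = D g\<close> as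
  \<open>\<integral>\<^sub>0\<^sup>h T\<^sup>s u ds\<close>, so that \<open>\<parallel>\<Delta>\<^sub>h\<^sup>r g\<parallel> \<le> h\<^sup>r \<parallel>D\<^sup>r g\<parallel>\<close>. For the inverse estimate the K-functional is tested
  with the Steklov mean \<open>g = f - (-1)\<^sup>r \<integral> \<Delta>\<^sub>s\<^sup>r f d\<mu>(s)\<close>, where \<open>\<mu>\<close> is the law of a sum of \<open>r\<close> independent
  uniform variables on \<open>(0, t/r]\<close>: \<open>f - g\<close> is an average of differences, and \<open>D\<^sup>r g\<close> is a combination
  of the differences \<open>\<Delta>\<^sub>j\<^sub>t\<^sub>/\<^sub>r\<^sup>r f\<close>.
  Both semigroups have explicit Gaussian kernels, by Mehler's formula in the Hermite case, and the weak
  derivative is carried over from test functions to these kernels by cutoffs.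
\<close>

section \<open>Norm bounds\<close>

text \<open>On L^\<infinity> these semigroups are not strongly continuous and test functions are not
  dense, so neither generators nor approximation of f serve all exponents at once. The relations
  between D and the semigroup are therefore obtained by duality: the kernels are symmetric, so an
  operator can be moved onto a test function, where classical calculus applies. To treat all p in
  one argument, functions are taken in L^1 + L^\<infinity> and paired with bounded integrable ones.
  The price is that T^s \<phi> has no compact support, although weak derivatives are defined by test
  functions. Averaging over a sum of r uniform times turns the j-th term of the binomial expansion
  of the difference into an r-fold iterated mean over (0, jt/r]. Each D then converts one mean into
  a difference quotient, whence the terms (r choose j) (r/j)^r of the constant. The other term 2^r
  arises because a difference at most doubles the norm. Only contractivity enters these
  estimates.\<close>

lemma powr_tangent:
  fixes a x p :: real
  assumes "0 < a" "0 \<le> x" "1 \<le> p"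
  shows "a powr p + p * a powr (p - 1) * (x - a) \<le> x powr p"
\<comment> \<open>\<open>powr_convex\<close> speaks of positive arguments only; at
  \<open>x = 0\<close> the claim is \<open>a powr p \<le> p * a powr p\<close>.\<close>
proof (cases "x = 0")
  case True
  have "a powr (p - 1) * a = a powr p"
    using assms(1) by (simp add: powr_diff)
  moreover have "a powr p \<le> p * a powr p"
    using assms(3) by (simp add: mult_le_cancel_right1)
  ultimately show ?thesis
    using True by (simp add: algebra_simps)
next
  case False
  have "p * a powr (p - 1) * (x - a) \<le> x powr p - a powr p"
  proof (rule convex_on_imp_above_tangent[OF powr_convex[OF assms(3)]])
    show "((\<lambda>x. x powr p) has_real_derivative p * a powr (p - 1)) (at a within {0<..})"
      using assms(1) by (auto intro!: derivative_eq_intros)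
  qed (use assms False in \<open>auto simp: interior_open\<close>)
  then show ?thesis by simp
qed

lemma abs_le_one_plus_powr:
  fixes x p :: real
  assumes "1 \<le> p"
  shows "\<bar>x\<bar> \<le> 1 + \<bar>x\<bar> powr p"
proof (cases "\<bar>x\<bar> \<le> 1")
  case True
  have "0 \<le> \<bar>x\<bar> powr p" by simp
  with True show ?thesis by linarith
next
  case False
  then have "\<bar>x\<bar> powr 1 \<le> \<bar>x\<bar> powr p"
    by (intro powr_mono assms) auto
  with False show ?thesis by simp
qed

text \<open>Jensen's inequality, by integrating the tangent of \<open>x powr p\<close> at the mean
  \<open>?a\<close> of \<open>\<bar>f\<bar>\<close>. With total mass m \<le> 1 the integral of the
  tangent is a^p (m + p (1 - m)), which is still at least a^p because p \<ge> 1.\<close>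

lemma powr_integral_le:
  fixes f :: "'a \<Rightarrow> real"
  assumes mass: "emeasure N (space N) \<le> 1" and "1 \<le> p"
    and [measurable]: "f \<in> borel_measurable N"
  shows "ennreal (\<bar>\<integral>x. f x \<partial>N\<bar> powr p) \<le> (\<integral>\<^sup>+x. ennreal (\<bar>f x\<bar> powr p) \<partial>N)"
proof -
  interpret finite_measure N
    using mass by (intro finite_measureI) (auto simp: top_unique)
  let ?a = "\<integral>x. \<bar>f x\<bar> \<partial>N"
  consider "(\<integral>\<^sup>+x. ennreal (\<bar>f x\<bar> powr p) \<partial>N) = \<infinity>" | "?a = 0"
    | "(\<integral>\<^sup>+x. ennreal (\<bar>f x\<bar> powr p) \<partial>N) < \<infinity>" "?a \<noteq> 0"
    by (metis infinity_ennreal_def less_top)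
  then show ?thesis
  proof cases
    case 1 then show ?thesis by simp
  next
    \<comment> \<open>\<open>?a = 0\<close> need not mean that f vanishes: the integral of a
      non-integrable function is 0 by default. Either way the left-hand side is 0.\<close>
    case 2
    then have "(\<integral>x. f x \<partial>N) = 0"
      using integral_abs_bound[of N f] by simp
    then show ?thesis by simp
  next
    case 3
    have pint: "integrable N (\<lambda>x. \<bar>f x\<bar> powr p)"
      using 3(1) by (intro integrableI_nonneg) auto
    have aint: "integrable N (\<lambda>x. \<bar>f x\<bar>)"
      by (rule Bochner_Integration.integrable_bound[of N "\<lambda>x. 1 + \<bar>f x\<bar> powr p"])
        (use pint abs_le_one_plus_powr[OF assms(2)] in auto)
    have a: "0 < ?a" using 3(2) by (simp add: less_le)
    have m: "measure N (space N) \<le> 1"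
      using mass by (simp add: emeasure_eq_measure)
    have "?a powr p \<le> ?a powr p * (measure N (space N) + p * (1 - measure N (space N)))"
    proof -
      have "(1 - measure N (space N)) * 1 \<le> (1 - measure N (space N)) * p"
        using m assms(2) by (intro mult_left_mono) auto
      then have "1 \<le> measure N (space N) + p * (1 - measure N (space N))"
        by (simp add: algebra_simps)
      then have "?a powr p * 1 \<le> ?a powr p * (measure N (space N) + p * (1 - measure N (space N)))"
        by (intro mult_left_mono) auto
      then show ?thesis by simp
    qed
    also have "\<dots> = (\<integral>x. ?a powr p + p * ?a powr (p - 1) * (\<bar>f x\<bar> - ?a) \<partial>N)"
    proof -
      have "?a powr (p - 1) * ?a = ?a powr p"
        using a by (simp add: powr_diff)
      moreover have "(\<integral>x. ?a powr p + p * ?a powr (p - 1) * (\<bar>f x\<bar> - ?a) \<partial>N)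
          = ?a powr p * measure N (space N) + p * (?a powr (p - 1) * ?a) * (1 - measure N (space N))"
        using aint by (simp add: algebra_simps)
      ultimately show ?thesis by (simp add: algebra_simps)
    qed
    also have "\<dots> \<le> (\<integral>x. \<bar>f x\<bar> powr p \<partial>N)"
      using aint pint powr_tangent[OF a] assms(2)
      by (intro integral_mono) auto
    finally have "?a powr p \<le> (\<integral>x. \<bar>f x\<bar> powr p \<partial>N)" .
    moreover have "\<bar>\<integral>x. f x \<partial>N\<bar> powr p \<le> ?a powr p"
      using assms(2) by (intro powr_mono2 integral_abs_bound) auto
    ultimately show ?thesis
      using pint by (subst nn_integral_eq_integral) (auto intro!: ennreal_leI)
  qed
qed

text \<open>For \<open>C \<ge> 0\<close> and p \<ge> 1 this amounts to
  \<open>Lp_norm p f \<le> ennreal C\<close> on Lebesgue measure (\<open>Lp_norm_le_iff\<close>). It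
  is stated for an arbitrary measure and compares p-th powers, so that bounds are real numbers and
  no root is taken.\<close>

definition Lp_le :: "'a measure \<Rightarrow> ennreal \<Rightarrow> real \<Rightarrow> ('a \<Rightarrow> real) \<Rightarrow> bool" where
  "Lp_le M p C f \<longleftrightarrow> f \<in> borel_measurable M \<and>
     (if p = \<infinity> then (AE x in M. \<bar>f x\<bar> \<le> C)
      else (\<integral>\<^sup>+x. ennreal (\<bar>f x\<bar> powr enn2real p) \<partial>M) \<le> ennreal (C powr enn2real p))"

lemma Lp_le_measurable: "Lp_le M p C f \<Longrightarrow> f \<in> borel_measurable M"
  by (simp add: Lp_le_def)

lemma Lp_le_AE_cong:
  assumes "Lp_le M p C f" "AE x in M. f x = g x" "g \<in> borel_measurable M"
  shows "Lp_le M p C g"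
proof (cases "p = \<infinity>")
  case True
  then have "AE x in M. \<bar>f x\<bar> \<le> C" using assms(1) by (simp add: Lp_le_def)
  with assms(2) have "AE x in M. \<bar>g x\<bar> \<le> C" by eventually_elim auto
  with True assms(3) show ?thesis by (simp add: Lp_le_def)
next
  case False
  have "(\<integral>\<^sup>+x. ennreal (\<bar>g x\<bar> powr enn2real p) \<partial>M) = (\<integral>\<^sup>+x. ennreal (\<bar>f x\<bar> powr enn2real p) \<partial>M)"
    using assms(2) by (intro nn_integral_cong_AE) auto
  with False assms show ?thesis by (simp add: Lp_le_def)
qed

lemma enn2real_ge_1: "1 \<le> p \<Longrightarrow> p \<noteq> \<infinity> \<Longrightarrow> 1 \<le> enn2real p"
  by (cases p) auto

lemma Lp_le_mult:
  assumes "Lp_le M p C f" "0 \<le> C"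
  shows "Lp_le M p (\<bar>c\<bar> * C) (\<lambda>x. c * f x)"
proof (cases "p = \<infinity>")
  case True
  then show ?thesis using assms
    by (auto simp: Lp_le_def abs_mult intro: mult_left_mono elim!: eventually_mono)
next
  case False
  have [measurable]: "f \<in> borel_measurable M" using assms by (simp add: Lp_le_def)
  have "(\<integral>\<^sup>+x. ennreal (\<bar>c * f x\<bar> powr enn2real p) \<partial>M)
      = ennreal (\<bar>c\<bar> powr enn2real p) * (\<integral>\<^sup>+x. ennreal (\<bar>f x\<bar> powr enn2real p) \<partial>M)"
    by (subst nn_integral_cmult[symmetric]) (auto simp: abs_mult powr_mult ennreal_mult' )
  also have "\<dots> \<le> ennreal (\<bar>c\<bar> powr enn2real p) * ennreal (C powr enn2real p)"
    using assms False by (intro mult_left_mono) (auto simp: Lp_le_def)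
  also have "\<dots> = ennreal ((\<bar>c\<bar> * C) powr enn2real p)"
    using assms by (simp add: powr_mult ennreal_mult')
  finally show ?thesis using False by (simp add: Lp_le_def)
qed

lemma Lp_le_zero_iff:
  assumes "1 \<le> p"
  shows "Lp_le M p 0 f \<longleftrightarrow> f \<in> borel_measurable M \<and> (AE x in M. f x = 0)"
proof -
  have "(\<integral>\<^sup>+x. ennreal (\<bar>f x\<bar> powr enn2real p) \<partial>M) = 0 \<longleftrightarrow> (AE x in M. f x = 0)"
    if [measurable]: "f \<in> borel_measurable M" and "p \<noteq> \<infinity>"
    by (subst nn_integral_0_iff_AE) (auto simp: ennreal_eq_0_iff)
  then show ?thesis by (auto simp: Lp_le_def)
qed

text \<open>The weights \<open>C / (C + D)\<close> and \<open>D / (C + D)\<close> turn the triangle inequality into convexity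
  of \<open>x\<^sup>p\<close>.\<close>

lemma Lp_le_add:
  assumes f: "Lp_le M p C f" and g: "Lp_le M p D g" and CD: "0 \<le> C" "0 \<le> D" and p: "1 \<le> p"
  shows "Lp_le M p (C + D) (\<lambda>x. f x + g x)"
proof -
  have [measurable]: "f \<in> borel_measurable M" "g \<in> borel_measurable M"
    using f g by (auto simp: Lp_le_def)
  \<comment> \<open>The weights require C and D to be positive. If one of them is 0, the
    corresponding function vanishes almost everywhere.\<close>
  consider "p = \<infinity>" | "C = 0" | "D = 0" | "p \<noteq> \<infinity>" "0 < C" "0 < D"
    using CD by fastforce
  then show ?thesis
  proof cases
    case 1
    then show ?thesis using f g
      by (auto simp: Lp_le_def elim: eventually_elim2)
  next
    case 2
    then have "AE x in M. g x = f x + g x"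
      using f Lp_le_zero_iff[OF p] by (auto elim: eventually_mono)
    then show ?thesis using g 2 by (auto intro: Lp_le_AE_cong)
  next
    case 3
    then have "AE x in M. f x = f x + g x"
      using g Lp_le_zero_iff[OF p] by (auto elim: eventually_mono)
    then show ?thesis using f 3 by (auto intro: Lp_le_AE_cong)
  next
    case 4
    define q where "q = enn2real p"
    have q: "1 \<le> q" using 4 p by (simp add: q_def enn2real_ge_1)
    define u v where "u = C / (C + D)" and "v = D / (C + D)"
    have uv: "0 < u" "0 < v" "u + v = 1"
      using 4 by (auto simp: u_def v_def add_divide_distrib[symmetric])
    \<comment> \<open>Two-point convexity: the tangent at \<open>?m\<close>, evaluated at a and b
      and weighted by u and v, has linear parts that cancel.\<close>
    have conv: "(u * a + v * b) powr q \<le> u * a powr q + v * b powr q" if "0 \<le> a" "0 \<le> b" for a b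
    proof (cases "u * a + v * b = 0")
      case True
      then show ?thesis using uv that q by simp
    next
      case False
      let ?m = "u * a + v * b"
      have m: "0 < ?m" using False uv that by (simp add: less_le)
      have "u * (?m powr q + q * ?m powr (q - 1) * (a - ?m)) +
            v * (?m powr q + q * ?m powr (q - 1) * (b - ?m)) \<le> u * a powr q + v * b powr q"
        using uv that q m by (intro add_mono mult_left_mono powr_tangent) auto
      also have "u * (?m powr q + q * ?m powr (q - 1) * (a - ?m)) +
            v * (?m powr q + q * ?m powr (q - 1) * (b - ?m))
          = (u + v) * ?m powr q + q * ?m powr (q - 1) * (?m - (u + v) * ?m)"
        by (simp add: algebra_simps)
      finally show ?thesis using uv by simp
    qed
    have "\<bar>f x + g x\<bar> powr q \<le> (C + D) powr q * (u * (\<bar>f x\<bar> / C) powr q + v * (\<bar>g x\<bar> / D) powr q)" for x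
    proof -
      have "\<bar>f x + g x\<bar> powr q \<le> ((C + D) * (u * (\<bar>f x\<bar> / C) + v * (\<bar>g x\<bar> / D))) powr q"
      proof (rule powr_mono2)
        have "(C + D) * (u * (\<bar>f x\<bar> / C) + v * (\<bar>g x\<bar> / D)) = \<bar>f x\<bar> + \<bar>g x\<bar>"
          using 4 unfolding u_def v_def distrib_left by simp
        then show "\<bar>f x + g x\<bar> \<le> (C + D) * (u * (\<bar>f x\<bar> / C) + v * (\<bar>g x\<bar> / D))" by simp
      qed (use q in auto)
      also have "\<dots> = (C + D) powr q * (u * (\<bar>f x\<bar> / C) + v * (\<bar>g x\<bar> / D)) powr q"
        using 4 uv by (intro powr_mult)
      also have "\<dots> \<le> (C + D) powr q * (u * (\<bar>f x\<bar> / C) powr q + v * (\<bar>g x\<bar> / D) powr q)"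
        using 4 by (intro mult_left_mono conv) auto
      finally show ?thesis .
    qed
    then have "(\<integral>\<^sup>+x. ennreal (\<bar>f x + g x\<bar> powr q) \<partial>M) \<le>
        (\<integral>\<^sup>+x. ennreal ((C + D) powr q * u / C powr q) * ennreal (\<bar>f x\<bar> powr q) +
              ennreal ((C + D) powr q * v / D powr q) * ennreal (\<bar>g x\<bar> powr q) \<partial>M)"
      using 4 uv by (intro nn_integral_mono)
        (auto simp: ennreal_mult'[symmetric] ennreal_plus[symmetric] powr_divide algebra_simps
           simp del: ennreal_plus intro!: ennreal_leI)
    also have "\<dots> = ennreal ((C + D) powr q * u / C powr q) * (\<integral>\<^sup>+x. ennreal (\<bar>f x\<bar> powr q) \<partial>M) +
              ennreal ((C + D) powr q * v / D powr q) * (\<integral>\<^sup>+x. ennreal (\<bar>g x\<bar> powr q) \<partial>M)"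
      by (simp add: nn_integral_add nn_integral_cmult)
    also have "\<dots> \<le> ennreal ((C + D) powr q * u / C powr q) * ennreal (C powr q) +
              ennreal ((C + D) powr q * v / D powr q) * ennreal (D powr q)"
      using f g 4 by (intro add_mono mult_left_mono) (auto simp: Lp_le_def q_def)
    also have "\<dots> = ennreal ((C + D) powr q * (u + v))"
      using 4 uv by (simp add: ennreal_mult'[symmetric] ennreal_plus[symmetric] distrib_left[symmetric] del: ennreal_plus)
    finally have "(\<integral>\<^sup>+x. ennreal (\<bar>f x + g x\<bar> powr q) \<partial>M) \<le> ennreal ((C + D) powr q)"
      using uv by simp
    then show ?thesis using 4 by (simp add: Lp_le_def q_def)
  qed
qed

lemma Lp_le_sum:
  assumes "finite I" "\<And>i. i \<in> I \<Longrightarrow> Lp_le M p (C i) (f i)" "\<And>i. i \<in> I \<Longrightarrow> 0 \<le> C i" "1 \<le> p"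
  shows "Lp_le M p (\<Sum>i\<in>I. C i) (\<lambda>x. \<Sum>i\<in>I. f i x)"
  using assms(1-3)
proof (induction I)
  case empty
  then show ?case using assms(4) by (simp add: Lp_le_zero_iff)
next
  case (insert i I)
  then show ?case using assms(4) by (auto intro!: Lp_le_add sum_nonneg)
qed

text \<open>Membership in \<open>L\<^sup>1 + L\<^sup>\<infinity>\<close>; \<open>ennreal\<close> truncates \<open>|f x| - C\<close> to its positive part.\<close>

definition L1_plus_Linf :: "'a measure \<Rightarrow> ('a \<Rightarrow> real) \<Rightarrow> bool" where
  "L1_plus_Linf M f \<longleftrightarrow> f \<in> borel_measurable M \<and>
     (\<exists>C\<ge>0. (\<integral>\<^sup>+x. ennreal (\<bar>f x\<bar> - C) \<partial>M) < \<infinity>)"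

lemma L1_plus_Linf_measurable: "L1_plus_Linf M f \<Longrightarrow> f \<in> borel_measurable M"
  by (simp add: L1_plus_Linf_def)

text \<open>One class for all exponents: kernel identities are proved on it once and then hold in
  every L^p. For finite p the cut at height 1 works, since
  \<open>\<bar>f x\<bar> - 1 \<le> \<bar>f x\<bar> powr p\<close>.\<close>

lemma Lp_le_imp_L1_plus_Linf:
  assumes "Lp_le M p C f" "1 \<le> p"
  shows "L1_plus_Linf M f"
proof (cases "p = \<infinity>")
  case True
  then have "AE x in M. \<bar>f x\<bar> \<le> C" using assms by (simp add: Lp_le_def)
  then have "AE x in M. ennreal (\<bar>f x\<bar> - max 0 C) = 0"
    by eventually_elim (auto simp: ennreal_eq_0_iff)
  then have "(\<integral>\<^sup>+x. ennreal (\<bar>f x\<bar> - max 0 C) \<partial>M) = 0"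
    by (simp add: nn_integral_cong_AE)
  then show ?thesis
    using assms by (auto simp: Lp_le_def L1_plus_Linf_def intro!: exI[of _ "max 0 C"])
next
  case False
  have "(\<integral>\<^sup>+x. ennreal (\<bar>f x\<bar> - 1) \<partial>M) \<le> (\<integral>\<^sup>+x. ennreal (\<bar>f x\<bar> powr enn2real p) \<partial>M)"
    using abs_le_one_plus_powr[OF enn2real_ge_1[OF assms(2) False]]
    by (intro nn_integral_mono ennreal_leI) (simp add: algebra_simps)
  also have "\<dots> \<le> ennreal (C powr enn2real p)"
    using False assms by (simp add: Lp_le_def)
  also have "\<dots> < \<infinity>" by simp
  finally show ?thesis
    using assms by (auto simp: Lp_le_def L1_plus_Linf_def intro!: exI[of _ 1])
qed

text \<open>The majorant \<open>w\<close> is \<open>ennreal\<close>-valued because in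
  \<open>kernel_op_L1_plus_Linf\<close> it is a nonnegative kernel integral, which may be infinite
  on a null set.\<close>

lemma L1_plus_LinfI:
  assumes [measurable]: "f \<in> borel_measurable M" "w \<in> borel_measurable M"
    and "0 \<le> C" "AE x in M. ennreal \<bar>f x\<bar> \<le> ennreal C + w x" "(\<integral>\<^sup>+x. w x \<partial>M) < \<infinity>"
  shows "L1_plus_Linf M f"
proof -
  have "AE x in M. ennreal (\<bar>f x\<bar> - C) \<le> w x"
    using assms(4)
  proof eventually_elim
    case (elim x)
    have "ennreal (\<bar>f x\<bar> - C) = ennreal \<bar>f x\<bar> - ennreal C"
      using assms(3) by (simp add: ennreal_minus)
    also have "\<dots> \<le> ennreal C + w x - ennreal C" using elim by (rule ennreal_minus_mono) simp
    also have "\<dots> = w x" by simp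
    finally show ?case .
  qed
  then have "(\<integral>\<^sup>+x. ennreal (\<bar>f x\<bar> - C) \<partial>M) \<le> (\<integral>\<^sup>+x. w x \<partial>M)"
    by (rule nn_integral_mono_AE)
  then show ?thesis using assms by (auto simp: L1_plus_Linf_def intro!: exI[of _ C])
qed

lemma L1_plus_Linf_AE_cong:
  assumes "L1_plus_Linf M f" "AE x in M. f x = g x" "g \<in> borel_measurable M"
  shows "L1_plus_Linf M g"
proof -
  obtain C where C: "0 \<le> C" "(\<integral>\<^sup>+x. ennreal (\<bar>f x\<bar> - C) \<partial>M) < \<infinity>"
    using assms by (auto simp: L1_plus_Linf_def)
  have "(\<integral>\<^sup>+x. ennreal (\<bar>g x\<bar> - C) \<partial>M) = (\<integral>\<^sup>+x. ennreal (\<bar>f x\<bar> - C) \<partial>M)"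
    using assms(2) by (intro nn_integral_cong_AE) auto
  with C assms(3) show ?thesis by (auto simp: L1_plus_Linf_def)
qed

lemma L1_plus_Linf_add:
  assumes "L1_plus_Linf M f" "L1_plus_Linf M g"
  shows "L1_plus_Linf M (\<lambda>x. f x + g x)"
proof -
  have [measurable]: "f \<in> borel_measurable M" "g \<in> borel_measurable M"
    using assms by (auto simp: L1_plus_Linf_def)
  obtain C D where C: "0 \<le> C" "(\<integral>\<^sup>+x. ennreal (\<bar>f x\<bar> - C) \<partial>M) < \<infinity>"
    and D: "0 \<le> D" "(\<integral>\<^sup>+x. ennreal (\<bar>g x\<bar> - D) \<partial>M) < \<infinity>"
    using assms by (auto simp: L1_plus_Linf_def)
  have "ennreal \<bar>f x + g x\<bar> \<le> ennreal (C + D) + (ennreal (\<bar>f x\<bar> - C) + ennreal (\<bar>g x\<bar> - D))" for x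
  proof -
    have "ennreal \<bar>f x + g x\<bar> \<le> ennreal ((C + D) + (max 0 (\<bar>f x\<bar> - C) + max 0 (\<bar>g x\<bar> - D)))"
      by (intro ennreal_leI) auto
    also have "\<dots> = ennreal (C + D) + (ennreal (\<bar>f x\<bar> - C) + ennreal (\<bar>g x\<bar> - D))"
      using C D by (simp add: ennreal_plus max_def ennreal_neg)
    finally show ?thesis .
  qed
  then show ?thesis using C D
    by (intro L1_plus_LinfI[where C = "C + D" and w = "\<lambda>x. ennreal (\<bar>f x\<bar> - C) + ennreal (\<bar>g x\<bar> - D)"])
      (auto simp: nn_integral_add)
qed

lemma L1_plus_Linf_mult:
  assumes "L1_plus_Linf M f"
  shows "L1_plus_Linf M (\<lambda>x. c * f x)"
proof -
  have [measurable]: "f \<in> borel_measurable M"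
    using assms by (auto simp: L1_plus_Linf_def)
  obtain C where C: "0 \<le> C" "(\<integral>\<^sup>+x. ennreal (\<bar>f x\<bar> - C) \<partial>M) < \<infinity>"
    using assms by (auto simp: L1_plus_Linf_def)
  have "ennreal \<bar>c * f x\<bar> \<le> ennreal (\<bar>c\<bar> * C) + ennreal \<bar>c\<bar> * ennreal (\<bar>f x\<bar> - C)" for x
  proof -
    have "ennreal \<bar>c * f x\<bar> \<le> ennreal (\<bar>c\<bar> * C + \<bar>c\<bar> * max 0 (\<bar>f x\<bar> - C))"
      unfolding abs_mult distrib_left[symmetric]
      by (intro ennreal_leI mult_left_mono) auto
    also have "\<dots> = ennreal (\<bar>c\<bar> * C) + ennreal \<bar>c\<bar> * ennreal (\<bar>f x\<bar> - C)"
      using C by (simp add: ennreal_plus max_def ennreal_neg ennreal_mult)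
    finally show ?thesis .
  qed
  then show ?thesis using C
    by (intro L1_plus_LinfI[where C = "\<bar>c\<bar> * C" and w = "\<lambda>x. ennreal \<bar>c\<bar> * ennreal (\<bar>f x\<bar> - C)"])
      (auto simp: nn_integral_cmult ennreal_mult_less_top)
qed

lemma L1_plus_Linf_sum:
  assumes "\<And>i. i \<in> I \<Longrightarrow> L1_plus_Linf M (f i)"
  shows "L1_plus_Linf M (\<lambda>x. \<Sum>i\<in>I. f i x)"
  using assms
proof (induction I rule: infinite_finite_induct)
  case (insert i I)
  then show ?case by (auto intro!: L1_plus_Linf_add)
qed (auto simp: L1_plus_Linf_def intro!: exI[of _ 0])

text \<open>The class in duality with \<open>L1_plus_Linf\<close>. It contains the test functions
  and, unlike them, is preserved by the kernel operators.\<close>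

definition bounded_integrable :: "'a measure \<Rightarrow> ('a \<Rightarrow> real) \<Rightarrow> bool" where
  "bounded_integrable M \<phi> \<longleftrightarrow> integrable M \<phi> \<and> (\<exists>B. \<forall>x\<in>space M. \<bar>\<phi> x\<bar> \<le> B)"

lemma bounded_integrable_imp_L1_plus_Linf: "bounded_integrable M \<phi> \<Longrightarrow> L1_plus_Linf M \<phi>"
  by (auto simp: bounded_integrable_def L1_plus_Linf_def integrable_iff_bounded intro!: exI[of _ 0])

text \<open>The part of f below height C meets the integrability of \<open>\<phi>\<close>, the
  integrable excess over C meets its boundedness.\<close>

lemma bounded_integrable_pairing:
  assumes "L1_plus_Linf M f" "bounded_integrable M \<phi>"
  shows "integrable M (\<lambda>x. f x * \<phi> x)"
proof -
  obtain C where C: "0 \<le> C" "(\<integral>\<^sup>+x. ennreal (\<bar>f x\<bar> - C) \<partial>M) < \<infinity>"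
    using assms by (auto simp: L1_plus_Linf_def)
  obtain B where B: "\<And>x. x \<in> space M \<Longrightarrow> \<bar>\<phi> x\<bar> \<le> B" using assms by (auto simp: bounded_integrable_def)
  have [measurable]: "f \<in> borel_measurable M" "\<phi> \<in> borel_measurable M" and i: "integrable M \<phi>"
    using assms by (auto simp: L1_plus_Linf_def bounded_integrable_def)
  have "ennreal (norm (f x * \<phi> x)) \<le> ennreal C * ennreal \<bar>\<phi> x\<bar> + ennreal \<bar>B\<bar> * ennreal (\<bar>f x\<bar> - C)"
    if "x \<in> space M" for x
  proof -
    have "\<bar>f x\<bar> * \<bar>\<phi> x\<bar> \<le> (C + max 0 (\<bar>f x\<bar> - C)) * \<bar>\<phi> x\<bar>"
      by (intro mult_right_mono) auto
    also have "\<dots> = C * \<bar>\<phi> x\<bar> + max 0 (\<bar>f x\<bar> - C) * \<bar>\<phi> x\<bar>" by (simp add: algebra_simps)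
    also have "\<dots> \<le> C * \<bar>\<phi> x\<bar> + max 0 (\<bar>f x\<bar> - C) * \<bar>B\<bar>"
      using B[OF that] by (intro add_left_mono mult_left_mono) auto
    finally have "ennreal (norm (f x * \<phi> x)) \<le> ennreal (C * \<bar>\<phi> x\<bar> + max 0 (\<bar>f x\<bar> - C) * \<bar>B\<bar>)"
      by (simp add: abs_mult ennreal_leI)
    also have "\<dots> = ennreal C * ennreal \<bar>\<phi> x\<bar> + ennreal \<bar>B\<bar> * ennreal (\<bar>f x\<bar> - C)"
      using C by (simp add: ennreal_plus max_def ennreal_neg ennreal_mult mult.commute)
    finally show ?thesis .
  qed
  then have "(\<integral>\<^sup>+x. ennreal (norm (f x * \<phi> x)) \<partial>M) \<le>
      (\<integral>\<^sup>+x. ennreal C * ennreal \<bar>\<phi> x\<bar> + ennreal \<bar>B\<bar> * ennreal (\<bar>f x\<bar> - C) \<partial>M)"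
    by (intro nn_integral_mono)
  also have "\<dots> = ennreal C * (\<integral>\<^sup>+x. ennreal \<bar>\<phi> x\<bar> \<partial>M) + ennreal \<bar>B\<bar> * (\<integral>\<^sup>+x. ennreal (\<bar>f x\<bar> - C) \<partial>M)"
    by (simp add: nn_integral_add nn_integral_cmult)
  also have "\<dots> < \<infinity>"
    using C i by (auto simp: ennreal_mult_less_top integrable_iff_bounded)
  finally show ?thesis by (intro integrableI_bounded) auto
qed

section \<open>Symmetric sub-Markov kernels\<close>

text \<open>Values lie in \<open>ennreal\<close> because an average of heat kernels over times
  reaching down to 0 can be infinite on the diagonal. By symmetry the mass bound holds in both
  variables.\<close>

definition submarkov :: "'a measure \<Rightarrow> ('a \<Rightarrow> 'a \<Rightarrow> ennreal) \<Rightarrow> bool" where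
  "submarkov M K \<longleftrightarrow> (\<lambda>(x, y). K x y) \<in> borel_measurable (M \<Otimes>\<^sub>M M) \<and>
     (\<forall>x\<in>space M. \<forall>y\<in>space M. K x y = K y x) \<and> (\<forall>x\<in>space M. (\<integral>\<^sup>+y. K x y \<partial>M) \<le> 1)"

text \<open>\<open>enn2real\<close> sends an infinite value to 0; for each x this affects only a
  null set of y (\<open>kernel_finite_AE\<close>).\<close>

definition kernel_op :: "'a measure \<Rightarrow> ('a \<Rightarrow> 'a \<Rightarrow> ennreal) \<Rightarrow> ('a \<Rightarrow> real) \<Rightarrow> 'a \<Rightarrow> real" where
  "kernel_op M K f x = (\<integral>y. enn2real (K x y) * f y \<partial>M)"

lemma kernel_op_cong_AE:
  assumes "AE y in M. f y = g y" "f \<in> borel_measurable M" "g \<in> borel_measurable M"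
    and "submarkov M K" "x \<in> space M"
  shows "kernel_op M K f x = kernel_op M K g x"
proof -
  have [measurable]: "(\<lambda>(x, y). K x y) \<in> borel_measurable (M \<Otimes>\<^sub>M M)"
    using assms(4) by (simp add: submarkov_def)
  have [measurable]: "K x \<in> borel_measurable M"
    using assms(5) by measurable
  show ?thesis
    unfolding kernel_op_def using assms by (intro integral_cong_AE) auto
qed

context sigma_finite_measure
begin

interpretation pair: pair_sigma_finite M M ..

context
  fixes K :: "'a \<Rightarrow> 'a \<Rightarrow> ennreal"
  assumes K: "submarkov M K"
begin

lemma kernel_measurable: "(\<lambda>(x, y). K x y) \<in> borel_measurable (M \<Otimes>\<^sub>M M)"
  using K by (simp add: submarkov_def)

lemma kernel_measurable1: "x \<in> space M \<Longrightarrow> K x \<in> borel_measurable M"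
  using measurable_Pair2[OF kernel_measurable] by simp

lemma kernel_mass: "x \<in> space M \<Longrightarrow> (\<integral>\<^sup>+y. K x y \<partial>M) \<le> 1"
  using K by (simp add: submarkov_def)

lemma kernel_sym: "x \<in> space M \<Longrightarrow> y \<in> space M \<Longrightarrow> K x y = K y x"
  using K by (simp add: submarkov_def)

lemma kernel_finite_AE:
  assumes "x \<in> space M"
  shows "AE y in M. ennreal (enn2real (K x y)) = K x y"
proof -
  have "(\<integral>\<^sup>+y. K x y \<partial>M) < \<infinity>"
    using kernel_mass[OF assms] by (rule le_less_trans) simp
  then have "AE y in M. K x y \<noteq> \<infinity>"
    using kernel_measurable1[OF assms] by (intro nn_integral_noteq_infinite) auto
  then show ?thesis
    by eventually_elim (simp add: less_top)
qed

lemma kernel_op_measurable: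
  assumes [measurable]: "f \<in> borel_measurable M"
  shows "kernel_op M K f \<in> borel_measurable M"
proof -
  note [measurable] = kernel_measurable
  show ?thesis unfolding kernel_op_def[abs_def] by measurable
qed

lemma kernel_nn_integral_abs:
  assumes [measurable]: "f \<in> borel_measurable M" and x: "x \<in> space M"
  shows "(\<integral>\<^sup>+y. ennreal \<bar>enn2real (K x y) * f y\<bar> \<partial>M) = (\<integral>\<^sup>+y. K x y * ennreal \<bar>f y\<bar> \<partial>M)"
  using kernel_finite_AE[OF x]
  by (intro nn_integral_cong_AE, eventually_elim) (simp add: abs_mult ennreal_mult')

lemma kernel_op_abs_le:
  assumes [measurable]: "f \<in> borel_measurable M" and x: "x \<in> space M"
  shows "ennreal \<bar>kernel_op M K f x\<bar> \<le> (\<integral>\<^sup>+y. K x y * ennreal \<bar>f y\<bar> \<partial>M)"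
proof -
  note [measurable] = kernel_measurable1[OF x]
  show ?thesis
    using integral_norm_bound_ennreal[of M "\<lambda>y. enn2real (K x y) * f y"]
    unfolding kernel_nn_integral_abs[OF assms, symmetric]
    by (cases "integrable M (\<lambda>y. enn2real (K x y) * f y)")
      (auto simp: kernel_op_def not_integrable_integral_eq)
qed

text \<open>Contraction in L^1: after Tonelli the inner integral is, by symmetry, the mass of
  \<open>K y\<close> times \<open>w y\<close>. The L^p bound and the finiteness statements reduce to
  this.\<close>

lemma kernel_nn_integral_contract:
  assumes [measurable]: "w \<in> borel_measurable M"
  shows "(\<integral>\<^sup>+x. (\<integral>\<^sup>+y. K x y * w y \<partial>M) \<partial>M) \<le> (\<integral>\<^sup>+y. w y \<partial>M)"
proof -
  note [measurable] = kernel_measurable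
  have "(\<integral>\<^sup>+x. (\<integral>\<^sup>+y. K x y * w y \<partial>M) \<partial>M) = (\<integral>\<^sup>+y. (\<integral>\<^sup>+x. K x y * w y \<partial>M) \<partial>M)"
    by (intro pair.Fubini') measurable
  also have "\<dots> \<le> (\<integral>\<^sup>+y. w y \<partial>M)"
  proof (rule nn_integral_mono)
    fix y assume y: "y \<in> space M"
    note [measurable] = kernel_measurable1[OF y]
    have "(\<integral>\<^sup>+x. K x y * w y \<partial>M) = (\<integral>\<^sup>+x. K y x * w y \<partial>M)"
      using y by (intro nn_integral_cong) (simp add: kernel_sym)
    also have "\<dots> = (\<integral>\<^sup>+x. K y x \<partial>M) * w y"
      by (rule nn_integral_multc) measurable
    also have "\<dots> \<le> 1 * w y"
      using kernel_mass[OF y] by (intro mult_right_mono) auto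
    finally show "(\<integral>\<^sup>+x. K x y * w y \<partial>M) \<le> w y" by simp
  qed
  finally show ?thesis .
qed

text \<open>The part of f below height C contributes at most C since the mass is at most 1. In the
  applications the excess is integrable, so \<open>kernel_nn_integral_contract\<close> controls the
  remaining term.\<close>

lemma kernel_abs_le_split:
  assumes [measurable]: "f \<in> borel_measurable M" and x: "x \<in> space M" and C: "0 \<le> C"
  shows "(\<integral>\<^sup>+y. K x y * ennreal \<bar>f y\<bar> \<partial>M) \<le> ennreal C + (\<integral>\<^sup>+y. K x y * ennreal (\<bar>f y\<bar> - C) \<partial>M)"
proof -
  note [measurable] = kernel_measurable1[OF x]
  have "ennreal \<bar>f y\<bar> \<le> ennreal C + ennreal (\<bar>f y\<bar> - C)" for y
  proof -
    have "ennreal \<bar>f y\<bar> \<le> ennreal (C + max 0 (\<bar>f y\<bar> - C))"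
      by (intro ennreal_leI) auto
    also have "\<dots> = ennreal C + ennreal (\<bar>f y\<bar> - C)"
      using C by (simp add: ennreal_plus max_def ennreal_neg)
    finally show ?thesis .
  qed
  then have "(\<integral>\<^sup>+y. K x y * ennreal \<bar>f y\<bar> \<partial>M) \<le> (\<integral>\<^sup>+y. K x y * (ennreal C + ennreal (\<bar>f y\<bar> - C)) \<partial>M)"
    by (intro nn_integral_mono mult_left_mono) auto
  also have "\<dots> = (\<integral>\<^sup>+y. K x y \<partial>M) * ennreal C + (\<integral>\<^sup>+y. K x y * ennreal (\<bar>f y\<bar> - C) \<partial>M)"
    by (simp add: distrib_left nn_integral_add nn_integral_multc)
  also have "\<dots> \<le> 1 * ennreal C + (\<integral>\<^sup>+y. K x y * ennreal (\<bar>f y\<bar> - C) \<partial>M)"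
    using kernel_mass[OF x] by (intro add_right_mono mult_right_mono) auto
  finally show ?thesis by simp
qed

lemma kernel_abs_finite_AE:
  assumes "L1_plus_Linf M f"
  shows "AE x in M. (\<integral>\<^sup>+y. K x y * ennreal \<bar>f y\<bar> \<partial>M) < \<infinity>"
proof -
  note [measurable] = kernel_measurable L1_plus_Linf_measurable[OF assms]
  obtain C where C: "0 \<le> C" "(\<integral>\<^sup>+x. ennreal (\<bar>f x\<bar> - C) \<partial>M) < \<infinity>"
    using assms by (auto simp: L1_plus_Linf_def)
  have "(\<integral>\<^sup>+x. (\<integral>\<^sup>+y. K x y * ennreal (\<bar>f y\<bar> - C) \<partial>M) \<partial>M) < \<infinity>"
    by (rule le_less_trans[OF kernel_nn_integral_contract C(2)]) measurable
  then have "AE x in M. (\<integral>\<^sup>+y. K x y * ennreal (\<bar>f y\<bar> - C) \<partial>M) \<noteq> \<infinity>"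
    by (intro nn_integral_noteq_infinite) auto
  then show ?thesis
    using AE_space
  proof eventually_elim
    case (elim x)
    have "(\<integral>\<^sup>+y. K x y * ennreal \<bar>f y\<bar> \<partial>M) \<le> ennreal C + (\<integral>\<^sup>+y. K x y * ennreal (\<bar>f y\<bar> - C) \<partial>M)"
      using elim C by (intro kernel_abs_le_split) auto
    also have "\<dots> < \<infinity>" using elim by (simp add: less_top)
    finally show ?case .
  qed
qed

lemma kernel_integrable_AE:
  assumes "L1_plus_Linf M f"
  shows "AE x in M. integrable M (\<lambda>y. enn2real (K x y) * f y)"
  using kernel_abs_finite_AE[OF assms] AE_space
proof eventually_elim
  case (elim x)
  note [measurable] = kernel_measurable1[OF elim(2)] L1_plus_Linf_measurable[OF assms]
  show ?case
    using elim kernel_nn_integral_abs[of f x]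
    by (intro integrableI_bounded) auto
qed

lemma kernel_op_L1_plus_Linf:
  assumes "L1_plus_Linf M f"
  shows "L1_plus_Linf M (kernel_op M K f)"
proof -
  note [measurable] = kernel_measurable L1_plus_Linf_measurable[OF assms]
  obtain C where C: "0 \<le> C" "(\<integral>\<^sup>+x. ennreal (\<bar>f x\<bar> - C) \<partial>M) < \<infinity>"
    using assms by (auto simp: L1_plus_Linf_def)
  show ?thesis
  proof (rule L1_plus_LinfI[where w = "\<lambda>x. \<integral>\<^sup>+y. K x y * ennreal (\<bar>f y\<bar> - C) \<partial>M"])
    show "kernel_op M K f \<in> borel_measurable M"
      by (intro kernel_op_measurable) measurable
    show "AE x in M. ennreal \<bar>kernel_op M K f x\<bar> \<le> ennreal C + (\<integral>\<^sup>+y. K x y * ennreal (\<bar>f y\<bar> - C) \<partial>M)"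
      using C by (auto intro!: order_trans[OF kernel_op_abs_le kernel_abs_le_split])
    show "(\<integral>\<^sup>+x. (\<integral>\<^sup>+y. K x y * ennreal (\<bar>f y\<bar> - C) \<partial>M) \<partial>M) < \<infinity>"
      by (rule le_less_trans[OF kernel_nn_integral_contract C(2)]) measurable
  qed (use C in measurable)
qed

lemma kernel_op_add:
  assumes "L1_plus_Linf M f" "L1_plus_Linf M g"
  shows "AE x in M. kernel_op M K (\<lambda>x. f x + g x) x = kernel_op M K f x + kernel_op M K g x"
  using kernel_integrable_AE[OF assms(1)] kernel_integrable_AE[OF assms(2)]
  by eventually_elim (simp add: kernel_op_def distrib_left)

lemma kernel_op_mult: "kernel_op M K (\<lambda>x. c * f x) x = c * kernel_op M K f x"
proof -
  have "(\<lambda>y. enn2real (K x y) * (c * f y)) = (\<lambda>y. c * (enn2real (K x y) * f y))"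
    by (auto simp: algebra_simps)
  then show ?thesis by (simp add: kernel_op_def)
qed

lemma kernel_op_sum:
  assumes "\<And>i. i \<in> I \<Longrightarrow> L1_plus_Linf M (f i)"
  shows "AE x in M. kernel_op M K (\<lambda>x. \<Sum>i\<in>I. f i x) x = (\<Sum>i\<in>I. kernel_op M K (f i) x)"
  using assms
proof (induction I rule: infinite_finite_induct)
  case (insert i I)
  then have "AE x in M. kernel_op M K (\<lambda>x. \<Sum>i\<in>I. f i x) x = (\<Sum>i\<in>I. kernel_op M K (f i) x)"
    by auto
  moreover have "AE x in M. kernel_op M K (\<lambda>x. f i x + (\<Sum>i\<in>I. f i x)) x =
     kernel_op M K (f i) x + kernel_op M K (\<lambda>x. \<Sum>i\<in>I. f i x) x"
    using insert.prems by (intro kernel_op_add L1_plus_Linf_sum) auto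
  ultimately show ?case
    by eventually_elim (use insert.hyps in simp)
qed (auto simp: kernel_op_def)

lemma kernel_op_bounded_integrable:
  assumes "bounded_integrable M \<phi>"
  shows "bounded_integrable M (kernel_op M K \<phi>)"
proof -
  obtain B where B: "\<And>x. x \<in> space M \<Longrightarrow> \<bar>\<phi> x\<bar> \<le> B" using assms by (auto simp: bounded_integrable_def)
  have [measurable]: "\<phi> \<in> borel_measurable M" and i: "integrable M \<phi>"
    using assms by (auto simp: bounded_integrable_def)
  have "\<bar>kernel_op M K \<phi> x\<bar> \<le> \<bar>B\<bar>" if x: "x \<in> space M" for x
  proof -
    note [measurable] = kernel_measurable1[OF x]
    have "ennreal \<bar>kernel_op M K \<phi> x\<bar> \<le> (\<integral>\<^sup>+y. K x y * ennreal \<bar>\<phi> y\<bar> \<partial>M)"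
      using x by (intro kernel_op_abs_le) auto
    also have "\<dots> \<le> (\<integral>\<^sup>+y. K x y * ennreal \<bar>B\<bar> \<partial>M)"
      using B by (intro nn_integral_mono mult_left_mono ennreal_leI) force+
    also have "\<dots> = (\<integral>\<^sup>+y. K x y \<partial>M) * ennreal \<bar>B\<bar>" by (simp add: nn_integral_multc)
    also have "\<dots> \<le> 1 * ennreal \<bar>B\<bar>" using kernel_mass[OF x] by (intro mult_right_mono) auto
    finally show ?thesis by simp
  qed
  moreover have "integrable M (kernel_op M K \<phi>)"
  proof (rule integrableI_bounded)
    have "(\<integral>\<^sup>+x. ennreal (norm (kernel_op M K \<phi> x)) \<partial>M) \<le> (\<integral>\<^sup>+x. (\<integral>\<^sup>+y. K x y * ennreal \<bar>\<phi> y\<bar> \<partial>M) \<partial>M)"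
      by (intro nn_integral_mono) (auto intro: kernel_op_abs_le)
    also have "\<dots> \<le> (\<integral>\<^sup>+y. ennreal \<bar>\<phi> y\<bar> \<partial>M)"
      by (rule kernel_nn_integral_contract) measurable
    also have "\<dots> < \<infinity>" using i by (simp add: integrable_iff_bounded)
    finally show "(\<integral>\<^sup>+x. ennreal (norm (kernel_op M K \<phi> x)) \<partial>M) < \<infinity>" .
  qed (intro kernel_op_measurable, measurable)
  ultimately show ?thesis by (auto simp: bounded_integrable_def)
qed

text \<open>The absolute convergence behind the uses of Fubini in \<open>kernel_op_adjoint\<close>
  and \<open>pairing_avg\<close>; as in \<open>bounded_integrable_pairing\<close>, f is split at
  height C.\<close>

lemma kernel_nn_pairing_finite:
  assumes "L1_plus_Linf M f" "bounded_integrable M \<phi>"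
  shows "(\<integral>\<^sup>+x. (\<integral>\<^sup>+y. K x y * ennreal \<bar>f y\<bar> * ennreal \<bar>\<phi> x\<bar> \<partial>M) \<partial>M) < \<infinity>"
proof -
  note [measurable] = kernel_measurable L1_plus_Linf_measurable[OF assms(1)]
  obtain C where C: "0 \<le> C" "(\<integral>\<^sup>+x. ennreal (\<bar>f x\<bar> - C) \<partial>M) < \<infinity>"
    using assms by (auto simp: L1_plus_Linf_def)
  obtain B where B: "\<And>x. x \<in> space M \<Longrightarrow> \<bar>\<phi> x\<bar> \<le> B" using assms by (auto simp: bounded_integrable_def)
  have [measurable]: "\<phi> \<in> borel_measurable M" and i: "integrable M \<phi>"
    using assms by (auto simp: bounded_integrable_def)
  let ?w = "\<lambda>x. \<integral>\<^sup>+y. K x y * ennreal (\<bar>f y\<bar> - C) \<partial>M"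
  have "(\<integral>\<^sup>+x. (\<integral>\<^sup>+y. K x y * ennreal \<bar>f y\<bar> * ennreal \<bar>\<phi> x\<bar> \<partial>M) \<partial>M)
      \<le> (\<integral>\<^sup>+x. ennreal C * ennreal \<bar>\<phi> x\<bar> + ?w x * ennreal \<bar>B\<bar> \<partial>M)"
  proof (rule nn_integral_mono)
    fix x assume x: "x \<in> space M"
    note [measurable] = kernel_measurable1[OF x]
    have "(\<integral>\<^sup>+y. K x y * ennreal \<bar>f y\<bar> * ennreal \<bar>\<phi> x\<bar> \<partial>M) =
        (\<integral>\<^sup>+y. K x y * ennreal \<bar>f y\<bar> \<partial>M) * ennreal \<bar>\<phi> x\<bar>"
      by (rule nn_integral_multc) measurable
    also have "\<dots> \<le> (ennreal C + ?w x) * ennreal \<bar>\<phi> x\<bar>"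
      using x C by (intro mult_right_mono kernel_abs_le_split) auto
    also have "\<dots> \<le> ennreal C * ennreal \<bar>\<phi> x\<bar> + ?w x * ennreal \<bar>B\<bar>"
      unfolding distrib_right using B[OF x] by (intro add_left_mono mult_left_mono ennreal_leI) auto
    finally show "(\<integral>\<^sup>+y. K x y * ennreal \<bar>f y\<bar> * ennreal \<bar>\<phi> x\<bar> \<partial>M)
      \<le> ennreal C * ennreal \<bar>\<phi> x\<bar> + ?w x * ennreal \<bar>B\<bar>" .
  qed
  also have "\<dots> = ennreal C * (\<integral>\<^sup>+x. ennreal \<bar>\<phi> x\<bar> \<partial>M) + (\<integral>\<^sup>+x. ?w x \<partial>M) * ennreal \<bar>B\<bar>"
    by (simp add: nn_integral_add nn_integral_cmult nn_integral_multc)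
  also have "\<dots> < \<infinity>"
  proof -
    have "(\<integral>\<^sup>+x. ?w x \<partial>M) < \<infinity>"
      by (rule le_less_trans[OF kernel_nn_integral_contract C(2)]) measurable
    then show ?thesis
      using i by (auto simp: ennreal_mult_less_top integrable_iff_bounded)
  qed
  finally show ?thesis .
qed

lemma kernel_op_adjoint:
  assumes "L1_plus_Linf M f" "bounded_integrable M \<phi>"
  shows "(\<integral>x. kernel_op M K f x * \<phi> x \<partial>M) = (\<integral>x. f x * kernel_op M K \<phi> x \<partial>M)"
proof -
  have [measurable]: "\<phi> \<in> borel_measurable M"
    using assms by (auto simp: bounded_integrable_def)
  note [measurable] = kernel_measurable L1_plus_Linf_measurable[OF assms(1)]
  let ?F = "\<lambda>x y. enn2real (K x y) * f y * \<phi> x"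
  have "integrable (M \<Otimes>\<^sub>M M) (case_prod ?F)"
  proof (rule integrableI_bounded)
    have "(\<integral>\<^sup>+z. ennreal (norm (case_prod ?F z)) \<partial>(M \<Otimes>\<^sub>M M)) =
        (\<integral>\<^sup>+x. (\<integral>\<^sup>+y. ennreal \<bar>?F x y\<bar> \<partial>M) \<partial>M)"
      by (subst nn_integral_fst[symmetric]) (auto simp: split_beta')
    also have "\<dots> = (\<integral>\<^sup>+x. (\<integral>\<^sup>+y. K x y * ennreal \<bar>f y\<bar> * ennreal \<bar>\<phi> x\<bar> \<partial>M) \<partial>M)"
    proof (rule nn_integral_cong)
      fix x assume x: "x \<in> space M"
      show "(\<integral>\<^sup>+y. ennreal \<bar>?F x y\<bar> \<partial>M) = (\<integral>\<^sup>+y. K x y * ennreal \<bar>f y\<bar> * ennreal \<bar>\<phi> x\<bar> \<partial>M)"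
        using kernel_finite_AE[OF x]
        by (intro nn_integral_cong_AE, eventually_elim) (simp add: abs_mult ennreal_mult' )
    qed
    also have "\<dots> < \<infinity>" by (rule kernel_nn_pairing_finite[OF assms])
    finally show "(\<integral>\<^sup>+z. ennreal (norm (case_prod ?F z)) \<partial>(M \<Otimes>\<^sub>M M)) < \<infinity>" .
  qed measurable
  then have eq: "(\<integral>y. (\<integral>x. ?F x y \<partial>M) \<partial>M) = (\<integral>x. (\<integral>y. ?F x y \<partial>M) \<partial>M)"
    by (rule pair.Fubini_integral)
  have l: "(\<integral>x. ?F x y \<partial>M) = f y * kernel_op M K \<phi> y" if "y \<in> space M" for y
  proof -
    have "(\<integral>x. ?F x y \<partial>M) = (\<integral>x. f y * (enn2real (K y x) * \<phi> x) \<partial>M)"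
      using that by (intro Bochner_Integration.integral_cong) (auto simp: kernel_sym)
    then show ?thesis by (simp add: kernel_op_def)
  qed
  have r: "(\<integral>y. ?F x y \<partial>M) = kernel_op M K f x * \<phi> x" for x
    by (simp add: kernel_op_def)
  have "(\<integral>y. (\<integral>x. ?F x y \<partial>M) \<partial>M) = (\<integral>y. f y * kernel_op M K \<phi> y \<partial>M)"
    by (intro Bochner_Integration.integral_cong refl l)
  with eq show ?thesis by (simp only: r)
qed

text \<open>For finite p, Jensen's inequality for the measure with density \<open>K x\<close>
  reduces the claim to the L^1 contraction applied to \<open>\<bar>f y\<bar> powr p\<close>; for p =
  \<infinity> the mass bound suffices.\<close>

lemma kernel_op_Lp_le:
  assumes f: "Lp_le M p C f" and C: "0 \<le> C" and p: "1 \<le> p"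
  shows "Lp_le M p C (kernel_op M K f)"
proof -
  note [measurable] = kernel_measurable Lp_le_measurable[OF f]
  have m: "kernel_op M K f \<in> borel_measurable M"
    by (intro kernel_op_measurable) measurable
  show ?thesis
  proof (cases "p = \<infinity>")
    case True
    then have le: "AE y in M. \<bar>f y\<bar> \<le> C" using f by (simp add: Lp_le_def)
    have "\<bar>kernel_op M K f x\<bar> \<le> C" if x: "x \<in> space M" for x
    proof -
      note [measurable] = kernel_measurable1[OF x]
      have "ennreal \<bar>kernel_op M K f x\<bar> \<le> (\<integral>\<^sup>+y. K x y * ennreal \<bar>f y\<bar> \<partial>M)"
        using x by (intro kernel_op_abs_le) auto
      also have "\<dots> \<le> (\<integral>\<^sup>+y. K x y * ennreal C \<partial>M)"
        using le by (intro nn_integral_mono_AE, eventually_elim) (intro mult_left_mono ennreal_leI, auto)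
      also have "\<dots> = (\<integral>\<^sup>+y. K x y \<partial>M) * ennreal C" by (simp add: nn_integral_multc)
      also have "\<dots> \<le> 1 * ennreal C" using kernel_mass[OF x] by (intro mult_right_mono) auto
      finally show ?thesis using C by simp
    qed
    with True m show ?thesis by (auto simp: Lp_le_def)
  next
    case False
    define q where "q = enn2real p"
    have q: "1 \<le> q" using False p by (simp add: q_def enn2real_ge_1)
    have "ennreal (\<bar>kernel_op M K f x\<bar> powr q) \<le> (\<integral>\<^sup>+y. K x y * ennreal (\<bar>f y\<bar> powr q) \<partial>M)"
      if x: "x \<in> space M" for x
    proof -
      note [measurable] = kernel_measurable1[OF x]
      let ?N = "density M (\<lambda>y. ennreal (enn2real (K x y)))"
      have mass: "emeasure ?N (space ?N) \<le> 1"
      proof -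
        have "emeasure ?N (space ?N) = (\<integral>\<^sup>+y. ennreal (enn2real (K x y)) \<partial>M)"
          by (auto simp: emeasure_density intro!: nn_integral_cong)
        also have "\<dots> = (\<integral>\<^sup>+y. K x y \<partial>M)"
          using kernel_finite_AE[OF x] by (rule nn_integral_cong_AE)
        finally show ?thesis using kernel_mass[OF x] by simp
      qed
      have "kernel_op M K f x = (\<integral>y. f y \<partial>?N)"
        unfolding kernel_op_def by (subst integral_real_density) auto
      then have "ennreal (\<bar>kernel_op M K f x\<bar> powr q) \<le> (\<integral>\<^sup>+y. ennreal (\<bar>f y\<bar> powr q) \<partial>?N)"
        using powr_integral_le[OF mass q, of f] by simp
      also have "\<dots> = (\<integral>\<^sup>+y. ennreal (enn2real (K x y)) * ennreal (\<bar>f y\<bar> powr q) \<partial>M)"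
        by (subst nn_integral_density) auto
      also have "\<dots> = (\<integral>\<^sup>+y. K x y * ennreal (\<bar>f y\<bar> powr q) \<partial>M)"
        using kernel_finite_AE[OF x] by (intro nn_integral_cong_AE, eventually_elim) simp
      finally show ?thesis .
    qed
    then have "(\<integral>\<^sup>+x. ennreal (\<bar>kernel_op M K f x\<bar> powr q) \<partial>M) \<le>
        (\<integral>\<^sup>+x. (\<integral>\<^sup>+y. K x y * ennreal (\<bar>f y\<bar> powr q) \<partial>M) \<partial>M)"
      by (intro nn_integral_mono)
    also have "\<dots> \<le> (\<integral>\<^sup>+y. ennreal (\<bar>f y\<bar> powr q) \<partial>M)"
      by (rule kernel_nn_integral_contract) measurable
    also have "\<dots> \<le> ennreal (C powr q)"
      using f False by (simp add: Lp_le_def q_def)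
    finally show ?thesis using False m by (simp add: Lp_le_def q_def)
  qed
qed

end

text \<open>Fubini at those x where the integral of \<open>J x y * \<bar>f y\<bar>\<close> is
  finite, hence only almost everywhere: by \<open>comp\<close> this integral is the absolute double
  integral.\<close>

lemma kernel_op_compose:
  assumes K: "submarkov M K" and L: "submarkov M L" and J: "submarkov M J"
    and comp: "\<And>x y. x \<in> space M \<Longrightarrow> y \<in> space M \<Longrightarrow> (\<integral>\<^sup>+z. K x z * L z y \<partial>M) = J x y"
    and f: "L1_plus_Linf M f"
  shows "AE x in M. kernel_op M K (kernel_op M L f) x = kernel_op M J f x"
  using kernel_abs_finite_AE[OF J f] AE_space
proof eventually_elim
  case (elim x)
  note x = elim(2)
  note [measurable] = kernel_measurable1[OF K x] kernel_measurable[OF L] L1_plus_Linf_measurable[OF f]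
    kernel_measurable1[OF J x]
  let ?F = "\<lambda>z y. enn2real (K x z) * (enn2real (L z y) * f y)"
  have KL: "(\<integral>\<^sup>+z. ennreal (enn2real (K x z) * enn2real (L z y)) \<partial>M) = J x y" if y: "y \<in> space M" for y
  proof -
    have "(\<integral>\<^sup>+z. ennreal (enn2real (K x z) * enn2real (L z y)) \<partial>M) = (\<integral>\<^sup>+z. K x z * L z y \<partial>M)"
      using kernel_finite_AE[OF K x] kernel_finite_AE[OF L y] AE_space[of M]
    proof (intro nn_integral_cong_AE, eventually_elim)
      case (elim z)
      then have "L z y = L y z" using kernel_sym[OF L] y by blast
      with elim show ?case by (simp add: ennreal_mult)
    qed
    then show ?thesis using comp[OF x y] by simp
  qed
  have "integrable (M \<Otimes>\<^sub>M M) (case_prod ?F)"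
  proof (rule integrableI_bounded)
    have "(\<integral>\<^sup>+w. ennreal (norm (case_prod ?F w)) \<partial>(M \<Otimes>\<^sub>M M)) =
        (\<integral>\<^sup>+y. (\<integral>\<^sup>+z. ennreal \<bar>?F z y\<bar> \<partial>M) \<partial>M)"
      by (subst pair.nn_integral_snd[symmetric]) (auto simp: split_beta')
    also have "\<dots> = (\<integral>\<^sup>+y. J x y * ennreal \<bar>f y\<bar> \<partial>M)"
    proof (rule nn_integral_cong)
      fix y assume y: "y \<in> space M"
      have "(\<integral>\<^sup>+z. ennreal \<bar>?F z y\<bar> \<partial>M) =
          (\<integral>\<^sup>+z. ennreal (enn2real (K x z) * enn2real (L z y)) * ennreal \<bar>f y\<bar> \<partial>M)"
        by (intro nn_integral_cong) (simp add: abs_mult ennreal_mult' mult.assoc)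
      also have "\<dots> = J x y * ennreal \<bar>f y\<bar>"
        using y by (subst nn_integral_multc) (auto simp: KL)
      finally show "(\<integral>\<^sup>+z. ennreal \<bar>?F z y\<bar> \<partial>M) = J x y * ennreal \<bar>f y\<bar>" .
    qed
    also have "\<dots> < \<infinity>" by (rule elim)
    finally show "(\<integral>\<^sup>+w. ennreal (norm (case_prod ?F w)) \<partial>(M \<Otimes>\<^sub>M M)) < \<infinity>" .
  qed measurable
  then have "(\<integral>z. (\<integral>y. ?F z y \<partial>M) \<partial>M) = (\<integral>y. (\<integral>z. ?F z y \<partial>M) \<partial>M)"
    by (rule pair.Fubini_integral[symmetric])
  also have "(\<integral>z. (\<integral>y. ?F z y \<partial>M) \<partial>M) = kernel_op M K (kernel_op M L f) x"
    by (simp add: kernel_op_def)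
  also have "(\<integral>y. (\<integral>z. ?F z y \<partial>M) \<partial>M) = kernel_op M J f x"
    unfolding kernel_op_def
  proof (rule Bochner_Integration.integral_cong[OF refl])
    fix y assume y: "y \<in> space M"
    have "(\<integral>z. ?F z y \<partial>M) = (\<integral>z. enn2real (K x z) * enn2real (L z y) * f y \<partial>M)"
      by (simp add: mult.assoc)
    also have "\<dots> = (\<integral>z. enn2real (K x z) * enn2real (L z y) \<partial>M) * f y"
      by simp
    also have "(\<integral>z. enn2real (K x z) * enn2real (L z y) \<partial>M) = enn2real (J x y)"
      using y by (subst integral_eq_nn_integral) (auto simp: KL)
    finally show "(\<integral>z. ?F z y \<partial>M) = enn2real (J x y) * f y" .
  qed
  finally show ?case .
qed

end

section \<open>Averages of a semigroup over random times\<close>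

text \<open>Time 0 is excluded because the kernels below are specified at positive times
  only.\<close>

definition time_law :: "real measure \<Rightarrow> bool" where
  "time_law \<mu> \<longleftrightarrow> prob_space \<mu> \<and> sets \<mu> = sets borel \<and> (AE s in \<mu>. 0 < s)"

text \<open>Off by one: \<open>convolution_power \<mu> n\<close> is the law of a sum of n + 1
  independent times. Starting at \<open>\<mu>\<close> avoids the unit mass at 0, which is not a
  \<open>time_law\<close>.\<close>

primrec convolution_power :: "real measure \<Rightarrow> nat \<Rightarrow> real measure" where
  "convolution_power \<mu> 0 = \<mu>"
| "convolution_power \<mu> (Suc n) = convolution \<mu> (convolution_power \<mu> n)"

definition scale :: "real \<Rightarrow> real measure \<Rightarrow> real measure" where
  "scale h \<mu> = distr \<mu> borel (\<lambda>s. h * s)"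

lemma sets_scale[simp]: "sets (scale h \<mu>) = sets borel"
  and space_scale[simp]: "space (scale h \<mu>) = UNIV"
  by (simp_all add: scale_def)

lemma time_law_return: "0 < t \<Longrightarrow> time_law (return borel t)"
  by (auto simp: time_law_def AE_return intro!: prob_space_return)

lemma AE_convolution:
  fixes \<mu> \<nu> :: "real measure"
  assumes "prob_space \<mu>" "prob_space \<nu>" and [measurable_cong, simp]: "sets \<mu> = sets borel" "sets \<nu> = sets borel"
    and [measurable]: "Measurable.pred borel P"
    and "AE s in \<mu>. AE t in \<nu>. P (s + t)"
  shows "AE s in convolution \<mu> \<nu>. P s"
proof -
  interpret m: prob_space \<mu> by fact
  interpret n: prob_space \<nu> by fact
  interpret pair_sigma_finite \<mu> \<nu> ..
  have "{z \<in> space (\<mu> \<Otimes>\<^sub>M \<nu>). P (fst z + snd z)} \<in> sets (\<mu> \<Otimes>\<^sub>M \<nu>)"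
    by measurable
  then have "AE z in \<mu> \<Otimes>\<^sub>M \<nu>. P (fst z + snd z)"
    by (rule AE_pair_measure) (use assms(6) in simp)
  then show ?thesis
    unfolding convolution_def by (subst AE_distr_iff) (auto simp: split_beta')
qed

lemma prob_space_convolution:
  fixes \<mu> \<nu> :: "real measure"
  assumes "prob_space \<mu>" "prob_space \<nu>" and [measurable_cong, simp]: "sets \<mu> = sets borel" "sets \<nu> = sets borel"
  shows "prob_space (convolution \<mu> \<nu>)"
proof -
  interpret m: prob_space \<mu> by fact
  interpret n: prob_space \<nu> by fact
  interpret pair_prob_space \<mu> \<nu> ..
  show ?thesis unfolding convolution_def
    by (intro prob_space.prob_space_distr) (auto intro: prob_space_axioms)
qed

lemma time_law_convolution:
  assumes "time_law \<mu>" "time_law \<nu>"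
  shows "time_law (convolution \<mu> \<nu>)"
proof -
  have "AE s in convolution \<mu> \<nu>. 0 < s"
  proof (rule AE_convolution)
    show "AE s in \<mu>. AE t in \<nu>. 0 < s + t"
    proof -
      have "AE s in \<mu>. 0 < s" using assms by (simp add: time_law_def)
      then show ?thesis
      proof eventually_elim
        case (elim s)
        have "AE t in \<nu>. 0 < t" using assms by (simp add: time_law_def)
        then show ?case using elim by (auto elim: eventually_mono)
      qed
    qed
  qed (use assms in \<open>auto simp: time_law_def\<close>)
  then show ?thesis
    using assms by (simp add: time_law_def prob_space_convolution)
qed

lemma time_law_convolution_power: "time_law \<mu> \<Longrightarrow> time_law (convolution_power \<mu> n)"
  by (induction n) (auto intro: time_law_convolution)

lemma time_law_scale:
  assumes "time_law \<mu>" "0 < h"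
  shows "time_law (scale h \<mu>)"
proof -
  have [measurable_cong]: "sets \<mu> = sets borel" using assms by (simp add: time_law_def)
  have "AE s in scale h \<mu>. 0 < s"
    unfolding scale_def using assms by (subst AE_distr_iff) (auto simp: time_law_def)
  moreover have "prob_space (scale h \<mu>)"
    unfolding scale_def using assms by (intro prob_space.prob_space_distr) (auto simp: time_law_def)
  ultimately show ?thesis by (simp add: time_law_def)
qed

lemma scale_convolution:
  assumes "time_law \<mu>" "time_law \<nu>"
  shows "scale h (convolution \<mu> \<nu>) = convolution (scale h \<mu>) (scale h \<nu>)"
proof (rule measure_eqI)
  have [measurable_cong, simp]: "sets \<mu> = sets borel" "sets \<nu> = sets borel"
    and p: "prob_space \<mu>" "prob_space \<nu>"
    using assms by (auto simp: time_law_def)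
  interpret m: prob_space \<mu> by fact
  interpret n: prob_space \<nu> by fact
  have fin: "finite_measure (scale h \<mu>)" "finite_measure (scale h \<nu>)"
    unfolding scale_def by (auto intro!: m.finite_measure_distr n.finite_measure_distr)
  fix A assume "A \<in> sets (scale h (convolution \<mu> \<nu>))"
  then have [measurable]: "A \<in> sets borel" by simp
  have "emeasure (scale h (convolution \<mu> \<nu>)) A = (\<integral>\<^sup>+x. indicator A x \<partial>scale h (convolution \<mu> \<nu>))"
    by simp
  also have "\<dots> = (\<integral>\<^sup>+x. indicator A (h * x) \<partial>convolution \<mu> \<nu>)"
    unfolding scale_def by (rule nn_integral_distr) auto
  also have "\<dots> = (\<integral>\<^sup>+x. \<integral>\<^sup>+y. indicator A (h * (x + y)) \<partial>\<nu> \<partial>\<mu>)"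
    by (rule nn_integral_convolution) (auto intro: m.finite_measure_axioms n.finite_measure_axioms)
  also have "\<dots> = (\<integral>\<^sup>+x. \<integral>\<^sup>+y. indicator A (h * x + y) \<partial>scale h \<nu> \<partial>\<mu>)"
    unfolding scale_def by (subst nn_integral_distr) (auto simp: distrib_left)
  also have "\<dots> = (\<integral>\<^sup>+x. \<integral>\<^sup>+y. indicator A (x + y) \<partial>scale h \<nu> \<partial>scale h \<mu>)"
  proof -
    interpret sigma_finite_measure "scale h \<nu>"
      using fin(2) by (rule finite_measure.sigma_finite_measure)
    have [measurable_cong]: "sets (scale h \<nu>) = sets borel" by simp
    show ?thesis unfolding scale_def[of h \<mu>] by (subst nn_integral_distr) auto
  qed
  also have "\<dots> = (\<integral>\<^sup>+x. indicator A x \<partial>convolution (scale h \<mu>) (scale h \<nu>))"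
    by (rule nn_integral_convolution[symmetric]) (auto intro: fin)
  finally show "emeasure (scale h (convolution \<mu> \<nu>)) A = emeasure (convolution (scale h \<mu>) (scale h \<nu>)) A"
    by simp
qed simp

text \<open>Scaling commutes with sums of independent times. Hence for every j the dilation by jh of
  one random time X_0 + ... + X_n yields an iterated average with step jh.\<close>

lemma scale_convolution_power:
  assumes "time_law \<mu>"
  shows "convolution_power (scale h \<mu>) n = scale h (convolution_power \<mu> n)"
  by (induction n) (simp_all add: scale_convolution assms time_law_convolution_power)

definition unit_law :: "real measure" where
  "unit_law = uniform_measure lborel {0<..1}"

lemma sets_unit_law[simp]: "sets unit_law = sets borel"
  by (simp add: unit_law_def)

lemma AE_unit_law: "AE s in unit_law. 0 < s \<and> s \<le> 1"
  unfolding unit_law_def by (rule AE_uniform_measureI) auto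

lemma time_law_unit_law: "time_law unit_law"
proof -
  have "prob_space unit_law"
    unfolding unit_law_def by (rule prob_space_uniform_measure) auto
  then show ?thesis using AE_unit_law by (auto simp: time_law_def elim: eventually_mono)
qed

lemma AE_convolution_power_unit_law:
  "AE s in convolution_power unit_law n. 0 < s \<and> s \<le> real (Suc n)"
proof (induction n)
  case 0
  show ?case unfolding convolution_power.simps using AE_unit_law by simp
next
  case (Suc n)
  note tl = time_law_unit_law time_law_convolution_power[OF time_law_unit_law, of n]
  show ?case
    unfolding convolution_power.simps
  proof (rule AE_convolution)
    show "AE s in unit_law. AE t in convolution_power unit_law n. 0 < s + t \<and> s + t \<le> real (Suc (Suc n))"
      using AE_unit_law
    proof eventually_elim
      case (elim s)
      show ?case using Suc.IH by eventually_elim (use elim in auto)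
    qed
  qed (use tl in \<open>auto simp: time_law_def\<close>)
qed

text \<open>Minkowski's integral inequality for a probability measure. For finite p it is Jensen in
  s at each x, then Tonelli. For p = \<infinity> the exceptional null sets depend on s, and
  \<open>AE_commute\<close> exchanges the two quantifiers.\<close>

lemma Lp_le_average:
  fixes F :: "'s \<Rightarrow> 'a \<Rightarrow> real"
  assumes "prob_space \<mu>" "sigma_finite_measure M"
    and F[measurable]: "(\<lambda>(s, x). F s x) \<in> borel_measurable (\<mu> \<Otimes>\<^sub>M M)"
    and le: "AE s in \<mu>. Lp_le M p C (F s)" and "0 \<le> C" "1 \<le> p"
  shows "Lp_le M p C (\<lambda>x. \<integral>s. F s x \<partial>\<mu>)"
proof -
  interpret m: prob_space \<mu> by fact
  interpret sigma_finite_measure M by fact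
  interpret pair_sigma_finite \<mu> M ..
  have meas: "(\<lambda>x. \<integral>s. F s x \<partial>\<mu>) \<in> borel_measurable M"
    by measurable
  show ?thesis
  proof (cases "p = \<infinity>")
    case True
    have "AE s in \<mu>. AE x in M. \<bar>F s x\<bar> \<le> C"
      using le True by (simp add: Lp_le_def)
    then have "AE x in M. AE s in \<mu>. \<bar>F s x\<bar> \<le> C"
      by (subst (asm) AE_commute) auto
    then have "AE x in M. \<bar>\<integral>s. F s x \<partial>\<mu>\<bar> \<le> C"
      using AE_space
    proof eventually_elim
      case (elim x)
      have [measurable]: "(\<lambda>s. F s x) \<in> borel_measurable \<mu>" using elim(2) by measurable
      have "integrable \<mu> (\<lambda>s. F s x)"
        by (rule m.integrable_const_bound[of _ C]) (use elim in auto)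
      then have "\<bar>\<integral>s. F s x \<partial>\<mu>\<bar> \<le> (\<integral>s. \<bar>F s x\<bar> \<partial>\<mu>)"
        by (intro integral_abs_bound)
      also have "\<dots> \<le> (\<integral>s. C \<partial>\<mu>)"
        using elim \<open>integrable \<mu> (\<lambda>s. F s x)\<close> by (intro integral_mono_AE) auto
      finally show ?case by (simp add: m.prob_space)
    qed
    with True meas show ?thesis by (simp add: Lp_le_def)
  next
    case False
    define q where "q = enn2real p"
    have q: "1 \<le> q" using False assms by (simp add: q_def enn2real_ge_1)
    have "(\<integral>\<^sup>+x. ennreal (\<bar>\<integral>s. F s x \<partial>\<mu>\<bar> powr q) \<partial>M) \<le> (\<integral>\<^sup>+x. (\<integral>\<^sup>+s. ennreal (\<bar>F s x\<bar> powr q) \<partial>\<mu>) \<partial>M)"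
    proof (rule nn_integral_mono)
      fix x assume x: "x \<in> space M"
      have [measurable]: "(\<lambda>s. F s x) \<in> borel_measurable \<mu>" using x by measurable
      show "ennreal (\<bar>\<integral>s. F s x \<partial>\<mu>\<bar> powr q) \<le> (\<integral>\<^sup>+s. ennreal (\<bar>F s x\<bar> powr q) \<partial>\<mu>)"
        by (rule powr_integral_le) (use q in \<open>auto simp: m.emeasure_space_1\<close>)
    qed
    also have "\<dots> = (\<integral>\<^sup>+s. (\<integral>\<^sup>+x. ennreal (\<bar>F s x\<bar> powr q) \<partial>M) \<partial>\<mu>)"
      by (rule Fubini') measurable
    also have "\<dots> \<le> (\<integral>\<^sup>+s. ennreal (C powr q) \<partial>\<mu>)"
      using le False by (intro nn_integral_mono_AE) (auto simp: Lp_le_def q_def)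
    also have "\<dots> = ennreal (C powr q)" by (simp add: m.emeasure_space_1)
    finally show ?thesis using False meas by (simp add: Lp_le_def q_def)
  qed
qed

text \<open>The assumptions concern positive times only. The mass is bounded by 1 instead of equal
  to 1 because the Hermite semigroup loses mass through the potential |x|^2.\<close>

locale kernel_semigroup = sigma_finite_measure M for M :: "'a measure" +
  fixes k :: "real \<Rightarrow> 'a \<Rightarrow> 'a \<Rightarrow> real"
  assumes k_measurable[measurable]: "(\<lambda>(t, x, y). k t x y) \<in> borel_measurable (borel \<Otimes>\<^sub>M M \<Otimes>\<^sub>M M)"
    and k_nonneg: "0 < t \<Longrightarrow> 0 \<le> k t x y"
    and k_sym: "0 < t \<Longrightarrow> k t x y = k t y x"
    and k_mass: "0 < t \<Longrightarrow> x \<in> space M \<Longrightarrow> (\<integral>\<^sup>+y. ennreal (k t x y) \<partial>M) \<le> 1"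
    and k_semigroup: "0 < s \<Longrightarrow> 0 < t \<Longrightarrow> x \<in> space M \<Longrightarrow> y \<in> space M \<Longrightarrow>
      (\<integral>\<^sup>+z. ennreal (k s x z * k t z y) \<partial>M) = ennreal (k (s + t) x y)"
begin

lemma k_compose_measurable[measurable (raw)]:
  assumes "a \<in> borel_measurable N" "g \<in> measurable N M" "h \<in> measurable N M"
  shows "(\<lambda>w. k (a w) (g w) (h w)) \<in> borel_measurable N"
  using measurable_compose[OF measurable_Pair[OF assms(1) measurable_Pair[OF assms(2,3)]] k_measurable]
  by simp

definition evolve :: "real \<Rightarrow> ('a \<Rightarrow> real) \<Rightarrow> 'a \<Rightarrow> real" where
  "evolve t f x = (\<integral>y. k t x y * f y \<partial>M)"

text \<open>The kernel is averaged, not the function, so that \<open>avg \<mu>\<close> is itself a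
  symmetric sub-Markov operator and everything about \<open>kernel_op\<close> applies to it.
  \<open>avg_has_integral\<close> recovers the average of \<open>evolve s f\<close>.\<close>

definition avg_kernel :: "real measure \<Rightarrow> 'a \<Rightarrow> 'a \<Rightarrow> ennreal" where
  "avg_kernel \<mu> x y = (\<integral>\<^sup>+s. ennreal (k s x y) \<partial>\<mu>)"

abbreviation avg :: "real measure \<Rightarrow> ('a \<Rightarrow> real) \<Rightarrow> 'a \<Rightarrow> real" where
  "avg \<mu> \<equiv> kernel_op M (avg_kernel \<mu>)"

lemma avg_kernel_measurable:
  assumes "time_law \<mu>"
  shows "(\<lambda>(x, y). avg_kernel \<mu> x y) \<in> borel_measurable (M \<Otimes>\<^sub>M M)"
proof -
  interpret m: prob_space \<mu> using assms by (simp add: time_law_def)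
  have [measurable_cong]: "sets \<mu> = sets borel" using assms by (simp add: time_law_def)
  show ?thesis unfolding avg_kernel_def split_beta' by measurable
qed

lemma submarkov_avg_kernel:
  assumes "time_law \<mu>"
  shows "submarkov M (avg_kernel \<mu>)"
proof -
  interpret m: prob_space \<mu> using assms by (simp add: time_law_def)
  have [measurable_cong]: "sets \<mu> = sets borel" and pos: "AE s in \<mu>. 0 < s"
    using assms by (simp_all add: time_law_def)
  interpret pair_sigma_finite \<mu> M ..
  have "avg_kernel \<mu> x y = avg_kernel \<mu> y x" for x y
    unfolding avg_kernel_def using pos
    by (intro nn_integral_cong_AE, eventually_elim) (use k_sym in auto)
  moreover have "(\<integral>\<^sup>+y. avg_kernel \<mu> x y \<partial>M) \<le> 1" if x: "x \<in> space M" for x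
  proof -
    have "(\<integral>\<^sup>+y. avg_kernel \<mu> x y \<partial>M) = (\<integral>\<^sup>+s. (\<integral>\<^sup>+y. ennreal (k s x y) \<partial>M) \<partial>\<mu>)"
      unfolding avg_kernel_def using x by (intro Fubini') measurable
    also have "\<dots> \<le> (\<integral>\<^sup>+s. 1 \<partial>\<mu>)"
      using pos by (intro nn_integral_mono_AE, eventually_elim) (use k_mass x in auto)
    finally show ?thesis by (simp add: m.emeasure_space_1)
  qed
  ultimately show ?thesis
    using avg_kernel_measurable[OF assms] by (auto simp: submarkov_def)
qed

lemma avg_kernel_return:
  assumes "x \<in> space M" "y \<in> space M"
  shows "avg_kernel (return borel t) x y = ennreal (k t x y)"
  unfolding avg_kernel_def using assms by (subst nn_integral_return) auto

text \<open>A fixed time is the point mass at it; this is how statements about \<open>avg\<close>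
  pass to \<open>evolve\<close>.\<close>

lemma avg_return:
  assumes "0 < t" "x \<in> space M"
  shows "avg (return borel t) f x = evolve t f x"
  unfolding kernel_op_def evolve_def using assms
  by (intro Bochner_Integration.integral_cong) (auto simp: avg_kernel_return k_nonneg)

text \<open>Tonelli brings the composition in z innermost, where \<open>k_semigroup\<close> adds the
  two times; the convolution is the law of the sum of independent times.\<close>

lemma avg_kernel_compose:
  assumes \<mu>: "time_law \<mu>" and \<nu>: "time_law \<nu>" and x: "x \<in> space M" and y: "y \<in> space M"
  shows "(\<integral>\<^sup>+z. avg_kernel \<mu> x z * avg_kernel \<nu> z y \<partial>M) = avg_kernel (convolution \<mu> \<nu>) x y"
proof -
  interpret m: prob_space \<mu> using \<mu> by (simp add: time_law_def)
  interpret n: prob_space \<nu> using \<nu> by (simp add: time_law_def)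
  have [measurable_cong, simp]: "sets \<mu> = sets borel" "sets \<nu> = sets borel"
    and pos: "AE s in \<mu>. 0 < s" "AE s in \<nu>. 0 < s"
    using assms by (simp_all add: time_law_def)
  interpret mM: pair_sigma_finite \<mu> M ..
  interpret nM: pair_sigma_finite \<nu> M ..
  note [measurable] = x y
  have "(\<integral>\<^sup>+z. avg_kernel \<mu> x z * avg_kernel \<nu> z y \<partial>M) =
      (\<integral>\<^sup>+z. (\<integral>\<^sup>+s. ennreal (k s x z) * avg_kernel \<nu> z y \<partial>\<mu>) \<partial>M)"
    using x y by (intro nn_integral_cong) (simp add: avg_kernel_def nn_integral_multc)
  also have "\<dots> = (\<integral>\<^sup>+s. (\<integral>\<^sup>+z. ennreal (k s x z) * avg_kernel \<nu> z y \<partial>M) \<partial>\<mu>)"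
    unfolding avg_kernel_def by (intro mM.Fubini') measurable
  also have "\<dots> = (\<integral>\<^sup>+s. (\<integral>\<^sup>+z. (\<integral>\<^sup>+t. ennreal (k s x z) * ennreal (k t z y) \<partial>\<nu>) \<partial>M) \<partial>\<mu>)"
    using x y by (intro nn_integral_cong) (simp add: avg_kernel_def nn_integral_cmult)
  also have "\<dots> = (\<integral>\<^sup>+s. (\<integral>\<^sup>+t. (\<integral>\<^sup>+z. ennreal (k s x z) * ennreal (k t z y) \<partial>M) \<partial>\<nu>) \<partial>\<mu>)"
    by (intro nn_integral_cong nM.Fubini') measurable
  also have "\<dots> = (\<integral>\<^sup>+s. (\<integral>\<^sup>+t. ennreal (k (s + t) x y) \<partial>\<nu>) \<partial>\<mu>)"
    using pos(1)
  proof (intro nn_integral_cong_AE, eventually_elim)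
    case (elim s)
    show ?case using pos(2)
    proof (intro nn_integral_cong_AE, eventually_elim)
      case (elim t)
      have "(\<integral>\<^sup>+z. ennreal (k s x z) * ennreal (k t z y) \<partial>M) = (\<integral>\<^sup>+z. ennreal (k s x z * k t z y) \<partial>M)"
        using elim \<open>0 < s\<close> by (intro nn_integral_cong) (simp add: ennreal_mult k_nonneg)
      then show ?case using k_semigroup[OF \<open>0 < s\<close> \<open>0 < t\<close> x y] by simp
    qed
  qed
  also have "\<dots> = avg_kernel (convolution \<mu> \<nu>) x y"
    unfolding avg_kernel_def
    by (rule nn_integral_convolution[symmetric])
      (auto intro: m.finite_measure_axioms n.finite_measure_axioms)
  finally show ?thesis .
qed

lemma avg_avg:
  assumes "time_law \<mu>" "time_law \<nu>" "L1_plus_Linf M f"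
  shows "AE x in M. avg \<mu> (avg \<nu> f) x = avg (convolution \<mu> \<nu>) f x"
  using assms
  by (intro kernel_op_compose submarkov_avg_kernel time_law_convolution avg_kernel_compose)

lemma avg_L1_plus_Linf:
  "time_law \<mu> \<Longrightarrow> L1_plus_Linf M f \<Longrightarrow> L1_plus_Linf M (avg \<mu> f)"
  by (intro kernel_op_L1_plus_Linf submarkov_avg_kernel)

lemma avg_cong_AE:
  assumes "time_law \<mu>" "AE x in M. f x = g x" "L1_plus_Linf M f" "L1_plus_Linf M g" "x \<in> space M"
  shows "avg \<mu> f x = avg \<mu> g x"
  using assms by (intro kernel_op_cong_AE submarkov_avg_kernel) (auto simp: L1_plus_Linf_measurable)

text \<open>Both orders are the average over one and the same convolution.\<close>

lemma avg_commute:
  assumes \<mu>: "time_law \<mu>" and \<nu>: "time_law \<nu>" and f: "L1_plus_Linf M f"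
  shows "AE x in M. avg \<mu> (avg \<nu> f) x = avg \<nu> (avg \<mu> f) x"
proof -
  have "convolution \<mu> \<nu> = convolution \<nu> \<mu>"
    using \<mu> \<nu> by (intro convolution_commutative) (auto simp: time_law_def prob_space.finite_measure)
  with avg_avg[OF \<mu> \<nu> f] avg_avg[OF \<nu> \<mu> f] show ?thesis
    by (auto elim: eventually_elim2)
qed

lemma evolve_measurable:
  assumes [measurable]: "f \<in> borel_measurable M"
  shows "(\<lambda>(s, x). evolve s f x) \<in> borel_measurable (borel \<Otimes>\<^sub>M M)"
  unfolding evolve_def split_beta' by measurable

lemma avg_has_integral:
  assumes \<mu>: "time_law \<mu>" and f: "L1_plus_Linf M f"
  shows "AE x in M. integrable \<mu> (\<lambda>s. evolve s f x) \<and> avg \<mu> f x = (\<integral>s. evolve s f x \<partial>\<mu>)"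
  using kernel_abs_finite_AE[OF submarkov_avg_kernel[OF \<mu>] f] AE_space
proof eventually_elim
  case (elim x)
  note x = elim(2)
  interpret m: prob_space \<mu> using \<mu> by (simp add: time_law_def)
  have [measurable_cong, simp]: "sets \<mu> = sets borel" and pos: "AE s in \<mu>. 0 < s"
    using \<mu> by (simp_all add: time_law_def)
  interpret P: pair_sigma_finite \<mu> M ..
  note [measurable] = x L1_plus_Linf_measurable[OF f]
  let ?F = "\<lambda>s y. k s x y * f y"
  have "integrable (\<mu> \<Otimes>\<^sub>M M) (case_prod ?F)"
  proof (rule integrableI_bounded)
    have "(\<integral>\<^sup>+w. ennreal (norm (case_prod ?F w)) \<partial>(\<mu> \<Otimes>\<^sub>M M)) =
        (\<integral>\<^sup>+y. (\<integral>\<^sup>+s. ennreal \<bar>?F s y\<bar> \<partial>\<mu>) \<partial>M)"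
      by (subst P.nn_integral_snd[symmetric]) (auto simp: split_beta')
    also have "\<dots> = (\<integral>\<^sup>+y. avg_kernel \<mu> x y * ennreal \<bar>f y\<bar> \<partial>M)"
    proof (rule nn_integral_cong)
      fix y assume y[measurable]: "y \<in> space M"
      have "(\<integral>\<^sup>+s. ennreal \<bar>?F s y\<bar> \<partial>\<mu>) = (\<integral>\<^sup>+s. ennreal (k s x y) * ennreal \<bar>f y\<bar> \<partial>\<mu>)"
        using pos by (intro nn_integral_cong_AE, eventually_elim) (simp add: abs_mult ennreal_mult' k_nonneg)
      also have "\<dots> = avg_kernel \<mu> x y * ennreal \<bar>f y\<bar>"
        unfolding avg_kernel_def by (rule nn_integral_multc) measurable
      finally show "(\<integral>\<^sup>+s. ennreal \<bar>?F s y\<bar> \<partial>\<mu>) = avg_kernel \<mu> x y * ennreal \<bar>f y\<bar>" .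
    qed
    also have "\<dots> < \<infinity>" by (rule elim)
    finally show "(\<integral>\<^sup>+w. ennreal (norm (case_prod ?F w)) \<partial>(\<mu> \<Otimes>\<^sub>M M)) < \<infinity>" .
  qed measurable
  then have "(\<integral>y. (\<integral>s. ?F s y \<partial>\<mu>) \<partial>M) = (\<integral>s. (\<integral>y. ?F s y \<partial>M) \<partial>\<mu>)"
    and "integrable \<mu> (\<lambda>s. \<integral>y. ?F s y \<partial>M)"
    using P.Fubini_integral[of ?F] P.integrable_fst'[of "case_prod ?F"] by simp_all
  moreover have "(\<integral>y. (\<integral>s. ?F s y \<partial>\<mu>) \<partial>M) = avg \<mu> f x"
    unfolding kernel_op_def
  proof (rule Bochner_Integration.integral_cong[OF refl])
    fix y assume y[measurable]: "y \<in> space M"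
    have "(\<integral>s. k s x y \<partial>\<mu>) = enn2real (avg_kernel \<mu> x y)"
      unfolding avg_kernel_def using pos
      by (intro integral_eq_nn_integral) (auto simp: k_nonneg elim: eventually_mono)
    then show "(\<integral>s. ?F s y \<partial>\<mu>) = enn2real (avg_kernel \<mu> x y) * f y" by simp
  qed
  ultimately show ?case by (simp add: evolve_def)
qed

lemma pairing_avg:
  assumes \<mu>: "time_law \<mu>" and f: "L1_plus_Linf M f" and \<phi>: "bounded_integrable M \<phi>"
  shows "(\<integral>x. f x * avg \<mu> \<phi> x \<partial>M) = (\<integral>s. (\<integral>x. f x * evolve s \<phi> x \<partial>M) \<partial>\<mu>)"
proof -
  interpret m: prob_space \<mu> using \<mu> by (simp add: time_law_def)
  have [measurable_cong, simp]: "sets \<mu> = sets borel" and pos: "AE s in \<mu>. 0 < s"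
    using \<mu> by (simp_all add: time_law_def)
  interpret P: pair_sigma_finite \<mu> M ..
  have [measurable]: "\<phi> \<in> borel_measurable M" using \<phi> by (auto simp: bounded_integrable_def)
  note [measurable] = L1_plus_Linf_measurable[OF f] evolve_measurable avg_kernel_measurable[OF \<mu>]
  note \<phi>' = bounded_integrable_imp_L1_plus_Linf[OF \<phi>]
  let ?F = "\<lambda>s x. f x * evolve s \<phi> x"
  have "integrable (\<mu> \<Otimes>\<^sub>M M) (case_prod ?F)"
  proof (rule integrableI_bounded)
    have "(\<integral>\<^sup>+w. ennreal (norm (case_prod ?F w)) \<partial>(\<mu> \<Otimes>\<^sub>M M)) =
        (\<integral>\<^sup>+x. (\<integral>\<^sup>+s. ennreal \<bar>?F s x\<bar> \<partial>\<mu>) \<partial>M)"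
      by (subst P.nn_integral_snd[symmetric]) (auto simp: split_beta')
    also have "\<dots> \<le> (\<integral>\<^sup>+x. (\<integral>\<^sup>+y. avg_kernel \<mu> x y * ennreal \<bar>\<phi> y\<bar> * ennreal \<bar>f x\<bar> \<partial>M) \<partial>M)"
    proof (rule nn_integral_mono)
      fix x assume x[measurable]: "x \<in> space M"
      have "(\<integral>\<^sup>+s. ennreal \<bar>?F s x\<bar> \<partial>\<mu>) \<le> (\<integral>\<^sup>+s. (\<integral>\<^sup>+y. ennreal (k s x y) * ennreal \<bar>\<phi> y\<bar> * ennreal \<bar>f x\<bar> \<partial>M) \<partial>\<mu>)"
        using pos
      proof (intro nn_integral_mono_AE, eventually_elim)
        case (elim s)
        have "ennreal \<bar>evolve s \<phi> x\<bar> \<le> (\<integral>\<^sup>+y. ennreal (k s x y) * ennreal \<bar>\<phi> y\<bar> \<partial>M)"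
        proof (cases "integrable M (\<lambda>y. k s x y * \<phi> y)")
          case True
          then have "ennreal \<bar>evolve s \<phi> x\<bar> \<le> (\<integral>\<^sup>+y. ennreal \<bar>k s x y * \<phi> y\<bar> \<partial>M)"
            using integral_norm_bound_ennreal[of M "\<lambda>y. k s x y * \<phi> y"] by (simp add: evolve_def)
          then show ?thesis using elim by (simp add: abs_mult ennreal_mult' k_nonneg)
        qed (simp add: evolve_def not_integrable_integral_eq)
        then have "ennreal \<bar>evolve s \<phi> x\<bar> * ennreal \<bar>f x\<bar> \<le>
            (\<integral>\<^sup>+y. ennreal (k s x y) * ennreal \<bar>\<phi> y\<bar> \<partial>M) * ennreal \<bar>f x\<bar>"
          by (rule mult_right_mono) simp
        also have "\<dots> = (\<integral>\<^sup>+y. ennreal (k s x y) * ennreal \<bar>\<phi> y\<bar> * ennreal \<bar>f x\<bar> \<partial>M)"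
          by (rule nn_integral_multc[symmetric]) measurable
        finally show ?case
          by (simp add: abs_mult ennreal_mult' mult.commute[of "ennreal \<bar>f x\<bar>"])
      qed
      also have "\<dots> = (\<integral>\<^sup>+y. (\<integral>\<^sup>+s. ennreal (k s x y) * ennreal \<bar>\<phi> y\<bar> * ennreal \<bar>f x\<bar> \<partial>\<mu>) \<partial>M)"
        by (rule P.Fubini'[symmetric]) measurable
      also have "\<dots> = (\<integral>\<^sup>+y. avg_kernel \<mu> x y * ennreal \<bar>\<phi> y\<bar> * ennreal \<bar>f x\<bar> \<partial>M)"
        unfolding avg_kernel_def
        by (intro nn_integral_cong) (simp add: nn_integral_multc)
      finally show "(\<integral>\<^sup>+s. ennreal \<bar>?F s x\<bar> \<partial>\<mu>) \<le>
        (\<integral>\<^sup>+y. avg_kernel \<mu> x y * ennreal \<bar>\<phi> y\<bar> * ennreal \<bar>f x\<bar> \<partial>M)" .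
    qed
    \<comment> \<open>Symmetry lets the kernel act on f and makes \<open>\<phi>\<close> the weight,
      the form that \<open>kernel_nn_pairing_finite\<close> bounds.\<close>
    also have "\<dots> = (\<integral>\<^sup>+y. (\<integral>\<^sup>+x. avg_kernel \<mu> y x * ennreal \<bar>f x\<bar> * ennreal \<bar>\<phi> y\<bar> \<partial>M) \<partial>M)"
    proof -
      interpret MM: pair_sigma_finite M M ..
      have "(\<integral>\<^sup>+x. (\<integral>\<^sup>+y. avg_kernel \<mu> x y * ennreal \<bar>\<phi> y\<bar> * ennreal \<bar>f x\<bar> \<partial>M) \<partial>M) =
          (\<integral>\<^sup>+y. (\<integral>\<^sup>+x. avg_kernel \<mu> x y * ennreal \<bar>\<phi> y\<bar> * ennreal \<bar>f x\<bar> \<partial>M) \<partial>M)"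
        by (rule MM.Fubini') measurable
      also have "\<dots> = (\<integral>\<^sup>+y. (\<integral>\<^sup>+x. avg_kernel \<mu> y x * ennreal \<bar>f x\<bar> * ennreal \<bar>\<phi> y\<bar> \<partial>M) \<partial>M)"
        by (intro nn_integral_cong)
          (simp add: kernel_sym[OF submarkov_avg_kernel[OF \<mu>]] mult_ac)
      finally show ?thesis .
    qed
    also have "\<dots> < \<infinity>"
      by (rule kernel_nn_pairing_finite[OF submarkov_avg_kernel[OF \<mu>] f \<phi>])
    finally show "(\<integral>\<^sup>+w. ennreal (norm (case_prod ?F w)) \<partial>(\<mu> \<Otimes>\<^sub>M M)) < \<infinity>" .
  qed measurable
  then have "(\<integral>x. (\<integral>s. ?F s x \<partial>\<mu>) \<partial>M) = (\<integral>s. (\<integral>x. ?F s x \<partial>M) \<partial>\<mu>)"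
    by (rule P.Fubini_integral)
  moreover have "(\<integral>x. f x * avg \<mu> \<phi> x \<partial>M) = (\<integral>x. (\<integral>s. ?F s x \<partial>\<mu>) \<partial>M)"
  proof (rule integral_cong_AE)
    show "(\<lambda>x. f x * avg \<mu> \<phi> x) \<in> borel_measurable M"
      by (intro borel_measurable_times kernel_op_measurable submarkov_avg_kernel \<mu>) measurable
    show "AE x in M. f x * avg \<mu> \<phi> x = (\<integral>s. ?F s x \<partial>\<mu>)"
      using avg_has_integral[OF \<mu> \<phi>'] by eventually_elim simp
  qed measurable
  ultimately show ?thesis by simp
qed

end

section \<open>Iterated differences\<close>

context kernel_semigroup
begin

section \<open>Fixed times as point masses\<close>

lemma evolve_measurable1: "f \<in> borel_measurable M \<Longrightarrow> evolve s f \<in> borel_measurable M"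
  by (drule evolve_measurable, drule measurable_Pair2[of _ _ _ _ s]) simp_all

lemma evolve_L1_plus_Linf:
  assumes "0 < t" "L1_plus_Linf M f"
  shows "L1_plus_Linf M (evolve t f)"
  by (rule L1_plus_Linf_AE_cong[OF avg_L1_plus_Linf[OF time_law_return assms(2), OF assms(1)]])
    (use assms in \<open>auto simp: avg_return evolve_measurable1 L1_plus_Linf_measurable\<close>)

lemma evolve_Lp_le:
  assumes "0 < t" "Lp_le M p C f" "0 \<le> C" "1 \<le> p"
  shows "Lp_le M p C (evolve t f)"
  by (rule Lp_le_AE_cong[OF kernel_op_Lp_le[OF submarkov_avg_kernel[OF time_law_return[OF assms(1)]] assms(2-4)]])
    (use assms in \<open>auto simp: avg_return evolve_measurable1 Lp_le_measurable\<close>)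

lemma evolve_bounded_integrable:
  assumes "0 < t" "bounded_integrable M \<phi>"
  shows "bounded_integrable M (evolve t \<phi>)"
proof -
  have "bounded_integrable M (avg (return borel t) \<phi>)"
    by (intro kernel_op_bounded_integrable submarkov_avg_kernel time_law_return assms)
  moreover have "integrable M (avg (return borel t) \<phi>) \<longleftrightarrow> integrable M (evolve t \<phi>)"
    using assms by (intro Bochner_Integration.integrable_cong) (auto simp: avg_return)
  ultimately show ?thesis
    using assms by (auto simp: bounded_integrable_def avg_return)
qed

lemma evolve_adjoint:
  assumes "0 < t" "L1_plus_Linf M f" "bounded_integrable M \<phi>"
  shows "(\<integral>x. evolve t f x * \<phi> x \<partial>M) = (\<integral>x. f x * evolve t \<phi> x \<partial>M)"
proof -
  have "(\<integral>x. avg (return borel t) f x * \<phi> x \<partial>M) = (\<integral>x. f x * avg (return borel t) \<phi> x \<partial>M)"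
    by (intro kernel_op_adjoint submarkov_avg_kernel time_law_return assms)
  then show ?thesis using assms(1) by (simp add: avg_return cong: Bochner_Integration.integral_cong)
qed

lemma evolve_cong_AE:
  assumes "0 < t" "AE x in M. f x = g x" "L1_plus_Linf M f" "L1_plus_Linf M g" "x \<in> space M"
  shows "evolve t f x = evolve t g x"
  using avg_cong_AE[OF time_law_return assms(2-5), of t] assms(1,5) by (simp add: avg_return)

lemma evolve_add:
  assumes "0 < t" "L1_plus_Linf M f" "L1_plus_Linf M g"
  shows "AE x in M. evolve t (\<lambda>x. f x + g x) x = evolve t f x + evolve t g x"
  using kernel_op_add[OF submarkov_avg_kernel[OF time_law_return[OF assms(1)]] assms(2,3)] AE_space
  by eventually_elim (use assms(1) in \<open>simp add: avg_return\<close>)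

lemma evolve_mult: "evolve t (\<lambda>x. c * f x) x = c * evolve t f x"
proof -
  have "(\<lambda>y. k t x y * (c * f y)) = (\<lambda>y. c * (k t x y * f y))"
    by (auto simp: algebra_simps)
  then show ?thesis by (simp add: evolve_def)
qed

lemma evolve_sum:
  assumes "0 < t" "\<And>i. i \<in> I \<Longrightarrow> L1_plus_Linf M (f i)"
  shows "AE x in M. evolve t (\<lambda>x. \<Sum>i\<in>I. f i x) x = (\<Sum>i\<in>I. evolve t (f i) x)"
proof -
  have "AE x in M. avg (return borel t) (\<lambda>x. \<Sum>i\<in>I. f i x) x = (\<Sum>i\<in>I. avg (return borel t) (f i) x)"
    by (intro kernel_op_sum submarkov_avg_kernel time_law_return assms)
  then show ?thesis
    using AE_space by eventually_elim (use assms(1) in \<open>simp add: avg_return\<close>)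
qed

lemma evolve_evolve:
  assumes s: "0 < s" and t: "0 < t" and f: "L1_plus_Linf M f"
  shows "AE x in M. evolve s (evolve t f) x = evolve (s + t) f x"
proof -
  let ?r = "return borel :: real \<Rightarrow> real measure"
  have "AE x in M. avg (?r s) (avg (?r t) f) x = avg (?r (s + t)) f x"
  proof (rule kernel_op_compose)
    fix x y assume "x \<in> space M" "y \<in> space M"
    then show "(\<integral>\<^sup>+z. avg_kernel (?r s) x z * avg_kernel (?r t) z y \<partial>M) = avg_kernel (?r (s + t)) x y"
      using s t k_semigroup[of s t x y]
      by (simp add: avg_kernel_return ennreal_mult k_nonneg cong: nn_integral_cong)
  qed (use s t f in \<open>auto intro!: submarkov_avg_kernel time_law_return\<close>)
  then show ?thesis
    using AE_space
  proof eventually_elim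
    case (elim x)
    have "avg (?r s) (avg (?r t) f) x = evolve s (avg (?r t) f) x"
      using elim s by (simp add: avg_return)
    also have "\<dots> = evolve s (evolve t f) x"
      unfolding evolve_def using t
      by (intro Bochner_Integration.integral_cong) (auto simp: avg_return evolve_def)
    finally show ?case using elim s t by (simp add: avg_return)
  qed
qed

section \<open>Powers of the difference operator and their commutation with averages\<close>

abbreviation diff :: "real \<Rightarrow> ('a \<Rightarrow> real) \<Rightarrow> 'a \<Rightarrow> real" where
  "diff \<equiv> semigroup_diff evolve"

lemma diff_L1_plus_Linf:
  assumes "0 < h" "L1_plus_Linf M f"
  shows "L1_plus_Linf M (diff h f)"
  using L1_plus_Linf_add[OF evolve_L1_plus_Linf[OF assms] L1_plus_Linf_mult[OF assms(2), of "- 1"]]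
  by (simp add: semigroup_diff_def)

lemma diff_power_L1_plus_Linf:
  "0 < h \<Longrightarrow> L1_plus_Linf M f \<Longrightarrow> L1_plus_Linf M ((diff h ^^ n) f)"
  by (induction n) (auto intro: diff_L1_plus_Linf)

lemma diff_cong_AE:
  assumes "0 < h" "AE x in M. f x = g x" "L1_plus_Linf M f" "L1_plus_Linf M g"
  shows "AE x in M. diff h f x = diff h g x"
  using assms(2) AE_space
  by eventually_elim (use evolve_cong_AE[OF assms] in \<open>auto simp: semigroup_diff_def\<close>)

lemma diff_power_cong_AE:
  assumes "0 < h" "AE x in M. f x = g x" "L1_plus_Linf M f" "L1_plus_Linf M g"
  shows "AE x in M. (diff h ^^ n) f x = (diff h ^^ n) g x"
proof (induction n)
  case 0
  show ?case using assms(2) by simp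
next
  case (Suc n)
  show ?case
    using diff_cong_AE[OF assms(1) Suc diff_power_L1_plus_Linf[OF assms(1,3)] diff_power_L1_plus_Linf[OF assms(1,4)]]
    by simp
qed

lemma diff_mult: "diff h (\<lambda>x. c * f x) = (\<lambda>x. c * diff h f x)"
  by (auto simp: semigroup_diff_def evolve_mult algebra_simps)

lemma diff_power_mult: "(diff h ^^ n) (\<lambda>x. c * f x) = (\<lambda>x. c * (diff h ^^ n) f x)"
  by (induction n) (auto simp: diff_mult)

lemma diff_add:
  assumes "0 < h" "L1_plus_Linf M f" "L1_plus_Linf M g"
  shows "AE x in M. diff h (\<lambda>x. f x + g x) x = diff h f x + diff h g x"
  using evolve_add[OF assms] by eventually_elim (simp add: semigroup_diff_def)

lemma diff_power_add:
  assumes "0 < h" "L1_plus_Linf M f" "L1_plus_Linf M g"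
  shows "AE x in M. (diff h ^^ n) (\<lambda>x. f x + g x) x = (diff h ^^ n) f x + (diff h ^^ n) g x"
proof (induction n)
  case (Suc n)
  note X = diff_power_L1_plus_Linf[OF assms(1)]
  have "AE x in M. diff h ((diff h ^^ n) (\<lambda>x. f x + g x)) x =
      diff h (\<lambda>x. (diff h ^^ n) f x + (diff h ^^ n) g x) x"
    using assms Suc by (intro diff_cong_AE X L1_plus_Linf_add)
  moreover have "AE x in M. diff h (\<lambda>x. (diff h ^^ n) f x + (diff h ^^ n) g x) x =
      diff h ((diff h ^^ n) f) x + diff h ((diff h ^^ n) g) x"
    using assms by (intro diff_add X)
  ultimately show ?case by eventually_elim simp
qed simp

text \<open>Contractivity of \<open>evolve h\<close> costs a factor 2 per difference; this is the
  origin of \<open>2 ^ r\<close> in the final constant.\<close>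

lemma diff_power_Lp_le:
  assumes "0 < h" "Lp_le M p C f" "0 \<le> C" "1 \<le> p"
  shows "Lp_le M p (2 ^ n * C) ((diff h ^^ n) f)"
proof (induction n)
  case 0
  show ?case using assms by simp
next
  case (Suc n)
  have "Lp_le M p (2 ^ n * C + \<bar>- 1\<bar> * (2 ^ n * C))
     (\<lambda>x. evolve h ((diff h ^^ n) f) x + - 1 * (diff h ^^ n) f x)"
    using assms Suc by (intro Lp_le_add evolve_Lp_le Lp_le_mult) auto
  then show ?case by (simp add: semigroup_diff_def[of evolve h "(diff h ^^ n) f"] algebra_simps)
qed

text \<open>Averages over any two time laws commute, in particular when one of them is the point
  mass at h.\<close>

lemma diff_avg:
  assumes "0 < h" "time_law \<mu>" "L1_plus_Linf M f"
  shows "AE x in M. diff h (avg \<mu> f) x = avg \<mu> (diff h f) x"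
proof -
  note tl = time_law_return[OF assms(1)]
  have X: "L1_plus_Linf M (evolve h f)" "L1_plus_Linf M (\<lambda>x. - 1 * f x)"
    using assms by (auto intro!: evolve_L1_plus_Linf L1_plus_Linf_mult[where c = "- 1", simplified])
  have "AE x in M. avg \<mu> (\<lambda>x. evolve h f x + - 1 * f x) x = avg \<mu> (evolve h f) x + avg \<mu> (\<lambda>x. - 1 * f x) x"
    by (rule kernel_op_add[OF submarkov_avg_kernel[OF assms(2)] X])
  moreover have "AE x in M. avg (return borel h) (avg \<mu> f) x = avg \<mu> (avg (return borel h) f) x"
    using tl assms by (intro avg_commute)
  ultimately show ?thesis
    using AE_space
  proof eventually_elim
    case (elim x)
    have "avg \<mu> (avg (return borel h) f) x = avg \<mu> (evolve h f) x"
      using assms elim tl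
      by (intro avg_cong_AE) (auto simp: avg_return intro: avg_L1_plus_Linf evolve_L1_plus_Linf)
    then have "evolve h (avg \<mu> f) x = avg \<mu> (evolve h f) x"
      using elim assms(1) by (simp add: avg_return)
    moreover have "avg \<mu> (\<lambda>x. - 1 * f x) x = - 1 * avg \<mu> f x"
      by (rule kernel_op_mult[OF submarkov_avg_kernel[OF assms(2)]])
    ultimately show ?case using elim by (simp add: semigroup_diff_def)
  qed
qed

lemma diff_power_avg:
  assumes "0 < h" "time_law \<mu>" "L1_plus_Linf M f"
  shows "AE x in M. (diff h ^^ n) (avg \<mu> f) x = avg \<mu> ((diff h ^^ n) f) x"
proof (induction n)
  case (Suc n)
  have "AE x in M. diff h ((diff h ^^ n) (avg \<mu> f)) x = diff h (avg \<mu> ((diff h ^^ n) f)) x"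
    using assms Suc by (intro diff_cong_AE diff_power_L1_plus_Linf avg_L1_plus_Linf)
  moreover have "AE x in M. diff h (avg \<mu> ((diff h ^^ n) f)) x = avg \<mu> (diff h ((diff h ^^ n) f)) x"
    using assms by (intro diff_avg diff_power_L1_plus_Linf)
  ultimately show ?case by eventually_elim simp
qed simp

lemma avg_power_L1_plus_Linf:
  "time_law \<mu> \<Longrightarrow> L1_plus_Linf M f \<Longrightarrow> L1_plus_Linf M ((avg \<mu> ^^ n) f)"
  by (induction n) (auto intro: avg_L1_plus_Linf)

lemma diff_avg_power:
  assumes "0 < h" "time_law \<mu>" "L1_plus_Linf M f"
  shows "AE x in M. diff h ((avg \<mu> ^^ n) f) x = (avg \<mu> ^^ n) (diff h f) x"
proof (induction n)
  case (Suc n)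
  have "AE x in M. diff h (avg \<mu> ((avg \<mu> ^^ n) f)) x = avg \<mu> (diff h ((avg \<mu> ^^ n) f)) x"
    using assms by (intro diff_avg avg_power_L1_plus_Linf)
  then show ?case
    using AE_space
  proof eventually_elim
    case (elim x)
    have "avg \<mu> (diff h ((avg \<mu> ^^ n) f)) x = avg \<mu> ((avg \<mu> ^^ n) (diff h f)) x"
      using assms Suc elim by (intro avg_cong_AE diff_L1_plus_Linf avg_power_L1_plus_Linf) auto
    with elim show ?case by simp
  qed
qed simp

lemma avg_power_Lp_le:
  assumes "time_law \<mu>" "Lp_le M p C f" "0 \<le> C" "1 \<le> p"
  shows "Lp_le M p C ((avg \<mu> ^^ n) f)"
  using assms by (induction n) (auto intro!: kernel_op_Lp_le submarkov_avg_kernel)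

lemma avg_power_eq:
  assumes "time_law \<mu>" "L1_plus_Linf M f"
  shows "AE x in M. (avg \<mu> ^^ Suc n) f x = avg (convolution_power \<mu> n) f x"
proof (induction n)
  case (Suc n)
  note tl = time_law_convolution_power[OF assms(1), of n]
  have "AE x in M. avg \<mu> (avg (convolution_power \<mu> n) f) x = avg (convolution \<mu> (convolution_power \<mu> n)) f x"
    using assms tl by (intro avg_avg)
  then show ?case
    using AE_space
  proof eventually_elim
    case (elim x)
    have "avg \<mu> ((avg \<mu> ^^ Suc n) f) x = avg \<mu> (avg (convolution_power \<mu> n) f) x"
      using assms tl elim Suc by (intro avg_cong_AE avg_power_L1_plus_Linf avg_L1_plus_Linf)
    with elim show ?case by simp
  qed
qed simp

text \<open>The coefficient of T^(jh) in (T^h - I)^n; the exponent n + j has the parity of n -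
  j.\<close>

definition diff_coeff :: "nat \<Rightarrow> nat \<Rightarrow> real" where
  "diff_coeff n j = (- 1) ^ (n + j) * real (n choose j)"

text \<open>The binomial theorem, by Pascal's rule. The term j = 0 stands apart because
  \<open>evolve 0\<close> is not assumed to be the identity.\<close>

lemma diff_power_expand:
  assumes h: "0 < h" and f: "L1_plus_Linf M f"
  shows "AE x in M. (diff h ^^ n) f x = (- 1) ^ n * f x + (\<Sum>j=1..n. diff_coeff n j * evolve (real j * h) f x)"
proof -
  define P where "P j = (if j = 0 then f else evolve (real j * h) f)" for j :: nat
  have PX: "L1_plus_Linf M (P j)" for j
    using h f by (auto simp: P_def intro: evolve_L1_plus_Linf)
  have step: "AE x in M. evolve h (P j) x = P (Suc j) x" for j
  proof (cases "j = 0")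
    case False
    then have "AE x in M. evolve h (evolve (real j * h) f) x = evolve (h + real j * h) f x"
      using h f by (intro evolve_evolve) auto
    then show ?thesis using False by (simp add: P_def distrib_right)
  qed (simp add: P_def)
  have "AE x in M. (diff h ^^ n) f x = (\<Sum>j\<le>n. diff_coeff n j * P j x)"
  proof (induction n)
    case 0
    then show ?case by (simp add: P_def diff_coeff_def)
  next
    case (Suc n)
    let ?S = "\<lambda>x. \<Sum>j\<le>n. diff_coeff n j * P j x"
    have cong: "AE x in M. diff h ((diff h ^^ n) f) x = diff h ?S x"
      using h f Suc PX
      by (intro diff_cong_AE diff_power_L1_plus_Linf L1_plus_Linf_sum L1_plus_Linf_mult)
    have ev: "AE x in M. evolve h ?S x = (\<Sum>j\<le>n. evolve h (\<lambda>x. diff_coeff n j * P j x) x)"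
      using h PX by (intro evolve_sum L1_plus_Linf_mult)
    have all: "AE x in M. \<forall>j\<in>{..n}. evolve h (P j) x = P (Suc j) x"
      by (subst AE_ball_countable) (auto intro: step)
    show ?case
      using cong ev all
    proof eventually_elim
      case (elim x)
      have coeff: "diff_coeff (Suc n) (Suc j) = diff_coeff n j - diff_coeff n (Suc j)" for j
        by (simp add: diff_coeff_def algebra_simps)
      have "(diff h ^^ Suc n) f x = (\<Sum>j\<le>n. diff_coeff n j * P (Suc j) x) - ?S x"
        using elim by (simp add: semigroup_diff_def evolve_mult)
      \<comment> \<open>The added term is 0, as n choose n + 1 vanishes; it aligns the two sums for
        the index shift.\<close>
      also have "?S x = (\<Sum>j\<le>Suc n. diff_coeff n j * P j x)"
        by (simp add: diff_coeff_def)
      also have "\<dots> = diff_coeff n 0 * P 0 x + (\<Sum>j\<le>n. diff_coeff n (Suc j) * P (Suc j) x)"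
        by (rule sum.atMost_Suc_shift)
      also have "(\<Sum>j\<le>n. diff_coeff n j * P (Suc j) x) - \<dots>
          = - diff_coeff n 0 * P 0 x + (\<Sum>j\<le>n. diff_coeff (Suc n) (Suc j) * P (Suc j) x)"
        by (simp add: coeff sum_subtractf left_diff_distrib)
      also have "- diff_coeff n 0 = diff_coeff (Suc n) 0" by (simp add: diff_coeff_def)
      also have "diff_coeff (Suc n) 0 * P 0 x + (\<Sum>j\<le>n. diff_coeff (Suc n) (Suc j) * P (Suc j) x)
          = (\<Sum>j\<le>Suc n. diff_coeff (Suc n) j * P j x)"
        by (rule sum.atMost_Suc_shift[symmetric])
      finally show ?case .
    qed
  qed
  moreover have "(\<Sum>j\<le>n. diff_coeff n j * P j x) =
      (- 1) ^ n * f x + (\<Sum>j=1..n. diff_coeff n j * evolve (real j * h) f x)" for x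
  proof -
    have "{..n} = insert 0 {1..n}" by auto
    then have "(\<Sum>j\<le>n. diff_coeff n j * P j x) = diff_coeff n 0 * P 0 x + (\<Sum>j=1..n. diff_coeff n j * P j x)"
      by simp
    also have "(\<Sum>j=1..n. diff_coeff n j * P j x) = (\<Sum>j=1..n. diff_coeff n j * evolve (real j * h) f x)"
      by (intro sum.cong) (auto simp: P_def)
    finally show ?thesis by (simp add: P_def diff_coeff_def)
  qed
  ultimately show ?thesis by simp
qed

text \<open>Measurability is required jointly in time and space because the time is averaged out
  afterwards; the induction step integrates over a third variable y.\<close>

lemma diff_power_measurable:
  assumes [measurable]: "f \<in> borel_measurable M"
  shows "(\<lambda>(s, x). (diff s ^^ m) f x) \<in> borel_measurable (borel \<Otimes>\<^sub>M M)"
proof (induction m)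
  case 0
  show ?case unfolding funpow.simps id_apply split_beta' by measurable
next
  case (Suc m)
  have "(\<lambda>w. (\<lambda>(s, x). (diff s ^^ m) f x) (fst (fst w), snd w)) \<in> borel_measurable ((borel \<Otimes>\<^sub>M M) \<Otimes>\<^sub>M M)"
    by (rule measurable_compose[OF _ Suc]) measurable
  then have [measurable]: "(\<lambda>w. (diff (fst (fst w)) ^^ m) f (snd w)) \<in> borel_measurable ((borel \<Otimes>\<^sub>M M) \<Otimes>\<^sub>M M)"
    by simp
  have [measurable]: "(\<lambda>w. (diff (fst w) ^^ m) f (snd w)) \<in> borel_measurable (borel \<Otimes>\<^sub>M M)"
    using Suc by (simp add: split_beta')
  have "(\<lambda>w. (\<integral>y. k (fst w) (snd w) y * (diff (fst w) ^^ m) f y \<partial>M) - (diff (fst w) ^^ m) f (snd w))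
      \<in> borel_measurable (borel \<Otimes>\<^sub>M M)"
    by measurable
  moreover have "(diff s ^^ Suc m) f x = (\<integral>y. k s x y * (diff s ^^ m) f y \<partial>M) - (diff s ^^ m) f x" for s x
    by (simp add: semigroup_diff_def[of evolve s "(diff s ^^ m) f"] evolve_def[of s "(diff s ^^ m) f"])
  ultimately show ?case
    by (simp only: split_beta')
qed

text \<open>Averaging the expansion of the \<open>n\<close>-th difference over the time turns its lower-order terms
  into iterated averages: this is the Steklov mean of \<open>f\<close>.\<close>

lemma average_diff_power:
  assumes h: "0 < h" and f: "L1_plus_Linf M f"
  shows "AE x in M. (\<integral>s. (diff (h * s) ^^ Suc n) f x \<partial>convolution_power unit_law n) =
    (- 1) ^ Suc n * f x +
    (\<Sum>j=1..Suc n. diff_coeff (Suc n) j * (avg (scale (real j * h) unit_law) ^^ Suc n) f x)"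
proof -
  let ?L = "convolution_power unit_law n"
  have tl: "time_law ?L" by (intro time_law_convolution_power time_law_unit_law)
  interpret L: prob_space ?L using tl by (simp add: time_law_def)
  have [measurable_cong]: "sets ?L = sets borel" using tl by (simp add: time_law_def)
  interpret P: pair_sigma_finite ?L M ..
  note [measurable] = L1_plus_Linf_measurable[OF f]
  have pos: "AE s in ?L. 0 < s" using tl by (simp add: time_law_def)
  have dm': "(\<lambda>(s, x). (diff (h * s) ^^ Suc n) f x) \<in> borel_measurable (?L \<Otimes>\<^sub>M M)"
  proof -
    have "(\<lambda>w. (\<lambda>(s, x). (diff s ^^ Suc n) f x) (h * fst w, snd w)) \<in> borel_measurable (?L \<Otimes>\<^sub>M M)"
      by (rule measurable_compose[OF _ diff_power_measurable[OF L1_plus_Linf_measurable[OF f]]]) measurable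
    then show ?thesis by (simp add: split_beta')
  qed
  have em: "(\<lambda>(s, x). evolve (real j * (h * s)) f x) \<in> borel_measurable (?L \<Otimes>\<^sub>M M)" for j
  proof -
    have "(\<lambda>w. (\<lambda>(s, x). evolve s f x) (real j * (h * fst w), snd w)) \<in> borel_measurable (?L \<Otimes>\<^sub>M M)"
      by (rule measurable_compose[OF _ evolve_measurable]) measurable
    then show ?thesis by (simp add: split_beta')
  qed
  let ?R = "\<lambda>s x. (- 1) ^ Suc n * f x + (\<Sum>j=1..Suc n. diff_coeff (Suc n) j * evolve (real j * (h * s)) f x)"
  have "AE s in ?L. AE x in M. (diff (h * s) ^^ Suc n) f x = ?R s x"
    using pos by eventually_elim (use h f in \<open>intro diff_power_expand, auto\<close>)
  moreover have rm: "(\<lambda>(s, x). ?R s x) \<in> borel_measurable (?L \<Otimes>\<^sub>M M)"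
    unfolding split_beta' using em[unfolded split_beta']
    by (intro borel_measurable_add borel_measurable_sum borel_measurable_times) auto
  have "{z \<in> space (?L \<Otimes>\<^sub>M M). (diff (h * fst z) ^^ Suc n) f (snd z) = ?R (fst z) (snd z)} \<in> sets (?L \<Otimes>\<^sub>M M)"
    using dm' rm unfolding split_beta' by (rule borel_measurable_eq)
  \<comment> \<open>For each s the expansion holds outside a null set of x that depends on s. Joint
    measurability allows the order of the two quantifiers to be exchanged.\<close>
  ultimately have "AE x in M. AE s in ?L. (diff (h * s) ^^ Suc n) f x = ?R s x"
    by (subst (asm) P.AE_commute)
  moreover have "AE x in M. \<forall>j\<in>{1..Suc n}. (avg (scale (real j * h) unit_law) ^^ Suc n) f x =
      (\<integral>s. evolve (real j * (h * s)) f x \<partial>?L) \<and> integrable ?L (\<lambda>s. evolve (real j * (h * s)) f x)"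
  proof (subst AE_ball_countable, simp, safe)
    fix j assume j: "j \<in> {1..Suc n}"
    then have jh: "0 < real j * h" using h by simp
    let ?S = "scale (real j * h) unit_law"
    have tlS: "time_law ?S" by (intro time_law_scale time_law_unit_law jh)
    have tlC: "time_law (convolution_power ?S n)" by (rule time_law_convolution_power[OF tlS])
    show "AE x in M. (avg ?S ^^ Suc n) f x =
      (\<integral>s. evolve (real j * (h * s)) f x \<partial>?L) \<and> integrable ?L (\<lambda>s. evolve (real j * (h * s)) f x)"
      using avg_power_eq[OF tlS f, of n] avg_has_integral[OF tlC f] AE_space
    proof eventually_elim
      case (elim x)
      have [measurable]: "(\<lambda>s. evolve s f x) \<in> borel_measurable borel"
        using measurable_Pair1[OF evolve_measurable elim(3)] by simp
      \<comment> \<open>If s has law \<open>?L\<close>, then j h s has the convolution power of the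
        scaled uniform law. So averaging \<open>evolve (real j * (h * s)) f\<close> over s gives the
        iterated average of \<open>f\<close>.\<close>
      have C: "convolution_power ?S n = distr ?L borel (\<lambda>s. real j * h * s)"
        unfolding scale_convolution_power[OF time_law_unit_law] by (simp add: scale_def)
      show ?case
        using elim(1,2) unfolding C by (simp add: integral_distr integrable_distr_eq mult.assoc)
    qed
  qed
  ultimately show ?thesis
    using AE_space
  proof eventually_elim
    case (elim x)
    have "(\<integral>s. (diff (h * s) ^^ Suc n) f x \<partial>?L) = (\<integral>s. ?R s x \<partial>?L)"
    proof (rule integral_cong_AE)
      show "(\<lambda>s. (diff (h * s) ^^ Suc n) f x) \<in> borel_measurable ?L"
        using dm' elim(3) by (auto dest: measurable_Pair1)
      show "(\<lambda>s. ?R s x) \<in> borel_measurable ?L"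
        using elim(2) by (intro borel_measurable_add borel_measurable_sum borel_measurable_times) auto
    qed (use elim in auto)
    also have "\<dots> = (- 1) ^ Suc n * f x + (\<Sum>j=1..Suc n. \<integral>s. diff_coeff (Suc n) j * evolve (real j * (h * s)) f x \<partial>?L)"
    proof -
      have ii: "integrable ?L (\<lambda>s. diff_coeff (Suc n) j * evolve (real j * (h * s)) f x)" if "j \<in> {1..Suc n}" for j
        using elim(2) that by (intro integrable_mult_right) blast
      have "(\<integral>s. ?R s x \<partial>?L) = (\<integral>s. (- 1) ^ Suc n * f x \<partial>?L) +
          (\<integral>s. (\<Sum>j=1..Suc n. diff_coeff (Suc n) j * evolve (real j * (h * s)) f x) \<partial>?L)"
        by (intro Bochner_Integration.integral_add Bochner_Integration.integrable_sum ii L.integrable_const)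
      also have "(\<integral>s. (\<Sum>j=1..Suc n. diff_coeff (Suc n) j * evolve (real j * (h * s)) f x) \<partial>?L) =
          (\<Sum>j=1..Suc n. \<integral>s. diff_coeff (Suc n) j * evolve (real j * (h * s)) f x \<partial>?L)"
        by (rule Bochner_Integration.integral_sum) (rule ii)
      finally show ?thesis by (simp only: lebesgue_integral_const L.prob_space scaleR_one)
    qed
    also have "\<dots> = (- 1) ^ Suc n * f x +
       (\<Sum>j=1..Suc n. diff_coeff (Suc n) j * (avg (scale (real j * h) unit_law) ^^ Suc n) f x)"
      using elim(2) by (intro arg_cong2[where f = "(+)"] sum.cong) auto
    finally show ?case .
  qed
qed

end

section \<open>Smooth functions\<close>

definition smooth :: "('a::euclidean_space \<Rightarrow> real) \<Rightarrow> bool" where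
  "smooth f \<longleftrightarrow> (\<forall>k. Ck k f)"

lemma partial_eq: "(f has_derivative f') (at x) \<Longrightarrow> partial i f x = f' i"
  unfolding partial_def by (metis frechet_derivative_at)

lemma Ck_SucD: "Ck (Suc k) f \<Longrightarrow> Ck k f"
proof (induction k arbitrary: f)
  case 0
  then show ?case by (auto intro: differentiable_imp_continuous_on)
next
  case (Suc k)
  then show ?case by simp
qed

lemma Ck_differentiable: "Ck (Suc k) f \<Longrightarrow> f differentiable at x"
  by (auto simp: differentiable_on_def)

lemma has_derivative_frechet: "f differentiable at x \<Longrightarrow> (f has_derivative frechet_derivative f (at x)) (at x)"
  by (simp add: frechet_derivative_works)

lemma partial_add:
  assumes "f differentiable at x" "g differentiable at x"
  shows "partial i (\<lambda>x. f x + g x) x = partial i f x + partial i g x"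
  using partial_eq[OF has_derivative_add[OF has_derivative_frechet[OF assms(1)] has_derivative_frechet[OF assms(2)]]]
  by (simp add: partial_def)

lemma partial_mult:
  assumes "f differentiable at x" "g differentiable at x"
  shows "partial i (\<lambda>x. f x * g x) x = f x * partial i g x + partial i f x * g x"
  using partial_eq[OF has_derivative_mult[OF has_derivative_frechet[OF assms(1)] has_derivative_frechet[OF assms(2)]]]
  by (simp add: partial_def)

lemma partial_const: "partial i (\<lambda>_. c) = (\<lambda>_. 0)"
  by (auto intro!: ext partial_eq has_derivative_const)

lemma Ck_const: "Ck k (\<lambda>_. c)"
  by (induction k arbitrary: c) (auto simp: partial_const)

lemma Ck_add: "Ck k f \<Longrightarrow> Ck k g \<Longrightarrow> Ck k (\<lambda>x. f x + g x)"
proof (induction k arbitrary: f g)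
  case 0
  then show ?case by (auto intro: continuous_on_add)
next
  case (Suc k)
  have "partial i (\<lambda>x. f x + g x) = (\<lambda>x. partial i f x + partial i g x)" for i
    using Suc.prems[THEN Ck_differentiable] by (auto intro!: ext partial_add)
  with Suc show ?case by (auto simp: differentiable_on_def)
qed

lemma Ck_mult: "Ck k f \<Longrightarrow> Ck k g \<Longrightarrow> Ck k (\<lambda>x. f x * g x)"
proof (induction k arbitrary: f g)
  case 0
  then show ?case by (auto intro: continuous_on_mult)
next
  case (Suc k)
  have "partial i (\<lambda>x. f x * g x) = (\<lambda>x. f x * partial i g x + partial i f x * g x)" for i
    using Suc.prems[THEN Ck_differentiable] by (auto intro!: ext partial_mult)
  moreover have "Ck k f" "Ck k g" using Suc.prems by (auto dest: Ck_SucD simp del: Ck.simps)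
  ultimately show ?case
    using Suc by (auto simp: differentiable_on_def intro!: Ck_add)
qed

lemma smooth_Ck: "smooth f \<Longrightarrow> Ck k f"
  by (simp add: smooth_def)

lemma smooth_differentiable: "smooth f \<Longrightarrow> f differentiable at x"
  using Ck_differentiable[of 0 f x] by (auto simp: smooth_def simp del: Ck.simps)

lemma smooth_continuous: "smooth f \<Longrightarrow> continuous_on UNIV f"
  using smooth_Ck[of f 0] by simp

lemma smooth_const: "smooth (\<lambda>_. c)"
  by (simp add: smooth_def Ck_const)

lemma smooth_add: "smooth f \<Longrightarrow> smooth g \<Longrightarrow> smooth (\<lambda>x. f x + g x)"
  by (simp add: smooth_def Ck_add)

lemma smooth_mult: "smooth f \<Longrightarrow> smooth g \<Longrightarrow> smooth (\<lambda>x. f x * g x)"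
  by (simp add: smooth_def Ck_mult)

lemma smooth_minus: "smooth f \<Longrightarrow> smooth (\<lambda>x. - f x)"
  using smooth_mult[OF smooth_const[of "- 1"], of f] by simp

lemma smooth_diff: "smooth f \<Longrightarrow> smooth g \<Longrightarrow> smooth (\<lambda>x. f x - g x)"
  using smooth_add[OF _ smooth_minus, of f g] by simp

lemma smooth_power: "smooth f \<Longrightarrow> smooth (\<lambda>x. f x ^ n)"
  by (induction n) (auto simp: smooth_const smooth_mult)

lemma smooth_sum: "(\<And>i. i \<in> I \<Longrightarrow> smooth (f i)) \<Longrightarrow> smooth (\<lambda>x. \<Sum>i\<in>I. f i x)"
  by (induction I rule: infinite_finite_induct) (auto simp: smooth_const smooth_add)

lemma smooth_prod: "(\<And>i. i \<in> I \<Longrightarrow> smooth (f i)) \<Longrightarrow> smooth (\<lambda>x. \<Prod>i\<in>I. f i x)"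
  by (induction I rule: infinite_finite_induct) (auto simp: smooth_const smooth_mult)

lemma smooth_partial: "smooth f \<Longrightarrow> i \<in> Basis \<Longrightarrow> smooth (partial i f)"
  unfolding smooth_def by (metis Ck.simps(2))

lemma partial_inner: "partial i (\<lambda>x. x \<bullet> v) = (\<lambda>_. i \<bullet> v)"
  by (rule ext, rule partial_eq) (rule has_derivative_inner_left[OF has_derivative_ident])

lemma smooth_inner: "smooth (\<lambda>x. x \<bullet> v)"
proof -
  have "Ck k (\<lambda>x. x \<bullet> v)" for k
  proof (cases k)
    case 0
    then show ?thesis by (simp add: continuous_on_inner)
  next
    case (Suc m)
    have "(\<lambda>x. x \<bullet> v) differentiable at y within UNIV" for y
      by (rule differentiableI[OF has_derivative_inner_left[OF has_derivative_ident]])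
    with Suc show ?thesis by (simp add: partial_inner Ck_const differentiable_on_def)
  qed
  then show ?thesis by (simp add: smooth_def)
qed

lemma smooth_norm_square: "smooth (\<lambda>x. (norm x)\<^sup>2)"
proof -
  have "smooth (\<lambda>x::'a. \<Sum>i\<in>Basis. (x \<bullet> i)\<^sup>2)"
    by (intro smooth_sum smooth_power smooth_inner)
  moreover have "(norm x)\<^sup>2 = (\<Sum>i\<in>Basis. (x \<bullet> i)\<^sup>2)" for x :: 'a
    by (subst power2_norm_eq_inner, subst euclidean_inner) (simp add: power2_eq_square)
  ultimately show ?thesis by simp
qed

lemma partial_compose:
  assumes "(d has_real_derivative d') (at (g x))" "g differentiable at x"
  shows "partial i (\<lambda>x. d (g x)) x = d' * partial i g x"
  using partial_eq[OF DERIV_compose_FDERIV[OF assms(1) has_derivative_frechet[OF assms(2)]], of i]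
  by (simp add: partial_def mult.commute)

text \<open>The outer function comes with all its derivatives \<open>d n\<close>, so that the
  induction on the order of differentiability can pass to \<open>d (Suc n)\<close>. For
  \<open>exp\<close> the sequence is constant; for \<open>flat\<close> it runs through
  polynomials.\<close>

lemma smooth_compose:
  fixes d :: "nat \<Rightarrow> real \<Rightarrow> real"
  assumes d: "\<And>n s. (d n has_real_derivative d (Suc n) s) (at s)" and g: "smooth g"
  shows "smooth (\<lambda>x. d n (g x))"
proof -
  have "Ck k (\<lambda>x. d n (g x))" for k n
  proof (induction k arbitrary: n)
    case 0
    have "continuous_on UNIV (d n)"
      by (intro continuous_at_imp_continuous_on ballI DERIV_isCont[OF d])
    then show ?case
      using smooth_continuous[OF g] by (auto intro: continuous_on_compose2)
  next
    case (Suc k)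
    have "partial i (\<lambda>x. d n (g x)) = (\<lambda>x. d (Suc n) (g x) * partial i g x)" for i
      by (intro ext partial_compose d smooth_differentiable g)
    moreover have "(\<lambda>x. d n (g x)) differentiable at x" for x
      using DERIV_compose_FDERIV[OF d has_derivative_frechet[OF smooth_differentiable[OF g]]]
      by (rule differentiableI)
    ultimately show ?case
      using Suc g by (auto simp: differentiable_on_def intro!: Ck_mult smooth_Ck[OF smooth_partial])
  qed
  then show ?thesis by (simp add: smooth_def)
qed

lemma smooth_exp: "smooth g \<Longrightarrow> smooth (\<lambda>x. exp (g x))"
  by (rule smooth_compose[where d = "\<lambda>_. exp"]) (auto intro: DERIV_exp)

lemma partial_scaleR:
  assumes "f differentiable at (a *\<^sub>R x)"
  shows "partial i (\<lambda>x. f (a *\<^sub>R x)) x = a * partial i f (a *\<^sub>R x)"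
proof -
  let ?f' = "frechet_derivative f (at (a *\<^sub>R x))"
  have f: "(f has_derivative ?f') (at (a *\<^sub>R x))" by (rule has_derivative_frechet[OF assms])
  have "((\<lambda>x. f (a *\<^sub>R x)) has_derivative (\<lambda>h. ?f' (a *\<^sub>R h))) (at x)"
    by (rule has_derivative_compose[where f = "\<lambda>x. a *\<^sub>R x" and g = f, OF _ f]) (auto intro!: derivative_eq_intros)
  then have "partial i (\<lambda>x. f (a *\<^sub>R x)) x = ?f' (a *\<^sub>R i)" by (rule partial_eq)
  also have "\<dots> = a * ?f' i"
    using linear_cmul[OF has_derivative_linear[OF f]] by simp
  finally show ?thesis by (simp add: partial_def)
qed

lemma smooth_scaleR:
  assumes "smooth f"
  shows "smooth (\<lambda>x. f (a *\<^sub>R x))"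
proof -
  have "Ck k (\<lambda>x. f (a *\<^sub>R x))" if "smooth f" for k f
    using that
  proof (induction k arbitrary: f)
    case 0
    have "continuous_on UNIV (\<lambda>x. f (a *\<^sub>R x))"
      by (rule continuous_on_compose2[OF smooth_continuous[OF 0]]) (auto intro!: continuous_intros)
    then show ?case by simp
  next
    case (Suc k)
    have "partial i (\<lambda>x. f (a *\<^sub>R x)) = (\<lambda>x. a * partial i f (a *\<^sub>R x))" for i
      by (intro ext partial_scaleR smooth_differentiable Suc.prems)
    moreover have "(\<lambda>x. f (a *\<^sub>R x)) differentiable at x" for x
    proof (rule differentiableI)
      show "((\<lambda>x. f (a *\<^sub>R x)) has_derivative (\<lambda>h. frechet_derivative f (at (a *\<^sub>R x)) (a *\<^sub>R h))) (at x)"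
        by (rule has_derivative_compose[where f = "\<lambda>x. a *\<^sub>R x" and g = f, OF _ has_derivative_frechet[OF smooth_differentiable[OF Suc.prems]]])
          (auto intro!: derivative_eq_intros)
    qed
    moreover have "Ck k (\<lambda>x. a * partial i f (a *\<^sub>R x))" if "i \<in> Basis" for i
      by (intro Ck_mult Ck_const Suc.IH smooth_partial Suc.prems that)
    ultimately show ?case
      by (simp add: differentiable_on_def)
  qed
  then show ?thesis unfolding smooth_def[of "\<lambda>x. f (a *\<^sub>R x)"] using assms by blast
qed

section \<open>Test functions\<close>

lemma test_function_smooth: "test_function \<phi> \<Longrightarrow> smooth \<phi>"
  by (simp add: test_function_def smooth_def)

lemma test_function_compact: "test_function \<phi> \<Longrightarrow> compact (closure {x. \<phi> x \<noteq> 0})"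
  by (simp add: test_function_def)

lemma test_functionI: "smooth \<phi> \<Longrightarrow> bounded {x. \<phi> x \<noteq> 0} \<Longrightarrow> test_function \<phi>"
  by (simp add: test_function_def smooth_def)

lemma test_function_bounded: "test_function \<phi> \<Longrightarrow> bounded {x. \<phi> x \<noteq> 0}"
  using test_function_compact[of \<phi>] by simp

lemma test_function_mult_smooth:
  assumes "test_function \<phi>" "smooth g"
  shows "test_function (\<lambda>x. \<phi> x * g x)"
  by (rule test_functionI[OF smooth_mult[OF test_function_smooth[OF assms(1)] assms(2)]
        bounded_subset[OF test_function_bounded[OF assms(1)]]]) auto

lemma test_function_add:
  assumes "test_function \<phi>" "test_function \<psi>"
  shows "test_function (\<lambda>x. \<phi> x + \<psi> x)"
proof (rule test_functionI)
  have "bounded ({x. \<phi> x \<noteq> 0} \<union> {x. \<psi> x \<noteq> 0})"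
    using assms by (simp add: test_function_bounded)
  then show "bounded {x. \<phi> x + \<psi> x \<noteq> 0}" by (rule bounded_subset) auto
qed (intro smooth_add test_function_smooth assms)

lemma test_function_zero: "test_function (\<lambda>_. 0)"
  by (rule test_functionI) (auto simp: smooth_const)

lemma test_function_sum:
  "(\<And>i. i \<in> I \<Longrightarrow> test_function (f i)) \<Longrightarrow> test_function (\<lambda>x. \<Sum>i\<in>I. f i x)"
  by (induction I rule: infinite_finite_induct) (auto simp: test_function_zero test_function_add)

lemma partial_eq_zero_outside:
  assumes "x \<notin> closure {x. \<phi> x \<noteq> 0}"
  shows "partial i \<phi> x = 0"
proof -
  have "(\<phi> has_derivative (\<lambda>_. 0)) (at x)"
    by (rule has_derivative_transform_within_open[OF has_derivative_const[of 0]
          open_Compl[OF closed_closure[of "{x. \<phi> x \<noteq> 0}"]]])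
      (use assms closure_subset[of "{x. \<phi> x \<noteq> 0}"] in auto)
  then show ?thesis by (rule partial_eq)
qed

lemma test_function_partial:
  assumes "test_function \<phi>" "i \<in> Basis"
  shows "test_function (partial i \<phi>)"
proof (rule test_functionI)
  have "{x. partial i \<phi> x \<noteq> 0} \<subseteq> closure {x. \<phi> x \<noteq> 0}"
    using partial_eq_zero_outside by blast
  then show "bounded {x. partial i \<phi> x \<noteq> 0}"
    by (rule bounded_subset[OF compact_imp_bounded[OF test_function_compact[OF assms(1)]]])
qed (intro smooth_partial test_function_smooth assms)

lemma continuous_compact_support:
  fixes f :: "'a::euclidean_space \<Rightarrow> real"
  assumes c: "continuous_on UNIV f" and b: "bounded {x. f x \<noteq> 0}"
  shows "bounded_integrable lebesgue f" "integrable lborel f" "f \<in> borel_measurable borel"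
    "\<exists>B\<ge>0. \<forall>x. \<bar>f x\<bar> \<le> B"
proof -
  obtain R where R: "{x. f x \<noteq> 0} \<subseteq> cball 0 R"
    using b unfolding bounded_pos by (auto simp: subset_iff)
  have "bounded (f ` cball 0 R)"
    by (intro compact_imp_bounded compact_continuous_image continuous_on_subset[OF c]) auto
  then obtain B where B: "0 < B" "\<And>x. x \<in> cball 0 R \<Longrightarrow> norm (f x) \<le> B"
    unfolding bounded_pos by auto
  have bd: "\<bar>f x\<bar> \<le> B" for x
  proof (cases "f x = 0")
    case False
    then have "x \<in> cball 0 R" using R by blast
    then show ?thesis using B(2) by fastforce
  qed (use B in simp)
  then show "\<exists>B\<ge>0. \<forall>x. \<bar>f x\<bar> \<le> B" using B(1) by (intro exI[of _ B]) auto
  show m: "f \<in> borel_measurable borel"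
    using c by (rule borel_measurable_continuous_onI)
  have "integrable lborel (\<lambda>x. indicator (cball 0 R) x *\<^sub>R f x)"
    by (rule borel_integrable_compact) (auto intro: continuous_on_subset[OF c])
  also have "(\<lambda>x. indicator (cball 0 R) x *\<^sub>R f x) = f"
    using R by (auto simp: indicator_def fun_eq_iff)
  finally show i: "integrable lborel f" .
  then have "integrable lebesgue f" using m by (simp add: integrable_completion)
  then show "bounded_integrable lebesgue f" using bd by (auto simp: bounded_integrable_def)
qed

lemma test_function_bounded_integrable: "test_function \<phi> \<Longrightarrow> bounded_integrable lebesgue \<phi>"
  by (intro continuous_compact_support smooth_continuous test_function_smooth test_function_bounded)

text \<open>The class of functions \<open>p (1 / s) e\<^bsup>-1/s\<^esup>\<close> (\<open>s > 0\<close>), extended by \<open>0\<close>, is closed under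
  differentiation.\<close>

definition flat :: "real poly \<Rightarrow> real \<Rightarrow> real" where
  "flat p s = (if s > 0 then poly p (1 / s) * exp (- 1 / s) else 0)"

lemma poly_exp_tendsto_0: "((\<lambda>u::real. poly p u * exp (- u)) \<longlongrightarrow> 0) at_top"
proof -
  have "((\<lambda>u::real. \<Sum>i\<le>degree p. coeff p i * (u ^ i / exp u)) \<longlongrightarrow> (\<Sum>i\<le>degree p. coeff p i * 0)) at_top"
    by (intro tendsto_sum tendsto_mult tendsto_const tendsto_power_div_exp_0)
  moreover have "(\<Sum>i\<le>degree p. coeff p i * (u ^ i / exp u)) = poly p u * exp (- u)" for u :: real
    by (simp add: poly_altdef sum_distrib_right exp_minus field_simps sum_divide_distrib)
  ultimately show ?thesis by simp
qed

text \<open>With u = 1/s, the derivative of p(u) e^(-u) in s is u^2 (p - p')(u) e^(-u). At s = 0 the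
  difference quotient from the right is u p(u) e^(-u), which tends to 0 as u grows.\<close>

lemma DERIV_flat:
  "(flat p has_real_derivative flat (monom 1 2 * (p - pderiv p)) s) (at s)"
proof -
  consider "s > 0" | "s < 0" | "s = 0" by linarith
  then show ?thesis
  proof cases
    case 1
    have "((\<lambda>s. poly p (1 / s) * exp (- 1 / s)) has_real_derivative flat (monom 1 2 * (p - pderiv p)) s) (at s)"
      using 1 by (auto intro!: derivative_eq_intros DERIV_chain2[OF poly_DERIV]
          simp: flat_def poly_monom field_simps power2_eq_square)
    then show ?thesis
      by (rule DERIV_cong_ev[THEN iffD1, rotated -1])
        (use 1 in \<open>auto simp: flat_def eventually_nhds intro!: exI[of _ "{0<..}"]\<close>)
  next
    case 2
    have "((\<lambda>_. 0) has_real_derivative flat (monom 1 2 * (p - pderiv p)) s) (at s)"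
      using 2 by (simp add: flat_def)
    then show ?thesis
      by (rule DERIV_cong_ev[THEN iffD1, rotated -1])
        (use 2 in \<open>auto simp: flat_def eventually_nhds intro!: exI[of _ "{..<0}"]\<close>)
  next
    case 3
    have "((\<lambda>h. flat p h / h) \<longlongrightarrow> 0) (at_right 0)"
    proof -
      have "((\<lambda>h. poly ([:0, 1:] * p) (inverse h) * exp (- inverse h)) \<longlongrightarrow> 0) (at_right 0)"
        by (rule filterlim_compose[OF poly_exp_tendsto_0 filterlim_inverse_at_top_right])
      then show ?thesis
        by (rule tendsto_cong[THEN iffD1, rotated])
          (auto simp: flat_def eventually_at_filter field_simps)
    qed
    moreover have "((\<lambda>h. flat p h / h) \<longlongrightarrow> 0) (at_left 0)"
      by (rule tendsto_eventually) (auto simp: flat_def eventually_at_filter)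
    ultimately have "((\<lambda>h. flat p h / h) \<longlongrightarrow> 0) (at 0)"
      by (simp add: filterlim_at_split)
    then show ?thesis using 3 by (simp add: DERIV_def flat_def)
  qed
qed

text \<open>Positive exactly on the open \<open>box a b\<close> and nowhere above 1; hence the
  powers of 1 minus the bump tend to 0 on the box and equal 1 off it.\<close>

definition bump :: "'a::euclidean_space \<Rightarrow> 'a \<Rightarrow> 'a \<Rightarrow> real" where
  "bump a b x = (\<Prod>i\<in>Basis. flat 1 (x \<bullet> i - a \<bullet> i) * flat 1 (b \<bullet> i - x \<bullet> i))"

lemma smooth_flat_compose:
  assumes "smooth g"
  shows "smooth (\<lambda>x. flat 1 (g x))"
proof -
  let ?p = "rec_nat (1 :: real poly) (\<lambda>_ p. monom 1 2 * (p - pderiv p))"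
  have "smooth (\<lambda>x. flat (?p 0) (g x))"
    by (rule smooth_compose[where d = "\<lambda>n. flat (?p n)"]) (use DERIV_flat assms in auto)
  then show ?thesis by simp
qed

lemma smooth_bump: "smooth (bump a b)"
  unfolding bump_def[abs_def]
  by (intro smooth_prod smooth_mult smooth_flat_compose smooth_diff smooth_inner smooth_const)

lemma bump_nonneg: "0 \<le> bump a b x"
  unfolding bump_def by (intro prod_nonneg) (auto simp: flat_def)

lemma bump_le_1: "bump a b x \<le> 1"
  unfolding bump_def by (intro prod_le_1) (auto simp: flat_def intro!: mult_le_one)

lemma bump_pos_iff: "0 < bump a b x \<longleftrightarrow> x \<in> box a b"
proof
  assume "x \<in> box a b"
  then show "0 < bump a b x" unfolding bump_def by (intro prod_pos) (auto simp: flat_def box_def)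
next
  assume "0 < bump a b x"
  then have "bump a b x \<noteq> 0" by simp
  then have "\<forall>i\<in>Basis. flat 1 (x \<bullet> i - a \<bullet> i) * flat 1 (b \<bullet> i - x \<bullet> i) \<noteq> 0"
    unfolding bump_def by (subst (asm) prod_zero_iff) auto
  then show "x \<in> box a b"
    by (auto simp: box_def flat_def split: if_splits)
qed

lemma test_function_bump: "test_function (bump a b)"
proof (rule test_functionI[OF smooth_bump])
  have "{x. bump a b x \<noteq> 0} \<subseteq> box a b"
    using bump_pos_iff[of a b] bump_nonneg[of a b] by (auto simp: less_le)
  then show "bounded {x. bump a b x \<noteq> 0}" by (rule bounded_subset[OF bounded_box])
qed

text \<open>Indicators of boxes are bounded limits of the test functions \<open>1 - (1 - \<beta>)\<^sup>n\<close>, where \<open>\<beta>\<close> is a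
  bump function.\<close>

lemma box_integral_zero:
  fixes w :: "'a::euclidean_space \<Rightarrow> real"
  assumes w: "L1_plus_Linf lebesgue w"
    and zero: "\<And>\<phi>. test_function \<phi> \<Longrightarrow> (\<integral>x. w x * \<phi> x \<partial>lebesgue) = 0"
  shows "(\<integral>x. w x * indicator (box a b) x \<partial>lebesgue) = 0"
proof -
  let ?\<phi> = "\<lambda>n x. 1 - (1 - bump a b x) ^ n"
  note [measurable] = L1_plus_Linf_measurable[OF w]
  have "(\<lambda>n. \<integral>x. w x * ?\<phi> n x \<partial>lebesgue) \<longlonglongrightarrow> (\<integral>x. w x * indicator (box a b) x \<partial>lebesgue)"
  proof (rule integral_dominated_convergence[where w = "\<lambda>x. \<bar>w x * indicator (box a b) x\<bar>"])
    have bi: "bounded_integrable lebesgue (indicator (box a b) :: 'a \<Rightarrow> real)"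
      using emeasure_lborel_box_finite[of a b]
      by (auto simp: bounded_integrable_def indicator_def intro!: integrable_real_indicator)
    then show "integrable lebesgue (\<lambda>x. \<bar>w x * indicator (box a b) x\<bar>)"
      by (intro integrable_abs bounded_integrable_pairing w)
    have "continuous_on UNIV (bump a b)" by (rule smooth_continuous[OF smooth_bump])
    then have [measurable]: "bump a b \<in> borel_measurable lebesgue"
      by (intro measurable_completion) (simp add: borel_measurable_continuous_onI)
    show "(\<lambda>x. w x * ?\<phi> n x) \<in> borel_measurable lebesgue" for n by measurable
    show "AE x in lebesgue. (\<lambda>n. w x * ?\<phi> n x) \<longlonglongrightarrow> w x * indicator (box a b) x"
    proof (rule AE_I2)
      fix x
      have "(\<lambda>n. ?\<phi> n x) \<longlonglongrightarrow> indicator (box a b) x"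
      proof (cases "x \<in> box a b")
        case True
        then have "0 < bump a b x" by (simp add: bump_pos_iff)
        then have "(\<lambda>n. (1 - bump a b x) ^ n) \<longlonglongrightarrow> 0"
          using bump_le_1[of a b x] by (intro LIMSEQ_power_zero) auto
        then have "(\<lambda>n. ?\<phi> n x) \<longlonglongrightarrow> 1 - 0" by (intro tendsto_diff tendsto_const)
        with True show ?thesis by simp
      next
        case False
        then have "bump a b x = 0" using bump_pos_iff[of a b x] bump_nonneg[of a b x] by auto
        with False show ?thesis by simp
      qed
      then show "(\<lambda>n. w x * ?\<phi> n x) \<longlonglongrightarrow> w x * indicator (box a b) x" by (intro tendsto_mult tendsto_const)
    qed
    show "AE x in lebesgue. norm (w x * ?\<phi> n x) \<le> \<bar>w x * indicator (box a b) x\<bar>" for n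
    proof (rule AE_I2)
      fix x
      show "norm (w x * ?\<phi> n x) \<le> \<bar>w x * indicator (box a b) x\<bar>"
      proof (cases "x \<in> box a b")
        case True
        have "0 \<le> (1 - bump a b x) ^ n" "(1 - bump a b x) ^ n \<le> 1"
          using bump_le_1[of a b x] bump_nonneg[of a b x] by (auto intro: power_le_one)
        then have "\<bar>?\<phi> n x\<bar> \<le> 1" by auto
        then have "\<bar>w x\<bar> * \<bar>?\<phi> n x\<bar> \<le> \<bar>w x\<bar> * 1" by (intro mult_left_mono) auto
        with True show ?thesis by (simp add: abs_mult)
      next
        case False
        then have "bump a b x = 0" using bump_pos_iff[of a b x] bump_nonneg[of a b x] by auto
        with False show ?thesis by simp
      qed
    qed
    show "(\<lambda>x. w x * indicator (box a b) x) \<in> borel_measurable lebesgue"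
    proof -
      have [measurable]: "box a b \<in> sets lebesgue" by simp
      show ?thesis by measurable
    qed
  qed
  moreover have "(\<integral>x. w x * ?\<phi> n x \<partial>lebesgue) = 0" for n
  proof (rule zero, rule test_functionI)
    show "smooth (?\<phi> n)"
      by (intro smooth_diff smooth_power smooth_const smooth_bump)
    show "bounded {x. ?\<phi> n x \<noteq> 0}"
      by (rule bounded_subset[OF test_function_bounded[OF test_function_bump[of a b]]]) auto
  qed
  ultimately show ?thesis by (simp add: LIMSEQ_const_iff)
qed

text \<open>A pi-lambda argument: boxes form an intersection-stable generator of the Borel sets. The
  vanishing total integral handles complements.\<close>

lemma AE_zero_if_box_integrals_zero:
  fixes F :: "'a::euclidean_space \<Rightarrow> real"
  assumes int: "integrable lborel F" and z: "integral\<^sup>L lborel F = 0"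
    and box: "\<And>a b. (\<integral>x. indicator (box a b) x * F x \<partial>lborel) = 0"
  shows "AE x in lborel. F x = 0"
proof (rule density_unique_real)
  fix A assume "A \<in> sets (lborel :: 'a measure)"
  then have sig: "A \<in> sigma_sets UNIV (range (\<lambda>(a, b). box a b :: 'a set))"
    by (simp add: borel_eq_box)
  have "Int_stable (range (\<lambda>(a, b). box a b :: 'a set))"
    by (auto simp: Int_stable_def box_Int_box)
  moreover have "range (\<lambda>(a, b). box a b :: 'a set) \<subseteq> Pow UNIV" by simp
  ultimately have "(\<integral>x. indicator A x * F x \<partial>lborel) = 0"
    using sig
  proof (induction rule: sigma_sets_induct_disjoint)
    case (basic A)
    then show ?case using box by auto
  next
    case empty
    show ?case by simp
  next
    case (compl A)
    then have A: "A \<in> sets borel" by (simp add: borel_eq_box)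
    have "integrable lborel (\<lambda>x. indicator A x * F x)"
      using integrable_real_mult_indicator[of A lborel F] int A by (simp add: mult.commute)
    moreover have "indicator (UNIV - A) x * F x = F x - indicator A x * F x" for x
      by (auto simp: indicator_def)
    ultimately show ?case using compl int z by simp
  next
    case (union A)
    then have A: "range A \<subseteq> sets borel" by (auto simp: borel_eq_box)
    have "set_integrable lborel (\<Union>i. A i) F"
      unfolding set_integrable_def using int A by (intro integrable_mult_indicator) auto
    then have "set_lebesgue_integral lborel (\<Union>i. A i) F = (\<Sum>i. set_lebesgue_integral lborel (A i) F)"
      using union A by (intro lebesgue_integral_countable_add) (auto simp: disjoint_family_on_def)
    moreover have "set_lebesgue_integral lborel (A i) F = 0" for i
      using union.IH by (simp add: set_lebesgue_integral_def)
    ultimately show ?case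
      by (simp add: set_lebesgue_integral_def)
  qed
  then show "set_lebesgue_integral lborel A F = set_lebesgue_integral lborel A (\<lambda>_. 0)"
    by (simp add: set_lebesgue_integral_def)
qed (use int in auto)

text \<open>\<open>w\<close> is only locally integrable, so
  \<open>AE_zero_if_box_integrals_zero\<close> is applied to its restrictions to boxes exhausting
  the space.\<close>

lemma fundamental_lemma:
  fixes w :: "'a::euclidean_space \<Rightarrow> real"
  assumes w: "L1_plus_Linf lebesgue w"
    and zero: "\<And>\<phi>. test_function \<phi> \<Longrightarrow> (\<integral>x. w x * \<phi> x \<partial>lebesgue) = 0"
  shows "AE x in lebesgue. w x = 0"
proof -
  \<comment> \<open>Boxes generate the Borel sets only, hence the passage to a Borel function equal
    to \<open>w\<close> outside a null set.\<close>
  obtain w' where w'[measurable]: "w' \<in> borel_measurable borel" and ww': "AE x in lebesgue. w x = w' x"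
    using completion_ex_borel_measurable_real[OF L1_plus_Linf_measurable[OF w]]
    by (auto simp: AE_completion)
  have [measurable]: "w' \<in> borel_measurable lebesgue"
    by (intro measurable_completion) simp
  note [measurable] = L1_plus_Linf_measurable[OF w]
  have "AE x in lborel. indicator (box (- real n *\<^sub>R One) (real n *\<^sub>R One)) x * w' x = 0" for n
  proof (rule AE_zero_if_box_integrals_zero)
    let ?B = "box (- real n *\<^sub>R One) (real n *\<^sub>R One) :: 'a set"
    have box0: "(\<integral>x. indicator (box a b) x * w' x \<partial>lborel) = 0" for a b :: 'a
    proof -
      have "(\<integral>x. indicator (box a b) x * w' x \<partial>lborel) = (\<integral>x. indicator (box a b) x * w' x \<partial>lebesgue)"
        by (subst integral_completion) auto
      also have "\<dots> = (\<integral>x. w x * indicator (box a b) x \<partial>lebesgue)"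
      proof (rule integral_cong_AE)
        have [measurable]: "box a b \<in> sets lebesgue" by simp
        show "(\<lambda>x. indicator (box a b) x * w' x) \<in> borel_measurable lebesgue"
          "(\<lambda>x. w x * indicator (box a b) x) \<in> borel_measurable lebesgue"
          by measurable
      qed (use ww' in auto)
      finally show ?thesis using box_integral_zero[OF w zero] by simp
    qed
    have bi: "bounded_integrable lebesgue (indicator ?B :: 'a \<Rightarrow> real)"
      using emeasure_lborel_box_finite
      by (auto simp: bounded_integrable_def indicator_def intro!: integrable_real_indicator)
    have "integrable lebesgue (\<lambda>x. w x * indicator ?B x)"
      by (rule bounded_integrable_pairing[OF w bi])
    moreover have "(\<lambda>x. indicator ?B x * w' x) \<in> borel_measurable lebesgue"
    proof -
      have [measurable]: "?B \<in> sets lebesgue" by simp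
      show ?thesis by measurable
    qed
    ultimately have "integrable lebesgue (\<lambda>x. indicator ?B x * w' x)"
      by (rule integrable_cong_AE_imp) (use ww' in \<open>auto elim: eventually_mono\<close>)
    then show "integrable lborel (\<lambda>x. indicator ?B x * w' x)"
      by (simp add: integrable_completion)
    show "(\<integral>x. indicator ?B x * w' x \<partial>lborel) = 0" by (rule box0)
    show "(\<integral>x. indicator (box a b) x * (indicator ?B x * w' x) \<partial>lborel) = 0" for a b
    proof -
      obtain c d where "box a b \<inter> ?B = box c d"
        using box_Int_box by blast
      then have "indicator (box a b) x * (indicator ?B x * w' x) = indicator (box c d) x * w' x" for x
        by (metis indicator_inter_arith mult.assoc)
      then show ?thesis by (simp only: box0)
    qed
  qed
  then have "AE x in lborel. \<forall>n. indicator (box (- real n *\<^sub>R One) (real n *\<^sub>R One)) x * w' x = 0"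
    unfolding AE_all_countable ..
  then have "AE x in lborel. w' x = 0"
  proof eventually_elim
    case (elim x)
    have "x \<in> (\<Union>n. box (- real n *\<^sub>R One) (real n *\<^sub>R One))" using UN_box_eq_UNIV by auto
    then show ?case using elim by (auto simp: indicator_def)
  qed
  then have "AE x in lebesgue. w' x = 0" by (rule AE_completion)
  with ww' show ?thesis by eventually_elim simp
qed

section \<open>Equivalence of the modulus and the K-functional\<close>

lemma Lp_norm_le_iff:
  assumes m: "f \<in> borel_measurable lebesgue" and C: "0 \<le> C" and p: "1 \<le> p"
  shows "Lp_norm p f \<le> ennreal C \<longleftrightarrow> Lp_le lebesgue p C f"
proof (cases "p = \<infinity>")
  case True
  have "esssup lebesgue (\<lambda>x. ennreal \<bar>f x\<bar>) \<le> ennreal C \<longleftrightarrow> (AE x in lebesgue. ennreal \<bar>f x\<bar> \<le> ennreal C)"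
  proof
    assume le: "esssup lebesgue (\<lambda>x. ennreal \<bar>f x\<bar>) \<le> ennreal C"
    show "AE x in lebesgue. ennreal \<bar>f x\<bar> \<le> ennreal C"
      using esssup_AE[of "\<lambda>x. ennreal \<bar>f x\<bar>" lebesgue] by eventually_elim (use le in auto)
  next
    assume "AE x in lebesgue. ennreal \<bar>f x\<bar> \<le> ennreal C"
    then show "esssup lebesgue (\<lambda>x. ennreal \<bar>f x\<bar>) \<le> ennreal C"
      using m by (intro esssup_I) auto
  qed
  then show ?thesis using True C m by (simp add: Lp_norm_def Lp_le_def)
next
  case False
  define q where "q = enn2real p"
  have q: "1 \<le> q" using False p by (simp add: q_def enn2real_ge_1)
  let ?I = "\<integral>\<^sup>+x. ennreal (\<bar>f x\<bar> powr q) \<partial>lebesgue"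
  show ?thesis
  proof (cases "?I = \<infinity>")
    case True
    then show ?thesis using False C m by (auto simp: Lp_norm_def Lp_le_def q_def Let_def top_unique)
  next
    case I: False
    then obtain I where I: "?I = ennreal I" "0 \<le> I" by (cases ?I) auto
    have "I powr (1 / q) \<le> C \<longleftrightarrow> I \<le> C powr q"
    proof
      assume "I powr (1 / q) \<le> C"
      then have "(I powr (1 / q)) powr q \<le> C powr q" using q by (intro powr_mono2) auto
      then show "I \<le> C powr q" using q I by (simp add: powr_powr powr_one)
    next
      assume "I \<le> C powr q"
      then have "I powr (1 / q) \<le> (C powr q) powr (1 / q)" using q I by (intro powr_mono2) auto
      then show "I powr (1 / q) \<le> C" using q C by (simp add: powr_powr)
    qed
    then show ?thesis
      using False C I m by (simp add: Lp_norm_def Lp_le_def q_def[symmetric] Let_def)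
  qed
qed

lemma Lp_iff:
  assumes "1 \<le> p"
  shows "f \<in> Lp p \<longleftrightarrow> (\<exists>C\<ge>0. Lp_le lebesgue p C f)"
proof
  assume f: "f \<in> Lp p"
  then obtain C where "Lp_norm p f = ennreal C" "0 \<le> C"
    by (cases "Lp_norm p f") (auto simp: Lp_def)
  then show "\<exists>C\<ge>0. Lp_le lebesgue p C f"
    using Lp_norm_le_iff[of f C p] f assms by (auto simp: Lp_def)
next
  assume "\<exists>C\<ge>0. Lp_le lebesgue p C f"
  then obtain C where C: "0 \<le> C" "Lp_le lebesgue p C f" by auto
  then have "Lp_norm p f \<le> ennreal C"
    using Lp_norm_le_iff[OF Lp_le_measurable] assms by blast
  also have "\<dots> < \<infinity>" by simp
  finally show "f \<in> Lp p" using C by (auto simp: Lp_def Lp_le_measurable)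
qed

lemma Lp_le_Lp_norm:
  assumes "f \<in> Lp p" "1 \<le> p"
  shows "Lp_le lebesgue p (enn2real (Lp_norm p f)) f"
  using Lp_norm_le_iff[of f "enn2real (Lp_norm p f)" p] assms
  by (auto simp: Lp_def)

lemma Lp_imp_L1_plus_Linf: "f \<in> Lp p \<Longrightarrow> 1 \<le> p \<Longrightarrow> L1_plus_Linf lebesgue f"
  using Lp_le_imp_L1_plus_Linf Lp_iff by blast

text \<open>What the equivalence requires of D. \<open>evolve_test\<close> is the formula T^h \<phi>
  - \<phi> = \<integral> T^s D\<phi> ds over (0, h], rescaled to the unit interval.
  \<open>weak_evolve\<close> is not an instance of \<open>weak_power\<close>, since T^s \<phi> need
  not have compact support.\<close>

locale test_semigroup = kernel_semigroup lebesgue k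
  for k :: "real \<Rightarrow> 'a::euclidean_space \<Rightarrow> 'a \<Rightarrow> real" +
  fixes D :: "('a \<Rightarrow> real) \<Rightarrow> 'a \<Rightarrow> real"
  assumes D_test: "test_function \<phi> \<Longrightarrow> test_function (D \<phi>)"
    and evolve_test: "test_function \<phi> \<Longrightarrow> 0 < h \<Longrightarrow>
      evolve h \<phi> x - \<phi> x = h * (\<integral>s. evolve (h * s) (D \<phi>) x \<partial>unit_law)"
    and weak_evolve: "L1_plus_Linf lebesgue g \<Longrightarrow> L1_plus_Linf lebesgue u \<Longrightarrow> weak_power D 1 g u \<Longrightarrow>
      test_function \<phi> \<Longrightarrow> 0 < s \<Longrightarrow>
      (\<integral>x. g x * evolve s (D \<phi>) x \<partial>lebesgue) = (\<integral>x. u x * evolve s \<phi> x \<partial>lebesgue)"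
begin

text \<open>The mean of T^s over 0 < s \<le> h, that is 1/h times the integral over that interval;
  written S_h below.\<close>

abbreviation steklov :: "real \<Rightarrow> ('a \<Rightarrow> real) \<Rightarrow> 'a \<Rightarrow> real" where
  "steklov h \<equiv> avg (scale h unit_law)"

lemma time_law_steklov: "0 < h \<Longrightarrow> time_law (scale h unit_law)"
  by (intro time_law_scale time_law_unit_law)

lemma D_power_test: "test_function \<phi> \<Longrightarrow> test_function ((D ^^ n) \<phi>)"
  by (induction n) (auto intro: D_test)

lemma test_L1_plus_Linf: "test_function \<phi> \<Longrightarrow> L1_plus_Linf lebesgue \<phi>"
  by (intro bounded_integrable_imp_L1_plus_Linf test_function_bounded_integrable)

lemma steklov_test:
  assumes \<phi>: "test_function \<phi>" and h: "0 < h"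
  shows "AE x in lebesgue. h * steklov h (D \<phi>) x = evolve h \<phi> x - \<phi> x"
  using avg_has_integral[OF time_law_steklov[OF h] test_L1_plus_Linf[OF D_test[OF \<phi>]]]
proof eventually_elim
  case (elim x)
  have D: "L1_plus_Linf lebesgue (D \<phi>)" by (intro test_L1_plus_Linf D_test \<phi>)
  have [measurable]: "(\<lambda>s. evolve s (D \<phi>) x) \<in> borel_measurable borel"
    using measurable_Pair1[OF evolve_measurable[OF L1_plus_Linf_measurable[OF D]], of x] by simp
  have "(\<integral>s. evolve s (D \<phi>) x \<partial>scale h unit_law) = (\<integral>s. evolve (h * s) (D \<phi>) x \<partial>unit_law)"
  proof -
    have [measurable_cong]: "sets unit_law = sets borel" by simp
    show ?thesis unfolding scale_def by (rule integral_distr) measurable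
  qed
  then show ?case using elim evolve_test[OF \<phi> h, of x] by simp
qed

text \<open>Averaging gains one derivative for arbitrary \<open>w\<close>: D S_h w = (T^h w - w) /
  h. The average is moved onto D\<phi>, \<open>steklov_test\<close> evaluates it there, and T^h is
  moved back onto \<open>w\<close>.\<close>

lemma weak_steklov:
  assumes w: "L1_plus_Linf lebesgue w" and h: "0 < h"
  shows "weak_power D 1 (steklov h w) (\<lambda>x. (1 / h) * diff h w x)"
  unfolding weak_power_def
proof (intro allI impI)
  fix \<phi> :: "'a \<Rightarrow> real" assume \<phi>: "test_function \<phi>"
  note tl = time_law_steklov[OF h]
  have bi: "bounded_integrable lebesgue (D \<phi>)" "bounded_integrable lebesgue \<phi>"
    using \<phi> by (auto intro: test_function_bounded_integrable D_test)
  have "(\<integral>x. steklov h w x * (D ^^ 1) \<phi> x \<partial>lebesgue) = (\<integral>x. w x * steklov h (D \<phi>) x \<partial>lebesgue)"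
    using kernel_op_adjoint[OF submarkov_avg_kernel[OF tl] w bi(1)] by simp
  also have "\<dots> = (\<integral>x. (1 / h) * (w x * evolve h \<phi> x - w x * \<phi> x) \<partial>lebesgue)"
  proof (rule integral_cong_AE)
    note [measurable] = L1_plus_Linf_measurable[OF w] L1_plus_Linf_measurable[OF test_L1_plus_Linf[OF \<phi>]]
      L1_plus_Linf_measurable[OF avg_L1_plus_Linf[OF tl test_L1_plus_Linf[OF D_test[OF \<phi>]]]]
      evolve_measurable1
    show "(\<lambda>x. w x * steklov h (D \<phi>) x) \<in> borel_measurable lebesgue" by measurable
    show "(\<lambda>x. (1 / h) * (w x * evolve h \<phi> x - w x * \<phi> x)) \<in> borel_measurable lebesgue" by measurable
    show "AE x in lebesgue. w x * steklov h (D \<phi>) x = (1 / h) * (w x * evolve h \<phi> x - w x * \<phi> x)"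
      using steklov_test[OF \<phi> h]
    proof eventually_elim
      case (elim x)
      have "(1 / h) * (w x * evolve h \<phi> x - w x * \<phi> x) = (1 / h) * w x * (h * steklov h (D \<phi>) x)"
        unfolding elim by (simp add: algebra_simps)
      also have "\<dots> = w x * steklov h (D \<phi>) x" using h by simp
      finally show ?case by simp
    qed
  qed
  also have "\<dots> = (1 / h) * ((\<integral>x. w x * evolve h \<phi> x \<partial>lebesgue) - (\<integral>x. w x * \<phi> x \<partial>lebesgue))"
    using bounded_integrable_pairing[OF w bi(2)]
      bounded_integrable_pairing[OF w evolve_bounded_integrable[OF h bi(2)]] by simp
  also have "(\<integral>x. w x * evolve h \<phi> x \<partial>lebesgue) = (\<integral>x. evolve h w x * \<phi> x \<partial>lebesgue)"
    by (rule evolve_adjoint[OF h w bi(2), symmetric])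
  also have "(1 / h) * ((\<integral>x. evolve h w x * \<phi> x \<partial>lebesgue) - (\<integral>x. w x * \<phi> x \<partial>lebesgue)) =
      (\<integral>x. (1 / h) * (evolve h w x * \<phi> x - w x * \<phi> x) \<partial>lebesgue)"
    using bounded_integrable_pairing[OF w bi(2)]
      bounded_integrable_pairing[OF evolve_L1_plus_Linf[OF h w] bi(2)] by simp
  finally show "(\<integral>x. steklov h w x * (D ^^ 1) \<phi> x \<partial>lebesgue) =
      (\<integral>x. (1 / h) * diff h w x * \<phi> x \<partial>lebesgue)"
    by (simp add: semigroup_diff_def algebra_simps)
qed

lemma weak_power_Suc:
  assumes "weak_power D l g u" "weak_power D 1 u w"
  shows "weak_power D (Suc l) g w"
  using assms D_test by (simp add: weak_power_def funpow_Suc_right del: funpow.simps)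

lemma weak_power_cong_AE:
  assumes "weak_power D l g u" "AE x in lebesgue. u x = u' x"
    "u \<in> borel_measurable lebesgue" "u' \<in> borel_measurable lebesgue"
  shows "weak_power D l g u'"
  unfolding weak_power_def
proof (intro allI impI)
  fix \<phi> :: "'a \<Rightarrow> real" assume \<phi>: "test_function \<phi>"
  note [measurable] = assms(3,4) L1_plus_Linf_measurable[OF test_L1_plus_Linf[OF \<phi>]]
  have "(\<integral>x. u x * \<phi> x \<partial>lebesgue) = (\<integral>x. u' x * \<phi> x \<partial>lebesgue)"
    using assms(2) by (intro integral_cong_AE) auto
  then show "(\<integral>x. g x * (D ^^ l) \<phi> x \<partial>lebesgue) = (\<integral>x. u' x * \<phi> x \<partial>lebesgue)"
    using assms(1) \<phi> by (simp add: weak_power_def)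
qed

lemma weak_power_mult:
  assumes "weak_power D l g u"
  shows "weak_power D l (\<lambda>x. c * g x) (\<lambda>x. c * u x)"
  using assms by (simp add: weak_power_def mult.assoc)

lemma weak_power_sum:
  assumes "\<And>i. i \<in> I \<Longrightarrow> weak_power D l (g i) (u i)"
    and "\<And>i. i \<in> I \<Longrightarrow> L1_plus_Linf lebesgue (g i)" "\<And>i. i \<in> I \<Longrightarrow> L1_plus_Linf lebesgue (u i)"
  shows "weak_power D l (\<lambda>x. \<Sum>i\<in>I. g i x) (\<lambda>x. \<Sum>i\<in>I. u i x)"
  unfolding weak_power_def
proof (intro allI impI)
  fix \<phi> :: "'a \<Rightarrow> real" assume \<phi>: "test_function \<phi>"
  have "(\<integral>x. (\<Sum>i\<in>I. g i x) * (D ^^ l) \<phi> x \<partial>lebesgue) = (\<Sum>i\<in>I. \<integral>x. g i x * (D ^^ l) \<phi> x \<partial>lebesgue)"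
    unfolding sum_distrib_right
    by (intro Bochner_Integration.integral_sum bounded_integrable_pairing assms test_function_bounded_integrable D_power_test \<phi>)
  also have "\<dots> = (\<Sum>i\<in>I. \<integral>x. u i x * \<phi> x \<partial>lebesgue)"
    using assms(1) \<phi> by (intro sum.cong) (auto simp: weak_power_def)
  also have "\<dots> = (\<integral>x. (\<Sum>i\<in>I. u i x) * \<phi> x \<partial>lebesgue)"
    unfolding sum_distrib_right
    by (intro Bochner_Integration.integral_sum[symmetric] bounded_integrable_pairing assms test_function_bounded_integrable \<phi>)
  finally show "(\<integral>x. (\<Sum>i\<in>I. g i x) * (D ^^ l) \<phi> x \<partial>lebesgue) = (\<integral>x. (\<Sum>i\<in>I. u i x) * \<phi> x \<partial>lebesgue)" .
qed

text \<open>Each D uses up one of the r averages and leaves a difference quotient. At l = r no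
  average is left, and the derivative is h^(-r) times the r-th difference of
  \<open>f\<close>.\<close>

lemma weak_steklov_power:
  assumes f: "L1_plus_Linf lebesgue f" and h: "0 < h" and l: "l \<le> r"
  shows "weak_power D l ((steklov h ^^ r) f) (\<lambda>x. (1 / h) ^ l * (steklov h ^^ (r - l)) ((diff h ^^ l) f) x)"
  using l
proof (induction l)
  case 0
  then show ?case by (simp add: weak_power_def)
next
  case (Suc l)
  note tl = time_law_steklov[OF h]
  let ?v = "(steklov h ^^ (r - Suc l)) ((diff h ^^ l) f)"
  have vX: "L1_plus_Linf lebesgue ?v"
    by (intro avg_power_L1_plus_Linf diff_power_L1_plus_Linf tl f h)
  have rl: "r - l = Suc (r - Suc l)" using Suc.prems by simp
  have IH: "weak_power D l ((steklov h ^^ r) f) (\<lambda>x. (1 / h) ^ l * steklov h ?v x)"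
    using Suc by (simp add: rl)
  have "weak_power D 1 (\<lambda>x. (1 / h) ^ l * steklov h ?v x) (\<lambda>x. (1 / h) ^ l * ((1 / h) * diff h ?v x))"
    by (rule weak_power_mult[OF weak_steklov[OF vX h]])
  then have "weak_power D 1 (\<lambda>x. (1 / h) ^ l * steklov h ?v x)
     (\<lambda>x. (1 / h) ^ Suc l * (steklov h ^^ (r - Suc l)) ((diff h ^^ Suc l) f) x)"
  proof (rule weak_power_cong_AE)
    have "AE x in lebesgue. diff h ?v x = (steklov h ^^ (r - Suc l)) (diff h ((diff h ^^ l) f)) x"
      by (intro diff_avg_power tl h diff_power_L1_plus_Linf f)
    then show "AE x in lebesgue. (1 / h) ^ l * ((1 / h) * diff h ?v x) =
        (1 / h) ^ Suc l * (steklov h ^^ (r - Suc l)) ((diff h ^^ Suc l) f) x"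
      by eventually_elim simp
  qed (intro L1_plus_Linf_measurable L1_plus_Linf_mult diff_L1_plus_Linf avg_power_L1_plus_Linf
        diff_power_L1_plus_Linf vX h tl f)+
  with IH show ?case by (rule weak_power_Suc)
qed

text \<open>The weak derivative integrates back to the difference: tested against \<open>\<phi>\<close>, both sides equal
  the average over \<open>s\<close> of \<open>\<integral> u T\<^sup>s\<phi>\<close>.\<close>

lemma diff_eq_steklov:
  assumes g: "L1_plus_Linf lebesgue g" and u: "L1_plus_Linf lebesgue u"
    and weak: "weak_power D 1 g u" and h: "0 < h"
  shows "AE x in lebesgue. diff h g x = h * steklov h u x"
proof -
  note tl = time_law_steklov[OF h]
  have X: "L1_plus_Linf lebesgue (diff h g)" "L1_plus_Linf lebesgue (steklov h u)"
    by (intro diff_L1_plus_Linf avg_L1_plus_Linf tl h g u)+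
  have "AE x in lebesgue. diff h g x + (- h) * steklov h u x = 0"
  proof (rule fundamental_lemma)
    show "L1_plus_Linf lebesgue (\<lambda>x. diff h g x + (- h) * steklov h u x)"
      by (intro L1_plus_Linf_add L1_plus_Linf_mult X)
    fix \<phi> :: "'a \<Rightarrow> real" assume \<phi>: "test_function \<phi>"
    note bi = test_function_bounded_integrable[OF \<phi>]
    note biD = test_function_bounded_integrable[OF D_test[OF \<phi>]]
    have pos: "AE s in scale h unit_law. 0 < s" using tl by (simp add: time_law_def)
    interpret U: prob_space "scale h unit_law" using tl by (simp add: time_law_def)
    have [measurable_cong]: "sets (scale h unit_law) = sets borel" by simp
    note [measurable] = L1_plus_Linf_measurable[OF g] L1_plus_Linf_measurable[OF u]
      L1_plus_Linf_measurable[OF test_L1_plus_Linf[OF \<phi>]] L1_plus_Linf_measurable[OF X(1)]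
      L1_plus_Linf_measurable[OF X(2)]
      L1_plus_Linf_measurable[OF test_L1_plus_Linf[OF D_test[OF \<phi>]]] evolve_measurable1
      L1_plus_Linf_measurable[OF avg_L1_plus_Linf[OF tl test_L1_plus_Linf[OF D_test[OF \<phi>]]]]
    have "(\<integral>x. diff h g x * \<phi> x \<partial>lebesgue) = (\<integral>x. evolve h g x * \<phi> x \<partial>lebesgue) - (\<integral>x. g x * \<phi> x \<partial>lebesgue)"
      using bounded_integrable_pairing[OF g bi] bounded_integrable_pairing[OF evolve_L1_plus_Linf[OF h g] bi]
      by (simp add: semigroup_diff_def left_diff_distrib)
    also have "(\<integral>x. evolve h g x * \<phi> x \<partial>lebesgue) = (\<integral>x. g x * evolve h \<phi> x \<partial>lebesgue)"
      by (rule evolve_adjoint[OF h g bi])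
    also have "\<dots> - (\<integral>x. g x * \<phi> x \<partial>lebesgue) = (\<integral>x. g x * (evolve h \<phi> x - \<phi> x) \<partial>lebesgue)"
      using bounded_integrable_pairing[OF g bi]
        bounded_integrable_pairing[OF g evolve_bounded_integrable[OF h bi]]
      by (simp add: right_diff_distrib)
    also have "\<dots> = (\<integral>x. h * (g x * steklov h (D \<phi>) x) \<partial>lebesgue)"
    proof (rule integral_cong_AE)
      show "AE x in lebesgue. g x * (evolve h \<phi> x - \<phi> x) = h * (g x * steklov h (D \<phi>) x)"
        using steklov_test[OF \<phi> h] by eventually_elim (metis mult.left_commute)
    qed measurable
    also have "\<dots> = h * (\<integral>x. g x * steklov h (D \<phi>) x \<partial>lebesgue)" by simp
    also have "(\<integral>x. g x * steklov h (D \<phi>) x \<partial>lebesgue) =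
        (\<integral>s. (\<integral>x. g x * evolve s (D \<phi>) x \<partial>lebesgue) \<partial>scale h unit_law)"
      by (rule pairing_avg[OF tl g biD])
    \<comment> \<open>The weak derivative enters here, separately at almost every time s.\<close>
    also have "\<dots> = (\<integral>s. (\<integral>x. u x * evolve s \<phi> x \<partial>lebesgue) \<partial>scale h unit_law)"
    proof (rule integral_cong_AE)
      have meas: "(\<lambda>s. \<integral>x. v x * evolve s \<psi> x \<partial>lebesgue) \<in> borel_measurable (scale h unit_law)"
        if [measurable]: "v \<in> borel_measurable lebesgue" "\<psi> \<in> borel_measurable lebesgue" for v \<psi>
      proof -
        note [measurable] = evolve_measurable[OF that(2)]
        show ?thesis by measurable
      qed
      show "(\<lambda>s. \<integral>x. g x * evolve s (D \<phi>) x \<partial>lebesgue) \<in> borel_measurable (scale h unit_law)"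
        by (rule meas) measurable
      show "(\<lambda>s. \<integral>x. u x * evolve s \<phi> x \<partial>lebesgue) \<in> borel_measurable (scale h unit_law)"
        by (rule meas) measurable
      show "AE s in scale h unit_law. (\<integral>x. g x * evolve s (D \<phi>) x \<partial>lebesgue) = (\<integral>x. u x * evolve s \<phi> x \<partial>lebesgue)"
        using pos by eventually_elim (rule weak_evolve[OF g u weak \<phi>])
    qed
    also have "\<dots> = (\<integral>x. u x * steklov h \<phi> x \<partial>lebesgue)"
      by (rule pairing_avg[OF tl u bi, symmetric])
    also have "\<dots> = (\<integral>x. steklov h u x * \<phi> x \<partial>lebesgue)"
      by (rule kernel_op_adjoint[OF submarkov_avg_kernel[OF tl] u bi, symmetric])
    finally have "(\<integral>x. diff h g x * \<phi> x \<partial>lebesgue) = h * (\<integral>x. steklov h u x * \<phi> x \<partial>lebesgue)" .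
    then show "(\<integral>x. (diff h g x + (- h) * steklov h u x) * \<phi> x \<partial>lebesgue) = 0"
      using bounded_integrable_pairing[OF X(1) bi] bounded_integrable_pairing[OF X(2) bi]
      by (simp add: left_diff_distrib mult.assoc)
  qed
  then show ?thesis by eventually_elim simp
qed

text \<open>Let w_0 = g, ..., w_r = u be a chain of weak derivatives. Then \<Delta>_h w_l = h S_h
  w_(l+1), and S_h is a contraction. The induction starts at w_r and adds one difference for each
  index it goes down.\<close>

lemma diff_power_weak:
  assumes g: "g \<in> sobolev D r p" and u: "u \<in> Lp p" and weak: "weak_power D r g u"
    and p: "1 \<le> p" and r: "1 \<le> r" and h: "0 < h" and B: "Lp_le lebesgue p B u" "0 \<le> B"
  shows "Lp_le lebesgue p (h ^ r * B) ((diff h ^^ r) g)"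
proof -
  note tl = time_law_steklov[OF h]
  have "\<exists>v. v \<in> Lp p \<and> weak_power D l g v" if "1 \<le> l" "l \<le> r" for l
    using g that by (auto simp: sobolev_def)
  then obtain v where v: "\<And>l. 1 \<le> l \<Longrightarrow> l \<le> r \<Longrightarrow> v l \<in> Lp p \<and> weak_power D l g (v l)"
    by metis
  \<comment> \<open>The last member has to be the given \<open>u\<close>, whose norm enters the
    bound, and not another weak derivative of order r.\<close>
  define w where "w l = (if l = 0 then g else if l = r then u else v l)" for l
  have wL: "w l \<in> Lp p" and ww: "weak_power D l g (w l)" if "l \<le> r" for l
    using v[of l] g u weak that by (auto simp: w_def sobolev_def weak_power_def)
  have wX: "L1_plus_Linf lebesgue (w l)" if "l \<le> r" for l
    using Lp_imp_L1_plus_Linf[OF wL[OF that] p] .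
  \<comment> \<open>\<open>D \<phi>\<close> is again a test function, so the identity of order l for
    g, applied to it, can be compared with the identity of order l + 1 applied to
    \<open>\<phi>\<close>.\<close>
  have step: "weak_power D 1 (w l) (w (Suc l))" if "Suc l \<le> r" for l
    unfolding weak_power_def
  proof (intro allI impI)
    fix \<phi> :: "'a \<Rightarrow> real" assume \<phi>: "test_function \<phi>"
    have "(\<integral>x. g x * (D ^^ l) (D \<phi>) x \<partial>lebesgue) = (\<integral>x. w l x * D \<phi> x \<partial>lebesgue)"
      using ww[of l] that D_test[OF \<phi>] by (simp add: weak_power_def)
    moreover have "(\<integral>x. g x * (D ^^ Suc l) \<phi> x \<partial>lebesgue) = (\<integral>x. w (Suc l) x * \<phi> x \<partial>lebesgue)"
      using ww[OF that] \<phi> by (simp add: weak_power_def del: funpow.simps)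
    ultimately show "(\<integral>x. w l x * (D ^^ 1) \<phi> x \<partial>lebesgue) = (\<integral>x. w (Suc l) x * \<phi> x \<partial>lebesgue)"
      by (simp add: funpow_swap1)
  qed
  have "Lp_le lebesgue p (h ^ n * B) ((diff h ^^ n) (w (r - n)))" if "n \<le> r" for n
    using that
  proof (induction n)
    case 0
    then show ?case using B r by (simp add: w_def)
  next
    case (Suc n)
    let ?l = "r - Suc n"
    have l: "Suc ?l = r - n" "Suc ?l \<le> r" using Suc.prems by auto
    have X: "L1_plus_Linf lebesgue (w ?l)" "L1_plus_Linf lebesgue (w (Suc ?l))"
      using l by (auto intro!: wX)
    have sX: "L1_plus_Linf lebesgue (steklov h (w (Suc ?l)))"
      by (intro avg_L1_plus_Linf tl X)
    have "AE x in lebesgue. diff h (w ?l) x = h * steklov h (w (Suc ?l)) x"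
      by (rule diff_eq_steklov[OF X step[OF l(2)] h])
    then have "AE x in lebesgue. (diff h ^^ n) (diff h (w ?l)) x = (diff h ^^ n) (\<lambda>x. h * steklov h (w (Suc ?l)) x) x"
      by (intro diff_power_cong_AE h diff_L1_plus_Linf X L1_plus_Linf_mult sX)
    moreover have "AE x in lebesgue. (diff h ^^ n) (steklov h (w (Suc ?l))) x = steklov h ((diff h ^^ n) (w (Suc ?l))) x"
      by (intro diff_power_avg h tl X)
    ultimately have eq: "AE x in lebesgue. h * steklov h ((diff h ^^ n) (w (Suc ?l))) x = (diff h ^^ Suc n) (w ?l) x"
      by eventually_elim (simp add: diff_power_mult funpow_swap1)
    have "Lp_le lebesgue p (h ^ n * B) ((diff h ^^ n) (w (Suc ?l)))"
      using Suc l by simp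
    then have "Lp_le lebesgue p (\<bar>h\<bar> * (h ^ n * B)) (\<lambda>x. h * steklov h ((diff h ^^ n) (w (Suc ?l))) x)"
      using B h p by (intro Lp_le_mult kernel_op_Lp_le submarkov_avg_kernel tl) auto
    then have "Lp_le lebesgue p (\<bar>h\<bar> * (h ^ n * B)) ((diff h ^^ Suc n) (w ?l))"
      using eq by (rule Lp_le_AE_cong)
        (intro L1_plus_Linf_measurable diff_power_L1_plus_Linf h X)
    then show ?case using h by (simp add: mult.assoc)
  qed
  from this[of r] show ?thesis by (simp add: w_def)
qed

text \<open>With f = (f - g) + g, the r-th difference of the first part is bounded by
  \<open>diff_power_Lp_le\<close> with factor 2^r, that of the second by
  \<open>diff_power_weak\<close> with factor h^r \<le> t^r.\<close>

lemma modulus_le_K_functional: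
  assumes r: "1 \<le> r" and p: "1 \<le> p" and f: "f \<in> Lp p" and t: "0 < t"
  shows "ennreal (1 / 2 ^ r) * modulus evolve r p f t \<le> K_functional D r p f (t ^ r)"
proof -
  have "Lp_norm p ((diff h ^^ r) f) \<le> ennreal (2 ^ r) * (Lp_norm p (\<lambda>x. f x - g x) + ennreal (t ^ r) * Lp_norm p u)"
    if h: "0 < h" "h \<le> t" and g: "g \<in> sobolev D r p" and u: "u \<in> Lp p" and w: "weak_power D r g u" for h g u
  proof -
    define A where "A = enn2real (Lp_norm p (\<lambda>x. f x - g x))"
    define B where "B = enn2real (Lp_norm p u)"
    have gL: "g \<in> Lp p" using g by (simp add: sobolev_def)
    obtain C1 C2 where C: "0 \<le> C1" "Lp_le lebesgue p C1 f" "0 \<le> C2" "Lp_le lebesgue p C2 g"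
      using f gL Lp_iff[OF p] by blast
    have "Lp_le lebesgue p (C1 + \<bar>- 1\<bar> * C2) (\<lambda>x. f x + - 1 * g x)"
      using C p by (intro Lp_le_add Lp_le_mult) auto
    then have fg: "(\<lambda>x. f x - g x) \<in> Lp p"
      using C p unfolding Lp_iff[OF p] by (intro exI[of _ "C1 + \<bar>- 1\<bar> * C2"]) auto
    have A: "Lp_le lebesgue p A (\<lambda>x. f x - g x)" "0 \<le> A" "ennreal A = Lp_norm p (\<lambda>x. f x - g x)"
      using Lp_le_Lp_norm[OF fg p] fg by (auto simp: A_def Lp_def)
    have B: "Lp_le lebesgue p B u" "0 \<le> B" "ennreal B = Lp_norm p u"
      using Lp_le_Lp_norm[OF u p] u by (auto simp: B_def Lp_def)
    have X: "L1_plus_Linf lebesgue (\<lambda>x. f x - g x)" "L1_plus_Linf lebesgue g" "L1_plus_Linf lebesgue f"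
      using fg gL f by (auto intro: Lp_imp_L1_plus_Linf p)
    have eq: "AE x in lebesgue. (diff h ^^ r) (\<lambda>x. f x - g x) x + (diff h ^^ r) g x = (diff h ^^ r) f x"
      using diff_power_add[OF h(1) X(1,2), of r] by (auto elim: eventually_mono)
    have "Lp_le lebesgue p (2 ^ r * A + h ^ r * B) (\<lambda>x. (diff h ^^ r) (\<lambda>x. f x - g x) x + (diff h ^^ r) g x)"
      using A B h p r g u w by (intro Lp_le_add diff_power_Lp_le diff_power_weak) auto
    then have L: "Lp_le lebesgue p (2 ^ r * A + h ^ r * B) ((diff h ^^ r) f)"
      by (rule Lp_le_AE_cong[OF _ eq])
        (intro L1_plus_Linf_measurable diff_power_L1_plus_Linf h X)
    then have "Lp_norm p ((diff h ^^ r) f) \<le> ennreal (2 ^ r * A + h ^ r * B)"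
      using A B h p by (subst Lp_norm_le_iff) (auto dest: Lp_le_measurable)
    \<comment> \<open>One factor 2^r in front of both terms, so that the bracket is the one in the
      K-functional.\<close>
    also have "\<dots> \<le> ennreal (2 ^ r * (A + t ^ r * B))"
    proof (rule ennreal_leI)
      have "h ^ r * B \<le> 1 * (t ^ r * B)" unfolding mult_1 using h B by (intro mult_right_mono power_mono) auto
      also have "1 * (t ^ r * B) \<le> 2 ^ r * (t ^ r * B)" using t B by (intro mult_right_mono) auto
      finally show "2 ^ r * A + h ^ r * B \<le> 2 ^ r * (A + t ^ r * B)" by (simp add: distrib_left)
    qed
    also have "\<dots> = ennreal (2 ^ r) * (ennreal A + ennreal (t ^ r) * ennreal B)"
      using A B t by (simp add: ennreal_mult ennreal_plus)
    finally show ?thesis using A B by simp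
  qed
  then have *: "modulus evolve r p f t \<le> ennreal (2 ^ r) * (Lp_norm p (\<lambda>x. f x - g x) + ennreal (t ^ r) * Lp_norm p u)"
    if "g \<in> sobolev D r p" "u \<in> Lp p" "weak_power D r g u" for g u
    unfolding modulus_def using that by (intro SUP_least) auto
  have "ennreal (1 / 2 ^ r) * modulus evolve r p f t \<le> Lp_norm p (\<lambda>x. f x - g x) + ennreal (t ^ r) * Lp_norm p u"
    if "g \<in> sobolev D r p" "u \<in> Lp p" "weak_power D r g u" for g u
  proof -
    let ?X = "Lp_norm p (\<lambda>x. f x - g x) + ennreal (t ^ r) * Lp_norm p u"
    have "ennreal (1 / 2 ^ r) * modulus evolve r p f t \<le> ennreal (1 / 2 ^ r) * (ennreal (2 ^ r) * ?X)"
      by (intro mult_left_mono *[OF that]) simp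
    also have "\<dots> = ennreal (1 / 2 ^ r * 2 ^ r) * ?X"
      by (subst ennreal_mult) (auto simp: mult.assoc)
    finally show ?thesis by simp
  qed
  then show ?thesis
    unfolding K_functional_def by (intro INF_greatest) auto
qed

text \<open>The Steklov mean g is a competitor. The distance f - g is an average of differences and
  contributes the 1 in the constant; D^r g is a combination of r-th difference quotients with steps
  jt/r and contributes the sum.\<close>

lemma K_functional_le_modulus:
  assumes r: "1 \<le> r" and p: "1 \<le> p" and f: "f \<in> Lp p" and t: "0 < t"
  shows "K_functional D r p f (t ^ r) \<le>
    ennreal (1 + (\<Sum>j=1..r. real (r choose j) * (real r / real j) ^ r)) * modulus evolve r p f t"
proof -
  obtain n where n: "r = Suc n" using r by (cases r) auto
  \<comment> \<open>With this step all times that occur lie in (0, t]: h s for s \<le> r in the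
    average, and j h for j \<le> r in the derivatives.\<close>
  define h where "h = t / real r"
  have h: "0 < h" using t r by (simp add: h_def)
  have fX: "L1_plus_Linf lebesgue f" by (rule Lp_imp_L1_plus_Linf[OF f p])
  obtain Cf where Cf: "0 \<le> Cf" "Lp_le lebesgue p Cf f" using f Lp_iff[OF p] by blast
  have mod_le: "Lp_norm p ((diff s ^^ r) f) \<le> modulus evolve r p f t" if "0 < s" "s \<le> t" for s
    unfolding modulus_def using that by (intro SUP_upper) auto
  have mod_fin: "modulus evolve r p f t \<le> ennreal (2 ^ r * Cf)"
    unfolding modulus_def
  proof (rule SUP_least)
    fix s assume "s \<in> {0<..t}"
    then show "Lp_norm p ((diff s ^^ r) f) \<le> ennreal (2 ^ r * Cf)"
      using Cf p diff_power_Lp_le[of s p Cf f r] by (subst Lp_norm_le_iff) (auto dest: Lp_le_measurable)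
  qed
  \<comment> \<open>The modulus is finite by \<open>mod_fin\<close>, so it can be replaced by a real
    number.\<close>
  define W where "W = enn2real (modulus evolve r p f t)"
  have W: "ennreal W = modulus evolve r p f t" "0 \<le> W"
    using le_less_trans[OF mod_fin] by (auto simp: W_def)
  have diffW: "Lp_le lebesgue p W ((diff s ^^ r) f)" if "0 < s" "s \<le> t" for s
    using mod_le[OF that] W diff_power_Lp_le[OF that(1) Cf(2,1) p, of r] p
    by (subst Lp_norm_le_iff[symmetric]) (auto dest: Lp_le_measurable)
  have jh: "0 < real j * h" "real j * h \<le> t" if "j \<in> {1..r}" for j
  proof -
    show "0 < real j * h" using that h by simp
    have "real j * t \<le> real r * t" using that t by simp
    then show "real j * h \<le> t" using r by (simp add: h_def field_simps)
  qed
  \<comment> \<open>\<open>v l j\<close> is the l-th weak derivative of the r-fold average with step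
    jh. Thus \<open>u 0\<close> is the Steklov mean and \<open>u l\<close> its l-th derivative. The
    sign in \<open>c\<close> comes from solving the averaged expansion for the mean.\<close>
  define v where "v l j x = (1 / (real j * h)) ^ l * (steklov (real j * h) ^^ (r - l)) ((diff (real j * h) ^^ l) f) x"
    for l j x
  define c where "c j = - ((- 1) ^ r) * diff_coeff r j" for j
  define u where "u l x = (\<Sum>j=1..r. c j * v l j x)" for l x
  have vX: "L1_plus_Linf lebesgue (v l j)" if "j \<in> {1..r}" for l j
    unfolding v_def[abs_def]
    by (intro L1_plus_Linf_mult avg_power_L1_plus_Linf diff_power_L1_plus_Linf time_law_steklov jh that fX)
  have vL: "Lp_le lebesgue p (\<bar>(1 / (real j * h)) ^ l\<bar> * (2 ^ l * Cf)) (v l j)" if "j \<in> {1..r}" for l j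
    unfolding v_def[abs_def] using Cf p
    by (intro Lp_le_mult avg_power_Lp_le diff_power_Lp_le time_law_steklov jh that) auto
  have uLp: "u l \<in> Lp p" for l
    unfolding Lp_iff[OF p] u_def[abs_def]
    by (rule exI, rule conjI[rotated], rule Lp_le_sum, simp, rule Lp_le_mult, rule vL)
      (use Cf p in \<open>auto intro!: sum_nonneg\<close>)
  have weak: "weak_power D l (u 0) (u l)" if "l \<le> r" for l
    unfolding u_def[abs_def]
  proof (intro weak_power_sum weak_power_mult L1_plus_Linf_mult vX)
    fix j assume j: "j \<in> {1..r}"
    show "weak_power D l (v 0 j) (v l j)"
      using weak_steklov_power[OF fX jh(1)[OF j] that] unfolding v_def[abs_def] by simp
  qed
  have sob: "u 0 \<in> sobolev D r p"
    unfolding sobolev_def using uLp weak by fastforce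
  have "Lp_le lebesgue p (\<bar>(- 1) ^ r\<bar> * W) (\<lambda>x. (- 1) ^ r * (\<integral>s. (diff (h * s) ^^ r) f x \<partial>convolution_power unit_law n))"
  proof (rule Lp_le_mult[OF Lp_le_average W(2)])
    let ?L = "convolution_power unit_law n"
    have tl: "time_law ?L" by (intro time_law_convolution_power time_law_unit_law)
    then show "prob_space ?L" by (simp add: time_law_def)
    have [measurable_cong]: "sets ?L = sets borel" using tl by (simp add: time_law_def)
    have "(\<lambda>w. (\<lambda>(s, x). (diff s ^^ r) f x) (h * fst w, snd w)) \<in> borel_measurable (?L \<Otimes>\<^sub>M lebesgue)"
      by (rule measurable_compose[OF _ diff_power_measurable[OF L1_plus_Linf_measurable[OF fX]]]) measurable
    then show "(\<lambda>(s, x). (diff (h * s) ^^ r) f x) \<in> borel_measurable (?L \<Otimes>\<^sub>M lebesgue)"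
      by (simp add: split_beta')
    show "AE s in ?L. Lp_le lebesgue p W ((diff (h * s) ^^ r) f)"
      using AE_convolution_power_unit_law[of n]
    proof eventually_elim
      case (elim s)
      have "h * s \<le> h * real r" using elim h n by (intro mult_left_mono) auto
      also have "\<dots> = t" using r by (simp add: h_def)
      finally show ?case using elim h by (intro diffW) auto
    qed
  qed (use W p sigma_finite_measure_axioms in auto)
  moreover have eq: "AE x in lebesgue. (- 1) ^ r * (\<integral>s. (diff (h * s) ^^ r) f x \<partial>convolution_power unit_law n) = f x - u 0 x"
    using average_diff_power[OF h fX, of n]
  proof eventually_elim
    case (elim x)
    have "(- 1) ^ r * (\<integral>s. (diff (h * s) ^^ r) f x \<partial>convolution_power unit_law n) =
       ((- 1) ^ r * (- 1) ^ r) * f x + (- 1) ^ r * (\<Sum>j=1..r. diff_coeff r j * (steklov (real j * h) ^^ r) f x)"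
      using elim by (simp only: n[symmetric] distrib_left mult.assoc)
    also have "(- 1) ^ r * (- 1 :: real) ^ r = 1" by (simp flip: power_mult_distrib)
    also have "(- 1) ^ r * (\<Sum>j=1..r. diff_coeff r j * (steklov (real j * h) ^^ r) f x) = - u 0 x"
      by (simp add: u_def v_def c_def sum_distrib_left sum_negf mult.assoc)
    finally show ?case by simp
  qed
  ultimately have fu: "Lp_le lebesgue p W (\<lambda>x. f x - u 0 x)"
    using Cf uLp[of 0] by (intro Lp_le_AE_cong[OF _ eq]) (auto dest: Lp_le_measurable simp: Lp_def)
  have "Lp_le lebesgue p (\<Sum>j=1..r. \<bar>c j\<bar> * (\<bar>(1 / (real j * h)) ^ r\<bar> * W)) (u r)"
    unfolding u_def[abs_def] v_def[abs_def] using W p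
    by (intro Lp_le_sum Lp_le_mult) (auto intro!: diffW jh)
  \<comment> \<open>Here (1 / (j h))^r = (r / j)^r / t^r; this power of t cancels against the weight
    t^r in the K-functional.\<close>
  also have "(\<Sum>j=1..r. \<bar>c j\<bar> * (\<bar>(1 / (real j * h)) ^ r\<bar> * W)) =
      (\<Sum>j=1..r. real (r choose j) * (real r / real j) ^ r) * W / t ^ r"
  proof -
    have "\<bar>c j\<bar> * (\<bar>(1 / (real j * h)) ^ r\<bar> * W) = real (r choose j) * (real r / real j) ^ r * W / t ^ r"
      if "j \<in> {1..r}" for j
      using t that by (simp add: c_def diff_coeff_def h_def abs_mult power_abs power_divide power_mult_distrib)
    then show ?thesis by (simp add: sum_distrib_right sum_divide_distrib)
  qed
  finally have ur: "Lp_le lebesgue p ((\<Sum>j=1..r. real (r choose j) * (real r / real j) ^ r) * W / t ^ r) (u r)" .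
  let ?S = "\<Sum>j=1..r. real (r choose j) * (real r / real j) ^ r"
  have S: "0 \<le> ?S" by (intro sum_nonneg) auto
  have "K_functional D r p f (t ^ r) \<le> Lp_norm p (\<lambda>x. f x - u 0 x) + ennreal (t ^ r) * Lp_norm p (u r)"
    unfolding K_functional_def using sob uLp weak
    by (intro INF_lower2[of "(u 0, u r)"]) auto
  also have "\<dots> \<le> ennreal W + ennreal (t ^ r) * ennreal (?S * W / t ^ r)"
    using Lp_norm_le_iff[OF Lp_le_measurable[OF fu] W(2) p] Lp_norm_le_iff[OF Lp_le_measurable[OF ur] _ p] fu ur W(2) S t
    by (intro add_mono mult_left_mono) auto
  also have "\<dots> = ennreal (W + t ^ r * (?S * W / t ^ r))"
  proof -
    have "ennreal W + ennreal a * ennreal b = ennreal (W + a * b)" if "0 \<le> a" "0 \<le> b" for a b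
      using W(2) that by (simp add: ennreal_mult ennreal_plus)
    then show ?thesis using W(2) S t by simp
  qed
  also have "\<dots> = ennreal ((1 + ?S) * W)" using t by (simp add: algebra_simps)
  also have "\<dots> = ennreal (1 + ?S) * modulus evolve r p f t"
    using W S by (simp add: ennreal_mult del: ennreal_plus)
  finally show ?thesis .
qed

end

section \<open>Integration by parts\<close>

lemma continuous_support_cball:
  fixes F :: "'a::euclidean_space \<Rightarrow> real"
  assumes "bounded {x. F x \<noteq> 0}"
  obtains R where "0 < R" "\<And>x. R < norm x \<Longrightarrow> F x = 0"
proof -
  obtain b where "0 < b" "\<forall>x\<in>{x. F x \<noteq> 0}. norm x \<le> b"
    using assms unfolding bounded_pos by blast
  then show ?thesis using that[of b] by force
qed

text \<open>By translation invariance the difference quotients of \<open>F\<close> have integral \<open>0\<close>.\<close>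

lemma integral_partial_eq_0:
  fixes F :: "'a::euclidean_space \<Rightarrow> real"
  assumes F: "test_function F" and i: "i \<in> Basis"
  shows "(\<integral>x. partial i F x \<partial>lborel) = 0"
proof -
  note P = test_function_partial[OF F i]
  have Fc: "continuous_on UNIV F" by (intro smooth_continuous test_function_smooth F)
  note cs = continuous_compact_support[OF Fc test_function_bounded[OF F]]
  note cp = continuous_compact_support[OF smooth_continuous[OF test_function_smooth[OF P]] test_function_bounded[OF P]]
  note [measurable] = cs(3) cp(3)
  obtain B where B: "0 \<le> B" "\<And>x. \<bar>partial i F x\<bar> \<le> B" using cp(4) by blast
  obtain R where R: "0 < R" "\<And>x. R < norm x \<Longrightarrow> F x = 0"
    using continuous_support_cball[OF test_function_bounded[OF F]] by blast
  have norm_i: "norm i = 1" using i by simp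
  have line: "((\<lambda>t. F (x + t *\<^sub>R i)) has_real_derivative partial i F (x + t *\<^sub>R i)) (at t)" for x t
  proof -
    let ?F' = "frechet_derivative F (at (x + t *\<^sub>R i))"
    have F': "(F has_derivative ?F') (at (x + t *\<^sub>R i))"
      by (intro has_derivative_frechet smooth_differentiable test_function_smooth F)
    have "((\<lambda>t. F (x + t *\<^sub>R i)) has_derivative (\<lambda>s. ?F' (s *\<^sub>R i))) (at t)"
      by (rule has_derivative_compose[where f = "\<lambda>t. x + t *\<^sub>R i" and g = F, OF _ F']) (auto intro!: derivative_eq_intros)
    moreover have "?F' (s *\<^sub>R i) = partial i F (x + t *\<^sub>R i) * s" for s
      using linear_cmul[OF has_derivative_linear[OF F']] by (simp add: partial_def mult.commute)
    ultimately show ?thesis by (simp add: has_field_derivative_def)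
  qed
  let ?q = "\<lambda>n x. real (Suc n) * (F (x + (1 / real (Suc n)) *\<^sub>R i) - F x)"
  have "(\<lambda>n. \<integral>x. ?q n x \<partial>lborel) \<longlonglongrightarrow> (\<integral>x. partial i F x \<partial>lborel)"
  \<comment> \<open>By the mean value theorem the quotients are bounded by a bound B of the partial
    derivative. The steps are at most 1, so all supports stay in the ball of radius R + 1.\<close>
  proof (rule integral_dominated_convergence[where w = "\<lambda>x. indicator (cball 0 (R + 1)) x * B"])
    have "integrable lborel (\<lambda>x::'a. indicator (cball 0 (R + 1)) x *\<^sub>R B)"
      by (rule borel_integrable_compact) auto
    then show "integrable lborel (\<lambda>x::'a. indicator (cball 0 (R + 1)) x * B)" by simp
    show "AE x in lborel. (\<lambda>n. ?q n x) \<longlonglongrightarrow> partial i F x"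
    proof (rule AE_I2)
      fix x
      have "((\<lambda>h. (F (x + h *\<^sub>R i) - F x) / h) \<longlongrightarrow> partial i F x) (at 0)"
        using line[of x 0] by (simp add: DERIV_def)
      moreover have "filterlim (\<lambda>n. 1 / real (Suc n)) (at 0) sequentially"
        using LIMSEQ_inverse_real_of_nat
        by (intro filterlim_atI) (auto simp: inverse_eq_divide)
      ultimately have "(\<lambda>n. (F (x + (1 / real (Suc n)) *\<^sub>R i) - F x) / (1 / real (Suc n))) \<longlonglongrightarrow> partial i F x"
        by (rule filterlim_compose)
      then show "(\<lambda>n. ?q n x) \<longlonglongrightarrow> partial i F x"
        by (simp add: mult.commute)
    qed
    show "AE x in lborel. norm (?q n x) \<le> indicator (cball 0 (R + 1)) x * B" for n
    proof (rule AE_I2)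
      fix x
      show "norm (?q n x) \<le> indicator (cball 0 (R + 1)) x * B"
      proof (cases "norm x \<le> R + 1")
        case True
        obtain z where z: "F (x + (1 / real (Suc n)) *\<^sub>R i) - F (x + 0 *\<^sub>R i) = (1 / real (Suc n) - 0) * partial i F (x + z *\<^sub>R i)"
          using MVT2[OF _ line, of 0 "1 / real (Suc n)" x] by auto
        then have "?q n x = partial i F (x + z *\<^sub>R i)" by simp
        then show ?thesis using B(2) True by (simp add: indicator_def)
      next
        case False
        have "norm x \<le> norm (x + (1 / real (Suc n)) *\<^sub>R i) + norm ((1 / real (Suc n)) *\<^sub>R i)"
          by (metis add_diff_cancel_right' norm_triangle_ineq4)
        also have "norm ((1 / real (Suc n)) *\<^sub>R i) \<le> 1" using norm_i by simp
        finally have "R < norm (x + (1 / real (Suc n)) *\<^sub>R i)" using False by simp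
        then show ?thesis using R(2) False R(1) by simp
      qed
    qed
  qed measurable
  moreover have "(\<integral>x. ?q n x \<partial>lborel) = 0" for n
  proof -
    let ?v = "(1 / real (Suc n)) *\<^sub>R i"
    have "(\<integral>x. F x \<partial>lborel) = (\<integral>x. F x \<partial>distr lborel borel ((+) ?v))"
      by (simp add: lborel_distr_plus)
    also have "\<dots> = (\<integral>x. F (?v + x) \<partial>lborel)" by (rule integral_distr) auto
    finally have eq: "(\<integral>x. F (x + ?v) \<partial>lborel) = (\<integral>x. F x \<partial>lborel)" by (simp add: add.commute)
    have "integrable (distr lborel borel ((+) ?v)) F" using cs(2) by (simp add: lborel_distr_plus)
    then have "integrable lborel (\<lambda>x. F (x + ?v))"
      by (subst (asm) integrable_distr_eq) (auto simp: add.commute)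
    then show ?thesis using eq cs(2) by simp
  qed
  ultimately show ?thesis by (simp add: LIMSEQ_const_iff)
qed

definition laplacian :: "('a::euclidean_space \<Rightarrow> real) \<Rightarrow> 'a \<Rightarrow> real" where
  "laplacian f x = (\<Sum>i\<in>Basis. partial i (partial i f) x)"

lemma smooth_laplacian: "smooth f \<Longrightarrow> smooth (laplacian f)"
  unfolding laplacian_def[abs_def] by (intro smooth_sum smooth_partial)

lemma test_function_laplacian: "test_function f \<Longrightarrow> test_function (laplacian f)"
  unfolding laplacian_def[abs_def] by (intro test_function_sum test_function_partial)

lemma integral_lborel_eq_lebesgue:
  fixes f :: "'a::euclidean_space \<Rightarrow> real"
  shows "f \<in> borel_measurable borel \<Longrightarrow> (\<integral>x. f x \<partial>lebesgue) = (\<integral>x. f x \<partial>lborel)"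
  by (intro integral_completion) simp

lemma smooth_borel_measurable: "smooth f \<Longrightarrow> f \<in> borel_measurable borel"
  by (intro borel_measurable_continuous_onI smooth_continuous)

lemma test_function_integrable: "test_function \<phi> \<Longrightarrow> integrable lborel \<phi>"
  by (intro continuous_compact_support smooth_continuous test_function_smooth test_function_bounded)

text \<open>Green's identity. Only \<open>\<phi>\<close> has compact support, but this passes to the
  components of G grad \<phi> - \<phi> grad G, whose partial derivatives integrate to 0.\<close>

lemma laplacian_by_parts:
  assumes \<phi>: "test_function \<phi>" and G: "smooth G"
  shows "(\<integral>x. laplacian \<phi> x * G x \<partial>lebesgue) = (\<integral>x. \<phi> x * laplacian G x \<partial>lebesgue)"
proof -
  note s\<phi> = test_function_smooth[OF \<phi>]
  have eq: "(\<integral>x. partial i (partial i \<phi>) x * G x \<partial>lborel) = (\<integral>x. \<phi> x * partial i (partial i G) x \<partial>lborel)"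
    if i: "i \<in> Basis" for i
  proof -
    let ?F = "\<lambda>x. partial i \<phi> x * G x + \<phi> x * (- partial i G x)"
    have t: "test_function ?F"
      by (intro test_function_add test_function_mult_smooth test_function_partial smooth_partial smooth_minus G \<phi> i)
    have "partial i ?F x = partial i (partial i \<phi>) x * G x + (- 1) * (\<phi> x * partial i (partial i G) x)" for x
    proof -
      have m: "partial i (\<lambda>x. - partial i G x) x = - partial i (partial i G) x"
        using partial_mult[of "\<lambda>_. - 1" x "partial i G" i] smooth_differentiable[OF smooth_partial[OF G i]]
        by (simp add: partial_const)
      have "partial i ?F x = partial i (\<lambda>x. partial i \<phi> x * G x) x + partial i (\<lambda>x. \<phi> x * (- partial i G x)) x"
        by (intro partial_add smooth_differentiable smooth_mult smooth_partial smooth_minus s\<phi> G i)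
      also have "partial i (\<lambda>x. partial i \<phi> x * G x) x = partial i \<phi> x * partial i G x + partial i (partial i \<phi>) x * G x"
        by (intro partial_mult smooth_differentiable smooth_partial s\<phi> G i)
      also have "partial i (\<lambda>x. \<phi> x * (- partial i G x)) x = \<phi> x * partial i (\<lambda>x. - partial i G x) x + partial i \<phi> x * (- partial i G x)"
        by (intro partial_mult smooth_differentiable smooth_partial smooth_minus s\<phi> G i)
      finally show ?thesis by (simp add: m)
    qed
    then have "(\<integral>x. partial i (partial i \<phi>) x * G x + (- 1) * (\<phi> x * partial i (partial i G) x) \<partial>lborel) = 0"
      using integral_partial_eq_0[OF t i] by simp
    moreover have "integrable lborel (\<lambda>x. partial i (partial i \<phi>) x * G x)"
      "integrable lborel (\<lambda>x. \<phi> x * partial i (partial i G) x)"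
      by (intro test_function_integrable test_function_mult_smooth test_function_partial smooth_partial \<phi> G i)+
    ultimately show ?thesis by simp
  qed
  have [measurable]: "G \<in> borel_measurable borel" "\<phi> \<in> borel_measurable borel" "laplacian \<phi> \<in> borel_measurable borel"
    "laplacian G \<in> borel_measurable borel"
    by (intro smooth_borel_measurable smooth_laplacian s\<phi> G)+
  have "(\<integral>x. laplacian \<phi> x * G x \<partial>lborel) = (\<Sum>i\<in>Basis. \<integral>x. partial i (partial i \<phi>) x * G x \<partial>lborel)"
    unfolding laplacian_def sum_distrib_right
    by (intro Bochner_Integration.integral_sum test_function_integrable test_function_mult_smooth test_function_partial \<phi> G)
  also have "\<dots> = (\<Sum>i\<in>Basis. \<integral>x. \<phi> x * partial i (partial i G) x \<partial>lborel)"
    by (intro sum.cong eq refl)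
  also have "\<dots> = (\<integral>x. \<phi> x * laplacian G x \<partial>lborel)"
    unfolding laplacian_def sum_distrib_left
    by (intro Bochner_Integration.integral_sum[symmetric] test_function_integrable test_function_mult_smooth smooth_partial \<phi> G)
  finally show ?thesis by (simp add: integral_lborel_eq_lebesgue)
qed

lemma laplacian_mult:
  assumes f: "smooth f" and g: "smooth g"
  shows "laplacian (\<lambda>x. f x * g x) x =
    f x * laplacian g x + 2 * (\<Sum>i\<in>Basis. partial i f x * partial i g x) + laplacian f x * g x"
proof -
  have "partial i (partial i (\<lambda>x. f x * g x)) x =
      f x * partial i (partial i g) x + 2 * (partial i f x * partial i g x) + partial i (partial i f) x * g x"
    if i: "i \<in> Basis" for i
  proof -
    note S = smooth_differentiable smooth_partial smooth_mult f g i
    have "partial i (\<lambda>x. f x * g x) = (\<lambda>x. f x * partial i g x + partial i f x * g x)"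
      by (intro ext partial_mult S)
    then have "partial i (partial i (\<lambda>x. f x * g x)) x =
        partial i (\<lambda>x. f x * partial i g x) x + partial i (\<lambda>x. partial i f x * g x) x"
      by (simp only:) (intro partial_add S)
    also have "partial i (\<lambda>x. f x * partial i g x) x = f x * partial i (partial i g) x + partial i f x * partial i g x"
      by (intro partial_mult S)
    also have "partial i (\<lambda>x. partial i f x * g x) x = partial i f x * partial i g x + partial i (partial i f) x * g x"
      by (intro partial_mult S)
    finally show ?thesis by simp
  qed
  then show ?thesis
    unfolding laplacian_def by (simp add: sum.distrib sum_distrib_left sum_distrib_right)
qed

section \<open>Gaussian integrals\<close>

lemma nn_integral_gaussian_real:
  assumes a: "0 < a"
  shows "(\<integral>\<^sup>+y. ennreal (exp (- (a / 2) * y\<^sup>2 + w * y)) \<partial>lborel) =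
    ennreal (sqrt (2 * pi / a) * exp (w\<^sup>2 / (2 * a)))"
proof -
  have "exp (- (a / 2) * y\<^sup>2 + w * y) = sqrt (2 * pi / a) * exp (w\<^sup>2 / (2 * a)) * normal_density (w / a) (1 / sqrt a) y"
    for y
  proof -
    have "exp (- (a / 2) * y\<^sup>2 + w * y) = exp (w\<^sup>2 / (2 * a)) * exp (- (y - w / a)\<^sup>2 / (2 * (1 / sqrt a)\<^sup>2))"
      unfolding exp_add[symmetric] using a
      by (intro arg_cong[where f = exp]) (simp add: power2_eq_square field_simps)
    moreover have "sqrt (2 * pi / a) * (1 / sqrt (2 * pi * (1 / sqrt a)\<^sup>2)) = 1"
      using a by (simp add: power_divide)
    ultimately show ?thesis
      unfolding normal_density_def by (simp add: mult.assoc mult.left_commute[of "exp (w\<^sup>2 / (2 * a))"])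
  qed
  then have "(\<integral>\<^sup>+y. ennreal (exp (- (a / 2) * y\<^sup>2 + w * y)) \<partial>lborel) =
      (\<integral>\<^sup>+y. ennreal (sqrt (2 * pi / a) * exp (w\<^sup>2 / (2 * a))) * ennreal (normal_density (w / a) (1 / sqrt a) y) \<partial>lborel)"
    using a by (simp add: ennreal_mult')
  also have "\<dots> = ennreal (sqrt (2 * pi / a) * exp (w\<^sup>2 / (2 * a))) * (\<integral>\<^sup>+y. ennreal (normal_density (w / a) (1 / sqrt a) y) \<partial>lborel)"
    by (rule nn_integral_cmult) measurable
  also have "(\<integral>\<^sup>+y. ennreal (normal_density (w / a) (1 / sqrt a) y) \<partial>lborel) = 1"
    using a by (subst nn_integral_eq_integral) auto
  finally show ?thesis by simp
qed

lemma nn_integral_gaussian: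
  fixes v :: "'a::euclidean_space"
  assumes a: "0 < a"
  shows "(\<integral>\<^sup>+y. ennreal (exp (- (a / 2) * (norm y)\<^sup>2 + v \<bullet> y)) \<partial>lborel) =
    ennreal (sqrt (2 * pi / a) ^ DIM('a) * exp ((norm v)\<^sup>2 / (2 * a)))"
proof -
  have ns: "(norm y)\<^sup>2 = (\<Sum>b\<in>Basis. (y \<bullet> b)\<^sup>2)" for y :: 'a
    by (subst power2_norm_eq_inner, subst euclidean_inner) (simp add: power2_eq_square)
  have "exp (- (a / 2) * (norm y)\<^sup>2 + v \<bullet> y) = (\<Prod>b\<in>Basis. exp (- (a / 2) * (y \<bullet> b)\<^sup>2 + (v \<bullet> b) * (y \<bullet> b)))" for y
    unfolding exp_sum[OF finite_Basis, symmetric] ns euclidean_inner[of v y]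
    by (simp only: sum.distrib sum_distrib_left)
  then have "(\<integral>\<^sup>+y. ennreal (exp (- (a / 2) * (norm y)\<^sup>2 + v \<bullet> y)) \<partial>lborel) =
      (\<integral>\<^sup>+y. (\<Prod>b\<in>Basis. ennreal (exp (- (a / 2) * (y \<bullet> b)\<^sup>2 + (v \<bullet> b) * (y \<bullet> b)))) \<partial>lborel)"
    by (simp add: prod_ennreal)
  also have "\<dots> = (\<Prod>b\<in>Basis. \<integral>\<^sup>+y. ennreal (exp (- (a / 2) * y\<^sup>2 + (v \<bullet> b) * y)) \<partial>lborel)"
    by (rule nn_integral_lborel_prod) auto
  also have "\<dots> = (\<Prod>b\<in>Basis. ennreal (sqrt (2 * pi / a) * exp ((v \<bullet> b)\<^sup>2 / (2 * a))))"
    by (intro prod.cong refl nn_integral_gaussian_real a)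
  also have "\<dots> = ennreal (\<Prod>b\<in>Basis. sqrt (2 * pi / a) * exp ((v \<bullet> b)\<^sup>2 / (2 * a)))"
    using a by (intro prod_ennreal) auto
  also have "(\<Prod>b\<in>Basis. sqrt (2 * pi / a) * exp ((v \<bullet> b)\<^sup>2 / (2 * a))) = sqrt (2 * pi / a) ^ DIM('a) * exp ((norm v)\<^sup>2 / (2 * a))"
    unfolding prod.distrib exp_sum[OF finite_Basis, symmetric] ns sum_divide_distrib by simp
  finally show ?thesis .
qed

lemma integrable_gaussian:
  assumes "0 < a"
  shows "integrable lborel (\<lambda>y::'a::euclidean_space. exp (- (a / 2) * (norm y)\<^sup>2 + v \<bullet> y))"
    "(\<integral>y. exp (- (a / 2) * (norm y)\<^sup>2 + v \<bullet> y) \<partial>lborel) = sqrt (2 * pi / a) ^ DIM('a) * exp ((norm v)\<^sup>2 / (2 * a))"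
proof -
  show "integrable lborel (\<lambda>y. exp (- (a / 2) * (norm y)\<^sup>2 + v \<bullet> y))"
  proof (rule integrableI_nonneg)
    show "(\<integral>\<^sup>+y. ennreal (exp (- (a / 2) * (norm y)\<^sup>2 + v \<bullet> y)) \<partial>lborel) < \<infinity>"
      unfolding nn_integral_gaussian[OF assms] by simp
  qed auto
  show "(\<integral>y. exp (- (a / 2) * (norm y)\<^sup>2 + v \<bullet> y) \<partial>lborel) = sqrt (2 * pi / a) ^ DIM('a) * exp ((norm v)\<^sup>2 / (2 * a))"
  proof (subst integral_eq_nn_integral)
    show "enn2real (\<integral>\<^sup>+y. ennreal (exp (- (a / 2) * (norm y)\<^sup>2 + v \<bullet> y)) \<partial>lborel) = sqrt (2 * pi / a) ^ DIM('a) * exp ((norm v)\<^sup>2 / (2 * a))"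
      unfolding nn_integral_gaussian[OF assms] using assms by simp
  qed auto
qed

lemma gaussian_bounded_integrable:
  assumes "0 < a"
  shows "bounded_integrable lebesgue (\<lambda>y::'a::euclidean_space. A * exp (- (a / 2) * (norm y)\<^sup>2))"
proof -
  have "integrable lborel (\<lambda>y::'a. A * exp (- (a / 2) * (norm y)\<^sup>2 + 0 \<bullet> y))"
    by (intro integrable_mult_right integrable_gaussian assms)
  then have "integrable lebesgue (\<lambda>y::'a. A * exp (- (a / 2) * (norm y)\<^sup>2))"
    by (simp add: integrable_completion)
  moreover have "\<bar>A * exp (- (a / 2) * (norm y)\<^sup>2)\<bar> \<le> \<bar>A\<bar>" for y :: 'a
    using assms by (simp add: abs_mult mult_left_le)
  ultimately show ?thesis by (auto simp: bounded_integrable_def)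
qed

text \<open>Half of the Gaussian decay pays for the quadratic factor and the linear exponent,
  uniformly in |y| \<le> R: of the rate c/2, c/8 goes to each of them and c/4 remains.\<close>

lemma gaussian_absorb:
  fixes c e R :: real
  assumes c: "0 < c" and R: "0 \<le> R"
  obtains A where "0 \<le> A" "\<And>x y :: 'a::euclidean_space. norm y \<le> R \<Longrightarrow>
    (1 + (norm x)\<^sup>2) * exp (- (c / 2) * (norm x)\<^sup>2 + e * (x \<bullet> y)) \<le> A * exp (- (c / 4) * (norm x)\<^sup>2)"
proof
  \<comment> \<open>\<open>m\<close> is chosen so that 1 + |x|^2 \<le> m exp(c |x|^2 / 8), and
    \<open>E\<close> is the remainder in |e| R |x| \<le> c |x|^2 / 8 + E, found by completing the
    square.\<close>
  define m where "m = max 1 (8 / c)"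
  define E where "E = 2 * (e * R)\<^sup>2 / c"
  have m: "0 < m" "1 \<le> m" "8 / c \<le> m" by (auto simp: m_def)
  show "0 \<le> m * exp E" using m by simp
  fix x y :: 'a assume y: "norm y \<le> R"
  have "1 + (norm x)\<^sup>2 \<le> m * (1 + (c / 8) * (norm x)\<^sup>2)"
  proof -
    have "1 \<le> m * (c / 8)" using m(3) c by (simp add: field_simps)
    then have "1 * (norm x)\<^sup>2 \<le> m * (c / 8) * (norm x)\<^sup>2" by (intro mult_right_mono) auto
    then show ?thesis using m by (simp add: algebra_simps)
  qed
  also have "\<dots> \<le> m * exp ((c / 8) * (norm x)\<^sup>2)"
    using m by (intro mult_left_mono exp_ge_add_one_self) auto
  finally have 1: "1 + (norm x)\<^sup>2 \<le> m * exp ((c / 8) * (norm x)\<^sup>2)" .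
  have "e * (x \<bullet> y) \<le> \<bar>e\<bar> * (norm x * R)"
  proof -
    have "e * (x \<bullet> y) \<le> \<bar>e\<bar> * \<bar>x \<bullet> y\<bar>" by (metis abs_ge_self abs_mult)
    also have "\<bar>x \<bullet> y\<bar> \<le> norm x * norm y" by (rule Cauchy_Schwarz_ineq2)
    also have "\<dots> \<le> norm x * R" using y by (intro mult_left_mono) auto
    finally show ?thesis by (simp add: mult_left_mono)
  qed
  also have "\<dots> \<le> (c / 8) * (norm x)\<^sup>2 + E"
  proof -
    have "0 \<le> (c * norm x - 4 * (\<bar>e\<bar> * R))\<^sup>2 / (8 * c)" using c by simp
    also have "\<dots> = (c / 8) * (norm x)\<^sup>2 + E - \<bar>e\<bar> * (norm x * R)"
      using c by (simp add: E_def power2_eq_square field_simps)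
    finally show ?thesis by simp
  qed
  finally have 2: "e * (x \<bullet> y) \<le> (c / 8) * (norm x)\<^sup>2 + E" .
  have "(1 + (norm x)\<^sup>2) * exp (- (c / 2) * (norm x)\<^sup>2 + e * (x \<bullet> y)) \<le>
      (m * exp ((c / 8) * (norm x)\<^sup>2)) * exp (- (c / 2) * (norm x)\<^sup>2 + ((c / 8) * (norm x)\<^sup>2 + E))"
    using 1 2 m by (intro mult_mono) auto
  also have "\<dots> = m * exp E * exp (- (c / 4) * (norm x)\<^sup>2)"
    by (simp add: mult_exp_exp algebra_simps)
  finally show "(1 + (norm x)\<^sup>2) * exp (- (c / 2) * (norm x)\<^sup>2 + e * (x \<bullet> y)) \<le> m * exp E * exp (- (c / 4) * (norm x)\<^sup>2)" .
qed

section \<open>Semigroups with Gaussian kernels\<close>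

lemma sigma_finite_lebesgue: "sigma_finite_measure (lebesgue :: 'a::euclidean_space measure)"
proof -
  obtain A :: "'a set set" where A: "countable A" "A \<subseteq> sets lborel" "\<Union>A = space lborel" "\<forall>a\<in>A. emeasure lborel a \<noteq> \<infinity>"
    using lborel.sigma_finite_countable by blast
  then show ?thesis
    by (intro sigma_finite_measure.intro exI[of _ A]) auto
qed

lemma abs_mult_le:
  fixes u v U V :: real
  assumes "\<bar>u\<bar> \<le> U" "\<bar>v\<bar> \<le> V"
  shows "\<bar>u * v\<bar> \<le> U * V"
  unfolding abs_mult by (rule mult_mono) (use assms abs_ge_zero order_trans in \<open>blast+\<close>)

lemma le_mult_one_plus_square:
  fixes z w :: real
  assumes "0 \<le> z"
  shows "z \<le> z * (1 + w\<^sup>2)"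
proof -
  have "0 \<le> z * w\<^sup>2" using assms by simp
  then show ?thesis unfolding distrib_left mult_1_right by linarith
qed

text \<open>Both settings at once: D = \<kappa> \<Delta> - \<gamma> |x|^2, and the kernel has a
  quadratic exponent. The three differential equations say that the kernel solves the evolution
  equation of D; \<open>ce\<close> fixes the value of c^2 - e^2, which they conserve.
  \<open>C_add\<close>, \<open>c_add\<close> and \<open>e_add\<close> are the semigroup law, and the
  three limits give the initial value.\<close>

locale gaussian_semigroup =
  fixes \<kappa> \<gamma> :: real and C c e :: "real \<Rightarrow> real"
    and k :: "real \<Rightarrow> 'a::euclidean_space \<Rightarrow> 'a \<Rightarrow> real"
    and D :: "('a \<Rightarrow> real) \<Rightarrow> 'a \<Rightarrow> real"
  assumes k_eq: "k t x y = C t * exp (- (c t / 2) * ((norm x)\<^sup>2 + (norm y)\<^sup>2) + e t * (x \<bullet> y))"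
    and D_eq: "test_function \<phi> \<Longrightarrow> D \<phi> x = \<kappa> * laplacian \<phi> x - \<gamma> * (norm x)\<^sup>2 * \<phi> x"
    and coeff_measurable: "C \<in> borel_measurable borel" "c \<in> borel_measurable borel" "e \<in> borel_measurable borel"
    and C_pos: "0 < t \<Longrightarrow> 0 < C t" and c_pos: "0 < t \<Longrightarrow> 0 < c t"
    and \<kappa>_pos: "0 < \<kappa>" and \<gamma>_nonneg: "0 \<le> \<gamma>"
    and DERIV_C: "0 < t \<Longrightarrow> (C has_real_derivative - \<kappa> * real DIM('a) * c t * C t) (at t)"
    and DERIV_c: "0 < t \<Longrightarrow> (c has_real_derivative - 2 * \<kappa> * (e t)\<^sup>2) (at t)"
    and DERIV_e: "0 < t \<Longrightarrow> (e has_real_derivative - 2 * \<kappa> * c t * e t) (at t)"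
    and ce: "0 < t \<Longrightarrow> \<kappa> * (c t)\<^sup>2 - \<gamma> = \<kappa> * (e t)\<^sup>2"
    and C_mass: "0 < t \<Longrightarrow> C t * sqrt (2 * pi / c t) ^ DIM('a) \<le> 1"
    and C_add: "0 < s \<Longrightarrow> 0 < t \<Longrightarrow> C s * C t * sqrt (2 * pi / (c s + c t)) ^ DIM('a) = C (s + t)"
    and c_add: "0 < s \<Longrightarrow> 0 < t \<Longrightarrow> c s - (e s)\<^sup>2 / (c s + c t) = c (s + t)"
    and e_add: "0 < s \<Longrightarrow> 0 < t \<Longrightarrow> e s * e t / (c s + c t) = e (s + t)"
    and lim_C: "((\<lambda>t. C t * sqrt (2 * pi / c t) ^ DIM('a)) \<longlongrightarrow> 1) (at_right 0)"
    and lim_c: "filterlim c at_top (at_right 0)"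
    and lim_e: "((\<lambda>t. e t / c t) \<longlongrightarrow> 1) (at_right 0)"
begin

lemma e_le_c: "0 < t \<Longrightarrow> (e t)\<^sup>2 \<le> (c t)\<^sup>2"
proof -
  assume "0 < t"
  then have "\<kappa> * (e t)\<^sup>2 \<le> \<kappa> * (c t)\<^sup>2" using ce[of t] \<gamma>_nonneg by simp
  then show ?thesis using \<kappa>_pos by simp
qed

lemma k_borel_measurable: "(\<lambda>(t, x, y). k t x y) \<in> borel_measurable (borel \<Otimes>\<^sub>M borel \<Otimes>\<^sub>M borel)"
proof -
  note [measurable] = coeff_measurable
  show ?thesis unfolding k_eq split_beta' by measurable
qed

lemma borel_lebesgue_id: "(\<lambda>x. x) \<in> lebesgue \<rightarrow>\<^sub>M (borel :: 'b::euclidean_space measure)"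
  by (rule measurable_completion) simp

text \<open>Mass and composition are Gaussian integrals in closed form. For the mass,
  \<open>e_le_c\<close> keeps the remaining exponent nonpositive. In the composition the integrand
  is Gaussian in z with coefficient c s + c t, and the three \<open>_add\<close> assumptions match
  the result with the kernel at time s + t.\<close>

lemma semigroup_kernel: "kernel_semigroup lebesgue k"
proof (rule kernel_semigroup.intro[OF sigma_finite_lebesgue], unfold_locales)
  note [measurable] = coeff_measurable
  show "(\<lambda>(t, x, y). k t x y) \<in> borel_measurable (borel \<Otimes>\<^sub>M lebesgue \<Otimes>\<^sub>M lebesgue)"
  proof -
    have "(\<lambda>w. (\<lambda>(t, x, y). k t x y) (fst w, fst (snd w), snd (snd w))) \<in> borel_measurable (borel \<Otimes>\<^sub>M lebesgue \<Otimes>\<^sub>M lebesgue)"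
      by (rule measurable_compose[OF _ k_borel_measurable])
        (intro measurable_Pair measurable_fst measurable_compose[OF _ borel_lebesgue_id]
          measurable_compose[OF measurable_snd measurable_fst] measurable_compose[OF measurable_snd measurable_snd])
    then show ?thesis by (simp add: split_beta')
  qed
  show "0 \<le> k t x y" if "0 < t" for t x y using C_pos[OF that] by (simp add: k_eq)
  show "k t x y = k t y x" for t x y by (simp add: k_eq add.commute inner_commute)
  show "(\<integral>\<^sup>+y. ennreal (k t x y) \<partial>lebesgue) \<le> 1" if t: "0 < t" for t x
  proof -
    have B: "0 \<le> C t * exp (- (c t / 2) * (norm x)\<^sup>2)" using C_pos[OF t] by simp
    have "k t x y = C t * exp (- (c t / 2) * (norm x)\<^sup>2) * exp (- (c t / 2) * (norm y)\<^sup>2 + (e t *\<^sub>R x) \<bullet> y)" for y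
      by (simp add: k_eq mult_exp_exp algebra_simps)
    then have "(\<integral>\<^sup>+y. ennreal (k t x y) \<partial>lborel) =
        (\<integral>\<^sup>+y. ennreal (C t * exp (- (c t / 2) * (norm x)\<^sup>2)) * ennreal (exp (- (c t / 2) * (norm y)\<^sup>2 + (e t *\<^sub>R x) \<bullet> y)) \<partial>lborel)"
      unfolding ennreal_mult'[OF B, symmetric] by simp
    also have "\<dots> = ennreal (C t * exp (- (c t / 2) * (norm x)\<^sup>2)) *
        (\<integral>\<^sup>+y. ennreal (exp (- (c t / 2) * (norm y)\<^sup>2 + (e t *\<^sub>R x) \<bullet> y)) \<partial>lborel)"
      by (rule nn_integral_cmult) measurable
    also have "\<dots> = ennreal (C t * exp (- (c t / 2) * (norm x)\<^sup>2)) *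
        ennreal (sqrt (2 * pi / c t) ^ DIM('a) * exp ((norm (e t *\<^sub>R x))\<^sup>2 / (2 * c t)))"
      by (subst nn_integral_gaussian[OF c_pos[OF t]]) simp
    also have "\<dots> = ennreal ((C t * sqrt (2 * pi / c t) ^ DIM('a)) *
        (exp (- (c t / 2) * (norm x)\<^sup>2) * exp ((norm (e t *\<^sub>R x))\<^sup>2 / (2 * c t))))"
      using C_pos[OF t] c_pos[OF t] by (subst ennreal_mult'[symmetric]) (auto simp: mult_ac)
    also have "\<dots> \<le> ennreal (1 * 1)"
    proof (rule ennreal_leI, rule mult_mono[OF C_mass[OF t]])
      have "(e t)\<^sup>2 * (norm x)\<^sup>2 \<le> (c t)\<^sup>2 * (norm x)\<^sup>2" by (intro mult_right_mono e_le_c t) simp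
      then have "- (c t / 2) * (norm x)\<^sup>2 + (norm (e t *\<^sub>R x))\<^sup>2 / (2 * c t) \<le> 0"
        using c_pos[OF t] by (simp add: power_mult_distrib field_simps power2_eq_square)
      then show "exp (- (c t / 2) * (norm x)\<^sup>2) * exp ((norm (e t *\<^sub>R x))\<^sup>2 / (2 * c t)) \<le> 1"
        by (simp add: mult_exp_exp)
    qed simp_all
    finally show ?thesis by (simp add: nn_integral_completion)
  qed
  show "(\<integral>\<^sup>+z. ennreal (k s x z * k t z y) \<partial>lebesgue) = ennreal (k (s + t) x y)"
    if s: "0 < s" and t: "0 < t" for s t x y
  proof -
    let ?v = "e s *\<^sub>R x + e t *\<^sub>R y" and ?B = "C s * C t * exp (- (c s / 2) * (norm x)\<^sup>2 - (c t / 2) * (norm y)\<^sup>2)"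
    have a: "0 < c s + c t" using c_pos[OF s] c_pos[OF t] by simp
    have B: "0 \<le> ?B" using C_pos[OF s] C_pos[OF t] by simp
    have "k s x z * k t z y = ?B * exp (- ((c s + c t) / 2) * (norm z)\<^sup>2 + ?v \<bullet> z)" for z
    proof -
      have "k s x z * k t z y = C s * C t * exp ((- (c s / 2) * ((norm x)\<^sup>2 + (norm z)\<^sup>2) + e s * (x \<bullet> z)) +
          (- (c t / 2) * ((norm z)\<^sup>2 + (norm y)\<^sup>2) + e t * (z \<bullet> y)))"
      proof -
        have "C s * exp a * (C t * exp b) = C s * C t * exp (a + b)" for a b by (simp add: exp_add)
        then show ?thesis unfolding k_eq .
      qed
      also have "(- (c s / 2) * ((norm x)\<^sup>2 + (norm z)\<^sup>2) + e s * (x \<bullet> z)) +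
          (- (c t / 2) * ((norm z)\<^sup>2 + (norm y)\<^sup>2) + e t * (z \<bullet> y)) =
          (- (c s / 2) * (norm x)\<^sup>2 - (c t / 2) * (norm y)\<^sup>2) + (- ((c s + c t) / 2) * (norm z)\<^sup>2 + ?v \<bullet> z)"
        by (simp add: inner_add_left inner_commute[of z y] field_simps)
      finally show ?thesis unfolding exp_add by simp
    qed
    then have "(\<integral>\<^sup>+z. ennreal (k s x z * k t z y) \<partial>lborel) =
        (\<integral>\<^sup>+z. ennreal ?B * ennreal (exp (- ((c s + c t) / 2) * (norm z)\<^sup>2 + ?v \<bullet> z)) \<partial>lborel)"
      unfolding ennreal_mult'[OF B, symmetric] by simp
    also have "\<dots> = ennreal ?B * (\<integral>\<^sup>+z. ennreal (exp (- ((c s + c t) / 2) * (norm z)\<^sup>2 + ?v \<bullet> z)) \<partial>lborel)"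
      by (rule nn_integral_cmult) measurable
    also have "\<dots> = ennreal ?B * ennreal (sqrt (2 * pi / (c s + c t)) ^ DIM('a) * exp ((norm ?v)\<^sup>2 / (2 * (c s + c t))))"
      by (subst nn_integral_gaussian[OF a]) simp
    also have "\<dots> = ennreal (?B * (sqrt (2 * pi / (c s + c t)) ^ DIM('a) * exp ((norm ?v)\<^sup>2 / (2 * (c s + c t)))))"
      unfolding ennreal_mult'[OF B] ..
    also have "?B * (sqrt (2 * pi / (c s + c t)) ^ DIM('a) * exp ((norm ?v)\<^sup>2 / (2 * (c s + c t)))) =
        C (s + t) * exp ((- (c s / 2) * (norm x)\<^sup>2 - (c t / 2) * (norm y)\<^sup>2) + (norm ?v)\<^sup>2 / (2 * (c s + c t)))"
      unfolding exp_add C_add[OF s t, symmetric] by simp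
    also have "(- (c s / 2) * (norm x)\<^sup>2 - (c t / 2) * (norm y)\<^sup>2) + (norm ?v)\<^sup>2 / (2 * (c s + c t)) =
        - (c (s + t) / 2) * ((norm x)\<^sup>2 + (norm y)\<^sup>2) + e (s + t) * (x \<bullet> y)"
    proof -
      have nv: "(norm ?v)\<^sup>2 = (e s)\<^sup>2 * (norm x)\<^sup>2 + 2 * (e s * e t) * (x \<bullet> y) + (e t)\<^sup>2 * (norm y)\<^sup>2"
        unfolding power2_norm_eq_inner
        by (simp add: inner_add_left inner_add_right inner_commute[of y x] power2_eq_square algebra_simps)
      have c1: "(e s)\<^sup>2 / (c s + c t) = c s - c (s + t)" using c_add[OF s t] by simp
      have c2: "(e t)\<^sup>2 / (c s + c t) = c t - c (s + t)" using c_add[OF t s] by (simp add: add.commute)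
      have "(norm ?v)\<^sup>2 / (2 * (c s + c t)) =
          ((e s)\<^sup>2 / (c s + c t)) * (norm x)\<^sup>2 / 2 + (e s * e t / (c s + c t)) * (x \<bullet> y) + ((e t)\<^sup>2 / (c s + c t)) * (norm y)\<^sup>2 / 2"
      proof -
        have "(p * n1 + 2 * q * z + r * n2) / (2 * d) = p / d * n1 / 2 + q / d * z + r / d * n2 / 2" for p q r n1 n2 z d :: real
          by (cases "d = 0") (simp_all add: field_simps)
        then show ?thesis unfolding nv .
      qed
      then show ?thesis unfolding c1 c2 e_add[OF s t] by (simp add: algebra_simps add_divide_distrib diff_divide_distrib)
    qed
    also have "C (s + t) * exp \<dots> = k (s + t) x y" by (simp add: k_eq)
    finally show ?thesis
    proof -
      assume "(\<integral>\<^sup>+z. ennreal (k s x z * k t z y) \<partial>lborel) = ennreal (k (s + t) x y)"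
      then show ?thesis by (simp add: nn_integral_completion)
    qed
  qed
qed

sublocale kernel_semigroup lebesgue k by (rule semigroup_kernel)

section \<open>The generator acting on the kernel\<close>

lemma D_test:
  assumes "test_function \<phi>"
  shows "test_function (D \<phi>)"
proof -
  have "test_function (\<lambda>x. laplacian \<phi> x * \<kappa> + \<phi> x * (- \<gamma> * (norm x)\<^sup>2))"
    by (intro test_function_add test_function_mult_smooth test_function_laplacian smooth_mult smooth_const
        smooth_norm_square assms)
  then show ?thesis by (simp add: D_eq[OF assms, abs_def] algebra_simps)
qed

lemma smooth_k: "smooth (k t x)"
proof -
  have "smooth (\<lambda>y. C t * exp (- (c t / 2) * ((norm x)\<^sup>2 + (norm y)\<^sup>2) + e t * (y \<bullet> x)))"
    by (intro smooth_mult smooth_const smooth_exp smooth_add smooth_norm_square smooth_inner)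
  then show ?thesis by (simp add: k_eq[abs_def] inner_commute)
qed

lemma has_derivative_exponent:
  "((\<lambda>y. - (c t / 2) * ((norm x)\<^sup>2 + (norm y)\<^sup>2) + e t * (x \<bullet> y)) has_derivative
    (\<lambda>h. - c t * (y \<bullet> h) + e t * (x \<bullet> h))) (at y)"
  unfolding power2_norm_eq_inner
  by (auto intro!: derivative_eq_intros simp: inner_commute field_simps)

lemma partial_k: "partial i (k t x) y = k t x y * (e t * (x \<bullet> i) - c t * (y \<bullet> i))"
proof -
  let ?E = "\<lambda>y. - (c t / 2) * ((norm x)\<^sup>2 + (norm y)\<^sup>2) + e t * (x \<bullet> y)"
  have "((\<lambda>y. C t * exp (?E y)) has_derivative (\<lambda>h. C t * ((- c t * (y \<bullet> h) + e t * (x \<bullet> h)) * exp (?E y)))) (at y)"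
    by (intro has_derivative_mult_right has_derivative_exp has_derivative_exponent)
  then show ?thesis
    unfolding k_eq[abs_def] by (subst partial_eq, assumption) (simp add: algebra_simps)
qed

lemma partial_partial_k:
  "partial i (partial i (k t x)) y = k t x y * ((e t * (x \<bullet> i) - c t * (y \<bullet> i))\<^sup>2 - c t * (i \<bullet> i))"
proof -
  have eq: "partial i (k t x) = (\<lambda>y. k t x y * (e t * (x \<bullet> i) - c t * (y \<bullet> i)))"
    by (rule ext) (rule partial_k)
  have d: "((\<lambda>y. e t * (x \<bullet> i) - c t * (y \<bullet> i)) has_derivative (\<lambda>h. - c t * (h \<bullet> i))) (at y)"
    by (auto intro!: derivative_eq_intros)
  have "partial i (\<lambda>y. k t x y * (e t * (x \<bullet> i) - c t * (y \<bullet> i))) y =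
      k t x y * partial i (\<lambda>y. e t * (x \<bullet> i) - c t * (y \<bullet> i)) y + partial i (k t x) y * (e t * (x \<bullet> i) - c t * (y \<bullet> i))"
    by (intro partial_mult smooth_differentiable smooth_k differentiableI[OF d])
  then show ?thesis
    unfolding eq partial_eq[OF d] by (simp add: power2_eq_square algebra_simps)
qed

text \<open>By the differential equations for the coefficients, \<open>k t x y * symbol t x y\<close> is at once
  \<open>\<partial>\<^sub>t k t x y\<close>, \<open>D\<close> applied in \<open>y\<close> and, by symmetry, \<open>D\<close> applied in \<open>x\<close>.\<close>

definition symbol :: "real \<Rightarrow> 'a \<Rightarrow> 'a \<Rightarrow> real" where
  "symbol t x y = \<kappa> * ((e t)\<^sup>2 * ((norm x)\<^sup>2 + (norm y)\<^sup>2) - 2 * c t * e t * (x \<bullet> y) - real DIM('a) * c t)"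

lemma symbol_sym: "symbol t x y = symbol t y x"
  by (simp add: symbol_def inner_commute add.commute)

lemma generator_k:
  assumes "0 < t"
  shows "\<kappa> * laplacian (k t x) y - \<gamma> * (norm y)\<^sup>2 * k t x y = k t x y * symbol t x y"
proof -
  have "laplacian (k t x) y = k t x y * (\<Sum>i\<in>Basis. (e t * (x \<bullet> i) - c t * (y \<bullet> i))\<^sup>2 - c t * (i \<bullet> i))"
    unfolding laplacian_def partial_partial_k by (simp add: sum_distrib_left)
  also have "(\<Sum>i\<in>Basis. (e t * (x \<bullet> i) - c t * (y \<bullet> i))\<^sup>2 - c t * (i \<bullet> i)) =
      (norm (e t *\<^sub>R x - c t *\<^sub>R y))\<^sup>2 - real DIM('a) * c t"
  proof -
    have "(norm (e t *\<^sub>R x - c t *\<^sub>R y))\<^sup>2 = (\<Sum>i\<in>Basis. (e t * (x \<bullet> i) - c t * (y \<bullet> i))\<^sup>2)"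
      by (subst power2_norm_eq_inner, subst euclidean_inner)
        (simp add: power2_eq_square inner_diff_left)
    moreover have "(\<Sum>i\<in>(Basis :: 'a set). c t * (i \<bullet> i)) = real DIM('a) * c t"
      by simp
    ultimately show ?thesis by (simp add: sum_subtractf)
  qed
  also have "(norm (e t *\<^sub>R x - c t *\<^sub>R y))\<^sup>2 = (e t)\<^sup>2 * (norm x)\<^sup>2 - 2 * c t * e t * (x \<bullet> y) + (c t)\<^sup>2 * (norm y)\<^sup>2"
    unfolding power2_norm_eq_inner
    by (simp add: inner_diff_left inner_diff_right inner_commute[of y x] power2_eq_square algebra_simps)
  finally have L: "laplacian (k t x) y = k t x y *
      ((e t)\<^sup>2 * (norm x)\<^sup>2 - 2 * c t * e t * (x \<bullet> y) + (c t)\<^sup>2 * (norm y)\<^sup>2 - real DIM('a) * c t)" .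
  have "\<kappa> * laplacian (k t x) y - \<gamma> * (norm y)\<^sup>2 * k t x y = k t x y *
      (\<kappa> * ((e t)\<^sup>2 * (norm x)\<^sup>2 - 2 * c t * e t * (x \<bullet> y) - real DIM('a) * c t) + (\<kappa> * (c t)\<^sup>2 - \<gamma>) * (norm y)\<^sup>2)"
    unfolding L by (simp add: algebra_simps)
  \<comment> \<open>\<open>ce\<close> replaces the coefficient of |y|^2 by \<kappa> e^2, the
    coefficient of |x|^2; this makes the result symmetric in x and y.\<close>
  then show ?thesis unfolding ce[OF assms] by (simp add: symbol_def algebra_simps)
qed

lemma DERIV_k:
  assumes "0 < t"
  shows "((\<lambda>t. k t x y) has_real_derivative k t x y * symbol t x y) (at t)"
proof -
  let ?E = "\<lambda>t. (- ((norm x)\<^sup>2 + (norm y)\<^sup>2) / 2) * c t + (x \<bullet> y) * e t"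
  have "((\<lambda>t. C t * exp (?E t)) has_real_derivative
      (- \<kappa> * real DIM('a) * c t * C t) * exp (?E t) +
      (exp (?E t) * ((- ((norm x)\<^sup>2 + (norm y)\<^sup>2) / 2) * (- 2 * \<kappa> * (e t)\<^sup>2) + (x \<bullet> y) * (- 2 * \<kappa> * c t * e t))) * C t) (at t)"
    by (intro DERIV_mult DERIV_C[OF assms] DERIV_fun_exp DERIV_add DERIV_cmult DERIV_c[OF assms] DERIV_e[OF assms])
  moreover have "(\<lambda>t. C t * exp (?E t)) = (\<lambda>t. k t x y)"
    by (simp add: k_eq fun_eq_iff field_simps)
  moreover have "C t * exp (?E t) = k t x y" by (simp add: k_eq field_simps)
  moreover have "(- \<kappa> * real DIM('a) * c t * C t) * exp (?E t) +
      (exp (?E t) * ((- ((norm x)\<^sup>2 + (norm y)\<^sup>2) / 2) * (- 2 * \<kappa> * (e t)\<^sup>2) + (x \<bullet> y) * (- 2 * \<kappa> * c t * e t))) * C t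
      = (C t * exp (?E t)) * symbol t x y"
    by (simp add: symbol_def algebra_simps)
  ultimately show ?thesis by simp
qed

text \<open>D passes from \<open>\<phi>\<close> to the kernel by \<open>laplacian_by_parts\<close>,
  and \<open>generator_k\<close> evaluates it there.\<close>

lemma evolve_D_test:
  assumes \<phi>: "test_function \<phi>" and t: "0 < t"
  shows "evolve t (D \<phi>) x = (\<integral>y. k t x y * symbol t x y * \<phi> y \<partial>lebesgue)"
proof -
  note sm = smooth_k[of t x]
  have int: "integrable lebesgue \<psi>" if "test_function \<psi>" for \<psi> :: "'a \<Rightarrow> real"
    using test_function_bounded_integrable[OF that] by (simp add: bounded_integrable_def)
  have "evolve t (D \<phi>) x = (\<integral>y. \<kappa> * (laplacian \<phi> y * k t x y) - \<gamma> * (\<phi> y * ((norm y)\<^sup>2 * k t x y)) \<partial>lebesgue)"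
    unfolding evolve_def D_eq[OF \<phi>] by (intro Bochner_Integration.integral_cong) (auto simp: algebra_simps)
  also have "\<dots> = \<kappa> * (\<integral>y. laplacian \<phi> y * k t x y \<partial>lebesgue) - \<gamma> * (\<integral>y. \<phi> y * ((norm y)\<^sup>2 * k t x y) \<partial>lebesgue)"
    by (subst Bochner_Integration.integral_diff)
      (auto intro!: integrable_mult_right int test_function_mult_smooth test_function_laplacian smooth_mult smooth_norm_square \<phi> sm)
  also have "(\<integral>y. laplacian \<phi> y * k t x y \<partial>lebesgue) = (\<integral>y. \<phi> y * laplacian (k t x) y \<partial>lebesgue)"
    by (rule laplacian_by_parts[OF \<phi> sm])
  also have "\<kappa> * \<dots> - \<gamma> * (\<integral>y. \<phi> y * ((norm y)\<^sup>2 * k t x y) \<partial>lebesgue) =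
      (\<integral>y. \<kappa> * (\<phi> y * laplacian (k t x) y) - \<gamma> * (\<phi> y * ((norm y)\<^sup>2 * k t x y)) \<partial>lebesgue)"
    by (subst Bochner_Integration.integral_diff)
      (auto intro!: integrable_mult_right int test_function_mult_smooth smooth_laplacian smooth_mult smooth_norm_square \<phi> sm)
  also have "\<dots> = (\<integral>y. k t x y * symbol t x y * \<phi> y \<partial>lebesgue)"
    unfolding generator_k[OF t, symmetric] by (intro Bochner_Integration.integral_cong) (auto simp: algebra_simps)
  finally show ?thesis .
qed

text \<open>The factor 1 + |x|^2 leaves room for the symbol and the gradient of the kernel, whose
  polynomial factors grow at most quadratically. Uniformity in |y| \<le> R serves when y runs
  through the support of a test function.\<close>

lemma k_decay:
  assumes t: "0 < t" and R: "0 \<le> R"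
  obtains A where "0 \<le> A" "\<And>x y. norm y \<le> R \<Longrightarrow> (1 + (norm x)\<^sup>2) * k t x y \<le> A * exp (- (c t / 4) * (norm x)\<^sup>2)"
proof -
  obtain A where A: "0 \<le> A" "\<And>x y :: 'a. norm y \<le> R \<Longrightarrow>
    (1 + (norm x)\<^sup>2) * exp (- (c t / 2) * (norm x)\<^sup>2 + e t * (x \<bullet> y)) \<le> A * exp (- (c t / 4) * (norm x)\<^sup>2)"
    using gaussian_absorb[OF c_pos[OF t] R] by blast
  show ?thesis
  proof (rule that[of "C t * A"])
    show "0 \<le> C t * A" using A C_pos[OF t] by simp
    fix x y :: 'a assume y: "norm y \<le> R"
    have "k t x y \<le> C t * exp (- (c t / 2) * (norm x)\<^sup>2 + e t * (x \<bullet> y))"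
      unfolding k_eq using C_pos[OF t] c_pos[OF t] by (intro mult_left_mono) (auto simp: algebra_simps)
    then have "(1 + (norm x)\<^sup>2) * k t x y \<le> (1 + (norm x)\<^sup>2) * (C t * exp (- (c t / 2) * (norm x)\<^sup>2 + e t * (x \<bullet> y)))"
      by (intro mult_left_mono) auto
    also have "\<dots> = C t * ((1 + (norm x)\<^sup>2) * exp (- (c t / 2) * (norm x)\<^sup>2 + e t * (x \<bullet> y)))" by simp
    also have "\<dots> \<le> C t * (A * exp (- (c t / 4) * (norm x)\<^sup>2))"
      using C_pos[OF t] by (intro mult_left_mono A y) auto
    finally show "(1 + (norm x)\<^sup>2) * k t x y \<le> C t * A * exp (- (c t / 4) * (norm x)\<^sup>2)" by simp
  qed
qed

lemma symbol_bound:
  assumes "0 \<le> R"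
  obtains S where "0 \<le> S" "\<And>x y. norm y \<le> R \<Longrightarrow> \<bar>symbol t x y\<bar> \<le> S * (1 + (norm x)\<^sup>2)"
proof
  let ?S = "\<kappa> * ((e t)\<^sup>2 * (1 + R\<^sup>2) + 2 * \<bar>c t * e t\<bar> * R + real DIM('a) * \<bar>c t\<bar>)"
  show "0 \<le> ?S" using \<kappa>_pos assms by simp
  fix x y :: 'a assume y: "norm y \<le> R"
  have n: "norm x \<le> 1 + (norm x)\<^sup>2"
    using sum_power2_ge_zero[of "norm x - 1" "norm x"] by (simp add: power2_eq_square algebra_simps)
  have yR: "(norm y)\<^sup>2 \<le> R\<^sup>2" using y by (intro power_mono) auto
  have "(norm x)\<^sup>2 + (norm y)\<^sup>2 \<le> (1 + R\<^sup>2) * (1 + (norm x)\<^sup>2)"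
  proof -
    have "0 \<le> R\<^sup>2 * (norm x)\<^sup>2" by simp
    then have "(norm x)\<^sup>2 + (norm y)\<^sup>2 \<le> 1 + (norm x)\<^sup>2 + R\<^sup>2 + R\<^sup>2 * (norm x)\<^sup>2" using yR by linarith
    then show ?thesis by (simp add: algebra_simps)
  qed
  then have 1: "(e t)\<^sup>2 * ((norm x)\<^sup>2 + (norm y)\<^sup>2) \<le> (e t)\<^sup>2 * (1 + R\<^sup>2) * (1 + (norm x)\<^sup>2)"
    unfolding mult.assoc by (intro mult_left_mono) auto
  have "\<bar>x \<bullet> y\<bar> \<le> norm x * norm y" by (rule Cauchy_Schwarz_ineq2)
  also have "\<dots> \<le> (1 + (norm x)\<^sup>2) * R" using y n by (intro mult_mono) auto
  finally have "2 * \<bar>c t * e t\<bar> * \<bar>x \<bullet> y\<bar> \<le> 2 * \<bar>c t * e t\<bar> * ((1 + (norm x)\<^sup>2) * R)"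
    by (intro mult_left_mono) auto
  then have 2: "2 * \<bar>c t * e t\<bar> * \<bar>x \<bullet> y\<bar> \<le> 2 * \<bar>c t * e t\<bar> * R * (1 + (norm x)\<^sup>2)"
    by (simp only: mult_ac)
  have 3: "real DIM('a) * \<bar>c t\<bar> \<le> real DIM('a) * \<bar>c t\<bar> * (1 + (norm x)\<^sup>2)"
    by (rule le_mult_one_plus_square) simp
  have "\<bar>symbol t x y\<bar> = \<kappa> * \<bar>(e t)\<^sup>2 * ((norm x)\<^sup>2 + (norm y)\<^sup>2) - 2 * c t * e t * (x \<bullet> y) - real DIM('a) * c t\<bar>"
    using \<kappa>_pos by (simp add: symbol_def abs_mult)
  also have "\<dots> \<le> \<kappa> * ((e t)\<^sup>2 * ((norm x)\<^sup>2 + (norm y)\<^sup>2) + 2 * \<bar>c t * e t\<bar> * \<bar>x \<bullet> y\<bar> + real DIM('a) * \<bar>c t\<bar>)"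
  proof -
    have "\<bar>a - b - d\<bar> \<le> a + \<bar>b\<bar> + \<bar>d\<bar>" if "0 \<le> a" for a b d :: real using that by linarith
    from this[of "(e t)\<^sup>2 * ((norm x)\<^sup>2 + (norm y)\<^sup>2)" "2 * c t * e t * (x \<bullet> y)" "real DIM('a) * c t"]
    show ?thesis using \<kappa>_pos by (intro mult_left_mono) (auto simp: abs_mult mult.assoc)
  qed
  also have "\<dots> \<le> \<kappa> * ((e t)\<^sup>2 * (1 + R\<^sup>2) * (1 + (norm x)\<^sup>2) + 2 * \<bar>c t * e t\<bar> * R * (1 + (norm x)\<^sup>2) + real DIM('a) * \<bar>c t\<bar> * (1 + (norm x)\<^sup>2))"
    using \<kappa>_pos by (intro mult_left_mono[OF add_mono[OF add_mono[OF 1 2] 3]]) simp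
  also have "\<dots> = ?S * (1 + (norm x)\<^sup>2)" by (simp add: algebra_simps)
  finally show "\<bar>symbol t x y\<bar> \<le> ?S * (1 + (norm x)\<^sup>2)" .
qed

section \<open>Weak derivatives tested against the kernel\<close>

lemma k_swap: "k t x y = k t y x"
  by (simp add: k_eq add.commute inner_commute)

text \<open>The kernel is not a test function, but its product with the cutoff \<zeta>_n(x) =
  \<psi>(x / (n + 1)) is. D of the product differs from \<zeta>_n times D of the kernel by terms in
  which a derivative falls on \<zeta>_n, and these tend to 0. A Gaussian majorant independent of n
  allows the limit under the integral.\<close>

lemma weak_generator_k:
  assumes g: "L1_plus_Linf lebesgue g" and u: "L1_plus_Linf lebesgue u" and weak: "weak_power D 1 g u"
    and t: "0 < t"
  shows "(\<integral>x. g x * (k t y x * symbol t y x) \<partial>lebesgue) = (\<integral>x. u x * k t y x \<partial>lebesgue)"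
proof -
  let ?G = "k t y"
  note sG = smooth_k[of t y]
  \<comment> \<open>A bump normalized at the origin: the value 1 there and continuity give \<zeta>_n
    \<rightarrow> 1 pointwise.\<close>
  define \<psi> :: "'a \<Rightarrow> real" where "\<psi> x = bump (- One) One x * (1 / bump (- One :: 'a) One 0)" for x
  have \<psi>: "test_function \<psi>"
    unfolding \<psi>_def[abs_def] by (intro test_function_mult_smooth test_function_bump smooth_const)
  have \<psi>0: "\<psi> 0 = 1"
    using bump_pos_iff[of "- One :: 'a" One 0] by (simp add: \<psi>_def box_def)
  note s\<psi> = test_function_smooth[OF \<psi>]
  have bdd: "\<exists>B\<ge>0. \<forall>x. \<bar>f x\<bar> \<le> B" if "test_function f" for f :: "'a \<Rightarrow> real"
    by (rule continuous_compact_support(4)[OF smooth_continuous[OF test_function_smooth[OF that]] test_function_bounded[OF that]])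
  obtain B0 where B0: "0 \<le> B0" "\<And>x. \<bar>\<psi> x\<bar> \<le> B0" using bdd[OF \<psi>] by blast
  obtain B2 where B2: "0 \<le> B2" "\<And>x. \<bar>laplacian \<psi> x\<bar> \<le> B2" using bdd[OF test_function_laplacian[OF \<psi>]] by blast
  have "\<exists>B\<ge>0. \<forall>x. \<bar>partial i \<psi> x\<bar> \<le> B" if "i \<in> Basis" for i
    by (rule bdd[OF test_function_partial[OF \<psi> that]])
  then obtain B1 where B1: "\<And>i. i \<in> Basis \<Longrightarrow> 0 \<le> B1 i" "\<And>i x. i \<in> Basis \<Longrightarrow> \<bar>partial i \<psi> x\<bar> \<le> B1 i"
    by metis
  define a where "a n = 1 / real (Suc n)" for n
  have a: "0 \<le> a n" "a n \<le> 1" "a \<longlonglongrightarrow> 0" for n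
    using LIMSEQ_inverse_real_of_nat by (auto simp: a_def[abs_def] inverse_eq_divide)
  define \<zeta> where "\<zeta> n x = \<psi> (a n *\<^sub>R x)" for n and x :: 'a
  have s\<zeta>: "smooth (\<zeta> n)" for n unfolding \<zeta>_def[abs_def] by (intro smooth_scaleR s\<psi>)
  have test\<zeta>: "test_function (\<zeta> n)" for n
  proof (rule test_functionI[OF s\<zeta>])
    obtain R where R: "0 < R" "\<And>x. R < norm x \<Longrightarrow> \<psi> x = 0"
      using continuous_support_cball[OF test_function_bounded[OF \<psi>]] by blast
    have "{x. \<zeta> n x \<noteq> 0} \<subseteq> cball 0 (R * real (Suc n))"
    proof
      fix x assume "x \<in> {x. \<zeta> n x \<noteq> 0}"
      then have "\<not> R < norm (a n *\<^sub>R x)" using R(2) by (auto simp: \<zeta>_def)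
      then show "x \<in> cball 0 (R * real (Suc n))" by (simp add: a_def field_simps)
    qed
    then show "bounded {x. \<zeta> n x \<noteq> 0}" by (rule bounded_subset[OF bounded_cball])
  qed
  have partial\<zeta>: "partial i (\<zeta> n) x = a n * partial i \<psi> (a n *\<^sub>R x)" for i n x
    unfolding \<zeta>_def[abs_def] by (intro partial_scaleR smooth_differentiable s\<psi>)
  have lap\<zeta>: "laplacian (\<zeta> n) x = (a n)\<^sup>2 * laplacian \<psi> (a n *\<^sub>R x)" for n x
  proof -
    have "partial i (partial i (\<zeta> n)) x = (a n)\<^sup>2 * partial i (partial i \<psi>) (a n *\<^sub>R x)" if i: "i \<in> Basis" for i
    proof -
      note sp = smooth_partial[OF s\<psi> i]
      have "partial i (partial i (\<zeta> n)) x = partial i (\<lambda>x. a n * partial i \<psi> (a n *\<^sub>R x)) x"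
        by (simp only: partial\<zeta>[abs_def])
      also have "\<dots> = a n * partial i (\<lambda>x. partial i \<psi> (a n *\<^sub>R x)) x"
        using partial_mult[of "\<lambda>_. a n" x "\<lambda>x. partial i \<psi> (a n *\<^sub>R x)" i]
          smooth_differentiable[OF smooth_scaleR[OF sp]] by (simp add: partial_const)
      also have "partial i (\<lambda>x. partial i \<psi> (a n *\<^sub>R x)) x = a n * partial i (partial i \<psi>) (a n *\<^sub>R x)"
        by (intro partial_scaleR smooth_differentiable sp)
      finally show ?thesis by (simp add: power2_eq_square)
    qed
    then show ?thesis unfolding laplacian_def by (simp add: sum_distrib_left)
  qed
  define q where "q n x = D (\<lambda>x. \<zeta> n x * ?G x) x" for n x
  have testq: "test_function (\<lambda>x. \<zeta> n x * ?G x)" for n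
    by (intro test_function_mult_smooth test\<zeta> sG)
  \<comment> \<open>Each derivative on the dilated cutoff brings a factor \<open>a n\<close>: one in
    the gradient term, two in the Laplacian term.\<close>
  have q_eq: "q n x = \<zeta> n x * (k t y x * symbol t y x) +
      a n * (2 * \<kappa> * (\<Sum>i\<in>Basis. partial i \<psi> (a n *\<^sub>R x) * partial i ?G x)) +
      (a n)\<^sup>2 * (\<kappa> * laplacian \<psi> (a n *\<^sub>R x) * ?G x)" for n x
  proof -
    have "q n x = \<zeta> n x * (\<kappa> * laplacian ?G x - \<gamma> * (norm x)\<^sup>2 * ?G x) +
       2 * \<kappa> * (\<Sum>i\<in>Basis. partial i (\<zeta> n) x * partial i ?G x) + \<kappa> * laplacian (\<zeta> n) x * ?G x"
      unfolding q_def D_eq[OF testq] laplacian_mult[OF s\<zeta> sG] by (simp add: algebra_simps)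
    moreover have "(\<Sum>i\<in>Basis. partial i (\<zeta> n) x * partial i ?G x) = a n * (\<Sum>i\<in>Basis. partial i \<psi> (a n *\<^sub>R x) * partial i ?G x)"
      by (simp add: partial\<zeta> sum_distrib_left mult.assoc)
    ultimately show ?thesis unfolding generator_k[OF t] lap\<zeta> by (simp add: algebra_simps)
  qed
  obtain A where A: "0 \<le> A" "\<And>x y'. norm y' \<le> norm y \<Longrightarrow> (1 + (norm x)\<^sup>2) * k t x y' \<le> A * exp (- (c t / 4) * (norm x)\<^sup>2)"
    using k_decay[OF t, of "norm y"] by auto
  have kA: "(1 + (norm x)\<^sup>2) * ?G x \<le> A * exp (- (c t / 4) * (norm x)\<^sup>2)" for x
    using A(2)[of y x] by (simp add: k_swap[of t y x])
  have G0: "0 \<le> ?G x" for x using C_pos[OF t] by (simp add: k_eq)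
  obtain S where S: "0 \<le> S" "\<And>x y'. norm y' \<le> norm y \<Longrightarrow> \<bar>symbol t x y'\<bar> \<le> S * (1 + (norm x)\<^sup>2)"
    using symbol_bound[of "norm y" t] by auto
  define P where "P = \<bar>e t\<bar> * norm y + \<bar>c t\<bar>"
  have dG: "\<bar>partial i ?G x\<bar> \<le> P * ((1 + (norm x)\<^sup>2) * ?G x)" if i: "i \<in> Basis" for i x
  proof -
    have n: "norm x \<le> 1 + (norm x)\<^sup>2"
      using sum_power2_ge_zero[of "norm x - 1" "norm x"] by (simp add: power2_eq_square algebra_simps)
    have "\<bar>e t * (y \<bullet> i) - c t * (x \<bullet> i)\<bar> \<le> \<bar>e t\<bar> * \<bar>y \<bullet> i\<bar> + \<bar>c t\<bar> * \<bar>x \<bullet> i\<bar>"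
      using abs_triangle_ineq4[of "e t * (y \<bullet> i)" "c t * (x \<bullet> i)"] by (simp add: abs_mult)
    also have "\<dots> \<le> \<bar>e t\<bar> * norm y + \<bar>c t\<bar> * norm x"
      by (intro add_mono mult_left_mono Basis_le_norm i) auto
    also have "\<dots> \<le> \<bar>e t\<bar> * norm y * (1 + (norm x)\<^sup>2) + \<bar>c t\<bar> * (1 + (norm x)\<^sup>2)"
      by (rule add_mono[OF le_mult_one_plus_square mult_left_mono[OF n]]) auto
    also have "\<dots> = P * (1 + (norm x)\<^sup>2)" by (simp add: P_def algebra_simps)
    finally have "?G x * \<bar>e t * (y \<bullet> i) - c t * (x \<bullet> i)\<bar> \<le> ?G x * (P * (1 + (norm x)\<^sup>2))"
      by (rule mult_left_mono[OF _ G0])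
    then show ?thesis by (simp add: partial_k abs_mult G0 mult_ac)
  qed
  have P: "0 \<le> P" by (simp add: P_def)
  \<comment> \<open>The bounds for the three terms of \<open>q_eq\<close>, relative to (1 + |x|^2)
    times the kernel; \<open>B0\<close>, \<open>B1\<close> and \<open>B2\<close> bound \<psi>, its
    first partial derivatives and its Laplacian.\<close>
  define Q where "Q = B0 * S + 2 * \<kappa> * (\<Sum>i\<in>Basis. B1 i * P) + \<kappa> * B2"
  have qb: "\<bar>q n x\<bar> \<le> Q * A * exp (- (c t / 4) * (norm x)\<^sup>2)" for n x
  proof -
    let ?W = "(1 + (norm x)\<^sup>2) * ?G x"
    have W: "0 \<le> ?W" using G0 by simp
    have GW: "?G x \<le> ?W" using le_mult_one_plus_square[OF G0[of x], of "norm x"] by (simp only: mult.commute)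
    have "\<bar>?G x * symbol t y x\<bar> \<le> S * ?W"
    proof -
      have "\<bar>symbol t y x\<bar> \<le> S * (1 + (norm x)\<^sup>2)" using S(2)[of y x] by (simp add: symbol_sym)
      then have "?G x * \<bar>symbol t y x\<bar> \<le> ?G x * (S * (1 + (norm x)\<^sup>2))" by (rule mult_left_mono[OF _ G0])
      then show ?thesis by (simp add: abs_mult G0 mult_ac)
    qed
    then have 1: "\<bar>\<zeta> n x * (?G x * symbol t y x)\<bar> \<le> B0 * (S * ?W)"
      by (rule abs_mult_le[rotated]) (simp add: \<zeta>_def B0(2))
    have an: "\<bar>a n\<bar> \<le> 1" "\<bar>(a n)\<^sup>2\<bar> \<le> 1" using a(1,2)[of n] by (auto intro: power_le_one)
    have "\<bar>partial i \<psi> (a n *\<^sub>R x) * partial i ?G x\<bar> \<le> B1 i * (P * ?W)" if "i \<in> Basis" for i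
      by (rule abs_mult_le[OF B1(2)[OF that] dG[OF that]])
    then have "(\<Sum>i\<in>Basis. \<bar>partial i \<psi> (a n *\<^sub>R x) * partial i ?G x\<bar>) \<le> (\<Sum>i\<in>Basis. B1 i * (P * ?W))"
      by (rule sum_mono)
    then have "\<bar>\<Sum>i\<in>Basis. partial i \<psi> (a n *\<^sub>R x) * partial i ?G x\<bar> \<le> (\<Sum>i\<in>Basis. B1 i * (P * ?W))"
      by (rule order_trans[OF sum_abs])
    then have 2: "\<bar>a n * (2 * \<kappa> * (\<Sum>i\<in>Basis. partial i \<psi> (a n *\<^sub>R x) * partial i ?G x))\<bar> \<le>
        1 * (2 * \<kappa> * (\<Sum>i\<in>Basis. B1 i * (P * ?W)))"
      by (intro abs_mult_le an) (use \<kappa>_pos in auto)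
    have 3: "\<bar>(a n)\<^sup>2 * (\<kappa> * laplacian \<psi> (a n *\<^sub>R x) * ?G x)\<bar> \<le> 1 * (\<kappa> * B2 * ?W)"
      by (intro abs_mult_le an B2) (use \<kappa>_pos GW G0 in auto)
    have "\<bar>q n x\<bar> \<le> B0 * (S * ?W) + 1 * (2 * \<kappa> * (\<Sum>i\<in>Basis. B1 i * (P * ?W))) + 1 * (\<kappa> * B2 * ?W)"
      unfolding q_eq by (rule order_trans[OF abs_triangle_ineq add_mono[OF order_trans[OF abs_triangle_ineq add_mono[OF 1 2]] 3]])
    also have "\<dots> = Q * ?W"
    proof -
      have "(\<Sum>i\<in>Basis. B1 i * (P * ?W)) = (\<Sum>i\<in>Basis. B1 i * P) * ?W"
        unfolding sum_distrib_right by (simp only: mult.assoc)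
      then show ?thesis unfolding Q_def by (simp only: distrib_right mult.assoc mult_1)
    qed
    also have "\<dots> \<le> Q * (A * exp (- (c t / 4) * (norm x)\<^sup>2))"
    proof (rule mult_left_mono[OF kA])
      show "0 \<le> Q" unfolding Q_def using B0 S B1 B2 P \<kappa>_pos by (intro add_nonneg_nonneg mult_nonneg_nonneg sum_nonneg) auto
    qed
    finally show ?thesis by (simp add: mult.assoc)
  qed
  have gauss: "bounded_integrable lebesgue (\<lambda>x::'a. Z * exp (- (c t / 4) * (norm x)\<^sup>2))" for Z
    using gaussian_bounded_integrable[of "c t / 2" Z] c_pos[OF t] by simp
  have leb: "f \<in> borel_measurable lebesgue" if "smooth f" for f :: "'a \<Rightarrow> real"
    using smooth_borel_measurable[OF that] by (intro measurable_completion) simp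
  have ksm: "(\<lambda>x. k t y x * symbol t y x) \<in> borel_measurable lebesgue"
  proof -
    have "smooth (\<lambda>x. \<kappa> * laplacian ?G x - \<gamma> * (norm x)\<^sup>2 * ?G x)"
      by (intro smooth_diff smooth_mult smooth_const smooth_norm_square smooth_laplacian sG)
    then show ?thesis unfolding generator_k[OF t] by (rule leb)
  qed
  have lim\<zeta>: "(\<lambda>n. f (a n *\<^sub>R x)) \<longlonglongrightarrow> f 0" if "smooth f" for f :: "'a \<Rightarrow> real" and x
  proof -
    have "(\<lambda>n. a n *\<^sub>R x) \<longlonglongrightarrow> 0 *\<^sub>R x" by (intro tendsto_scaleR a tendsto_const)
    then have "(\<lambda>n. a n *\<^sub>R x) \<longlonglongrightarrow> 0" by simp
    moreover have "isCont f 0" using smooth_continuous[OF that] by (simp add: continuous_on_eq_continuous_at)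
    ultimately show ?thesis by (rule isCont_tendsto_compose[rotated])
  qed
  have L1: "(\<lambda>n. \<integral>x. g x * q n x \<partial>lebesgue) \<longlonglongrightarrow> (\<integral>x. g x * (k t y x * symbol t y x) \<partial>lebesgue)"
  proof (rule integral_dominated_convergence[where w = "\<lambda>x. \<bar>g x * (Q * A * exp (- (c t / 4) * (norm x)\<^sup>2))\<bar>"])
    show "integrable lebesgue (\<lambda>x. \<bar>g x * (Q * A * exp (- (c t / 4) * (norm x)\<^sup>2))\<bar>)"
      by (intro integrable_abs bounded_integrable_pairing g gauss)
    show "(\<lambda>x. g x * q n x) \<in> borel_measurable lebesgue" for n
      unfolding q_def by (intro borel_measurable_times[OF L1_plus_Linf_measurable[OF g]] leb test_function_smooth[OF D_test] testq)
    show "(\<lambda>x. g x * (k t y x * symbol t y x)) \<in> borel_measurable lebesgue"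
      by (intro borel_measurable_times[OF L1_plus_Linf_measurable[OF g]] ksm)
    show "AE x in lebesgue. (\<lambda>n. g x * q n x) \<longlonglongrightarrow> g x * (k t y x * symbol t y x)"
    proof (rule AE_I2)
      fix x
      have "(\<lambda>n. q n x) \<longlonglongrightarrow> \<psi> 0 * (k t y x * symbol t y x) +
        0 * (2 * \<kappa> * (\<Sum>i\<in>Basis. partial i \<psi> 0 * partial i ?G x)) + 0\<^sup>2 * (\<kappa> * laplacian \<psi> 0 * ?G x)"
        unfolding q_eq \<zeta>_def
        by (intro tendsto_add tendsto_mult tendsto_const tendsto_power tendsto_sum lim\<zeta> a s\<psi> smooth_partial smooth_laplacian)
      then have "(\<lambda>n. q n x) \<longlonglongrightarrow> k t y x * symbol t y x" by (simp add: \<psi>0)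
      then show "(\<lambda>n. g x * q n x) \<longlonglongrightarrow> g x * (k t y x * symbol t y x)" by (intro tendsto_mult tendsto_const)
    qed
    show "AE x in lebesgue. norm (g x * q n x) \<le> \<bar>g x * (Q * A * exp (- (c t / 4) * (norm x)\<^sup>2))\<bar>" for n
    proof (rule AE_I2)
      fix x
      have "\<bar>q n x\<bar> \<le> \<bar>Q * A * exp (- (c t / 4) * (norm x)\<^sup>2)\<bar>" using qb[of n x] by linarith
      then show "norm (g x * q n x) \<le> \<bar>g x * (Q * A * exp (- (c t / 4) * (norm x)\<^sup>2))\<bar>"
        unfolding real_norm_def abs_mult[of "g x"] by (intro mult_left_mono) auto
    qed
  qed
  have L2: "(\<lambda>n. \<integral>x. u x * (\<zeta> n x * ?G x) \<partial>lebesgue) \<longlonglongrightarrow> (\<integral>x. u x * ?G x \<partial>lebesgue)"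
  proof (rule integral_dominated_convergence[where w = "\<lambda>x. \<bar>u x * (B0 * A * exp (- (c t / 4) * (norm x)\<^sup>2))\<bar>"])
    show "integrable lebesgue (\<lambda>x. \<bar>u x * (B0 * A * exp (- (c t / 4) * (norm x)\<^sup>2))\<bar>)"
      by (intro integrable_abs bounded_integrable_pairing u gauss)
    show "(\<lambda>x. u x * (\<zeta> n x * ?G x)) \<in> borel_measurable lebesgue" for n
      by (intro borel_measurable_times[OF L1_plus_Linf_measurable[OF u]] leb smooth_mult sG s\<zeta>)
    show "(\<lambda>x. u x * ?G x) \<in> borel_measurable lebesgue"
      by (intro borel_measurable_times[OF L1_plus_Linf_measurable[OF u]] leb sG)
    show "AE x in lebesgue. (\<lambda>n. u x * (\<zeta> n x * ?G x)) \<longlonglongrightarrow> u x * ?G x"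
    proof (rule AE_I2)
      fix x
      have "(\<lambda>n. u x * (\<zeta> n x * ?G x)) \<longlonglongrightarrow> u x * (\<psi> 0 * ?G x)"
        unfolding \<zeta>_def by (intro tendsto_mult tendsto_const lim\<zeta> s\<psi>)
      then show "(\<lambda>n. u x * (\<zeta> n x * ?G x)) \<longlonglongrightarrow> u x * ?G x" by (simp add: \<psi>0)
    qed
    show "AE x in lebesgue. norm (u x * (\<zeta> n x * ?G x)) \<le> \<bar>u x * (B0 * A * exp (- (c t / 4) * (norm x)\<^sup>2))\<bar>" for n
    proof (rule AE_I2)
      fix x
      have "?G x \<le> (1 + (norm x)\<^sup>2) * ?G x" using le_mult_one_plus_square[OF G0[of x], of "norm x"] by (simp only: mult.commute)
      also note kA[of x]
      finally have "\<bar>\<zeta> n x * ?G x\<bar> \<le> B0 * (A * exp (- (c t / 4) * (norm x)\<^sup>2))"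
        by (intro abs_mult_le) (use B0 G0 in \<open>auto simp: \<zeta>_def\<close>)
      then have "\<bar>\<zeta> n x * ?G x\<bar> \<le> \<bar>B0 * A * exp (- (c t / 4) * (norm x)\<^sup>2)\<bar>" by (simp add: mult.assoc)
      then show "norm (u x * (\<zeta> n x * ?G x)) \<le> \<bar>u x * (B0 * A * exp (- (c t / 4) * (norm x)\<^sup>2))\<bar>"
        unfolding real_norm_def abs_mult[of "u x"] by (intro mult_left_mono) auto
    qed
  qed
  have "(\<integral>x. g x * q n x \<partial>lebesgue) = (\<integral>x. u x * (\<zeta> n x * ?G x) \<partial>lebesgue)" for n
    using weak testq[of n] by (simp add: weak_power_def q_def)
  then show ?thesis using LIMSEQ_unique[OF L1] L2 by simp
qed

text \<open>\<open>weak_generator_k\<close> integrated in y against \<open>\<phi>\<close>, with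
  Fubini. Since y stays in the support of \<open>\<phi>\<close>, the bounds on kernel and symbol are
  uniform in y.\<close>

lemma weak_evolve_test:
  assumes g: "L1_plus_Linf lebesgue g" and u: "L1_plus_Linf lebesgue u" and weak: "weak_power D 1 g u"
    and \<phi>: "test_function \<phi>" and t: "0 < t"
  shows "(\<integral>x. g x * evolve t (D \<phi>) x \<partial>lebesgue) = (\<integral>x. u x * evolve t \<phi> x \<partial>lebesgue)"
proof -
  interpret pair: pair_sigma_finite "lebesgue :: 'a measure" "lebesgue :: 'a measure" ..
  have bi: "bounded_integrable lebesgue \<phi>" by (rule test_function_bounded_integrable[OF \<phi>])
  have [measurable]: "\<phi> \<in> borel_measurable lebesgue" using bi by (auto simp: bounded_integrable_def)
  have [measurable]: "g \<in> borel_measurable lebesgue" by (rule L1_plus_Linf_measurable[OF g])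
  obtain R where R: "0 < R" "\<And>x. R < norm x \<Longrightarrow> \<phi> x = 0"
    using continuous_support_cball[OF test_function_bounded[OF \<phi>]] by blast
  have R0: "0 \<le> R" using R(1) by simp
  obtain A where A: "0 \<le> A" "\<And>x y. norm y \<le> R \<Longrightarrow> (1 + (norm x)\<^sup>2) * k t x y \<le> A * exp (- (c t / 4) * (norm x)\<^sup>2)"
    using k_decay[OF t R0] by blast
  obtain S where S: "0 \<le> S" "\<And>x y. norm y \<le> R \<Longrightarrow> \<bar>symbol t x y\<bar> \<le> S * (1 + (norm x)\<^sup>2)"
    using symbol_bound[OF R0] by blast
  let ?F = "\<lambda>x y. g x * (k t x y * symbol t x y * \<phi> y)"
  let ?w = "\<lambda>x. S * A * exp (- (c t / 4) * (norm x)\<^sup>2)"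
  have bound: "\<bar>?F x y\<bar> \<le> \<bar>g x * ?w x\<bar> * \<bar>\<phi> y\<bar>" for x y
  proof (cases "norm y \<le> R")
    case True
    have k0: "0 \<le> k t x y" by (rule k_nonneg[OF t])
    have "\<bar>k t x y * symbol t x y\<bar> \<le> k t x y * (S * (1 + (norm x)\<^sup>2))"
      by (rule abs_mult_le) (use k0 S(2)[OF True] in auto)
    also have "\<dots> = S * ((1 + (norm x)\<^sup>2) * k t x y)" by (simp only: mult_ac)
    also have "\<dots> \<le> S * (A * exp (- (c t / 4) * (norm x)\<^sup>2))" by (intro mult_left_mono A S True)
    finally have "\<bar>k t x y * symbol t x y\<bar> \<le> \<bar>?w x\<bar>" by (simp add: mult.assoc)
    then have "\<bar>k t x y * symbol t x y * \<phi> y\<bar> \<le> \<bar>?w x\<bar> * \<bar>\<phi> y\<bar>" by (rule abs_mult_le) simp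
    then have "\<bar>?F x y\<bar> \<le> \<bar>g x\<bar> * (\<bar>?w x\<bar> * \<bar>\<phi> y\<bar>)" by (rule abs_mult_le[rotated]) simp
    then show ?thesis by (simp only: abs_mult[of "g x"] mult.assoc)
  next
    case False
    then show ?thesis using R(2)[of y] by simp
  qed
  have gw: "integrable lebesgue (\<lambda>x. g x * ?w x)"
    using bounded_integrable_pairing[OF g gaussian_bounded_integrable[of "c t / 2" "S * A"]] c_pos[OF t] by simp
  have meas: "(\<lambda>(x, y). ?F x y) \<in> borel_measurable (lebesgue \<Otimes>\<^sub>M lebesgue)"
  proof -
    have [measurable]: "(\<lambda>w. symbol t (fst w) (snd w)) \<in> borel_measurable (lebesgue \<Otimes>\<^sub>M lebesgue)"
    proof -
      have "(\<lambda>(x, y). symbol t x y) \<in> borel_measurable (borel \<Otimes>\<^sub>M borel)"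
        unfolding symbol_def split_beta' by measurable
      then have "(\<lambda>w. (\<lambda>(x, y). symbol t x y) (fst w, snd w)) \<in> borel_measurable (lebesgue \<Otimes>\<^sub>M lebesgue)"
        by (rule measurable_compose[rotated])
          (intro measurable_Pair measurable_compose[OF measurable_fst borel_lebesgue_id] measurable_compose[OF measurable_snd borel_lebesgue_id])
      then show ?thesis by simp
    qed
    show ?thesis unfolding split_beta' by measurable
  qed
  have "integrable (lebesgue \<Otimes>\<^sub>M lebesgue) (\<lambda>(x, y). ?F x y)"
  proof (rule integrableI_bounded[OF meas])
    have "(\<integral>\<^sup>+z. ennreal (norm (case z of (x, y) \<Rightarrow> ?F x y)) \<partial>(lebesgue \<Otimes>\<^sub>M lebesgue)) =
        (\<integral>\<^sup>+x. (\<integral>\<^sup>+y. ennreal \<bar>?F x y\<bar> \<partial>lebesgue) \<partial>lebesgue)"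
      using meas by (subst nn_integral_fst[symmetric]) (auto simp: split_beta')
    also have "\<dots> \<le> (\<integral>\<^sup>+x. (\<integral>\<^sup>+y. ennreal \<bar>g x * ?w x\<bar> * ennreal \<bar>\<phi> y\<bar> \<partial>lebesgue) \<partial>lebesgue)"
      using bound by (intro nn_integral_mono) (simp add: ennreal_mult'[symmetric] ennreal_leI)
    also have "\<dots> = (\<integral>\<^sup>+x. ennreal \<bar>g x * ?w x\<bar> \<partial>lebesgue) * (\<integral>\<^sup>+y. ennreal \<bar>\<phi> y\<bar> \<partial>lebesgue)"
      using gw by (simp add: nn_integral_cmult nn_integral_multc borel_measurable_integrable)
    also have "\<dots> < \<infinity>"
      using gw bi by (auto simp: ennreal_mult_less_top integrable_iff_bounded bounded_integrable_def)
    finally show "(\<integral>\<^sup>+z. ennreal (norm (case z of (x, y) \<Rightarrow> ?F x y)) \<partial>(lebesgue \<Otimes>\<^sub>M lebesgue)) < \<infinity>" .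
  qed
  then have fub: "(\<integral>y. (\<integral>x. ?F x y \<partial>lebesgue) \<partial>lebesgue) = (\<integral>x. (\<integral>y. ?F x y \<partial>lebesgue) \<partial>lebesgue)"
    by (rule pair.Fubini_integral)
  have inner: "(\<integral>x. ?F x y \<partial>lebesgue) = evolve t u y * \<phi> y" for y
  proof -
    have "(\<integral>x. ?F x y \<partial>lebesgue) = (\<integral>x. \<phi> y * (g x * (k t y x * symbol t y x)) \<partial>lebesgue)"
      by (intro Bochner_Integration.integral_cong) (simp_all only: k_swap[of t _ y] symbol_sym[of t _ y] mult_ac)
    also have "\<dots> = \<phi> y * (\<integral>x. u x * k t y x \<partial>lebesgue)"
      by (simp only: integral_mult_right_zero weak_generator_k[OF g u weak t])
    finally show ?thesis by (simp add: evolve_def mult.commute)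
  qed
  have "(\<integral>x. g x * evolve t (D \<phi>) x \<partial>lebesgue) = (\<integral>x. (\<integral>y. ?F x y \<partial>lebesgue) \<partial>lebesgue)"
    by (simp add: evolve_D_test[OF \<phi> t])
  also have "\<dots> = (\<integral>y. evolve t u y * \<phi> y \<partial>lebesgue)"
    unfolding fub[symmetric] inner ..
  also have "\<dots> = (\<integral>x. u x * evolve t \<phi> x \<partial>lebesgue)"
    by (rule evolve_adjoint[OF t u bi])
  finally show ?thesis .
qed

section \<open>Time derivative and initial value on test functions\<close>

lemma lebesgue_integral_eq_cbox_integral:
  fixes f :: "'a \<Rightarrow> real"
  assumes "continuous_on UNIV f" "\<And>y. y \<notin> cbox a b \<Longrightarrow> f y = 0"
  shows "(\<integral>y. f y \<partial>lebesgue) = integral (cbox a b) f"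
proof -
  have "bounded {y. f y \<noteq> 0}" by (rule bounded_subset[OF bounded_cbox[of a b]]) (use assms(2) in auto)
  note cs = continuous_compact_support[OF assms(1) this]
  have "(\<integral>y. f y \<partial>lborel) = integral UNIV f"
    using has_integral_integral_lborel[OF cs(2)] by (simp add: integral_unique)
  also have "\<dots> = integral UNIV (\<lambda>y. if y \<in> cbox a b then f y else 0)"
    using assms(2) by (intro integral_cong) auto
  also have "\<dots> = integral (cbox a b) f" by (rule integral_restrict_UNIV)
  finally show ?thesis using cs(3) by (simp add: integral_lborel_eq_lebesgue)
qed

text \<open>Differentiation under the integral sign, with \<open>DERIV_k\<close> for the integrand
  and \<open>evolve_D_test\<close> for the result. The Leibniz rule applied is one for gauge
  integrals over a box, hence the passage to a box containing the support.\<close>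

lemma DERIV_evolve_test:
  assumes \<phi>: "test_function \<phi>" and t: "0 < t"
  shows "((\<lambda>t. evolve t \<phi> x) has_real_derivative evolve t (D \<phi>) x) (at t)"
proof -
  obtain a where a: "{y. \<phi> y \<noteq> 0} \<subseteq> cbox (- a) a"
    using bounded_subset_cbox_symmetric[OF test_function_bounded[OF \<phi>]] by blast
  have \<phi>0: "\<phi> y = 0" if "y \<notin> cbox (- a) a" for y using a that by blast
  note c\<phi> = smooth_continuous[OF test_function_smooth[OF \<phi>]]
  have ck: "continuous_on UNIV (k s x)" for s by (rule smooth_continuous[OF smooth_k])
  \<comment> \<open>An interval around t bounded away from 0, on which the coefficients are
    continuous.\<close>
  define U where "U = {t / 2<..<2 * t}"
  have U: "t \<in> U" "open U" "convex U" and Upos: "0 < s" if "s \<in> U" for s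
    using t that by (auto simp: U_def)
  have U': "t \<in> U" "open U" "convex U" using t by (auto simp: U_def)
  have evolve_eq: "evolve s \<phi> x = integral (cbox (- a) a) (\<lambda>y. k s x y * \<phi> y)" for s
    unfolding evolve_def using \<phi>0
    by (intro lebesgue_integral_eq_cbox_integral continuous_on_mult ck c\<phi>) auto
  have cC: "continuous_on U C" "continuous_on U c" "continuous_on U e"
    by (auto intro!: continuous_at_imp_continuous_on intro: DERIV_isCont DERIV_C DERIV_c DERIV_e Upos)
  have csym: "continuous_on UNIV (\<lambda>y. symbol s x y)" for s
    unfolding symbol_def by (intro continuous_intros)
  have joint: "continuous_on (U \<times> cbox (- a) a) (\<lambda>(s, y). k s x y * symbol s x y * \<phi> y)"
  proof -
    have [continuous_intros]: "continuous_on (U \<times> cbox (- a) a) (\<lambda>w. C (fst w))"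
      "continuous_on (U \<times> cbox (- a) a) (\<lambda>w. c (fst w))" "continuous_on (U \<times> cbox (- a) a) (\<lambda>w. e (fst w))"
      by (auto intro!: continuous_on_compose2[OF cC(1)] continuous_on_compose2[OF cC(2)] continuous_on_compose2[OF cC(3)]
          continuous_on_fst continuous_on_id)
    have [continuous_intros]: "continuous_on (U \<times> cbox (- a) a) (\<lambda>w. \<phi> (snd w))"
      by (auto intro!: continuous_on_compose2[OF c\<phi>] continuous_on_snd continuous_on_id)
    show ?thesis unfolding k_eq symbol_def split_beta' by (intro continuous_intros) auto
  qed
  have "((\<lambda>s. integral (cbox (- a) a) (\<lambda>y. k s x y * \<phi> y)) has_field_derivative
      integral (cbox (- a) a) (\<lambda>y. k t x y * symbol t x y * \<phi> y)) (at t within U)"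
  proof (rule leibniz_rule_field_derivative[OF _ _ joint U'(1,3)])
    show "((\<lambda>s. k s x y * \<phi> y) has_field_derivative k s x y * symbol s x y * \<phi> y) (at s within U)"
      if "s \<in> U" for s y
      by (rule has_field_derivative_at_within[OF DERIV_cmult_right[OF DERIV_k[OF Upos[OF that]]]])
    show "(\<lambda>y. k s x y * \<phi> y) integrable_on cbox (- a) a" for s
      by (intro integrable_continuous continuous_on_mult continuous_on_subset[OF ck] continuous_on_subset[OF c\<phi>]) auto
  qed
  moreover have "evolve t (D \<phi>) x = integral (cbox (- a) a) (\<lambda>y. k t x y * symbol t x y * \<phi> y)"
    unfolding evolve_D_test[OF \<phi> t] using \<phi>0
    by (intro lebesgue_integral_eq_cbox_integral continuous_on_mult ck c\<phi> csym) auto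
  ultimately show ?thesis
    unfolding evolve_eq using at_within_open[OF U'(1,2)] by simp
qed

lemma evolve_bound:
  assumes t: "0 < t" and B: "\<And>y. \<bar>f y\<bar> \<le> B" and [measurable]: "f \<in> borel_measurable lebesgue"
  shows "\<bar>evolve t f x\<bar> \<le> B"
proof -
  have B0: "0 \<le> B" using order_trans[OF abs_ge_zero B] .
  have km[measurable]: "(\<lambda>y. k t x y) \<in> borel_measurable lebesgue"
    using smooth_borel_measurable[OF smooth_k, of t x] by (intro measurable_completion) simp
  have mass: "(\<integral>\<^sup>+y. ennreal (k t x y) \<partial>lebesgue) \<le> 1" using k_mass[OF t] by simp
  have ik: "integrable lebesgue (k t x)"
    by (rule integrableI_nonneg) (use mass k_nonneg[OF t] in \<open>auto simp: le_less_trans\<close>)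
  have "ennreal (\<integral>y. k t x y \<partial>lebesgue) \<le> 1"
    using mass by (subst (asm) nn_integral_eq_integral[OF ik]) (auto simp: k_nonneg[OF t])
  then have m: "(\<integral>y. k t x y \<partial>lebesgue) \<le> 1" by simp
  have le: "\<bar>k t x y * f y\<bar> \<le> k t x y * B" for y
    by (rule abs_mult_le[OF _ B]) (simp add: k_nonneg[OF t])
  have ikf: "integrable lebesgue (\<lambda>y. k t x y * f y)"
    by (rule Bochner_Integration.integrable_bound[OF integrable_mult_left[OF ik, of B]]) (use le in \<open>auto intro!: AE_I2 order_trans[OF _ abs_ge_self]\<close>)
  have "\<bar>evolve t f x\<bar> \<le> (\<integral>y. \<bar>k t x y * f y\<bar> \<partial>lebesgue)"
    unfolding evolve_def by (rule integral_abs_bound)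
  also have "\<dots> \<le> (\<integral>y. k t x y * B \<partial>lebesgue)"
    by (intro integral_mono integrable_abs ikf integrable_mult_left ik le)
  also have "\<dots> = (\<integral>y. k t x y \<partial>lebesgue) * B" by simp
  also have "\<dots> \<le> 1 * B" by (intro mult_right_mono m B0)
  finally show ?thesis by simp
qed

text \<open>Substituting \<open>y = (e / c) x + z / \<surd>c\<close> turns the kernel into a fixed Gaussian in \<open>z\<close>.\<close>

lemma evolve_substitution:
  assumes t: "0 < t" and f: "continuous_on UNIV f"
  shows "evolve t f x = (C t * sqrt (2 * pi / c t) ^ DIM('a)) * exp (- (\<gamma> / \<kappa> / c t / 2) * (norm x)\<^sup>2) *
    ((1 / sqrt (2 * pi)) ^ DIM('a) *
      (\<integral>z. exp (- (1 / 2) * (norm z)\<^sup>2) * f ((e t / c t) *\<^sub>R x + (1 / sqrt (c t)) *\<^sub>R z) \<partial>lborel))"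
proof -
  note cp = c_pos[OF t]
  define m where "m = 1 / sqrt (c t)"
  define w where "w = (e t / c t) *\<^sub>R x"
  have m: "0 < m" using cp by (simp add: m_def)
  have m2: "m\<^sup>2 = 1 / c t" using cp by (simp add: m_def power_divide)
  have [measurable]: "f \<in> borel_measurable borel" by (rule borel_measurable_continuous_onI[OF f])
  have [measurable]: "k t x \<in> borel_measurable borel" by (rule smooth_borel_measurable[OF smooth_k])
  have "evolve t f x = (\<integral>y. k t x y * f y \<partial>lborel)"
    unfolding evolve_def by (rule integral_lborel_eq_lebesgue) measurable
  also have "\<dots> = (\<integral>y. k t x y * f y \<partial>density (distr lborel borel (\<lambda>z. w + m *\<^sub>R z)) (\<lambda>_. ennreal (\<bar>m\<bar> ^ DIM('a))))"
    using lborel_affine[of m w] m by simp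
  also have "\<dots> = (\<integral>z. m ^ DIM('a) * (k t x (w + m *\<^sub>R z) * f (w + m *\<^sub>R z)) \<partial>lborel)"
    using m by (subst integral_real_density) (auto simp: integral_distr)
  also have "\<dots> = (\<integral>z. (m ^ DIM('a) * (C t * exp (- (\<gamma> / \<kappa> / c t / 2) * (norm x)\<^sup>2))) * (exp (- (1 / 2) * (norm z)\<^sup>2) * f (w + m *\<^sub>R z)) \<partial>lborel)"
  proof (intro Bochner_Integration.integral_cong refl)
    fix z :: 'a
    \<comment> \<open>The coefficient of |x|^2 left over after completing the square; since c tends
      to infinity, it vanishes in the limit of small times.\<close>
    have ce': "c t - (e t)\<^sup>2 / c t = \<gamma> / \<kappa> / c t"
    proof -
      have "\<gamma> = \<kappa> * ((c t)\<^sup>2 - (e t)\<^sup>2)" using ce[OF t] by (simp add: algebra_simps)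
      then have "\<gamma> / \<kappa> = (c t)\<^sup>2 - (e t)\<^sup>2" using \<kappa>_pos by simp
      then show ?thesis using cp by (simp add: diff_divide_distrib power2_eq_square)
    qed
    have n: "(norm (w + m *\<^sub>R z))\<^sup>2 = (e t / c t)\<^sup>2 * (norm x)\<^sup>2 + 2 * (e t / c t) * m * (x \<bullet> z) + (1 / c t) * (norm z)\<^sup>2"
      unfolding power2_norm_eq_inner w_def m2[symmetric]
      by (simp add: inner_add_left inner_add_right inner_commute[of z x] power2_eq_square algebra_simps)
    have i: "x \<bullet> (w + m *\<^sub>R z) = (e t / c t) * (norm x)\<^sup>2 + m * (x \<bullet> z)"
      unfolding power2_norm_eq_inner w_def by (simp add: inner_add_right)
    have "- (c t / 2) * ((norm x)\<^sup>2 + (norm (w + m *\<^sub>R z))\<^sup>2) + e t * (x \<bullet> (w + m *\<^sub>R z)) =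
        - ((c t - (e t)\<^sup>2 / c t) / 2) * (norm x)\<^sup>2 - (1 / 2) * (norm z)\<^sup>2"
    proof -
      have "- (p / 2) * (X + ((q / p)\<^sup>2 * X + 2 * (q / p) * m * Y + (1 / p) * Z)) + q * ((q / p) * X + m * Y) =
          - ((p - q\<^sup>2 / p) / 2) * X - (1 / 2) * Z" if "p \<noteq> 0" for p q X Y Z :: real
        using that by (simp add: field_simps power2_eq_square)
      then show ?thesis unfolding n i using cp by simp
    qed
    then have "k t x (w + m *\<^sub>R z) = C t * (exp (- (\<gamma> / \<kappa> / c t / 2) * (norm x)\<^sup>2) * exp (- (1 / 2) * (norm z)\<^sup>2))"
      unfolding k_eq ce' by (simp add: mult_exp_exp)
    then show "m ^ DIM('a) * (k t x (w + m *\<^sub>R z) * f (w + m *\<^sub>R z)) =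
        (m ^ DIM('a) * (C t * exp (- (\<gamma> / \<kappa> / c t / 2) * (norm x)\<^sup>2))) * (exp (- (1 / 2) * (norm z)\<^sup>2) * f (w + m *\<^sub>R z))"
      by (simp only: mult_ac)
  qed
  also have "\<dots> = (m ^ DIM('a) * (C t * exp (- (\<gamma> / \<kappa> / c t / 2) * (norm x)\<^sup>2))) *
      (\<integral>z. exp (- (1 / 2) * (norm z)\<^sup>2) * f (w + m *\<^sub>R z) \<partial>lborel)"
    by (rule integral_mult_right_zero)
  also have "m ^ DIM('a) = sqrt (2 * pi / c t) ^ DIM('a) * (1 / sqrt (2 * pi)) ^ DIM('a)"
    unfolding power_mult_distrib[symmetric] by (simp add: m_def real_sqrt_divide)
  finally show ?thesis
    by (simp only: w_def m_def mult_ac)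
qed

text \<open>After \<open>evolve_substitution\<close> the time enters only through a convergent
  prefactor and the argument of \<open>\<phi>\<close>. As \<open>\<phi>\<close> is bounded and
  continuous, dominated convergence against the fixed Gaussian applies.\<close>

lemma tendsto_evolve_test:
  assumes \<phi>: "test_function \<phi>"
  shows "((\<lambda>t. evolve t \<phi> x) \<longlongrightarrow> \<phi> x) (at_right 0)"
proof -
  note c\<phi> = smooth_continuous[OF test_function_smooth[OF \<phi>]]
  obtain B where B: "0 \<le> B" "\<And>y. \<bar>\<phi> y\<bar> \<le> B"
    using continuous_compact_support(4)[OF c\<phi> test_function_bounded[OF \<phi>]] by blast
  have [measurable]: "\<phi> \<in> borel_measurable borel" by (rule borel_measurable_continuous_onI[OF c\<phi>])
  let ?g = "\<lambda>z::'a. exp (- (1 / 2) * (norm z)\<^sup>2)"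
  have ig: "integrable lborel ?g" "(\<integral>z. ?g z \<partial>lborel) = sqrt (2 * pi) ^ DIM('a)"
    using integrable_gaussian[of 1 "0 :: 'a"] by simp_all
  let ?I = "\<lambda>t. \<integral>z. ?g z * \<phi> ((e t / c t) *\<^sub>R x + (1 / sqrt (c t)) *\<^sub>R z) \<partial>lborel"
  have inv_c: "((\<lambda>t. 1 / c t) \<longlongrightarrow> 0) (at_right 0)"
    by (rule tendsto_divide_0[OF tendsto_const filterlim_at_top_imp_at_infinity[OF lim_c]])
  have inv_sqrt: "((\<lambda>t. 1 / sqrt (c t)) \<longlongrightarrow> 0) (at_right 0)"
    by (rule tendsto_divide_0[OF tendsto_const filterlim_at_top_imp_at_infinity[OF filterlim_compose[OF sqrt_at_top lim_c]]])
  have "(?I \<longlongrightarrow> (\<integral>z. ?g z * \<phi> x \<partial>lborel)) (at_right 0)"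
    \<comment> \<open>Replacing t by 1/s turns the limit at 0 into a limit at infinity, the form of
      the dominated convergence theorem for a real parameter.\<close>
    unfolding filterlim_at_right_to_top
  proof (rule integral_dominated_convergence_at_top[where w = "\<lambda>z. ?g z * B"])
    show "\<forall>\<^sub>F s in at_top. AE z in lborel. norm (?g z * \<phi> ((e (inverse s) / c (inverse s)) *\<^sub>R x + (1 / sqrt (c (inverse s))) *\<^sub>R z)) \<le> ?g z * B"
      using B by (intro always_eventually allI AE_I2) (simp add: abs_mult)
    show "AE z in lborel. ((\<lambda>s. ?g z * \<phi> ((e (inverse s) / c (inverse s)) *\<^sub>R x + (1 / sqrt (c (inverse s))) *\<^sub>R z)) \<longlongrightarrow> ?g z * \<phi> x) at_top"
    proof (rule AE_I2)
      fix z :: 'a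
      have "((\<lambda>t. (e t / c t) *\<^sub>R x + (1 / sqrt (c t)) *\<^sub>R z) \<longlongrightarrow> 1 *\<^sub>R x + 0 *\<^sub>R z) (at_right 0)"
        by (intro tendsto_add tendsto_scaleR tendsto_const lim_e inv_sqrt)
      moreover have "isCont \<phi> (1 *\<^sub>R x + 0 *\<^sub>R z)" using c\<phi> by (simp add: continuous_on_eq_continuous_at)
      ultimately have "((\<lambda>t. \<phi> ((e t / c t) *\<^sub>R x + (1 / sqrt (c t)) *\<^sub>R z)) \<longlongrightarrow> \<phi> (1 *\<^sub>R x + 0 *\<^sub>R z)) (at_right 0)"
        by (rule isCont_tendsto_compose[rotated])
      then have "((\<lambda>t. ?g z * \<phi> ((e t / c t) *\<^sub>R x + (1 / sqrt (c t)) *\<^sub>R z)) \<longlongrightarrow> ?g z * \<phi> x) (at_right 0)"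
        by (intro tendsto_mult tendsto_const) simp
      then show "((\<lambda>s. ?g z * \<phi> ((e (inverse s) / c (inverse s)) *\<^sub>R x + (1 / sqrt (c (inverse s))) *\<^sub>R z)) \<longlongrightarrow> ?g z * \<phi> x) at_top"
        unfolding filterlim_at_right_to_top .
    qed
    show "integrable lborel (\<lambda>z. ?g z * B)" by (intro integrable_mult_left ig)
  qed measurable
  then have I: "(?I \<longlongrightarrow> sqrt (2 * pi) ^ DIM('a) * \<phi> x) (at_right 0)"
    by (simp only: integral_mult_left_zero ig(2))
  have "((\<lambda>t. - (\<gamma> / \<kappa> * (1 / c t) / 2) * (norm x)\<^sup>2) \<longlongrightarrow> - (\<gamma> / \<kappa> * 0 / 2) * (norm x)\<^sup>2) (at_right 0)"
    by (intro tendsto_mult tendsto_minus tendsto_divide tendsto_const inv_c) simp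
  then have E: "((\<lambda>t. exp (- (\<gamma> / \<kappa> / c t / 2) * (norm x)\<^sup>2)) \<longlongrightarrow> exp 0) (at_right 0)"
    by (intro tendsto_exp) simp
  have "((\<lambda>t. (C t * sqrt (2 * pi / c t) ^ DIM('a)) * exp (- (\<gamma> / \<kappa> / c t / 2) * (norm x)\<^sup>2) *
      ((1 / sqrt (2 * pi)) ^ DIM('a) * ?I t)) \<longlongrightarrow> 1 * exp 0 * ((1 / sqrt (2 * pi)) ^ DIM('a) * (sqrt (2 * pi) ^ DIM('a) * \<phi> x))) (at_right 0)"
    by (intro tendsto_mult tendsto_const lim_C E I)
  also have "1 * exp 0 * ((1 / sqrt (2 * pi)) ^ DIM('a) * (sqrt (2 * pi) ^ DIM('a) * \<phi> x)) = \<phi> x"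
    by (simp add: power_divide)
  finally show ?thesis
  proof (rule Lim_transform_eventually)
    show "\<forall>\<^sub>F t in at_right 0. (C t * sqrt (2 * pi / c t) ^ DIM('a)) * exp (- (\<gamma> / \<kappa> / c t / 2) * (norm x)\<^sup>2) *
      ((1 / sqrt (2 * pi)) ^ DIM('a) * ?I t) = evolve t \<phi> x"
      using eventually_at_right_less[of 0] by eventually_elim (rule evolve_substitution[OF _ c\<phi>, symmetric])
  qed
qed

text \<open>The fundamental theorem of calculus for s in [0, 1], with
  \<open>DERIV_evolve_test\<close> in the interior and \<open>tendsto_evolve_test\<close> at the
  left end.\<close>

lemma evolve_test_integral:
  assumes \<phi>: "test_function \<phi>" and h: "0 < h"
  shows "evolve h \<phi> x - \<phi> x = h * (\<integral>s. evolve (h * s) (D \<phi>) x \<partial>unit_law)"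
proof -
  \<comment> \<open>The kernel at time 0 is unspecified, so the value \<open>\<phi> x\<close> is put
    in by hand; it is the one that makes \<open>F\<close> continuous at 0.\<close>
  define F where "F s = (if s \<le> 0 then \<phi> x else evolve (h * s) \<phi> x)" for s
  let ?G = "\<lambda>s. h * evolve (h * s) (D \<phi>) x"
  have DF: "(F has_real_derivative ?G s) (at s)" if s: "0 < s" for s
  proof -
    have "((\<lambda>s. evolve (h * s) \<phi> x) has_real_derivative evolve (h * s) (D \<phi>) x * h) (at s)"
      by (rule DERIV_chain2[OF DERIV_evolve_test[OF \<phi>]]) (use s h in \<open>auto intro!: derivative_eq_intros\<close>)
    moreover have "\<forall>\<^sub>F s in nhds s. F s = evolve (h * s) \<phi> x"
      using eventually_nhds_in_open[of "{0<..}" s] s by (auto simp: F_def elim: eventually_mono)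
    ultimately show ?thesis by (simp add: DERIV_cong_ev[OF refl _ refl] mult.commute)
  qed
  have "(?G has_integral (F 1 - F 0)) {0..1}"
  proof (rule fundamental_theorem_of_calculus_interior)
    show "continuous_on {0..1} F"
      unfolding continuous_on_def
    proof
      fix s :: real assume "s \<in> {0..1}"
      then consider "s = 0" | "0 < s" by fastforce
      then show "(F \<longlongrightarrow> F s) (at s within {0..1})"
      proof cases
        case 1
        have "filterlim (\<lambda>s. h * s) (at_right 0) (at_right 0)"
          unfolding filterlim_at using h
          by (auto simp: eventually_at_filter intro!: tendsto_eq_intros)
        then have "((\<lambda>s. evolve (h * s) \<phi> x) \<longlongrightarrow> \<phi> x) (at_right 0)"
          by (rule filterlim_compose[OF tendsto_evolve_test[OF \<phi>]])
        then have "(F \<longlongrightarrow> \<phi> x) (at_right 0)"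
          by (rule Lim_transform_eventually) (auto simp: F_def eventually_at_filter)
        moreover have "at 0 within {0..1} \<le> at_right (0 :: real)"
          unfolding at_within_def by (intro inf_mono order_refl) (auto simp: principal_le_iff)
        ultimately have "(F \<longlongrightarrow> \<phi> x) (at 0 within {0..1})" by (rule tendsto_mono[rotated])
        then show ?thesis using 1 by (simp add: F_def)
      next
        case 2
        then show ?thesis using DERIV_isCont[OF DF[OF 2]] tendsto_within_subset[of F _ s UNIV] by (simp add: isCont_def)
      qed
    qed
    show "(F has_vector_derivative ?G s) (at s)" if "s \<in> {0<..<1}" for s
      using DF[of s] that by (simp add: has_real_derivative_iff_has_vector_derivative)
  qed simp
  then have H1: "((\<lambda>s. if s \<in> {0..1} then ?G s else 0) has_integral (F 1 - F 0)) UNIV"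
    by (simp only: has_integral_restrict_UNIV)
  \<comment> \<open>The endpoint 0 is removed to match \<open>unit_law\<close>, which is uniform on
    \<open>{0<..1}\<close>.\<close>
  have H1: "((\<lambda>s. indicator {0<..1} s * ?G s) has_integral (F 1 - F 0)) UNIV"
    by (rule has_integral_spike_finite[OF _ _ H1, of "{0}"]) (auto simp: indicator_def)
  have D: "test_function (D \<phi>)" by (rule D_test[OF \<phi>])
  obtain B where B: "0 \<le> B" "\<And>y. \<bar>D \<phi> y\<bar> \<le> B"
    using continuous_compact_support(4)[OF smooth_continuous[OF test_function_smooth[OF D]] test_function_bounded[OF D]] by blast
  have Dm: "D \<phi> \<in> borel_measurable lebesgue"
    using test_function_bounded_integrable[OF D] by (auto simp: bounded_integrable_def)
  have [measurable]: "(\<lambda>s. evolve s (D \<phi>) x) \<in> borel_measurable borel"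
    using measurable_Pair1[OF evolve_measurable[OF Dm], of x] by simp
  have int: "integrable lborel (\<lambda>s. indicator {0<..1} s * ?G s)"
  proof (rule Bochner_Integration.integrable_bound[of _ "\<lambda>s::real. indicator {0<..1} s * (h * B)"])
    show "integrable lborel (\<lambda>s::real. indicator {0<..1} s * (h * B))"
      by (intro integrable_mult_left integrable_real_indicator) auto
    show "AE s in lborel. norm (indicator {0<..1} s * ?G s) \<le> norm (indicator {0<..1} s * (h * B))"
    proof (rule AE_I2)
      fix s :: real
      show "norm (indicator {0<..1} s * ?G s) \<le> norm (indicator {0<..1} s * (h * B))"
      proof (cases "s \<in> {0<..1}")
        case True
        then have "\<bar>evolve (h * s) (D \<phi>) x\<bar> \<le> B" using h by (intro evolve_bound B Dm) auto
        then show ?thesis using h B True by (simp add: abs_mult)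
      qed simp
    qed
  qed measurable
  have "(\<integral>s. indicator {0<..1} s * ?G s \<partial>lborel) = F 1 - F 0"
    by (rule has_integral_unique[OF has_integral_integral_lborel[OF int] H1])
  moreover have "(\<integral>s. evolve (h * s) (D \<phi>) x \<partial>unit_law) = (\<integral>s. indicator {0<..1} s * evolve (h * s) (D \<phi>) x \<partial>lborel)"
  proof -
    have u: "unit_law = density lborel (\<lambda>s. ennreal (indicator {0<..1} s))"
      unfolding unit_law_def uniform_measure_def by (simp add: ennreal_indicator divide_ennreal_def)
    show ?thesis unfolding u by (subst integral_real_density) auto
  qed
  moreover have "(\<integral>s. indicator {0<..1} s * ?G s \<partial>lborel) = h * (\<integral>s. indicator {0<..1} s * evolve (h * s) (D \<phi>) x \<partial>lborel)"
    by (simp flip: integral_mult_right_zero add: mult.left_commute)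
  ultimately show ?thesis by (simp add: F_def)
qed

lemma test_semigroup: "test_semigroup k D"
  by unfold_locales (auto intro: D_test evolve_test_integral weak_evolve_test)

end

section \<open>Mehler's formula\<close>

text \<open>The three-term recurrence of the Hermite polynomials H_n, from which the differential
  equation of the generating function is derived; \<open>hermite_poly_eq\<close> links it to
  Rodrigues' formula.\<close>

fun hermite_rec :: "nat \<Rightarrow> real \<Rightarrow> real" where
  "hermite_rec 0 s = 1"
| "hermite_rec (Suc 0) s = 2 * s"
| "hermite_rec (Suc (Suc n)) s = 2 * s * hermite_rec (Suc n) s - 2 * real (Suc n) * hermite_rec n s"

text \<open>In this form, as opposed to 2n H_(n-1), the derivative of H_n(s) e^(-s^2) is visibly -
  H_(n+1)(s) e^(-s^2), which is the induction step for Rodrigues' formula.\<close>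

lemma DERIV_hermite_rec: "(hermite_rec n has_real_derivative 2 * s * hermite_rec n s - hermite_rec (Suc n) s) (at s)"
proof (induction n arbitrary: s rule: less_induct)
  case (less n)
  consider "n = 0" | "n = 1" | m where "n = Suc (Suc m)" by (metis One_nat_def not0_implies_Suc)
  then show ?case
  proof cases
    case 1
    have "hermite_rec 0 = (\<lambda>_. 1)" by auto
    then show ?thesis using 1 by simp
  next
    case 2
    have "hermite_rec (Suc 0) = (\<lambda>s. 2 * s)" by auto
    then show ?thesis using 2 by (auto intro!: derivative_eq_intros simp: algebra_simps)
  next
    case (3 m)
    have eq: "hermite_rec n = (\<lambda>s. 2 * s * hermite_rec (Suc m) s - 2 * real (Suc m) * hermite_rec m s)"
      using 3 by auto
    have "((\<lambda>s. 2 * s * hermite_rec (Suc m) s - 2 * real (Suc m) * hermite_rec m s) has_real_derivative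
       (2 * 1) * hermite_rec (Suc m) s + (2 * s * hermite_rec (Suc m) s - hermite_rec (Suc (Suc m)) s) * (2 * s) -
       2 * real (Suc m) * (2 * s * hermite_rec m s - hermite_rec (Suc m) s)) (at s)"
      using 3 by (intro DERIV_diff DERIV_mult DERIV_cmult DERIV_ident less) auto
    then show ?thesis unfolding eq unfolding 3 by (simp add: algebra_simps)
  qed
qed

lemma deriv_power_gauss: "(deriv ^^ n) (\<lambda>u::real. exp (- u\<^sup>2)) = (\<lambda>s. (- 1) ^ n * hermite_rec n s * exp (- s\<^sup>2))"
proof (induction n)
  case (Suc n)
  have "((\<lambda>s. (- 1) ^ n * hermite_rec n s * exp (- s\<^sup>2)) has_real_derivative
     ((- 1) ^ n * (2 * s * hermite_rec n s - hermite_rec (Suc n) s)) * exp (- s\<^sup>2) +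
     (exp (- s\<^sup>2) * - (2 * s)) * ((- 1) ^ n * hermite_rec n s)) (at s)" for s
    by (intro DERIV_mult DERIV_cmult DERIV_hermite_rec DERIV_fun_exp DERIV_minus)
      (auto intro!: derivative_eq_intros)
  then have "deriv (\<lambda>s. (- 1) ^ n * hermite_rec n s * exp (- s\<^sup>2)) s = (- 1) ^ Suc n * hermite_rec (Suc n) s * exp (- s\<^sup>2)" for s
    by (subst DERIV_imp_deriv) (auto simp: algebra_simps)
  then show ?case using Suc by auto
qed simp

lemma hermite_poly_eq: "hermite_poly n s = hermite_rec n s"
proof -
  have "exp (s\<^sup>2) * exp (- s\<^sup>2) = 1" by (simp add: mult_exp_exp)
  then have "hermite_poly n s = ((- 1) ^ n * (- 1) ^ n) * hermite_rec n s"
    unfolding hermite_poly_def deriv_power_gauss by (simp add: mult_ac)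
  then show ?thesis by (simp flip: power_mult_distrib)
qed

section \<open>The generating function of H_n(a) H_n(b)\<close>

definition mehler_coeff :: "real \<Rightarrow> real \<Rightarrow> nat \<Rightarrow> real" where
  "mehler_coeff a b n = hermite_rec n a * hermite_rec n b / (2 ^ n * fact n)"

text \<open>The Wronskian f' g - f g' is annihilated by the nonzero series \<open>U\<close>, hence
  vanishes. So f / g has derivative 0 and equals its constant term 1.\<close>

lemma fps_ode_unique:
  fixes f g U P :: "'a::field_char_0 fps"
  assumes f: "U * fps_deriv f = P * f" and g: "U * fps_deriv g = P * g"
    and U: "fps_nth U 0 \<noteq> 0" and f0: "fps_nth f 0 = 1" and g0: "fps_nth g 0 = 1"
  shows "f = g"
proof -
  have "U * (fps_deriv f * g - f * fps_deriv g) = (U * fps_deriv f) * g - f * (U * fps_deriv g)"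
    by (simp only: right_diff_distrib mult_ac)
  also have "\<dots> = 0" unfolding f g by (simp only: mult_ac diff_self)
  finally have W: "fps_deriv f * g - f * fps_deriv g = 0" using U by auto
  let ?i = "inverse g"
  have ig: "g * ?i = 1" using g0 by (simp add: inverse_mult_eq_1')
  have "fps_deriv (f * ?i) = fps_deriv f * ?i * (g * ?i) - f * (fps_deriv g * ?i\<^sup>2)"
    unfolding ig using g0 by (simp add: fps_inverse_deriv mult.commute)
  also have "\<dots> = ?i\<^sup>2 * (fps_deriv f * g - f * fps_deriv g)"
    by (simp only: power2_eq_square right_diff_distrib mult_ac)
  finally have "fps_deriv (f * ?i) = 0" unfolding W by simp
  then have "f * ?i = fps_const (fps_nth (f * ?i) 0)" by (simp only: fps_deriv_eq_0_iff)
  also have "fps_nth (f * ?i) 0 = 1" using f0 g0 by simp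
  finally have "f * ?i = 1" by simp
  then have "g * (f * ?i) = g" by (simp only: mult_1_right)
  then have "f * (g * ?i) = g" by (simp only: mult.left_commute)
  then show ?thesis by (simp only: ig mult_1_right)
qed

text \<open>With \<open>B\<close> and \<open>C\<close> the generating functions of \<open>H\<^sub>n\<^sub>+\<^sub>1(a) H\<^sub>n(b)\<close> and \<open>H\<^sub>n(a) H\<^sub>n\<^sub>+\<^sub>1(b)\<close>, the three-term
  recurrence gives \<open>B = 2 a A - X C\<close>, \<open>C = 2 b A - X B\<close> and \<open>A' = a C - X (b C - X A' - A)\<close>.\<close>

lemma mehler_coeff_ode:
  fixes a b :: real
  defines "A \<equiv> Abs_fps (\<lambda>n. complex_of_real (mehler_coeff a b n))"
  shows "(1 - fps_X\<^sup>2)\<^sup>2 * fps_deriv A =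
    (fps_X * (1 - fps_X\<^sup>2) + fps_const (complex_of_real (2 * a * b)) * (1 + fps_X\<^sup>2)
      - fps_const (complex_of_real (2 * (a\<^sup>2 + b\<^sup>2))) * fps_X) * A"
proof -
  let ?H = hermite_rec
  define B where "B = Abs_fps (\<lambda>n. complex_of_real (?H (Suc n) a * ?H n b / (2 ^ n * fact n)))"
  define C where "C = Abs_fps (\<lambda>n. complex_of_real (?H n a * ?H (Suc n) b / (2 ^ n * fact n)))"
  let ?c = "\<lambda>x::real. fps_const (complex_of_real x)"
  have B: "B = ?c (2 * a) * A - fps_X * C"
  proof (rule fps_ext)
    fix n
    show "fps_nth B n = fps_nth (?c (2 * a) * A - fps_X * C) n"
    proof (cases n)
      case (Suc m)
      have "?H (Suc (Suc m)) a * ?H (Suc m) b / (2 ^ Suc m * fact (Suc m)) =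
          2 * a * (?H (Suc m) a * ?H (Suc m) b / (2 ^ Suc m * fact (Suc m))) - ?H m a * ?H (Suc m) b / (2 ^ m * fact m)"
        by (simp add: divide_simps) (simp add: algebra_simps)
      then have "complex_of_real (?H (Suc (Suc m)) a * ?H (Suc m) b / (2 ^ Suc m * fact (Suc m))) =
          complex_of_real (2 * a) * complex_of_real (?H (Suc m) a * ?H (Suc m) b / (2 ^ Suc m * fact (Suc m))) - complex_of_real (?H m a * ?H (Suc m) b / (2 ^ m * fact m))"
        by (simp only: of_real_diff of_real_mult)
      then show ?thesis unfolding Suc A_def B_def C_def mehler_coeff_def
        by (simp only: fps_sub_nth fps_mult_left_const_nth fps_X_mult_nth fps_nth_Abs_fps) simp
    qed (simp add: A_def B_def C_def mehler_coeff_def)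
  qed
  have C: "C = ?c (2 * b) * A - fps_X * B"
  proof (rule fps_ext)
    fix n
    show "fps_nth C n = fps_nth (?c (2 * b) * A - fps_X * B) n"
    proof (cases n)
      case (Suc m)
      have "?H (Suc m) a * ?H (Suc (Suc m)) b / (2 ^ Suc m * fact (Suc m)) =
          2 * b * (?H (Suc m) a * ?H (Suc m) b / (2 ^ Suc m * fact (Suc m))) - ?H (Suc m) a * ?H m b / (2 ^ m * fact m)"
        by (simp add: divide_simps) (simp add: algebra_simps)
      then have "complex_of_real (?H (Suc m) a * ?H (Suc (Suc m)) b / (2 ^ Suc m * fact (Suc m))) =
          complex_of_real (2 * b) * complex_of_real (?H (Suc m) a * ?H (Suc m) b / (2 ^ Suc m * fact (Suc m))) - complex_of_real (?H (Suc m) a * ?H m b / (2 ^ m * fact m))"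
        by (simp only: of_real_diff of_real_mult)
      then show ?thesis unfolding Suc A_def B_def C_def mehler_coeff_def
        by (simp only: fps_sub_nth fps_mult_left_const_nth fps_X_mult_nth fps_nth_Abs_fps) simp
    qed (simp add: A_def B_def C_def mehler_coeff_def)
  qed
  have A': "fps_deriv A = ?c a * C - fps_X * (?c b * C - fps_X * fps_deriv A - A)"
  proof (rule fps_ext)
    fix n
    have d: "fps_nth (fps_deriv A) n = complex_of_real (?H (Suc n) a * ?H (Suc n) b / (2 * (2 ^ n * fact n)))" for n
    proof -
      have "real (Suc n) * mehler_coeff a b (Suc n) = ?H (Suc n) a * ?H (Suc n) b / (2 * (2 ^ n * fact n))"
        by (simp add: mehler_coeff_def divide_simps del: hermite_rec.simps)
      then have "complex_of_real (real (Suc n)) * complex_of_real (mehler_coeff a b (Suc n)) =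
          complex_of_real (?H (Suc n) a * ?H (Suc n) b / (2 * (2 ^ n * fact n)))"
        by (simp only: of_real_mult[symmetric])
      then show ?thesis by (simp add: A_def del: hermite_rec.simps)
    qed
    show "fps_nth (fps_deriv A) n = fps_nth (?c a * C - fps_X * (?c b * C - fps_X * fps_deriv A - A)) n"
    \<comment> \<open>The term with the square of \<open>fps_X\<close> reaches back two indices, so
      n = 0 and n = 1 are treated apart.\<close>
    proof (cases n)
      case 0
      show ?thesis unfolding 0
        by (simp only: d fps_sub_nth fps_mult_left_const_nth fps_X_mult_nth) (simp add: C_def)
    next
      case (Suc m)
      show ?thesis
      proof (cases m)
        case 0
        have r: "?H (Suc 1) a * ?H (Suc 1) b / (2 * (2 ^ 1 * fact 1)) =
          a * (?H 1 a * ?H (Suc 1) b / (2 ^ 1 * fact 1)) - (b * (?H 0 a * ?H (Suc 0) b / (2 ^ 0 * fact 0)) - ?H 0 a * ?H 0 b / (2 ^ 0 * fact 0))"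
          by (simp add: field_simps)
        have "complex_of_real (?H (Suc 1) a * ?H (Suc 1) b / (2 * (2 ^ 1 * fact 1))) =
          complex_of_real a * complex_of_real (?H 1 a * ?H (Suc 1) b / (2 ^ 1 * fact 1)) - (complex_of_real b * complex_of_real (?H 0 a * ?H (Suc 0) b / (2 ^ 0 * fact 0)) - complex_of_real (?H 0 a * ?H 0 b / (2 ^ 0 * fact 0)))"
          unfolding r by (simp only: of_real_diff of_real_mult)
        then show ?thesis using Suc 0
          by (simp only: d) (simp add: C_def A_def mehler_coeff_def fps_X_mult_nth)
      next
        case (Suc l)
        let ?D = "2 ^ l * fact l :: real"
        have r: "?H (Suc n) a * ?H (Suc n) b / (2 * (2 ^ n * fact n)) =
          a * (?H n a * ?H (Suc n) b / (2 ^ n * fact n)) - (b * (?H m a * ?H (Suc m) b / (2 ^ m * fact m)) -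
            ?H (Suc l) a * ?H (Suc l) b / (2 * ?D) - ?H m a * ?H m b / (2 ^ m * fact m))"
          unfolding \<open>n = Suc m\<close> \<open>m = Suc l\<close>
          by (simp add: divide_simps) (simp add: algebra_simps)
        have "complex_of_real (?H (Suc n) a * ?H (Suc n) b / (2 * (2 ^ n * fact n))) =
          complex_of_real a * complex_of_real (?H n a * ?H (Suc n) b / (2 ^ n * fact n)) - (complex_of_real b * complex_of_real (?H m a * ?H (Suc m) b / (2 ^ m * fact m)) -
            complex_of_real (?H (Suc l) a * ?H (Suc l) b / (2 * ?D)) - complex_of_real (?H m a * ?H m b / (2 ^ m * fact m)))"
          unfolding r by (simp only: of_real_diff of_real_mult)
        then show ?thesis unfolding \<open>n = Suc m\<close> \<open>m = Suc l\<close>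
          by (simp only: fps_sub_nth fps_mult_left_const_nth fps_X_mult_nth d)
            (simp add: C_def A_def mehler_coeff_def fps_X_mult_nth del: hermite_rec.simps)
      qed
    qed
  qed
  \<comment> \<open>Solving for C and solving for A' each leave a factor 1 - X^2 on the left;
    substituting the first result in the second gives the coefficient (1 - X^2)^2.\<close>
  let ?X = "fps_X :: complex fps"
  have hC: "(1 - ?X\<^sup>2) * C = (?c (2 * b) - ?X * ?c (2 * a)) * A"
  proof -
    have "C = ?c (2 * b) * A - ?X * (?c (2 * a) * A - ?X * C)" using B C by simp
    then show ?thesis by (simp add: algebra_simps power2_eq_square)
  qed
  have hA: "(1 - ?X\<^sup>2) * fps_deriv A = (?c a - ?X * ?c b) * C + ?X * A"
    using A' by (simp add: algebra_simps power2_eq_square)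
  have "(1 - ?X\<^sup>2)\<^sup>2 * fps_deriv A = (1 - ?X\<^sup>2) * ((1 - ?X\<^sup>2) * fps_deriv A)"
    unfolding power2_eq_square[of "1 - ?X\<^sup>2"] by (simp only: mult.assoc)
  also have "\<dots> = (?c a - ?X * ?c b) * ((1 - ?X\<^sup>2) * C) + ?X * (1 - ?X\<^sup>2) * A"
    unfolding hA by (simp only: distrib_left mult_ac)
  also have "\<dots> = (?c a - ?X * ?c b) * ((?c (2 * b) - ?X * ?c (2 * a)) * A) + ?X * (1 - ?X\<^sup>2) * A"
    unfolding hC ..
  also have "\<dots> = ((?c a - ?X * ?c b) * (?c (2 * b) - ?X * ?c (2 * a)) + ?X * (1 - ?X\<^sup>2)) * A"
    by (simp add: algebra_simps)
  also have "(?c a - ?X * ?c b) * (?c (2 * b) - ?X * ?c (2 * a)) =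
     ?c (2 * a * b) * (1 + ?X\<^sup>2) - ?c (2 * (a\<^sup>2 + b\<^sup>2)) * ?X"
  proof -
    have k: "?c a * ?c (2 * b) = ?c (2 * a * b)" "?c b * ?c (2 * a) = ?c (2 * a * b)"
      "?c (2 * (a\<^sup>2 + b\<^sup>2)) = ?c a * ?c (2 * a) + ?c b * ?c (2 * b)"
      by (simp_all add: power2_eq_square algebra_simps flip: of_real_mult)
    have "(?c a - ?X * ?c b) * (?c (2 * b) - ?X * ?c (2 * a)) =
       ?c a * ?c (2 * b) + (?c b * ?c (2 * a)) * ?X\<^sup>2 - (?c a * ?c (2 * a) + ?c b * ?c (2 * b)) * ?X"
      by (simp add: algebra_simps power2_eq_square)
    then show ?thesis unfolding k by (simp add: algebra_simps)
  qed
  finally show ?thesis by (simp add: algebra_simps)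
qed

text \<open>The closed form is holomorphic in the unit disc, and its Taylor series satisfies the
  equation of \<open>mehler_coeff_ode\<close> with the same constant term, so the coefficients
  agree. Convergence in the whole disc comes from holomorphy, which is the reason for working over
  the complex numbers.\<close>

lemma mehler_formula:
  fixes a b \<rho> :: real
  assumes \<rho>: "\<bar>\<rho>\<bar> < 1"
  shows "(\<lambda>n. mehler_coeff a b n * \<rho> ^ n) sums
    (exp ((2 * a * b * \<rho> - (a\<^sup>2 + b\<^sup>2) * \<rho>\<^sup>2) / (1 - \<rho>\<^sup>2)) / sqrt (1 - \<rho>\<^sup>2))"
proof -
  define p where "p = complex_of_real (2 * a * b)"
  define q where "q = complex_of_real (a\<^sup>2 + b\<^sup>2)"
  \<comment> \<open>The square root is written through \<open>Ln\<close>, so that the logarithmic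
    derivative of \<open>F\<close> is the rational function
    \<open>P z / (1 - z\<^sup>2)\<^sup>2\<close>.\<close>
  define F where "F z = exp (- Ln (1 - z\<^sup>2) / 2 + (p * z - q * z\<^sup>2) / (1 - z\<^sup>2))" for z
  define P where "P z = z * (1 - z\<^sup>2) + p * (1 + z\<^sup>2) - (2 * q) * z" for z
  have dom: "1 - z\<^sup>2 \<notin> \<real>\<^sub>\<le>\<^sub>0" "1 - z\<^sup>2 \<noteq> 0" if "z \<in> ball 0 1" for z :: complex
  proof -
    have "norm (z\<^sup>2) < 1" using that by (simp add: norm_power power_less_one_iff)
    then have "Re (z\<^sup>2) < 1" using complex_Re_le_cmod[of "z\<^sup>2"] by linarith
    then show "1 - z\<^sup>2 \<notin> \<real>\<^sub>\<le>\<^sub>0" by (auto simp: complex_nonpos_Reals_iff)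
    then show "1 - z\<^sup>2 \<noteq> 0" by auto
  qed
  have DF: "(F has_field_derivative F z * (P z / (1 - z\<^sup>2)\<^sup>2)) (at z)" if z: "z \<in> ball 0 1" for z
  proof -
    have "(F has_field_derivative F z * (inverse (1 - z\<^sup>2) * z +
        ((p - q * (2 * z)) * (1 - z\<^sup>2) - (p * z - q * z\<^sup>2) * (- (2 * z))) / ((1 - z\<^sup>2) * (1 - z\<^sup>2)))) (at z)"
      unfolding F_def using dom[OF z] by (auto intro!: derivative_eq_intros)
    also have "inverse (1 - z\<^sup>2) * z +
        ((p - q * (2 * z)) * (1 - z\<^sup>2) - (p * z - q * z\<^sup>2) * (- (2 * z))) / ((1 - z\<^sup>2) * (1 - z\<^sup>2)) = P z / (1 - z\<^sup>2)\<^sup>2"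
      using dom(2)[OF z] unfolding P_def by (simp add: divide_simps inverse_eq_divide) (simp add: algebra_simps power2_eq_square)
    finally show ?thesis .
  qed
  have hol: "F holomorphic_on ball 0 1"
    unfolding holomorphic_on_def field_differentiable_def
    using has_field_derivative_at_within[OF DF] by blast
  define f where "f = fps_expansion F 0"
  have exp_f: "F has_fps_expansion f"
    unfolding f_def by (rule has_fps_expansion_fps_expansion[OF _ _ hol]) auto
  have U_exp: "(\<lambda>z. (1 - z\<^sup>2)\<^sup>2 * deriv F z) has_fps_expansion (1 - fps_X\<^sup>2)\<^sup>2 * fps_deriv f"
    by (intro fps_expansion_intros exp_f)
  have P_exp: "(\<lambda>z. P z * F z) has_fps_expansion
      (fps_X * (1 - fps_X\<^sup>2) + fps_const p * (1 + fps_X\<^sup>2) - fps_const (2 * q) * fps_X) * f"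
    unfolding P_def by (intro fps_expansion_intros exp_f)
  have ev: "eventually (\<lambda>z. (1 - z\<^sup>2)\<^sup>2 * deriv F z = P z * F z) (nhds 0)"
  proof -
    have "eventually (\<lambda>z::complex. z \<in> ball 0 1) (nhds 0)" by (intro eventually_nhds_in_open) auto
    then show ?thesis
    proof eventually_elim
      case (elim z)
      show ?case using DERIV_imp_deriv[OF DF[OF elim]] dom(2)[OF elim] by simp
    qed
  qed
  have "(\<lambda>z. P z * F z) has_fps_expansion (1 - fps_X\<^sup>2)\<^sup>2 * fps_deriv f"
    by (rule has_fps_expansion_cong[OF ev refl, THEN iffD1, OF U_exp])
  then have ode_f: "(1 - fps_X\<^sup>2)\<^sup>2 * fps_deriv f =
      (fps_X * (1 - fps_X\<^sup>2) + fps_const p * (1 + fps_X\<^sup>2) - fps_const (2 * q) * fps_X) * f"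
    by (rule fps_expansion_unique_complex[OF _ P_exp])
  let ?A = "Abs_fps (\<lambda>n. complex_of_real (mehler_coeff a b n))"
  have q2: "complex_of_real (2 * (a\<^sup>2 + b\<^sup>2)) = 2 * q" unfolding q_def by simp
  have "?A = f"
  proof (rule fps_ode_unique[OF mehler_coeff_ode[of a b, unfolded q2, folded p_def] ode_f])
    show "fps_nth f 0 = 1"
      using has_fps_expansion_imp_0_eq_fps_nth_0[OF exp_f] by (simp add: F_def)
  qed (simp_all add: mehler_coeff_def)
  have "(\<lambda>n. fps_nth f n * complex_of_real \<rho> ^ n) sums F (complex_of_real \<rho>)"
  proof (rule has_fps_expansion_imp_sums_complex[OF exp_f])
    show "F holomorphic_on eball 0 1" using hol by (simp add: eball_def ball_def one_ereal_def)
    show "ereal (norm (complex_of_real \<rho>)) < 1" using \<rho> by (simp add: one_ereal_def)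
  qed
  then have "(\<lambda>n. complex_of_real (mehler_coeff a b n * \<rho> ^ n)) sums F (complex_of_real \<rho>)"
    unfolding \<open>?A = f\<close>[symmetric] by simp
  moreover have "F (complex_of_real \<rho>) = complex_of_real (exp ((2 * a * b * \<rho> - (a\<^sup>2 + b\<^sup>2) * \<rho>\<^sup>2) / (1 - \<rho>\<^sup>2)) / sqrt (1 - \<rho>\<^sup>2))"
  proof -
    have pos: "0 < 1 - \<rho>\<^sup>2" using \<rho> by (simp add: abs_square_less_1)
    have "Ln (1 - (complex_of_real \<rho>)\<^sup>2) = complex_of_real (ln (1 - \<rho>\<^sup>2))"
      using Ln_of_real[OF pos] by simp
    then have "F (complex_of_real \<rho>) = exp (complex_of_real (- ln (1 - \<rho>\<^sup>2) / 2 + (2 * a * b * \<rho> - (a\<^sup>2 + b\<^sup>2) * \<rho>\<^sup>2) / (1 - \<rho>\<^sup>2)))"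
      by (simp add: F_def p_def q_def)
    also have "\<dots> = complex_of_real (exp (- ln (1 - \<rho>\<^sup>2) / 2 + (2 * a * b * \<rho> - (a\<^sup>2 + b\<^sup>2) * \<rho>\<^sup>2) / (1 - \<rho>\<^sup>2)))"
      by (rule exp_of_real)
    also have "exp (- ln (1 - \<rho>\<^sup>2) / 2 + (2 * a * b * \<rho> - (a\<^sup>2 + b\<^sup>2) * \<rho>\<^sup>2) / (1 - \<rho>\<^sup>2)) =
        exp ((2 * a * b * \<rho> - (a\<^sup>2 + b\<^sup>2) * \<rho>\<^sup>2) / (1 - \<rho>\<^sup>2)) / sqrt (1 - \<rho>\<^sup>2)"
    proof -
      have "exp (- ln (1 - \<rho>\<^sup>2) / 2) = 1 / sqrt (1 - \<rho>\<^sup>2)"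
        using pos by (simp add: ln_sqrt[symmetric] exp_minus inverse_eq_divide)
      then show ?thesis unfolding exp_add by (simp only: times_divide_eq_left mult_1)
    qed
    finally show ?thesis .
  qed
  ultimately show ?thesis by (simp only: sums_of_real_iff)
qed

section \<open>The Hermite kernel as a product of Mehler kernels\<close>

definition mehler_kernel :: "real \<Rightarrow> real \<Rightarrow> real \<Rightarrow> real" where
  "mehler_kernel t a b =
    exp (- (cosh (2 * t) / sinh (2 * t) / 2) * (a\<^sup>2 + b\<^sup>2) + a * b / sinh (2 * t)) / sqrt (2 * pi * sinh (2 * t))"

definition hermite_term :: "real \<Rightarrow> real \<Rightarrow> real \<Rightarrow> nat \<Rightarrow> real" where
  "hermite_term t a b n = exp (- (2 * real n + 1) * t) * (hermite_fun n a * hermite_fun n b)"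

lemma hermite_term_eq:
  "hermite_term t a b n = exp (- t) / sqrt pi * exp (- (a\<^sup>2 + b\<^sup>2) / 2) * (mehler_coeff a b n * exp (- 2 * t) ^ n)"
proof -
  let ?N = "2 ^ n * fact n * sqrt pi :: real"
  have N: "0 < ?N" by simp
  have p: "?N powr (- 1 / 2) * ?N powr (- 1 / 2) = 1 / ?N"
    using N by (simp add: powr_add[symmetric] powr_minus_divide)
  have e: "exp (- (2 * real n + 1) * t) = exp (- t) * exp (- 2 * t) ^ n"
    by (simp add: exp_of_nat_mult[symmetric] mult_exp_exp algebra_simps)
  have g: "exp (- a\<^sup>2 / 2) * exp (- b\<^sup>2 / 2) = exp (- (a\<^sup>2 + b\<^sup>2) / 2)"
    by (simp add: mult_exp_exp add_divide_distrib)
  have "hermite_term t a b n = exp (- (2 * real n + 1) * t) * (?N powr (- 1 / 2) * ?N powr (- 1 / 2)) *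
      (hermite_rec n a * hermite_rec n b) * (exp (- a\<^sup>2 / 2) * exp (- b\<^sup>2 / 2))"
    unfolding hermite_term_def hermite_fun_def hermite_poly_eq by (simp only: mult_ac)
  also have "\<dots> = exp (- t) / sqrt pi * exp (- (a\<^sup>2 + b\<^sup>2) / 2) * (mehler_coeff a b n * exp (- 2 * t) ^ n)"
    unfolding p e g mehler_coeff_def by (simp only: times_divide_eq_right times_divide_eq_left divide_divide_eq_left mult_ac mult_1_right)
  finally show ?thesis .
qed

text \<open>Mehler's formula at \<rho> = e^(-2t); what remains is to rewrite \<rho> in terms of sinh
  and cosh of 2t.\<close>

lemma hermite_term_sums:
  assumes t: "0 < t"
  shows "hermite_term t a b sums mehler_kernel t a b"
proof -
  define \<rho> where "\<rho> = exp (- 2 * t)"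
  have \<rho>: "0 < \<rho>" "\<rho> < 1" using t by (auto simp: \<rho>_def)
  have \<rho>2: "0 < 1 - \<rho>\<^sup>2" using \<rho> by (simp add: power_less_one_iff)
  have E: "exp (2 * t) = 1 / \<rho>" by (simp add: \<rho>_def exp_minus inverse_eq_divide)
  have E': "exp (- (2 * t)) = \<rho>" by (simp add: \<rho>_def)
  have sinh: "sinh (2 * t) = (1 - \<rho>\<^sup>2) / (2 * \<rho>)"
    unfolding sinh_field_def E E' using \<rho> by (simp add: field_simps power2_eq_square)
  have cosh: "cosh (2 * t) = (1 + \<rho>\<^sup>2) / (2 * \<rho>)"
    unfolding cosh_field_def E E' using \<rho> by (simp add: field_simps power2_eq_square)
  have "(\<lambda>n. mehler_coeff a b n * \<rho> ^ n) sums
      (exp ((2 * a * b * \<rho> - (a\<^sup>2 + b\<^sup>2) * \<rho>\<^sup>2) / (1 - \<rho>\<^sup>2)) / sqrt (1 - \<rho>\<^sup>2))"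
    using \<rho> by (intro mehler_formula) auto
  then have "(\<lambda>n. exp (- t) / sqrt pi * exp (- (a\<^sup>2 + b\<^sup>2) / 2) * (mehler_coeff a b n * \<rho> ^ n)) sums
     (exp (- t) / sqrt pi * exp (- (a\<^sup>2 + b\<^sup>2) / 2) *
      (exp ((2 * a * b * \<rho> - (a\<^sup>2 + b\<^sup>2) * \<rho>\<^sup>2) / (1 - \<rho>\<^sup>2)) / sqrt (1 - \<rho>\<^sup>2)))"
    by (rule sums_mult)
  also have "(\<lambda>n. exp (- t) / sqrt pi * exp (- (a\<^sup>2 + b\<^sup>2) / 2) * (mehler_coeff a b n * \<rho> ^ n)) = hermite_term t a b"
    by (rule ext) (simp only: hermite_term_eq \<rho>_def)
  also have "exp (- t) / sqrt pi * exp (- (a\<^sup>2 + b\<^sup>2) / 2) *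
      (exp ((2 * a * b * \<rho> - (a\<^sup>2 + b\<^sup>2) * \<rho>\<^sup>2) / (1 - \<rho>\<^sup>2)) / sqrt (1 - \<rho>\<^sup>2)) = mehler_kernel t a b"
  proof -
    have ee: "(exp t)\<^sup>2 = 1 / \<rho>" using E by (simp add: exp_double[symmetric])
    have "2 * pi * sinh (2 * t) = pi * (exp t)\<^sup>2 * (1 - \<rho>\<^sup>2)"
      unfolding sinh ee by simp
    then have sq: "sqrt (2 * pi * sinh (2 * t)) = sqrt pi * exp t * sqrt (1 - \<rho>\<^sup>2)"
      by (simp only: real_sqrt_mult real_sqrt_abs abs_exp_cancel)
    have ex: "- (cosh (2 * t) / sinh (2 * t) / 2) * (a\<^sup>2 + b\<^sup>2) + a * b / sinh (2 * t) =
        - (a\<^sup>2 + b\<^sup>2) / 2 + (2 * a * b * \<rho> - (a\<^sup>2 + b\<^sup>2) * \<rho>\<^sup>2) / (1 - \<rho>\<^sup>2)"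
    proof -
      have "- (((1 + r2) / (2 * r)) / ((1 - r2) / (2 * r)) / 2) * S + p / ((1 - r2) / (2 * r)) =
          - S / 2 + (2 * p * r - S * r2) / (1 - r2)" if "0 < r" "0 < 1 - r2" for r r2 S p :: real
      proof -
        define w where "w = 1 - r2"
        have w: "0 < w" "r2 = 1 - w" using that by (auto simp: w_def)
        have 1: "((1 + r2) / (2 * r)) / (w / (2 * r)) = (2 - w) / w" "p / (w / (2 * r)) = 2 * p * r / w"
          using that w by auto
        have "- ((2 - w) / w / 2) * S + 2 * p * r / w = - S / 2 + (2 * p * r - S * (1 - w)) / w"
          using w(1) by (simp add: field_simps)
        then show ?thesis unfolding w_def[symmetric] 1 w(2)[symmetric] .
      qed
      from this[OF \<rho>(1) \<rho>2, of "a\<^sup>2 + b\<^sup>2" "a * b"] show ?thesis unfolding sinh cosh by (simp only: mult.assoc)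
    qed
    show ?thesis unfolding mehler_kernel_def sq ex exp_add by (simp add: exp_minus field_simps)
  qed
  finally show ?thesis .
qed

text \<open>A power series that converges at e^(-t) converges absolutely at the smaller number
  e^(-2t).\<close>

lemma hermite_term_abs_summable:
  assumes t: "0 < t"
  shows "summable (\<lambda>n. norm (hermite_term t a b n))"
proof -
  have "summable (\<lambda>n. mehler_coeff a b n * exp (- t) ^ n)"
    using mehler_formula[of "exp (- t)" a b] t by (auto simp: sums_iff)
  then have "summable (\<lambda>n. norm (mehler_coeff a b n * exp (- 2 * t) ^ n))"
    by (rule powser_insidea) (use t in auto)
  then have "summable (\<lambda>n. norm (exp (- t) / sqrt pi * exp (- (a\<^sup>2 + b\<^sup>2) / 2)) * norm (mehler_coeff a b n * exp (- 2 * t) ^ n))"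
    by (rule summable_mult)
  then show ?thesis unfolding hermite_term_eq norm_mult .
qed

text \<open>The product of the one-dimensional series, regrouped by the total degree \<open>|\<nu>|\<close>.\<close>

lemma hermite_kernel_eq:
  fixes x y :: "real ^ 'n::finite"
  assumes t: "0 < t"
  shows "hermite_kernel t x y = (\<Prod>i\<in>UNIV. mehler_kernel t (x $ i) (y $ i))"
proof -
  let ?f = "\<lambda>i. hermite_term t (x $ i) (y $ i)"
  let ?F = "\<lambda>\<nu>. \<Prod>i\<in>UNIV. ?f i (\<nu> i)"
  have PiE: "PiE UNIV (\<lambda>_. UNIV) = (UNIV :: ('n \<Rightarrow> nat) set)" by auto
  have "summable (\<lambda>n. norm (norm (?f i n)))" for i using hermite_term_abs_summable[OF t] by simp
  then have abs: "(\<lambda>n. norm (?f i n)) summable_on UNIV" for i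
    by (rule norm_summable_imp_summable_on)
  define T where "T i = infsum (\<lambda>n. norm (?f i n)) UNIV" for i
  have "(\<lambda>\<nu>. norm (?F \<nu>)) summable_on UNIV"
  proof (rule nonneg_bdd_above_summable_on)
    show "bdd_above (sum (\<lambda>\<nu>. norm (?F \<nu>)) ` {S. S \<subseteq> UNIV \<and> finite S})"
    proof (rule bdd_aboveI2)
      fix S :: "('n \<Rightarrow> nat) set" assume "S \<in> {S. S \<subseteq> UNIV \<and> finite S}"
      then have S: "finite S" by simp
      \<comment> \<open>A finite set of multi-indices lies in the product of its coordinate
        projections, over which the sum factorizes.\<close>
      define B where "B i = (\<lambda>\<nu>. \<nu> i) ` S" for i
      have B: "finite (B i)" for i using S by (simp add: B_def)
      have "(\<Sum>\<nu>\<in>S. norm (?F \<nu>)) \<le> (\<Sum>\<nu>\<in>PiE UNIV B. norm (?F \<nu>))"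
        by (rule sum_mono2) (use B in \<open>auto simp: B_def intro!: finite_PiE\<close>)
      also have "\<dots> = (\<Sum>\<nu>\<in>PiE UNIV B. \<Prod>i\<in>UNIV. norm (?f i (\<nu> i)))"
        by (simp only: prod_norm)
      also have "\<dots> = (\<Prod>i\<in>UNIV. \<Sum>n\<in>B i. norm (?f i n))"
        by (rule prod_sum_PiE[symmetric]) (use B in auto)
      also have "\<dots> \<le> (\<Prod>i\<in>UNIV. T i)"
        unfolding T_def using B abs
        by (intro prod_mono conjI sum_nonneg finite_sum_le_infsum) auto
      finally show "(\<Sum>\<nu>\<in>S. norm (?F \<nu>)) \<le> (\<Prod>i\<in>UNIV. T i)" .
    qed
  qed simp
  then have sF: "?F summable_on UNIV" by (rule abs_summable_summable)
  have "infsum ?F (PiE UNIV (\<lambda>_. UNIV)) = (\<Prod>i\<in>UNIV. infsum (?f i) UNIV)"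
    by (rule infsum_prod_PiE_abs) (use abs in auto)
  also have "\<dots> = (\<Prod>i\<in>UNIV. mehler_kernel t (x $ i) (y $ i))"
    by (intro prod.cong refl infsumI norm_summable_imp_has_sum hermite_term_abs_summable hermite_term_sums t)
  finally have hs: "(?F has_sum (\<Prod>i\<in>UNIV. mehler_kernel t (x $ i) (y $ i))) UNIV"
    using has_sum_infsum[OF sF] unfolding PiE by simp
  let ?B = "\<lambda>n. {\<nu> :: 'n \<Rightarrow> nat. sum \<nu> UNIV = n}"
  \<comment> \<open>Each multi-index is tagged with its degree: \<open>snd\<close> maps the disjoint
    union of the level sets bijectively onto all multi-indices.\<close>
  have img: "snd ` Sigma UNIV ?B = UNIV" by (auto simp: image_iff)
  have inj: "inj_on snd (Sigma UNIV ?B)" by (auto simp: inj_on_def)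
  have hs': "((\<lambda>p. ?F (snd p)) has_sum (\<Prod>i\<in>UNIV. mehler_kernel t (x $ i) (y $ i))) (Sigma UNIV ?B)"
    using hs has_sum_reindex[OF inj, of ?F] unfolding img o_def by simp
  have fin: "finite (?B n)" for n
  proof (rule finite_subset)
    show "?B n \<subseteq> PiE UNIV (\<lambda>_. {..n})"
      by (auto simp: PiE_iff intro: member_le_sum)
    show "finite (PiE UNIV (\<lambda>_ :: 'n. {..n}))" by (intro finite_PiE) auto
  qed
  have "((\<lambda>n. \<Sum>\<nu>\<in>?B n. ?F \<nu>) has_sum (\<Prod>i\<in>UNIV. mehler_kernel t (x $ i) (y $ i))) UNIV"
    by (rule has_sum_Sigma'[OF hs']) (use fin in \<open>auto intro: has_sum_finite\<close>)
  then have "(\<lambda>n. \<Sum>\<nu>\<in>?B n. ?F \<nu>) sums (\<Prod>i\<in>UNIV. mehler_kernel t (x $ i) (y $ i))"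
    by (rule has_sum_imp_sums)
  moreover have "(\<Sum>\<nu>\<in>?B n. ?F \<nu>) = exp (- (2 * real n + real CARD('n)) * t) *
      (\<Sum>\<nu>\<in>?B n. hermite_fun_multi \<nu> x * hermite_fun_multi \<nu> y)" for n
    unfolding sum_distrib_left
  proof (rule sum.cong[OF refl])
    fix \<nu> :: "'n \<Rightarrow> nat" assume "\<nu> \<in> ?B n"
    then have n: "(\<Sum>i\<in>UNIV. real (\<nu> i)) = real n" by (auto simp flip: of_nat_sum)
    have "(\<Prod>i\<in>UNIV. exp (- (2 * real (\<nu> i) + 1) * t)) = exp (\<Sum>i\<in>UNIV. - (2 * real (\<nu> i) + 1) * t)"
      by (simp add: exp_sum)
    also have "(\<Sum>i\<in>UNIV. - (2 * real (\<nu> i) + 1) * t) = - (2 * (\<Sum>i\<in>UNIV. real (\<nu> i)) + real CARD('n)) * t"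
      unfolding sum_distrib_right[symmetric] sum_negf sum.distrib sum_distrib_left[symmetric] by simp
    finally show "?F \<nu> = exp (- (2 * real n + real CARD('n)) * t) * (hermite_fun_multi \<nu> x * hermite_fun_multi \<nu> y)"
      unfolding hermite_term_def prod.distrib hermite_fun_multi_def n by simp
  qed
  ultimately have "(\<lambda>n. exp (- (2 * real n + real CARD('n)) * t) *
      (\<Sum>\<nu>\<in>?B n. hermite_fun_multi \<nu> x * hermite_fun_multi \<nu> y)) sums (\<Prod>i\<in>UNIV. mehler_kernel t (x $ i) (y $ i))"
    by simp
  then show ?thesis unfolding hermite_kernel_def by (simp add: sums_iff)
qed

section \<open>The two semigroups\<close>

text \<open>The sum of the constants in the two inequalities. It depends on r alone, so it serves
  every p, every dimension and every b.\<close>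

definition equivalence_const :: "nat \<Rightarrow> real" where
  "equivalence_const r = 2 ^ r + (1 + (\<Sum>j=1..r. real (r choose j) * (real r / real j) ^ r))"

lemma equivalence_const_pos: "0 < equivalence_const r"
  unfolding equivalence_const_def by (intro add_pos_nonneg add_nonneg_nonneg sum_nonneg) auto

lemma (in test_semigroup) modulus_K_functional_equivalence:
  assumes r: "1 \<le> r" and p: "1 \<le> p" and f: "f \<in> Lp p" and t: "0 < t"
    and T: "\<And>h. 0 < h \<Longrightarrow> T h = evolve h"
  shows "ennreal (1 / equivalence_const r) * modulus T r p f t \<le> K_functional D r p f (t ^ r) \<and>
    K_functional D r p f (t ^ r) \<le> ennreal (equivalence_const r) * modulus T r p f t"
proof -
  let ?S = "\<Sum>j=1..r. real (r choose j) * (real r / real j) ^ r"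
  have S: "0 \<le> ?S" by (intro sum_nonneg) auto
  \<comment> \<open>The modulus takes differences at positive times only, and there \<open>T\<close>
    agrees with \<open>evolve\<close>.\<close>
  have m: "modulus T r p f t = modulus evolve r p f t"
  proof -
    have "semigroup_diff T h = semigroup_diff evolve h" if "h \<in> {0<..t}" for h
      using T[of h] that by (simp add: semigroup_diff_def fun_eq_iff)
    then show ?thesis unfolding modulus_def by (intro SUP_cong) simp_all
  qed
  have "ennreal (1 / equivalence_const r) * modulus evolve r p f t \<le> ennreal (1 / 2 ^ r) * modulus evolve r p f t"
    unfolding equivalence_const_def using S by (intro mult_right_mono ennreal_leI frac_le) auto
  also have "\<dots> \<le> K_functional D r p f (t ^ r)" by (rule modulus_le_K_functional[OF r p f t])
  moreover have "K_functional D r p f (t ^ r) \<le> ennreal (1 + ?S) * modulus evolve r p f t"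
    by (rule K_functional_le_modulus[OF r p f t])
  moreover have "\<dots> \<le> ennreal (equivalence_const r) * modulus evolve r p f t"
    unfolding equivalence_const_def by (intro mult_right_mono ennreal_leI) auto
  ultimately show ?thesis unfolding m by (auto intro: order_trans)
qed

lemma deriv_eq_partial:
  assumes "f differentiable at (x :: real)"
  shows "deriv f x = partial 1 f x"
proof -
  obtain d where d: "(f has_real_derivative d) (at x)"
    using assms by (auto simp: real_differentiable_def)
  then have "partial 1 f x = d * 1" unfolding has_field_derivative_def by (rule partial_eq)
  then show ?thesis using DERIV_imp_deriv[OF d] by simp
qed

definition heat_kernel :: "real \<Rightarrow> real \<Rightarrow> real \<Rightarrow> real \<Rightarrow> real" where
  "heat_kernel b t x \<xi> = exp (- (x - \<xi>)\<^sup>2 / (4 * b\<^sup>2 * t)) / (2 * b * sqrt (pi * t))"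

text \<open>Here \<gamma> = 0 and c = e, so the exponent is - (c / 2) (x - y)^2; the kernel has mass
  exactly 1.\<close>

lemma gaussian_semigroup_heat:
  assumes b: "0 < b"
  shows "gaussian_semigroup (b\<^sup>2) 0 (\<lambda>t. 1 / (2 * b * sqrt (pi * t))) (\<lambda>t. 1 / (2 * b\<^sup>2 * t)) (\<lambda>t. 1 / (2 * b\<^sup>2 * t))
    (heat_kernel b) (heat_op b)"
proof
  show "heat_kernel b t x y = 1 / (2 * b * sqrt (pi * t)) *
    exp (- (1 / (2 * b\<^sup>2 * t) / 2) * ((norm x)\<^sup>2 + (norm y)\<^sup>2) + 1 / (2 * b\<^sup>2 * t) * (x \<bullet> y))" for t x y
  proof -
    have "- (x - y)\<^sup>2 / (4 * b\<^sup>2 * t) = - (1 / (2 * b\<^sup>2 * t) / 2) * ((norm x)\<^sup>2 + (norm y)\<^sup>2) + 1 / (2 * b\<^sup>2 * t) * (x \<bullet> y)"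
      using b by (cases "t = 0") (simp_all add: field_simps power2_diff)
    then show ?thesis unfolding heat_kernel_def by simp
  qed
  show "heat_op b \<phi> x = b\<^sup>2 * laplacian \<phi> x - 0 * (norm x)\<^sup>2 * \<phi> x" if \<phi>: "test_function \<phi>" for \<phi> x
  proof -
    note s = test_function_smooth[OF \<phi>]
    have "deriv \<phi> = partial 1 \<phi>" by (rule ext) (intro deriv_eq_partial smooth_differentiable s)
    moreover have "deriv (partial 1 \<phi>) x = partial 1 (partial 1 \<phi>) x"
      by (intro deriv_eq_partial smooth_differentiable smooth_partial s) simp
    ultimately show ?thesis by (simp add: heat_op_def laplacian_def)
  qed
  show "((\<lambda>t. 1 / (2 * b * sqrt (pi * t))) has_real_derivative - b\<^sup>2 * real DIM(real) * (1 / (2 * b\<^sup>2 * t)) * (1 / (2 * b * sqrt (pi * t)))) (at t)"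
    if t: "0 < t" for t
  proof -
    define s where "s = sqrt (pi * t)"
    have s: "0 < s" "s * s = pi * t" using t by (auto simp: s_def)
    have pos: "0 < pi * t" using t by simp
    have "((\<lambda>t. sqrt (pi * t)) has_real_derivative (inverse s / 2) * (pi * 1)) (at t)"
      unfolding s_def by (rule DERIV_chain2[OF DERIV_real_sqrt[OF pos] DERIV_cmult[OF DERIV_ident]])
    then have "((\<lambda>t. 1 / (2 * b * sqrt (pi * t))) has_real_derivative
        (0 * (2 * b * s) - 1 * (2 * b * ((inverse s / 2) * (pi * 1)))) / ((2 * b * s) * (2 * b * s))) (at t)"
      unfolding s_def using b t by (intro DERIV_divide DERIV_const DERIV_cmult) auto
    also have "(0 * (2 * b * s) - 1 * (2 * b * ((inverse s / 2) * (pi * 1)))) / ((2 * b * s) * (2 * b * s)) = - (pi / (s * s)) / (2 * (2 * b * s))"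
      using b s(1) by (simp add: field_simps)
    also have "\<dots> = - b\<^sup>2 * real DIM(real) * (1 / (2 * b\<^sup>2 * t)) * (1 / (2 * b * s))"
      unfolding s(2) using t b by (simp add: field_simps)
    finally show ?thesis by (simp only: s_def)
  qed
  show "((\<lambda>t. 1 / (2 * b\<^sup>2 * t)) has_real_derivative - 2 * b\<^sup>2 * (1 / (2 * b\<^sup>2 * t))\<^sup>2) (at t)" if t: "0 < t" for t
    using t b by (auto intro!: derivative_eq_intros simp: field_simps power2_eq_square)
  show "((\<lambda>t. 1 / (2 * b\<^sup>2 * t)) has_real_derivative - 2 * b\<^sup>2 * (1 / (2 * b\<^sup>2 * t)) * (1 / (2 * b\<^sup>2 * t))) (at t)" if t: "0 < t" for t
    using t b by (auto intro!: derivative_eq_intros simp: field_simps power2_eq_square)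
  have one: "1 / (2 * b * sqrt (pi * t)) * sqrt (2 * pi / (1 / (2 * b\<^sup>2 * t))) = 1" if t: "0 < t" for t
  proof -
    have "2 * pi / (1 / (2 * b\<^sup>2 * t)) = (2 * b)\<^sup>2 * (pi * t)" by (simp add: power2_eq_square)
    then have "sqrt (2 * pi / (1 / (2 * b\<^sup>2 * t))) = 2 * b * sqrt (pi * t)"
      using b by (simp add: real_sqrt_mult)
    then show ?thesis using b t by simp
  qed
  show "1 / (2 * b * sqrt (pi * t)) * sqrt (2 * pi / (1 / (2 * b\<^sup>2 * t))) ^ DIM(real) \<le> 1" if "0 < t" for t
    using one[OF that] by simp
  show "1 / (2 * b * sqrt (pi * s)) * (1 / (2 * b * sqrt (pi * t))) * sqrt (2 * pi / (1 / (2 * b\<^sup>2 * s) + 1 / (2 * b\<^sup>2 * t))) ^ DIM(real) =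
      1 / (2 * b * sqrt (pi * (s + t)))" if s: "0 < s" and t: "0 < t" for s t
  proof -
    have "2 * pi / (1 / (2 * b\<^sup>2 * s) + 1 / (2 * b\<^sup>2 * t)) = (2 * b)\<^sup>2 * ((pi * s) * (pi * t)) / (pi * (s + t))"
    proof -
      have "2 * pi / (1 / (2 * b\<^sup>2 * s) + 1 / (2 * b\<^sup>2 * t)) = 2 * pi * (2 * b\<^sup>2 * s * t) / (s + t)"
        using s t b by (simp add: divide_simps)
      also have "\<dots> = pi * (2 * pi * (2 * b\<^sup>2 * s * t)) / (pi * (s + t))" by simp
      also have "pi * (2 * pi * (2 * b\<^sup>2 * s * t)) = (2 * b)\<^sup>2 * ((pi * s) * (pi * t))"
        by (simp add: power2_eq_square)
      finally show ?thesis .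
    qed
    then have "sqrt (2 * pi / (1 / (2 * b\<^sup>2 * s) + 1 / (2 * b\<^sup>2 * t))) = 2 * b * (sqrt (pi * s) * sqrt (pi * t)) / sqrt (pi * (s + t))"
      using b by (simp only: real_sqrt_mult[of "(2 * b)\<^sup>2"] real_sqrt_mult[of "pi * s"] real_sqrt_divide real_sqrt_abs)
    then show ?thesis using b s t by simp
  qed
  show "1 / (2 * b\<^sup>2 * s) - (1 / (2 * b\<^sup>2 * s))\<^sup>2 / (1 / (2 * b\<^sup>2 * s) + 1 / (2 * b\<^sup>2 * t)) = 1 / (2 * b\<^sup>2 * (s + t))"
    "1 / (2 * b\<^sup>2 * s) * (1 / (2 * b\<^sup>2 * t)) / (1 / (2 * b\<^sup>2 * s) + 1 / (2 * b\<^sup>2 * t)) = 1 / (2 * b\<^sup>2 * (s + t))"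
    if s: "0 < s" and t: "0 < t" for s t
  proof -
    define B where "B = 2 * b\<^sup>2"
    have B: "0 < B" using b by (simp add: B_def)
    have sum: "1 / (B * s) + 1 / (B * t) = (s + t) / (B * s * t)" using B s t by (simp add: field_simps)
    have "(1 / (B * s))\<^sup>2 / ((s + t) / (B * s * t)) = t / (B * s * (s + t))"
      using B s t by (simp add: power2_eq_square)
    moreover have "1 / (B * s) - t / (B * s * (s + t)) = 1 / (B * (s + t))"
      using B s t by (simp add: divide_simps)
    ultimately show "1 / (2 * b\<^sup>2 * s) - (1 / (2 * b\<^sup>2 * s))\<^sup>2 / (1 / (2 * b\<^sup>2 * s) + 1 / (2 * b\<^sup>2 * t)) = 1 / (2 * b\<^sup>2 * (s + t))"
      unfolding B_def[symmetric] sum by simp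
    show "1 / (2 * b\<^sup>2 * s) * (1 / (2 * b\<^sup>2 * t)) / (1 / (2 * b\<^sup>2 * s) + 1 / (2 * b\<^sup>2 * t)) = 1 / (2 * b\<^sup>2 * (s + t))"
      unfolding B_def[symmetric] sum using B s t by simp
  qed
  have ev: "eventually (\<lambda>t::real. 0 < t) (at_right 0)" by (rule eventually_at_right_less)
  show "((\<lambda>t. 1 / (2 * b * sqrt (pi * t)) * sqrt (2 * pi / (1 / (2 * b\<^sup>2 * t))) ^ DIM(real)) \<longlongrightarrow> 1) (at_right 0)"
    by (rule tendsto_eventually, rule eventually_mono[OF ev]) (simp only: DIM_real power_one_right one)
  show "((\<lambda>t. 1 / (2 * b\<^sup>2 * t) / (1 / (2 * b\<^sup>2 * t))) \<longlongrightarrow> 1) (at_right 0)"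
    by (rule tendsto_eventually) (use ev b in \<open>auto elim: eventually_mono\<close>)
  show "filterlim (\<lambda>t. 1 / (2 * b\<^sup>2 * t)) at_top (at_right 0)"
  proof -
    have "filterlim (\<lambda>t. 1 / (2 * b\<^sup>2) * inverse t) at_top (at_right 0)"
      by (rule filterlim_tendsto_pos_mult_at_top[OF tendsto_const _ filterlim_inverse_at_top_right]) (use b in auto)
    then show ?thesis by (simp add: inverse_eq_divide)
  qed
qed (use b in auto)

lemma norm_square_vec: "(norm x)\<^sup>2 = (\<Sum>i\<in>UNIV. (x $ i)\<^sup>2)" for x :: "real ^ 'n::finite"
  by (simp add: norm_vec_def L2_set_def sum_nonneg)

text \<open>Here c = coth(2t) and e = 1 / sinh(2t). The assumption \<open>ce\<close> is cosh^2 -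
  sinh^2 = 1, the semigroup law comes from the addition theorems, and the mass of the kernel at x =
  0 is cosh(2t)^(-d/2).\<close>

lemma gaussian_semigroup_hermite:
  "gaussian_semigroup 1 1 (\<lambda>t. (1 / sqrt (2 * pi * sinh (2 * t))) ^ CARD('n::finite))
    (\<lambda>t. cosh (2 * t) / sinh (2 * t)) (\<lambda>t. 1 / sinh (2 * t))
    (\<lambda>t (x :: real ^ 'n) y. \<Prod>i\<in>UNIV. mehler_kernel t (x $ i) (y $ i)) hermite_op"
proof
  let ?S = "\<lambda>t::real. sinh (2 * t)" and ?H = "\<lambda>t::real. cosh (2 * t)"
  let ?q = "\<lambda>t. 1 / sqrt (2 * pi * ?S t)"
  have S: "0 < ?S t" if "0 < t" for t using that by simp
  have H: "0 < ?H t" "1 \<le> ?H t" for t by (auto simp: cosh_real_pos cosh_real_ge_1)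
  have HS: "(?H t)\<^sup>2 = (?S t)\<^sup>2 + 1" for t by (rule cosh_square_eq)
  show "(\<Prod>i\<in>UNIV. mehler_kernel t (x $ i) (y $ i)) = ?q t ^ CARD('n) *
      exp (- (?H t / ?S t / 2) * ((norm x)\<^sup>2 + (norm y)\<^sup>2) + 1 / ?S t * (x \<bullet> y))" for t and x y :: "real ^ 'n"
  proof -
    have "(\<Prod>i\<in>UNIV. mehler_kernel t (x $ i) (y $ i)) =
      (\<Prod>i\<in>UNIV. exp (- (?H t / ?S t / 2) * ((x $ i)\<^sup>2 + (y $ i)\<^sup>2) + (x $ i) * (y $ i) / ?S t)) * ?q t ^ CARD('n)"
      by (simp add: mehler_kernel_def prod_dividef power_divide)
    also have "(\<Prod>i\<in>UNIV. exp (- (?H t / ?S t / 2) * ((x $ i)\<^sup>2 + (y $ i)\<^sup>2) + (x $ i) * (y $ i) / ?S t)) =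
        exp (\<Sum>i\<in>UNIV. - (?H t / ?S t / 2) * ((x $ i)\<^sup>2 + (y $ i)\<^sup>2) + (x $ i) * (y $ i) / ?S t)"
      by (simp add: exp_sum)
    also have "(\<Sum>i\<in>UNIV. - (?H t / ?S t / 2) * ((x $ i)\<^sup>2 + (y $ i)\<^sup>2) + (x $ i) * (y $ i) / ?S t) =
        - (?H t / ?S t / 2) * ((norm x)\<^sup>2 + (norm y)\<^sup>2) + 1 / ?S t * (x \<bullet> y)"
      unfolding sum.distrib sum_distrib_left[symmetric] norm_square_vec inner_vec_def
      by (simp add: sum_divide_distrib)
    finally show ?thesis by (simp only: mult.commute)
  qed
  show "hermite_op \<phi> x = 1 * laplacian \<phi> x - 1 * (norm x)\<^sup>2 * \<phi> x" for \<phi> :: "real ^ 'n \<Rightarrow> real" and x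
    by (simp add: hermite_op_def laplacian_def)
  have DS: "(?S has_real_derivative 2 * ?H t) (at t)" for t
    by (auto intro!: derivative_eq_intros)
  have DH: "(?H has_real_derivative 2 * ?S t) (at t)" for t
    by (auto intro!: derivative_eq_intros)
  have Dq: "(?q has_real_derivative - (?H t / ?S t) * ?q t) (at t)" if t: "0 < t" for t
  proof -
    define w where "w = sqrt (2 * pi * ?S t)"
    have w: "0 < w" "w * w = 2 * pi * ?S t" using S[OF t] by (auto simp: w_def)
    have pos: "0 < 2 * pi * ?S t" using S[OF t] by simp
    have "((\<lambda>t. sqrt (2 * pi * ?S t)) has_real_derivative (inverse w / 2) * (2 * pi * (2 * ?H t))) (at t)"
      unfolding w_def by (rule DERIV_chain2[OF DERIV_real_sqrt[OF pos] DERIV_cmult[OF DS]])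
    then have "(?q has_real_derivative (0 * w - 1 * ((inverse w / 2) * (2 * pi * (2 * ?H t)))) / (w * w)) (at t)"
      unfolding w_def using w(1) unfolding w_def by (intro DERIV_divide DERIV_const) auto
    also have "(0 * w - 1 * ((inverse w / 2) * (2 * pi * (2 * ?H t)))) / (w * w) = - (?H t / ?S t) * (1 / w)"
      unfolding w(2) using S[OF t] w(1) by (simp add: field_simps)
    finally show ?thesis unfolding w_def .
  qed
  show "((\<lambda>t. ?q t ^ CARD('n)) has_real_derivative - 1 * real DIM(real ^ 'n) * (?H t / ?S t) * ?q t ^ CARD('n)) (at t)"
    if t: "0 < t" for t
  proof -
    have "((\<lambda>t. ?q t ^ CARD('n)) has_real_derivative real CARD('n) * ((- (?H t / ?S t) * ?q t) * ?q t ^ (CARD('n) - Suc 0))) (at t)"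
      by (rule DERIV_power[OF Dq[OF t]])
    also have "real CARD('n) * ((- (?H t / ?S t) * ?q t) * ?q t ^ (CARD('n) - Suc 0)) =
        - 1 * real CARD('n) * (?H t / ?S t) * (?q t * ?q t ^ (CARD('n) - Suc 0))"
      by simp
    also have "?q t * ?q t ^ (CARD('n) - Suc 0) = ?q t ^ CARD('n)"
      by (metis One_nat_def power_eq_if zero_less_card_finite less_numeral_extra(3))
    finally show ?thesis by simp
  qed
  show "((\<lambda>t. ?H t / ?S t) has_real_derivative - 2 * 1 * (1 / ?S t)\<^sup>2) (at t)" if t: "0 < t" for t
  proof -
    have "((\<lambda>t. ?H t / ?S t) has_real_derivative (2 * ?S t * ?S t - ?H t * (2 * ?H t)) / (?S t * ?S t)) (at t)"
      using S[OF t] by (intro DERIV_divide DH DS) auto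
    also have "2 * ?S t * ?S t - ?H t * (2 * ?H t) = - 2"
      using HS[of t] by (simp add: power2_eq_square)
    also have "- 2 / (?S t * ?S t) = - 2 * 1 * (1 / ?S t)\<^sup>2"
      by (simp add: power2_eq_square)
    finally show ?thesis .
  qed
  show "((\<lambda>t. 1 / ?S t) has_real_derivative - 2 * 1 * (?H t / ?S t) * (1 / ?S t)) (at t)" if t: "0 < t" for t
  proof -
    have "((\<lambda>t. 1 / ?S t) has_real_derivative (0 * ?S t - 1 * (2 * ?H t)) / (?S t * ?S t)) (at t)"
      using S[OF t] by (intro DERIV_divide DERIV_const DS) auto
    then show ?thesis by simp
  qed
  show "1 * (?H t / ?S t)\<^sup>2 - 1 = 1 * (1 / ?S t)\<^sup>2" if t: "0 < t" for t
    using HS[of t] S[OF t] by (simp add: power_divide field_simps)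
  have mass: "?q t ^ CARD('n) * sqrt (2 * pi / (?H t / ?S t)) ^ DIM(real ^ 'n) = (1 / sqrt (?H t)) ^ CARD('n)"
    if t: "0 < t" for t
  proof -
    have "?q t * sqrt (2 * pi / (?H t / ?S t)) = 1 / sqrt (?H t)"
      using S[OF t] H(1)[of t] by (simp add: real_sqrt_mult real_sqrt_divide)
    then show ?thesis by (simp flip: power_mult_distrib)
  qed
  show "?q t ^ CARD('n) * sqrt (2 * pi / (?H t / ?S t)) ^ DIM(real ^ 'n) \<le> 1" if t: "0 < t" for t
    unfolding mass[OF t] using H[of t] by (intro power_le_one) auto
  have sum: "?H s / ?S s + ?H t / ?S t = ?S (s + t) / (?S s * ?S t)" if "0 < s" "0 < t" for s t
  proof -
    have "?S (s + t) = ?S s * ?H t + ?H s * ?S t" by (simp add: distrib_left sinh_add)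
    then show ?thesis using S that by (simp add: add_divide_distrib)
  qed
  have SH: "?H (s + t) = ?H s * ?H t + ?S s * ?S t" for s t by (simp add: distrib_left cosh_add)
  have SS: "?S (s + t) = ?S s * ?H t + ?H s * ?S t" for s t by (simp add: distrib_left sinh_add)
  show "?q s ^ CARD('n) * ?q t ^ CARD('n) * sqrt (2 * pi / (?H s / ?S s + ?H t / ?S t)) ^ DIM(real ^ 'n) = ?q (s + t) ^ CARD('n)"
    if s: "0 < s" and t: "0 < t" for s t
  proof -
    have "2 * pi / (?S (s + t) / (?S s * ?S t)) = ((2 * pi * ?S s) * (2 * pi * ?S t)) / (2 * pi * ?S (s + t))"
      using S[OF s] S[OF t] by simp
    then have "sqrt (2 * pi / (?S (s + t) / (?S s * ?S t))) = sqrt (2 * pi * ?S s) * sqrt (2 * pi * ?S t) / sqrt (2 * pi * ?S (s + t))"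
      by (simp only: real_sqrt_divide real_sqrt_mult[of "2 * pi * ?S s"])
    then have "?q s * ?q t * sqrt (2 * pi / (?S (s + t) / (?S s * ?S t))) = ?q (s + t)"
      using S[OF s] S[OF t] by simp
    then show ?thesis unfolding sum[OF s t] by (simp flip: power_mult_distrib)
  qed
  show "?H s / ?S s - (1 / ?S s)\<^sup>2 / (?H s / ?S s + ?H t / ?S t) = ?H (s + t) / ?S (s + t)"
    if s: "0 < s" and t: "0 < t" for s t
  proof -
    define u v w z where "u = ?S s" and "v = ?S t" and "w = ?H s" and "z = ?H t"
    have p: "0 < u" "0 < v" "0 < u * z + w * v"
      using S[OF s] S[OF t] H(1)[of s] H(1)[of t] by (auto simp: u_def v_def w_def z_def intro!: add_pos_pos)
    have w2: "w * w = u * u + 1" using HS[of s] by (simp add: u_def w_def power2_eq_square)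
    have "w / u - (1 / u)\<^sup>2 / ((u * z + w * v) / (u * v)) = (w * (u * z + w * v) - v) / (u * (u * z + w * v))"
      using p by (simp add: divide_simps power2_eq_square)
    also have "w * (u * z + w * v) - v = u * (w * z + u * v)"
      using w2 by (simp add: algebra_simps)
    also have "\<dots> / (u * (u * z + w * v)) = (w * z + u * v) / (u * z + w * v)"
      using p by simp
    finally show ?thesis unfolding sum[OF s t] SS SH by (simp only: u_def v_def w_def z_def)
  qed
  show "1 / ?S s * (1 / ?S t) / (?H s / ?S s + ?H t / ?S t) = 1 / ?S (s + t)" if s: "0 < s" and t: "0 < t" for s t
    unfolding sum[OF s t] using S[OF s] S[OF t] by simp
  have ev: "eventually (\<lambda>t::real. 0 < t) (at_right 0)" by (rule eventually_at_right_less)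
  have Hlim: "(?H \<longlongrightarrow> 1) (at_right 0)"
    using DERIV_isCont[OF DH, of 0] by (auto simp: isCont_def intro: filterlim_mono[OF _ order_refl at_le])
  have Slim: "(?S \<longlongrightarrow> 0) (at_right 0)"
    using DERIV_isCont[OF DS, of 0] by (auto simp: isCont_def intro: filterlim_mono[OF _ order_refl at_le])
  show "((\<lambda>t. ?q t ^ CARD('n) * sqrt (2 * pi / (?H t / ?S t)) ^ DIM(real ^ 'n)) \<longlongrightarrow> 1) (at_right 0)"
  proof -
    have "((\<lambda>t. (1 / sqrt (?H t)) ^ CARD('n)) \<longlongrightarrow> (1 / sqrt 1) ^ CARD('n)) (at_right 0)"
      by (intro tendsto_power tendsto_divide tendsto_const tendsto_real_sqrt Hlim) simp
    then have "((\<lambda>t. (1 / sqrt (?H t)) ^ CARD('n)) \<longlongrightarrow> 1) (at_right 0)" by simp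
    then show ?thesis
      by (rule Lim_transform_eventually) (use ev in eventually_elim, simp only: mass)
  qed
  show "((\<lambda>t. 1 / ?S t / (?H t / ?S t)) \<longlongrightarrow> 1) (at_right 0)"
  proof -
    have "((\<lambda>t. 1 / ?H t) \<longlongrightarrow> 1 / 1) (at_right 0)"
      by (intro tendsto_divide tendsto_const Hlim) simp
    then have "((\<lambda>t. 1 / ?H t) \<longlongrightarrow> 1) (at_right 0)" by simp
    then show ?thesis
      by (rule Lim_transform_eventually) (use ev in \<open>auto elim!: eventually_mono\<close>)
  qed
  show "filterlim (\<lambda>t. ?H t / ?S t) at_top (at_right 0)"
  proof -
    have "filterlim (\<lambda>t. inverse (?S t)) at_top (at_right 0)"
    proof (rule filterlim_compose[OF filterlim_inverse_at_top_right])
      show "filterlim ?S (at_right 0) (at_right 0)"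
        unfolding filterlim_at using Slim ev by (auto elim: eventually_mono)
    qed
    then have "filterlim (\<lambda>t. ?H t * inverse (?S t)) at_top (at_right 0)"
      by (rule filterlim_tendsto_pos_mult_at_top[OF Hlim zero_less_one])
    then show ?thesis by (simp add: divide_inverse)
  qed
  show "0 < ?q t ^ CARD('n)" "0 < ?H t / ?S t" if "0 < t" for t using S[OF that] H(1)[of t] by auto
qed (auto simp: sinh_field_def cosh_field_def)

theorem theorem4:
  fixes r :: nat and p :: ennreal
  assumes "1 \<le> r" and "1 \<le> p"
  shows
    "(\<exists>M::real. M > 0 \<and>
        (\<forall>f :: real ^ 'n::finite \<Rightarrow> real. f \<in> Lp p \<longrightarrow> (\<forall>t::real. t > 0 \<longrightarrow>
          ennreal (1 / M) * modulus hermite_semigroup r p f t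
            \<le> K_functional hermite_op r p f (t ^ r) \<and>
          K_functional hermite_op r p f (t ^ r)
            \<le> ennreal M * modulus hermite_semigroup r p f t))) \<and>
     (\<exists>M::real. M > 0 \<and>
        (\<forall>b::real. b > 0 \<longrightarrow>
          (\<forall>f :: real \<Rightarrow> real. f \<in> Lp p \<longrightarrow> (\<forall>t::real. t > 0 \<longrightarrow>
            ennreal (1 / M) * modulus (heat_semigroup b) r p f t
              \<le> K_functional (heat_op b) r p f (t ^ r) \<and>
            K_functional (heat_op b) r p f (t ^ r)
              \<le> ennreal M * modulus (heat_semigroup b) r p f t))))"
proof (intro conjI exI[of _ "equivalence_const r"] equivalence_const_pos allI impI)
  interpret gaussian_semigroup 1 1 "\<lambda>t. (1 / sqrt (2 * pi * sinh (2 * t))) ^ CARD('n)"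
    "\<lambda>t. cosh (2 * t) / sinh (2 * t)" "\<lambda>t. 1 / sinh (2 * t)"
    "\<lambda>t (x :: real ^ 'n) y. \<Prod>i\<in>UNIV. mehler_kernel t (x $ i) (y $ i)" hermite_op
    by (rule gaussian_semigroup_hermite)
  fix f :: "real ^ 'n \<Rightarrow> real" and t :: real assume f: "f \<in> Lp p" and t: "0 < t"
  \<comment> \<open>\<open>hermite_kernel_eq\<close> holds at positive times, which are all that the
    modulus sees.\<close>
  have T: "hermite_semigroup h = evolve h" if "0 < h" for h
    using that by (simp add: hermite_semigroup_def evolve_def hermite_kernel_eq fun_eq_iff)
  note * = test_semigroup.modulus_K_functional_equivalence[OF test_semigroup assms f t T]
  show "ennreal (1 / equivalence_const r) * modulus hermite_semigroup r p f t \<le> K_functional hermite_op r p f (t ^ r)"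
    "K_functional hermite_op r p f (t ^ r) \<le> ennreal (equivalence_const r) * modulus hermite_semigroup r p f t"
    using * by blast+
next
  fix b :: real and f :: "real \<Rightarrow> real" and t :: real assume b: "0 < b" and f: "f \<in> Lp p" and t: "0 < t"
  interpret gaussian_semigroup "b\<^sup>2" 0 "\<lambda>t. 1 / (2 * b * sqrt (pi * t))" "\<lambda>t. 1 / (2 * b\<^sup>2 * t)"
    "\<lambda>t. 1 / (2 * b\<^sup>2 * t)" "heat_kernel b" "heat_op b"
    by (rule gaussian_semigroup_heat[OF b])
  have T: "heat_semigroup b h = evolve h" for h
    by (simp add: heat_semigroup_def evolve_def heat_kernel_def fun_eq_iff mult.commute)
  note * = test_semigroup.modulus_K_functional_equivalence[OF test_semigroup assms f t T]
  show "ennreal (1 / equivalence_const r) * modulus (heat_semigroup b) r p f t \<le> K_functional (heat_op b) r p f (t ^ r)"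
    "K_functional (heat_op b) r p f (t ^ r) \<le> ennreal (equivalence_const r) * modulus (heat_semigroup b) r p f t"
    using * by blast+
qed

end
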